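(* Let $X$ be a complex manifold, $D\subset X$ a simple normal crossings divisor, $f:(X,D)\to(X,D)$ a strict logarithmic self-map, and $(E,\Phi)$ an $f$-linearised holomorphic vector bundle. Let $p\in D$ be an isolated fixed point of $f$ lying on exactly $k$ branches of $D$, and suppose that $p$ is normally non-resonant. Then $$\operatorname{Ind}_{p,D}^{\mathrm{bdry}}(f,E,\Phi;y)=(1+y)^k\operatorname{Res}_p^{S_p}\left[\frac{\tau_{\Phi|S_p}\,\det(1+yJ_{f_{S_p}})\,\det(1-\mathrm d_Nf)^{-1}\,\Omega_{S_p}}{h_1,\ldots,h_m}\right].$$
   Context: Strict logarithmic self-map: holomorphic $f:X\to X$ with $f^{-1}\mathcal I_{D_i}\cdot\mathcal O_X=\mathcal I_{D_i}$ for every irreducible component $D_i$ of $D$. At the fixed point $p$ choose adapted coordinates $(z_1,\ldots,z_k,w_1,\ldots,w_m)$ centred at $p$ with $D=\{z_1\cdots z_k=0\}$, and write $f^*z_i=z_ia_i(z,w)$ with $a_i$ units, $f^*w_\alpha=F_\alpha(z,w)$. Put $b_i=1-a_i$, $n=k+m$. $S_p=\{z_1=\cdots=z_k=0\}$ is the stratum germ; $f_{S_p}:w\mapsto F(0,w)$ is the restricted map; $h_\alpha(w)=w_\alpha-F_\alpha(0,w)$; $\Omega_{S_p}=\mathrm dw_1\wedge\cdots\wedge \mathrm dw_m$; $\det(1-\mathrm d_Nf)=\prod_{i=1}^kb_i(0,w)$. The point $p$ is normally non-resonant if $\det(1-\mathrm d_Nf_p)=\prod_i b_i(0,0)\ne0$.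 $A_{f,p}=\mathcal O_{X,p}/(x_1-f_1,\ldots,x_n-f_n)$ (any local coordinates $x$ centred at $p$, $f_i=f^*x_i$) is the local fixed-point algebra, and $\lambda_{f,p}:A_{f,p}\to\mathbb C$ is the Grothendieck residue functional $[h]\mapsto\operatorname{Res}_p\left[\frac{h\,\mathrm dx_1\wedge\cdots\wedge \mathrm dx_n}{x_1-f_1,\ldots,x_n-f_n}\right]$, extended coefficientwise to polynomials in $y$. $\operatorname{Res}^{S_p}_p$ is the Grothendieck residue on $S_p$. $\Phi:f^*E\to E$ is a bundle morphism; $\tau_{\Phi,p}\in A_{f,p}$ is the class of the trace of its matrix in a local frame (frame independent). When the $b_i$ are units, $A_{f,p}$ is canonically identified with $\mathcal O_{S_p,p}/(h_1,\ldots,h_m)$, and $\tau_{\Phi|S_p}$ denotes the image of $\tau_{\Phi,p}$ there. $J_{f_{S_p}}$ is the cotangent endomorphism of $f_{S_p}$ over its fixed-point scheme. $J_f^{\log}$ is the endomorphism of $\Omega_X^1(\log D)$ restricted to the fixed-point scheme of $f$ induced by pull-back of logarithmic forms, $f^*(\mathrm dz_i/z_i)=\mathrm dz_i/z_i+\mathrm da_i/a_i$. The boundary index is $\operatorname{Ind}_{p,D}^{\mathrm{bdry}}(f,E,\Phi;y)=\lambda_{f,p}\bigl(\tau_{\Phi,p}\det(1+yJ_f^{\log})\bigr)$. *)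

theory Defs
  imports "HOL-Analysis.Analysis" "HOL-Computational_Algebra.Polynomial"
begin

section \<open>Holomorphic functions of several variables and complex manifolds\<close>

definition holo_on :: "(complex ^ 'n) set \<Rightarrow> (complex ^ 'n \<Rightarrow> complex) \<Rightarrow> bool" where
  "holo_on V g \<longleftrightarrow>
     (\<forall>v\<in>V. \<exists>L. (g has_derivative L) (at v) \<and> (\<forall>c u. L (c *s u) = c * L u))"

definition partial :: "'n \<Rightarrow> (complex ^ 'n \<Rightarrow> complex) \<Rightarrow> complex ^ 'n \<Rightarrow> complex" where
  "partial j g v = deriv (\<lambda>t. g (v + t *s axis j 1)) 0"

type_synonym ('a, 'n) chart = "'a set \<times> ('a \<Rightarrow> complex ^ 'n)"

abbreviation chart_inv :: "('a, 'n) chart \<Rightarrow> complex ^ 'n \<Rightarrow> 'a" where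
  "chart_inv \<xi> \<equiv> inv_into (fst \<xi>) (snd \<xi>)"

definition is_chart :: "('a::topological_space, 'n::finite) chart \<Rightarrow> bool" where
  "is_chart \<xi> \<longleftrightarrow> open (fst \<xi>) \<and> open (snd \<xi> ` fst \<xi>) \<and>
     homeomorphism (fst \<xi>) (snd \<xi> ` fst \<xi>) (snd \<xi>) (chart_inv \<xi>)"

definition compatible :: "('a, 'n::finite) chart \<Rightarrow> ('a, 'n) chart \<Rightarrow> bool" where
  "compatible \<xi> \<eta> \<longleftrightarrow>
     (\<forall>i. holo_on (snd \<xi> ` (fst \<xi> \<inter> fst \<eta>)) (\<lambda>v. snd \<eta> (chart_inv \<xi> v) $ i)) \<and>
     (\<forall>i. holo_on (snd \<eta> ` (fst \<xi> \<inter> fst \<eta>)) (\<lambda>v. snd \<xi> (chart_inv \<eta> v) $ i))"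

text \<open>The manifold is the whole type \<open>'a\<close>; Hausdorffness and second countability are
  imposed by the type classes. The atlas need not be maximal.\<close>

definition complex_manifold ::
    "('a::{t2_space, second_countable_topology}, 'n::finite) chart set \<Rightarrow> bool" where
  "complex_manifold A \<longleftrightarrow>
     (\<forall>\<xi>\<in>A. is_chart \<xi>) \<and> (\<Union>\<xi>\<in>A. fst \<xi>) = UNIV \<and> (\<forall>\<xi>\<in>A. \<forall>\<eta>\<in>A. compatible \<xi> \<eta>)"

definition local_coordinates ::
    "('a::topological_space, 'n::finite) chart set \<Rightarrow> 'a \<Rightarrow> ('a, 'n) chart \<Rightarrow> bool" where
  "local_coordinates A q \<xi> \<longleftrightarrow>
     is_chart \<xi> \<and> (\<forall>\<eta>\<in>A. compatible \<xi> \<eta>) \<and> q \<in> fst \<xi> \<and> snd \<xi> q = 0"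

definition hol_fun_on ::
    "('a::topological_space, 'n::finite) chart set \<Rightarrow> 'a set \<Rightarrow> ('a \<Rightarrow> complex) \<Rightarrow> bool" where
  "hol_fun_on A W g \<longleftrightarrow> (\<forall>\<xi>\<in>A. holo_on (snd \<xi> ` (fst \<xi> \<inter> W)) (g \<circ> chart_inv \<xi>))"

text \<open>Representatives of elements of the local ring of the manifold at \<open>q\<close>; two of them
  are identified when they agree near \<open>q\<close>.\<close>

definition hol_at ::
    "('a::topological_space, 'n::finite) chart set \<Rightarrow> 'a \<Rightarrow> ('a \<Rightarrow> complex) \<Rightarrow> bool" where
  "hol_at A q g \<longleftrightarrow> (\<exists>W. open W \<and> q \<in> W \<and> hol_fun_on A W g)"

definition hol_self_map ::
    "('a::topological_space, 'n::finite) chart set \<Rightarrow> ('a \<Rightarrow> 'a) \<Rightarrow> bool" where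
  "hol_self_map A f \<longleftrightarrow> continuous_on UNIV f \<and>
     (\<forall>\<xi>\<in>A. \<forall>\<eta>\<in>A. \<forall>i.
        holo_on (snd \<xi> ` (fst \<xi> \<inter> f -` fst \<eta>)) (\<lambda>v. snd \<eta> (f (chart_inv \<xi> v)) $ i))"


section \<open>Simple normal crossings divisors and strict logarithmic self-maps\<close>

text \<open>A simple normal crossings divisor is given by the set \<open>DD\<close> of its irreducible
  components. In coordinates \<open>\<zeta>\<close> adapted at \<open>q\<close>, the indices in \<open>K\<close> are those of the
  \<open>z\<close>-coordinates, one for each component through \<open>q\<close>, and the indices outside \<open>K\<close> are
  those of the \<open>w\<close>-coordinates (there may be none).\<close>

definition adapted_coordinates ::
    "('a::topological_space, 'n::finite) chart set \<Rightarrow> 'a set set \<Rightarrow> 'a \<Rightarrow> ('a, 'n) chart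
      \<Rightarrow> 'n set \<Rightarrow> bool" where
  "adapted_coordinates A DD q \<zeta> K \<longleftrightarrow> local_coordinates A q \<zeta> \<and>
     (\<exists>\<sigma>. bij_betw \<sigma> {C\<in>DD. q \<in> C} K \<and>
        (\<forall>C\<in>DD. C \<inter> fst \<zeta> = (if q \<in> C then {u\<in>fst \<zeta>. snd \<zeta> u $ \<sigma> C = 0} else {})))"

text \<open>The components are smooth by the local condition, so that irreducible means
  connected.\<close>

definition snc_divisor ::
    "('a::topological_space, 'n::finite) chart set \<Rightarrow> 'a set set \<Rightarrow> bool" where
  "snc_divisor A DD \<longleftrightarrow>
     (\<forall>C\<in>DD. closed C \<and> connected C \<and> C \<noteq> {}) \<and>
     (\<forall>q. \<exists>\<zeta> K. adapted_coordinates A DD q \<zeta> K)"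

text \<open>The stalk at \<open>q\<close> of the ideal sheaf of \<open>C\<close>, and the stalk at \<open>q\<close> of its inverse image
  ideal sheaf under \<open>f\<close>, generated by pull-backs of germs at \<open>f q\<close> vanishing on \<open>C\<close>.\<close>

definition ideal_stalk ::
    "('a::topological_space, 'n::finite) chart set \<Rightarrow> 'a set \<Rightarrow> 'a \<Rightarrow> ('a \<Rightarrow> complex) set" where
  "ideal_stalk A C q = {g. hol_at A q g \<and> (\<forall>\<^sub>F u in nhds q. u \<in> C \<longrightarrow> g u = 0)}"

definition inverse_image_ideal_stalk ::
    "('a::topological_space, 'n::finite) chart set \<Rightarrow> ('a \<Rightarrow> 'a) \<Rightarrow> 'a set \<Rightarrow> 'a
      \<Rightarrow> ('a \<Rightarrow> complex) set" where
  "inverse_image_ideal_stalk A f C q = {h. hol_at A q h \<and>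
     (\<exists>(l::nat) c g. (\<forall>j<l. hol_at A q (c j) \<and> g j \<in> ideal_stalk A C (f q)) \<and>
        (\<forall>\<^sub>F u in nhds q. h u = (\<Sum>j<l. c j u * g j (f u))))}"

definition strict_log_self_map ::
    "('a::topological_space, 'n::finite) chart set \<Rightarrow> 'a set set \<Rightarrow> ('a \<Rightarrow> 'a) \<Rightarrow> bool" where
  "strict_log_self_map A DD f \<longleftrightarrow> hol_self_map A f \<and>
     (\<forall>C\<in>DD. \<forall>q. inverse_image_ideal_stalk A f C q = ideal_stalk A C q)"

definition isolated_fixed_point :: "('a::topological_space \<Rightarrow> 'a) \<Rightarrow> 'a \<Rightarrow> bool" where
  "isolated_fixed_point f p \<longleftrightarrow>
     f p = p \<and> (\<exists>W. open W \<and> p \<in> W \<and> (\<forall>q\<in>W. f q = q \<longrightarrow> q = p))"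


section \<open>Linearised holomorphic vector bundles\<close>

text \<open>A bundle of rank \<open>r\<close> has total space \<open>'e\<close>, projection \<open>\<pi>\<close> and a set of trivialisations
  \<open>(U, \<theta>)\<close>, where \<open>\<theta>\<close> identifies each fibre over \<open>U\<close> with the space of vectors
  \<open>nat \<Rightarrow> complex\<close> supported on \<open>{..<r}\<close>. The linear structure of the fibres and the complex
  structure of the total space are those transported by the trivialisations.\<close>

type_synonym ('a, 'e) triv = "'a set \<times> ('e \<Rightarrow> nat \<Rightarrow> complex)"

definition is_triv :: "nat \<Rightarrow> ('e \<Rightarrow> 'a::topological_space) \<Rightarrow> ('a, 'e) triv \<Rightarrow> bool" where
  "is_triv r \<pi> t \<longleftrightarrow> open (fst t) \<and>
     (\<forall>q\<in>fst t. bij_betw (snd t) (\<pi> -` {q}) {v. \<forall>i\<ge>r. v i = 0})"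

definition hol_transition ::
    "('a::topological_space, 'n::finite) chart set \<Rightarrow> nat \<Rightarrow> ('e \<Rightarrow> 'a) \<Rightarrow> ('a, 'e) triv
      \<Rightarrow> ('a, 'e) triv \<Rightarrow> bool" where
  "hol_transition A r \<pi> s t \<longleftrightarrow>
     (\<exists>G :: 'a \<Rightarrow> nat \<Rightarrow> nat \<Rightarrow> complex.
        (\<forall>i<r. \<forall>j<r. hol_fun_on A (fst s \<inter> fst t) (\<lambda>q. G q i j)) \<and>
        (\<forall>e. \<pi> e \<in> fst s \<inter> fst t \<longrightarrow>
          (\<forall>i<r. snd s e i = (\<Sum>j<r. G (\<pi> e) i j * snd t e j))))"

definition hol_vector_bundle ::
    "('a::topological_space, 'n::finite) chart set \<Rightarrow> nat \<Rightarrow> ('e \<Rightarrow> 'a) \<Rightarrow> ('a, 'e) triv set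
      \<Rightarrow> bool" where
  "hol_vector_bundle A r \<pi> T \<longleftrightarrow>
     (\<forall>t\<in>T. is_triv r \<pi> t) \<and> (\<Union>t\<in>T. fst t) = UNIV \<and>
     (\<forall>s\<in>T. \<forall>t\<in>T. hol_transition A r \<pi> s t)"

text \<open>A local frame near \<open>p\<close>, given as a trivialisation which need not belong to \<open>T\<close>.\<close>

definition local_frame ::
    "('a::topological_space, 'n::finite) chart set \<Rightarrow> nat \<Rightarrow> ('e \<Rightarrow> 'a) \<Rightarrow> ('a, 'e) triv set
      \<Rightarrow> 'a \<Rightarrow> ('a, 'e) triv \<Rightarrow> bool" where
  "local_frame A r \<pi> T p s \<longleftrightarrow> is_triv r \<pi> s \<and> p \<in> fst s \<and>
     (\<forall>t\<in>T. hol_transition A r \<pi> s t \<and> hol_transition A r \<pi> t s)"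

text \<open>A bundle morphism from the pull-back of the bundle by \<open>f\<close> to the bundle: \<open>\<Phi> q\<close> maps
  the fibre over \<open>f q\<close> linearly to the fibre over \<open>q\<close>, holomorphically in \<open>q\<close>. Its values on
  the other fibres are irrelevant.\<close>

definition linearisation ::
    "('a::topological_space, 'n::finite) chart set \<Rightarrow> nat \<Rightarrow> ('e \<Rightarrow> 'a) \<Rightarrow> ('a, 'e) triv set
      \<Rightarrow> ('a \<Rightarrow> 'a) \<Rightarrow> ('a \<Rightarrow> 'e \<Rightarrow> 'e) \<Rightarrow> bool" where
  "linearisation A r \<pi> T f \<Phi> \<longleftrightarrow>
     (\<forall>q e. \<pi> e = f q \<longrightarrow> \<pi> (\<Phi> q e) = q) \<and>
     (\<forall>s\<in>T. \<forall>t\<in>T. \<exists>M :: 'a \<Rightarrow> nat \<Rightarrow> nat \<Rightarrow> complex.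
        (\<forall>i<r. \<forall>j<r. hol_fun_on A (fst s \<inter> f -` fst t) (\<lambda>q. M q i j)) \<and>
        (\<forall>q\<in>fst s \<inter> f -` fst t. \<forall>e. \<pi> e = f q \<longrightarrow>
          (\<forall>i<r. snd s (\<Phi> q e) i = (\<Sum>j<r. M q i j * snd t e j))))"

definition frame_vector :: "('e \<Rightarrow> 'a) \<Rightarrow> ('a, 'e) triv \<Rightarrow> 'a \<Rightarrow> nat \<Rightarrow> 'e" where
  "frame_vector \<pi> s q j = (THE e. \<pi> e = q \<and> snd s e = (\<lambda>i. if i = j then 1 else 0))"

definition frame_trace ::
    "nat \<Rightarrow> ('e \<Rightarrow> 'a) \<Rightarrow> ('a, 'e) triv \<Rightarrow> ('a \<Rightarrow> 'a) \<Rightarrow> ('a \<Rightarrow> 'e \<Rightarrow> 'e) \<Rightarrow> 'a \<Rightarrow> complex" where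
  "frame_trace r \<pi> s f \<Phi> q = (\<Sum>i<r. snd s (\<Phi> q (frame_vector \<pi> s (f q) i)) i)"


section \<open>The Grothendieck residue\<close>

text \<open>Residues are needed on the ambient space and on coordinate subspaces, so they are
  defined for an index set \<open>I\<close>, on the space of vectors supported on \<open>I\<close>; \<open>I\<close> may be empty.
  Germs at the origin of that space are represented by functions of which only the values
  on it matter.\<close>

definition coord_proj :: "'n set \<Rightarrow> complex ^ 'n \<Rightarrow> complex ^ 'n" where
  "coord_proj I v = (\<chi> i. if i \<in> I then v $ i else 0)"

definition germ :: "'n::finite set \<Rightarrow> (complex ^ 'n \<Rightarrow> complex) \<Rightarrow> bool" where
  "germ I g \<longleftrightarrow> (\<exists>V. open V \<and> 0 \<in> V \<and> holo_on V (g \<circ> coord_proj I))"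

definition germ_eq ::
    "'n::finite set \<Rightarrow> (complex ^ 'n \<Rightarrow> complex) \<Rightarrow> (complex ^ 'n \<Rightarrow> complex) \<Rightarrow> bool" where
  "germ_eq I g h \<longleftrightarrow> (\<forall>\<^sub>F v in nhds 0. g (coord_proj I v) = h (coord_proj I v))"

definition in_germ_ideal ::
    "'n::finite set \<Rightarrow> ('n \<Rightarrow> complex ^ 'n \<Rightarrow> complex) \<Rightarrow> (complex ^ 'n \<Rightarrow> complex) \<Rightarrow> bool" where
  "in_germ_ideal I g h \<longleftrightarrow>
     (\<exists>c. (\<forall>i\<in>I. germ I (c i)) \<and> germ_eq I h (\<lambda>v. \<Sum>i\<in>I. c i v * g i v))"

text \<open>The determinant of the block of \<open>M\<close> with rows and columns in \<open>I\<close>, obtained by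
  extending the block by an identity matrix.\<close>

definition block_det :: "'n::finite set \<Rightarrow> ('n \<Rightarrow> 'n \<Rightarrow> 'c::comm_ring_1) \<Rightarrow> 'c" where
  "block_det I M =
     det ((\<chi> i j. if i \<in> I \<and> j \<in> I then M i j else if i = j then 1 else 0) :: 'c ^ 'n ^ 'n)"

text \<open>\<open>power_residue I N h r\<close>: the germ \<open>h\<close> has coefficient \<open>r\<close> at the monomial
  \<open>\<Prod>i\<in>I. v\<^sub>i ^ (N - 1)\<close>. Only the Taylor polynomial of \<open>h\<close> modulo the ideal of the powers
  \<open>v\<^sub>i ^ N\<close> is used; thus \<open>r\<close> is the residue of \<open>h dv\<close> with denominators \<open>v\<^sub>i ^ N\<close>.\<close>

definition power_residue ::
    "'n::finite set \<Rightarrow> nat \<Rightarrow> (complex ^ 'n \<Rightarrow> complex) \<Rightarrow> complex \<Rightarrow> bool" where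
  "power_residue I N h r \<longleftrightarrow>
     (\<exists>c :: ('n \<Rightarrow> nat) \<Rightarrow> complex.
        in_germ_ideal I (\<lambda>i v. v $ i ^ N)
          (\<lambda>v. h v - (\<Sum>\<alpha> | (\<forall>i\<in>I. \<alpha> i < N) \<and> (\<forall>i. i \<notin> I \<longrightarrow> \<alpha> i = 0).
                        c \<alpha> * (\<Prod>i\<in>I. v $ i ^ \<alpha> i))) \<and>
        r = c (\<lambda>i. if i \<in> I then N - 1 else 0))"

text \<open>The Grothendieck residue of \<open>h dv / (g\<^sub>i)\<close>. If \<open>v\<^sub>i ^ N = \<Sum>\<^sub>j A\<^sub>i\<^sub>j g\<^sub>j\<close>, then by the
  transformation law it is the residue of \<open>h det A dv\<close> with denominators \<open>v\<^sub>i ^ N\<close>. This is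
  the local cohomology description, in which the generalised fraction \<open>h dv / (g\<^sub>i)\<close> is a class
  in the direct limit, along these multiplications by determinants, of the quotients by
  the ideals \<open>(v\<^sub>i ^ N)\<close>. Such an \<open>A\<close> exists exactly when the \<open>g\<^sub>i\<close> have an isolated common
  zero at the origin or no common zero there.\<close>

definition is_residue ::
    "'n::finite set \<Rightarrow> ('n \<Rightarrow> complex ^ 'n \<Rightarrow> complex) \<Rightarrow> (complex ^ 'n \<Rightarrow> complex) \<Rightarrow> complex
      \<Rightarrow> bool" where
  "is_residue I g h r \<longleftrightarrow>
     (\<exists>N A. 0 < N \<and> (\<forall>i\<in>I. \<forall>j\<in>I. germ I (A i j)) \<and>
        (\<forall>i\<in>I. germ_eq I (\<lambda>v. v $ i ^ N) (\<lambda>v. \<Sum>j\<in>I. A i j v * g j v)) \<and>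
        power_residue I N (\<lambda>v. h v * block_det I (\<lambda>i j. A i j v)) r)"

definition residue ::
    "'n::finite set \<Rightarrow> ('n \<Rightarrow> complex ^ 'n \<Rightarrow> complex) \<Rightarrow> (complex ^ 'n \<Rightarrow> complex) \<Rightarrow> complex"
  where
  "residue I g h = (if \<exists>r. is_residue I g h r then THE r. is_residue I g h r else 0)"

text \<open>Extension of a functional to polynomial-valued germs, coefficient by coefficient.\<close>

definition coeffwise ::
    "(('b \<Rightarrow> complex) \<Rightarrow> complex) \<Rightarrow> ('b \<Rightarrow> complex poly) \<Rightarrow> complex poly" where
  "coeffwise \<Lambda> H = Abs_poly (\<lambda>d. \<Lambda> (\<lambda>u. coeff (H u) d))"


section \<open>Local data at the fixed point\<close>

text \<open>Elements of the local fixed-point algebra are represented by holomorphic germs at the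
  fixed point. \<open>fixed_point_functional f x\<close> is the Grothendieck residue functional of that
  algebra, computed in the coordinates \<open>x\<close>.\<close>

definition fixed_point_functional ::
    "('a \<Rightarrow> 'a) \<Rightarrow> ('a, 'n::finite) chart \<Rightarrow> ('a \<Rightarrow> complex) \<Rightarrow> complex" where
  "fixed_point_functional f x h =
     residue UNIV (\<lambda>i v. v $ i - snd x (f (chart_inv x v)) $ i) (h \<circ> chart_inv x)"

text \<open>\<open>log_unit A f p \<zeta> i\<close> is the germ \<open>a\<^sub>i\<close> with \<open>f\<^sup>*z\<^sub>i = z\<^sub>i a\<^sub>i\<close>, for \<open>i \<in> K\<close>. It is unique as
  a germ, and for a strict logarithmic self-map it exists and is a unit.\<close>

definition log_unit ::
    "('a::topological_space, 'n::finite) chart set \<Rightarrow> ('a \<Rightarrow> 'a) \<Rightarrow> 'a \<Rightarrow> ('a, 'n) chart \<Rightarrow> 'n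
      \<Rightarrow> 'a \<Rightarrow> complex" where
  "log_unit A f p \<zeta> i =
     (SOME a. hol_at A p a \<and> (\<forall>\<^sub>F u in nhds p. snd \<zeta> (f u) $ i = snd \<zeta> u $ i * a u))"

definition normal_det ::
    "('a::topological_space, 'n::finite) chart set \<Rightarrow> ('a \<Rightarrow> 'a) \<Rightarrow> 'a \<Rightarrow> ('a, 'n) chart
      \<Rightarrow> 'n set \<Rightarrow> 'a \<Rightarrow> complex" where
  "normal_det A f p \<zeta> K u = (\<Prod>i\<in>K. 1 - log_unit A f p \<zeta> i u)"

definition normally_non_resonant ::
    "('a::topological_space, 'n::finite) chart set \<Rightarrow> ('a \<Rightarrow> 'a) \<Rightarrow> 'a \<Rightarrow> ('a, 'n) chart
      \<Rightarrow> 'n set \<Rightarrow> bool" where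
  "normally_non_resonant A f p \<zeta> K \<longleftrightarrow> normal_det A f p \<zeta> K p \<noteq> 0"

text \<open>The coefficient of \<open>dg\<close> at the \<open>j\<close>-th member of the frame \<open>dz\<^sub>i / z\<^sub>i\<close> (\<open>i \<in> K\<close>),
  \<open>dw\<^sub>\<alpha>\<close> (\<open>\<alpha> \<notin> K\<close>) of the logarithmic forms, as a function of the coordinates.\<close>

definition log_partial ::
    "'n set \<Rightarrow> 'n \<Rightarrow> (complex ^ 'n \<Rightarrow> complex) \<Rightarrow> complex ^ 'n \<Rightarrow> complex" where
  "log_partial K j g v = (if j \<in> K then v $ j else 1) * partial j g v"

text \<open>Matrix of the pull-back of logarithmic forms in that frame: row \<open>i\<close> holds the
  coefficients of \<open>f\<^sup>*(dz\<^sub>i / z\<^sub>i) = dz\<^sub>i / z\<^sub>i + da\<^sub>i / a\<^sub>i\<close>, respectively of \<open>f\<^sup>*dw\<^sub>i = dF\<^sub>i\<close>. Its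
  reduction to the fixed-point scheme is the matrix of the logarithmic cotangent
  endomorphism.\<close>

definition J_log ::
    "('a::topological_space, 'n::finite) chart set \<Rightarrow> ('a \<Rightarrow> 'a) \<Rightarrow> 'a \<Rightarrow> ('a, 'n) chart
      \<Rightarrow> 'n set \<Rightarrow> 'a \<Rightarrow> 'n \<Rightarrow> 'n \<Rightarrow> complex" where
  "J_log A f p \<zeta> K u i j =
     (if i \<in> K then
        (if i = j then 1 else 0) +
        log_partial K j (log_unit A f p \<zeta> i \<circ> chart_inv \<zeta>) (snd \<zeta> u) / log_unit A f p \<zeta> i u
      else log_partial K j (\<lambda>v. snd \<zeta> (f (chart_inv \<zeta> v)) $ i) (snd \<zeta> u))"

text \<open>Cotangent matrix of the restriction of \<open>f\<close> to the stratum, for \<open>i, j \<notin> K\<close>; \<open>w\<close> is a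
  point of the stratum in the coordinates \<open>\<zeta>\<close>, so that its \<open>K\<close>-components vanish.\<close>

definition J_stratum ::
    "('a \<Rightarrow> 'a) \<Rightarrow> ('a, 'n::finite) chart \<Rightarrow> complex ^ 'n \<Rightarrow> 'n \<Rightarrow> 'n \<Rightarrow> complex" where
  "J_stratum f \<zeta> w i j = partial j (\<lambda>v. snd \<zeta> (f (chart_inv \<zeta> v)) $ i) w"

text \<open>\<open>det (1 + y M)\<close> for the block of \<open>M\<close> with index set \<open>I\<close>, as a polynomial in \<open>y\<close>.\<close>

definition det_one_plus_y :: "'n::finite set \<Rightarrow> ('n \<Rightarrow> 'n \<Rightarrow> complex) \<Rightarrow> complex poly" where
  "det_one_plus_y I M = block_det I (\<lambda>i j. (if i = j then 1 else 0) + monom (M i j) 1)"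

text \<open>The coordinates \<open>x\<close> are those used for the residue functional; the adapted coordinates
  \<open>\<zeta>\<close> are those used for the logarithmic forms; \<open>s\<close> is the local frame of the bundle.\<close>

definition boundary_index ::
    "('a::topological_space, 'n::finite) chart set \<Rightarrow> ('a \<Rightarrow> 'a) \<Rightarrow> 'a \<Rightarrow> ('a, 'n) chart
      \<Rightarrow> ('a, 'n) chart \<Rightarrow> 'n set \<Rightarrow> nat \<Rightarrow> ('e \<Rightarrow> 'a) \<Rightarrow> ('a, 'e) triv \<Rightarrow> ('a \<Rightarrow> 'e \<Rightarrow> 'e)
      \<Rightarrow> complex poly" where
  "boundary_index A f p x \<zeta> K r \<pi> s \<Phi> =
     coeffwise (fixed_point_functional f x)
       (\<lambda>u. smult (frame_trace r \<pi> s f \<Phi> u) (det_one_plus_y UNIV (J_log A f p \<zeta> K u)))"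

text \<open>The residue on the stratum with the equations \<open>h\<^sub>\<alpha>(w) = w\<^sub>\<alpha> - F\<^sub>\<alpha>(0, w)\<close>, of a function
  on the stratum expressed in the coordinates \<open>w\<^sub>\<alpha>\<close>, \<open>\<alpha> \<notin> K\<close>.\<close>

definition stratum_residue ::
    "('a \<Rightarrow> 'a) \<Rightarrow> ('a, 'n::finite) chart \<Rightarrow> 'n set \<Rightarrow> (complex ^ 'n \<Rightarrow> complex) \<Rightarrow> complex"
  where
  "stratum_residue f \<zeta> K =
     residue (- K) (\<lambda>\<alpha> w. w $ \<alpha> - snd \<zeta> (f (chart_inv \<zeta> w)) $ \<alpha>)"

end

theory Submission
  imports Defs "HOL-Complex_Analysis.Cauchy_Integral_Formula"
begin

text \<open>
  All residues are computed as means over small tori: if \<open>v\<^sub>i ^ N = \<Sum>\<^sub>j A\<^sub>i\<^sub>j g\<^sub>j\<close>, the residue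
  of \<open>h\<close> with denominators \<open>g\<^sub>i\<close> is the mean of \<open>h det A \<Prod>\<^sub>i v\<^sub>i / v\<^sub>i ^ N\<close>. Cramer's rule shows that
  this does not change when the rows of \<open>A\<close> are replaced by other solutions, and that it
  vanishes when \<open>h\<close> lies in the ideal of the \<open>g\<^sub>i\<close>.

  If \<open>\<phi>\<close> are new coordinates, comparing the kernels \<open>\<Prod>\<^sub>i (\<phi>\<^sub>i(v)^N - \<phi>\<^sub>i(u)^N) / (\<phi>\<^sub>i(v) - \<phi>\<^sub>i(u))\<close> and
  \<open>\<Prod>\<^sub>i (v\<^sub>i^L - u\<^sub>i^L) / (v\<^sub>i - u\<^sub>i)\<close> modulo the ideal of the \<open>\<phi>\<^sub>i(u)^N\<close> gives the invariance of
  residues of top forms. Moreover \<open>\<phi>(v) - \<phi>(F(v)) = B(v) (v - F(v))\<close> with \<open>det B\<close> congruent to the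
  Jacobian determinant modulo the components of \<open>v - F(v)\<close>, so the Jacobian cancels and the
  fixed-point functional does not depend on the coordinates.

  In adapted coordinates the equations are \<open>z\<^sub>i b\<^sub>i\<close> and \<open>w\<^sub>\<alpha> - F\<^sub>\<alpha>\<close>, where the \<open>b\<^sub>i\<close> are units, so the
  residue is the one on \<open>z = 0\<close> of the integrand divided by \<open>\<Prod>\<^sub>i b\<^sub>i\<close>. There the logarithmic cotangent
  matrix is block triangular with an identity block for the \<open>dz\<^sub>i / z\<^sub>i\<close>, which contributes \<open>(1 + y)^k\<close>.
\<close>

section \<open>Holomorphic functions of several variables\<close>

text \<open>A biholomorphism does not carry tori of one coordinate system to tori of the other, so
  changing variables in the mean would need a homology argument. The comparison of kernels avoids
  it: all means stay on a torus in v, and only the point u moves. The comparison is quantitative,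
  since a bound by a constant times the sum of the |\<phi>_j(u)|^N, for each u separately, is easier
  to carry along than ideal membership jointly in u and v. It suffices because the compared mean is
  a polynomial in x = \<phi>(u) that differs from 1 by O(|x|^N), which forces its coefficients in
  total degree below N. To reach every coefficient needed for denominators \<phi>_i^N0 in dimension
  n, the computation is done with N = N0 + n N0. Division of holomorphic functions (by a coordinate,
  or of \<phi>(v) - \<phi>(u) by v - u) is Hadamard's lemma with quotients given by integrals over a
  segment; it yields holomorphy and bounds of the quotients together. A residue is 0 by convention
  if no matrix A exists for its denominators, so each comparison of residues also has to transport
  such matrices between the two sides.\<close>

lemma holo_onI:
  assumes "\<And>v. v \<in> V \<Longrightarrow> (g has_derivative L v) (at v)" "\<And>v c u. v \<in> V \<Longrightarrow> L v (c *s u) = c * L v u"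
  shows "holo_on V g"
  using assms unfolding holo_on_def by blast

lemma holo_on_subset: "holo_on V g \<Longrightarrow> W \<subseteq> V \<Longrightarrow> holo_on W g"
  unfolding holo_on_def by blast

text \<open>Openness matters because \<open>holo_on\<close> asks for the full derivative at each
  point, which sees a whole neighbourhood.\<close>

lemma holo_on_cong:
  assumes "open V" "\<And>v. v \<in> V \<Longrightarrow> g v = h v"
  shows "holo_on V g \<longleftrightarrow> holo_on V h"
proof -
  have "(g has_derivative L) (at v) \<longleftrightarrow> (h has_derivative L) (at v)" if "v \<in> V" for v L
    using has_derivative_transform_within_open[of g L v UNIV V h]
      has_derivative_transform_within_open[of h L v UNIV V g] assms that by auto
  then show ?thesis unfolding holo_on_def by blast
qed

lemma holo_on_const [intro]: "holo_on V (\<lambda>v. c)"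
  by (rule holo_onI[where L="\<lambda>v u. 0"]) auto

lemma has_derivative_vec_nth: "((\<lambda>v. v $ i) has_derivative (\<lambda>u. u $ i)) F"
  by (rule bounded_linear.has_derivative[OF bounded_linear_vec_nth]) auto

lemma holo_on_coord [intro]: "holo_on V (\<lambda>v. v $ i)"
  by (rule holo_onI[where L="\<lambda>v u. u $ i"]) (auto intro: has_derivative_vec_nth)

lemma holo_on_add [intro]:
  assumes "holo_on V g" "holo_on V h" shows "holo_on V (\<lambda>v. g v + h v)"
  unfolding holo_on_def
proof
  fix v assume "v \<in> V"
  then obtain L M where "(g has_derivative L) (at v)" "\<forall>c u. L (c *s u) = c * L u"
    "(h has_derivative M) (at v)" "\<forall>c u. M (c *s u) = c * M u"
    using assms unfolding holo_on_def by meson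
  then show "\<exists>L. ((\<lambda>v. g v + h v) has_derivative L) (at v) \<and> (\<forall>c u. L (c *s u) = c * L u)"
    by (intro exI[of _ "\<lambda>u. L u + M u"]) (auto intro!: derivative_intros simp: algebra_simps)
qed

lemma holo_on_mult [intro]:
  assumes "holo_on V g" "holo_on V h" shows "holo_on V (\<lambda>v. g v * h v)"
  unfolding holo_on_def
proof
  fix v assume "v \<in> V"
  then obtain L M where "(g has_derivative L) (at v)" "\<forall>c u. L (c *s u) = c * L u"
    "(h has_derivative M) (at v)" "\<forall>c u. M (c *s u) = c * M u"
    using assms unfolding holo_on_def by meson
  moreover from this have "((\<lambda>v. g v * h v) has_derivative (\<lambda>u. g v * M u + L u * h v)) (at v)"
    by (intro has_derivative_mult)
  ultimately show "\<exists>L. ((\<lambda>v. g v * h v) has_derivative L) (at v) \<and> (\<forall>c u. L (c *s u) = c * L u)"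
    by (intro exI[of _ "\<lambda>u. g v * M u + L u * h v"]) (simp add: distrib_left mult_ac)
qed

lemma holo_on_minus [intro]: "holo_on V g \<Longrightarrow> holo_on V (\<lambda>v. - g v)"
  using holo_on_mult[OF holo_on_const[of V "-1"]] by simp

lemma holo_on_diff [intro]: "holo_on V g \<Longrightarrow> holo_on V h \<Longrightarrow> holo_on V (\<lambda>v. g v - h v)"
  using holo_on_add[OF _ holo_on_minus] by fastforce

lemma holo_on_sum [intro]: "(\<And>i. i \<in> S \<Longrightarrow> holo_on V (g i)) \<Longrightarrow> holo_on V (\<lambda>v. \<Sum>i\<in>S. g i v)"
  by (induction S rule: infinite_finite_induct) (auto intro!: holo_on_add)

lemma holo_on_prod [intro]: "(\<And>i. i \<in> S \<Longrightarrow> holo_on V (g i)) \<Longrightarrow> holo_on V (\<lambda>v. \<Prod>i\<in>S. g i v)"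
  by (induction S rule: infinite_finite_induct) (auto intro!: holo_on_mult)

lemma holo_on_power [intro]: "holo_on V g \<Longrightarrow> holo_on V (\<lambda>v. g v ^ k)"
  by (induction k) auto

lemma holo_on_inverse [intro]:
  assumes "holo_on V g" "\<And>v. v \<in> V \<Longrightarrow> g v \<noteq> 0" shows "holo_on V (\<lambda>v. inverse (g v))"
  unfolding holo_on_def
proof
  fix v assume v: "v \<in> V"
  then obtain L where L: "(g has_derivative L) (at v)" "\<forall>c u. L (c *s u) = c * L u"
    using assms unfolding holo_on_def by meson
  have "((\<lambda>v. inverse (g v)) has_derivative (\<lambda>u. - (inverse (g v) * L u * inverse (g v)))) (at v)"
    using Deriv.has_derivative_inverse[OF _ L(1)] assms(2)[OF v] by auto
  then show "\<exists>L. ((\<lambda>v. inverse (g v)) has_derivative L) (at v) \<and> (\<forall>c u. L (c *s u) = c * L u)"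
    using L(2) by (intro exI[of _ "\<lambda>u. - (inverse (g v) * L u * inverse (g v))"]) (auto simp: algebra_simps)
qed

lemma holo_on_divide [intro]:
  "holo_on V g \<Longrightarrow> holo_on V h \<Longrightarrow> (\<And>v. v \<in> V \<Longrightarrow> h v \<noteq> 0) \<Longrightarrow> holo_on V (\<lambda>v. g v / h v)"
  unfolding divide_inverse by (intro holo_on_mult holo_on_inverse)

lemma holo_on_det [intro]:
  assumes "\<And>i j. holo_on V (\<lambda>v. C v $ i $ j)"
  shows "holo_on V (\<lambda>v. det (C v))"
  unfolding det_def by (intro holo_on_sum holo_on_mult holo_on_const holo_on_prod assms)

lemma holo_on_imp_continuous_on: "holo_on V g \<Longrightarrow> continuous_on V g"
  unfolding holo_on_def
  by (meson continuous_at_imp_continuous_on has_derivative_continuous)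

lemma has_derivative_vec_lambda:
  fixes F :: "'b::real_normed_vector \<Rightarrow> complex ^ 'n"
  assumes "\<And>i. ((\<lambda>v. F v $ i) has_derivative (\<lambda>u. L u $ i)) (at v within S)"
  shows "(F has_derivative L) (at v within S)"
proof (subst has_derivative_componentwise_within, safe)
  fix b :: "complex ^ 'n" assume "b \<in> Basis"
  then obtain i c where b: "b = axis i c" by (auto simp: Basis_vec_def)
  show "((\<lambda>x. F x \<bullet> b) has_derivative (\<lambda>x. L x \<bullet> b)) (at v within S)"
    unfolding b inner_axis
    by (rule bounded_linear.has_derivative[OF bounded_linear_inner_left assms])
qed

lemma holo_on_compose:
  assumes g: "holo_on W g" and F: "\<And>i. holo_on V (\<lambda>v. F v $ i)" and im: "F ` V \<subseteq> W"
  shows "holo_on V (\<lambda>v. g (F v))"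
  unfolding holo_on_def
proof
  fix v assume v: "v \<in> V"
  have "\<forall>i. \<exists>L. ((\<lambda>v. F v $ i) has_derivative L) (at v) \<and> (\<forall>c u. L (c *s u) = c * L u)"
    using F v unfolding holo_on_def by blast
  then obtain L where L: "\<And>i. ((\<lambda>v. F v $ i) has_derivative L i) (at v)" "\<And>i c u. L i (c *s u) = c * L i u"
    by metis
  define M where "M = (\<lambda>u. \<chi> i. L i u)"
  have M: "(F has_derivative M) (at v)"
    by (rule has_derivative_vec_lambda) (auto simp: M_def L)
  obtain G where G: "(g has_derivative G) (at (F v))" "\<And>c u. G (c *s u) = c * G u"
    using g im v unfolding holo_on_def by blast
  have "((\<lambda>v. g (F v)) has_derivative (\<lambda>u. G (M u))) (at v)"
    using has_derivative_compose[OF M] G(1) by auto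
  moreover have "M (c *s u) = c *s M u" for c u
    by (simp add: M_def L vec_eq_iff)
  ultimately show "\<exists>L. ((\<lambda>v. g (F v)) has_derivative L) (at v) \<and> (\<forall>c u. L (c *s u) = c * L u)"
    using G(2) by (intro exI[of _ "\<lambda>u. G (M u)"]) auto
qed

lemma continuous_on_vec_componentwise:
  fixes F :: "'b::topological_space \<Rightarrow> complex ^ 'n::finite"
  assumes "\<And>i. continuous_on V (\<lambda>v. F v $ i)" shows "continuous_on V F"
  using continuous_on_vec_lambda[of V "\<lambda>i v. F v $ i"] assms by simp

lemma continuous_on_smult [continuous_intros]:
  fixes G :: "'b::topological_space \<Rightarrow> complex ^ 'n::finite"
  assumes "continuous_on V f" "continuous_on V G"
  shows "continuous_on V (\<lambda>v. f v *s G v)"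
proof (rule continuous_on_vec_componentwise)
  show "continuous_on V (\<lambda>v. (f v *s G v) $ i)" for i
    unfolding vector_smult_component using assms by (intro continuous_intros)
qed

lemma vec_eq_sum_axis: "(u :: complex ^ 'n) = (\<Sum>j\<in>UNIV. u $ j *s axis j 1)"
  by (simp add: basis_expansion)

lemma has_derivative_line:
  "((\<lambda>\<xi>. a + \<xi> *s b) has_derivative (\<lambda>c. c *s b)) (at t within S)" for a b :: "complex ^ 'n"
  by (rule has_derivative_vec_lambda) (auto intro!: derivative_eq_intros)

lemma has_field_derivative_line:
  fixes a b :: "complex ^ 'n::finite"
  assumes "(g has_derivative L) (at (a + t *s b))" "\<And>c u. L (c *s u) = c * L u"
  shows "((\<lambda>\<xi>. g (a + \<xi> *s b)) has_field_derivative L b) (at t)"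
proof -
  have "((\<lambda>\<xi>. g (a + \<xi> *s b)) has_derivative (\<lambda>c. L (c *s b))) (at t)"
    using has_derivative_compose[OF has_derivative_line[where a=a and b=b and t=t and S=UNIV], of g L] assms(1) by simp
  then show ?thesis
    unfolding has_field_derivative_def
    by (rule has_derivative_eq_rhs) (auto simp: assms(2))
qed

lemma holo_on_line:
  assumes "holo_on V g" "\<And>\<xi>. \<xi> \<in> S \<Longrightarrow> a + \<xi> *s b \<in> V"
  shows "(\<lambda>\<xi>. g (a + \<xi> *s b)) holomorphic_on S"
  unfolding holomorphic_on_def field_differentiable_def
proof safe
  fix t assume "t \<in> S"
  then obtain L where "(g has_derivative L) (at (a + t *s b))" "\<And>c u. L (c *s u) = c * L u"
    using assms unfolding holo_on_def by meson
  from has_field_derivative_line[OF this] 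
  show "\<exists>f'. ((\<lambda>\<xi>. g (a + \<xi> *s b)) has_field_derivative f') (at t within S)"
    using has_field_derivative_at_within by blast
qed

text \<open>Complex homogeneity, on top of real linearity, determines the derivative by its values
  at the vectors \<open>axis j 1\<close>, and these are the partial derivatives.\<close>

lemma holo_on_has_derivative_partial:
  assumes "holo_on V g" "v \<in> V"
  shows "(g has_derivative (\<lambda>u. \<Sum>j\<in>UNIV. u $ j * partial j g v)) (at v)"
proof -
  obtain L where L: "(g has_derivative L) (at v)" "\<And>c u. L (c *s u) = c * L u"
    using assms unfolding holo_on_def by meson
  have p: "partial j g v = L (axis j 1)" for j
    unfolding partial_def
    by (rule DERIV_imp_deriv, rule has_field_derivative_line) (use L in auto)
  have lin: "linear L" using L(1) by (rule has_derivative_linear)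
  have "L u = (\<Sum>j\<in>UNIV. u $ j * partial j g v)" for u
    by (subst vec_eq_sum_axis[of u]) (simp only: linear_sum[OF lin] L(2) p)
  then have "L = (\<lambda>u. \<Sum>j\<in>UNIV. u $ j * partial j g v)" by blast
  then show ?thesis using L(1) by simp
qed

section \<open>Circle means and Cauchy's formula in one variable\<close>

definition circ :: "real \<Rightarrow> real \<Rightarrow> complex" where
  "circ \<rho> t = of_real \<rho> * exp (2 * of_real pi * \<i> * of_real t)"

lemma norm_circ [simp]: "\<rho> \<ge> 0 \<Longrightarrow> norm (circ \<rho> t) = \<rho>"
  unfolding circ_def by (simp add: norm_mult)

lemma circ_nonzero [simp]: "\<rho> \<noteq> 0 \<Longrightarrow> circ \<rho> t \<noteq> 0"
  unfolding circ_def by simp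

lemma continuous_on_circ [continuous_intros]:
  "continuous_on S f \<Longrightarrow> continuous_on S (\<lambda>x. circ \<rho> (f x))"
  unfolding circ_def by (intro continuous_intros)

text \<open>For \<xi> = \<open>circ \<rho> t\<close> one has d\<xi> = 2 pi i \<xi> dt. Normalised
  contour integrals become means over [0, 1] at the price of a factor \<xi> in the integrand; this
  is the origin of the numerators \<open>v $ k\<close> in all later weights
  \<open>v $ k / v $ k ^ N\<close>.\<close>

lemma circ_mean_Cauchy:
  assumes "g holomorphic_on ball 0 R" "0 < \<rho>" "\<rho> < R" "norm w < \<rho>"
  shows "integral {0..1} (\<lambda>t. g (circ \<rho> t) * circ \<rho> t / (circ \<rho> t - w)) = g w"
proof -
  have c: "circlepath 0 \<rho> t = circ \<rho> t" for t
    by (simp add: circlepath circ_def)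
  have "g holomorphic_on cball 0 \<rho>" using assms(1) by (rule holomorphic_on_subset) (use assms in auto)
  then have "((\<lambda>u. g u / (u - w)) has_contour_integral (2 * of_real pi * \<i> * g w)) (circlepath 0 \<rho>)"
    using Cauchy_integral_circlepath_simple[of g 0 \<rho> w] assms(4) by auto
  then have "contour_integral (circlepath 0 \<rho>) (\<lambda>u. g u / (u - w)) = 2 * of_real pi * \<i> * g w"
    by (rule contour_integral_unique)
  then have "integral {0..1} (\<lambda>t. (2 * of_real pi * \<i>) * (g (circ \<rho> t) * circ \<rho> t / (circ \<rho> t - w))) =
      2 * of_real pi * \<i> * g w"
    unfolding contour_integral_integral vector_derivative_circlepath
    by (simp add: c circ_def ac_simps)
  then show ?thesis
    unfolding integral_mult_right by simp
qed

lemma circ_mean: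
  assumes "g holomorphic_on ball 0 R" "0 < \<rho>" "\<rho> < R"
  shows "integral {0..1} (\<lambda>t. g (circ \<rho> t)) = g 0"
  using circ_mean_Cauchy[OF assms, of 0] assms by simp

lemma circ_mean_deriv:
  assumes "g holomorphic_on ball 0 R" "0 < \<rho>" "\<rho> < R"
  shows "integral {0..1} (\<lambda>t. g (circ \<rho> t) / circ \<rho> t) = deriv g 0"
proof -
  have c: "circlepath 0 \<rho> t = circ \<rho> t" for t
    by (simp add: circlepath circ_def)
  have "g holomorphic_on cball 0 \<rho>" "g holomorphic_on ball 0 \<rho>"
    using assms by (auto intro: holomorphic_on_subset)
  then have "((\<lambda>u. g u / (u - 0) ^ Suc 1) has_contour_integral (complex_of_real (2 * pi) * \<i> / fact 1 * (deriv ^^ 1)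
      g 0)) (circlepath 0 \<rho>)"
    using Cauchy_has_contour_integral_higher_derivative_circlepath[of 0 \<rho> g 0 1] assms
    by (auto simp: holomorphic_on_imp_continuous_on)
  then have "contour_integral (circlepath 0 \<rho>) (\<lambda>u. g u / u ^ 2) = 2 * of_real pi * \<i> * deriv g 0"
    using contour_integral_unique by (fastforce simp: numeral_2_eq_2)
  moreover have "vector_derivative (circlepath 0 \<rho>) (at t) = 2 * of_real pi * \<i> * circ \<rho> t" for t
    by (simp add: vector_derivative_circlepath circ_def)
  moreover have "g (circ \<rho> t) / circ \<rho> t ^ 2 * (2 * of_real pi * \<i> * circ \<rho> t)
      = 2 * of_real pi * \<i> * (g (circ \<rho> t) / circ \<rho> t)" for t
    using assms by (simp add: power2_eq_square field_simps)
  ultimately have "integral {0..1} (\<lambda>t. (2 * of_real pi * \<i>) * (g (circ \<rho> t) / circ \<rho> t)) =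
      2 * of_real pi * \<i> * deriv g 0"
    unfolding contour_integral_integral by (simp only: c)
  then show ?thesis
    unfolding integral_mult_right by simp
qed

lemma norm_smult_axis [simp]: "norm (c *s axis j (1::complex)) = norm c"
proof -
  have "c *s axis j (1::complex) = axis j c" by (simp add: vec_eq_iff axis_def)
  moreover have "norm (axis j c) = norm c"
    unfolding norm_vec_def L2_set_def axis_def by (simp add: if_distrib[of "\<lambda>x. (norm x)\<^sup>2"] cong: if_cong)
  ultimately show ?thesis by simp
qed

text \<open>As an integral of values of \<open>g\<close>, the partial derivative inherits
  continuity, holomorphy and bounds from \<open>g\<close>.\<close>

lemma partial_Cauchy:
  assumes "holo_on V g" "ball v R \<subseteq> V" "0 < \<epsilon>" "\<epsilon> < R"
  shows "partial j g v = integral {0..1} (\<lambda>t. g (v + circ \<epsilon> t *s axis j 1) / circ \<epsilon> t)"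
proof -
  have "(\<lambda>\<xi>. g (v + \<xi> *s axis j 1)) holomorphic_on ball 0 R"
    by (rule holo_on_line[OF assms(1)]) (use assms(2) in \<open>auto simp: dist_norm subset_iff\<close>)
  from circ_mean_deriv[OF this assms(3,4)] show ?thesis unfolding partial_def by simp
qed

text \<open>Cauchy's estimate on the circle of radius R/2, which stays strictly inside the ball;
  hence the factor 2.\<close>

lemma partial_bound:
  assumes "holo_on V g" "ball v R \<subseteq> V" "0 < R" "\<And>w. w \<in> ball v R \<Longrightarrow> norm (g w) \<le> B"
  shows "norm (partial j g v) \<le> 2 * B / R"
proof -
  have e: "norm (g (v + circ (R/2) t *s axis j 1) / circ (R/2) t) \<le> B / (R/2)" for t
    using assms(3) assms(4)[of "v + circ (R/2) t *s axis j 1"]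
    by (simp add: norm_divide dist_norm divide_right_mono)
  have c: "continuous_on {0..1} (\<lambda>t. g (v + circ (R/2) t *s axis j 1) / circ (R/2) t)"
    using assms(2,3)
    by (intro continuous_intros continuous_on_compose2[OF holo_on_imp_continuous_on[OF assms(1)]])
        (auto simp: dist_norm subset_iff)
  show ?thesis
    using partial_Cauchy[OF assms(1,2), of "R/2" j] assms(3)
      integral_bound[OF _ c, of "B / (R/2)"] e by (simp add: mult.commute)
qed

section \<open>Dependence on parameters\<close>

lemma continuous_on_local:
  fixes f :: "'a::t2_space \<Rightarrow> 'b::topological_space"
  assumes "\<And>x. x \<in> A \<Longrightarrow> \<exists>T. open T \<and> x \<in> T \<and> continuous_on (A \<inter> T) f"
  shows "continuous_on A f"
  unfolding continuous_on_eq_continuous_within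
proof
  fix x assume x: "x \<in> A"
  then obtain T where T: "open T" "x \<in> T" "continuous_on (A \<inter> T) f" using assms by blast
  have "at x within A = at x within (A \<inter> T)"
    by (rule at_within_nhd[OF T(2,1)]) auto
  then show "continuous (at x within A) f"
    using T x by (simp add: continuous_on_eq_continuous_within)
qed

text \<open>The Leibniz rule asks for joint continuity of the derivative in point and parameter.
  Cauchy's formula reduces it to joint continuity of \<open>G\<close>.\<close>

lemma continuous_on_partial_param:
  fixes G :: "complex ^ 'n::finite \<Rightarrow> 'b::t2_space \<Rightarrow> complex"
  assumes U: "open U" and cont: "continuous_on (U \<times> S) (\<lambda>(v, \<tau>). G v \<tau>)"
    and holo: "\<And>\<tau>. \<tau> \<in> S \<Longrightarrow> holo_on U (\<lambda>v. G v \<tau>)"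
  shows "continuous_on (U \<times> S) (\<lambda>(v, \<tau>). partial j (\<lambda>v. G v \<tau>) v)"
proof (rule continuous_on_local)
  fix x assume "x \<in> U \<times> S"
  then obtain v0 \<tau>0 where x: "x = (v0, \<tau>0)" "v0 \<in> U" "\<tau>0 \<in> S" by auto
  obtain e where e: "e > 0" "ball v0 e \<subseteq> U" using U x openE by blast
  \<comment> \<open>Centres at distance less than e/2 from \<open>v0\<close> and circles of radius
    e/4 around them stay inside \<open>U\<close>.\<close>
  define N where "N = ball v0 (e/2)"
  have N: "ball v (e/2) \<subseteq> U" if "v \<in> N" for v
  proof -
    have "dist v0 w < e" if "dist v w < e/2" for w
      using \<open>v \<in> N\<close> that dist_triangle_half_r[of v v0 e w] by (auto simp: N_def dist_commute)
    then show ?thesis using e by auto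
  qed
  have "continuous_on (N \<times> S) (\<lambda>p. integral (cbox 0 1) (\<lambda>t. G (fst p + circ (e/4) t *s axis j 1) (snd p) / circ
      (e/4) t))"
  proof (rule integral_continuous_on_param)
    have "continuous_on ((N \<times> S) \<times> cbox 0 1) (\<lambda>q. G (fst (fst q) + circ (e/4) (snd q) *s axis j 1) (snd (fst q)) /
        circ (e/4) (snd q))"
    proof (intro continuous_on_divide continuous_intros)
      show "continuous_on ((N \<times> S) \<times> cbox 0 (1::real)) (\<lambda>q. G (fst (fst q) + circ (e/4) (snd q) *s axis j 1)
          (snd (fst q)))"
      proof -
        have "continuous_on ((N \<times> S) \<times> cbox 0 (1::real)) (\<lambda>q. (fst (fst q) + circ (e/4) (snd q) *s axis j 1, snd
            (fst q)))"
          by (intro continuous_intros)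
        moreover have "v + circ (e/4) t *s axis j 1 \<in> U" if "v \<in> N" for v t
          using N[OF that] e(1) by (auto simp: dist_norm subset_iff)
        then have "(\<lambda>q. (fst (fst q) + circ (e/4) (snd q) *s axis j 1, snd (fst q))) ` ((N \<times> S) \<times> cbox 0 (1::real))
            \<subseteq> U \<times> S"
          by auto
        ultimately show ?thesis
          using continuous_on_compose2[OF cont] by (fastforce simp: case_prod_beta)
      qed
    qed (use e in auto)
    then show "continuous_on ((N \<times> S) \<times> cbox 0 1) (\<lambda>(p, t). G (fst p + circ (e/4) t *s axis j 1) (snd p) / circ
        (e/4) t)"
      by (simp add: case_prod_beta)
  qed
  moreover have "partial j (\<lambda>v. G v (snd p)) (fst p) =
      integral (cbox 0 1) (\<lambda>t. G (fst p + circ (e/4) t *s axis j 1) (snd p) / circ (e/4) t)"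
    if "p \<in> N \<times> S" for p
    using partial_Cauchy[OF holo N, of "snd p" "fst p" "e/4" j] that e by auto
  ultimately have "continuous_on (N \<times> S) (\<lambda>(v, \<tau>). partial j (\<lambda>v. G v \<tau>) v)"
    by (subst continuous_on_cong[OF refl]) (auto simp: case_prod_beta)
  then show "\<exists>T. open T \<and> x \<in> T \<and> continuous_on (U \<times> S \<inter> T) (\<lambda>(v, \<tau>). partial j (\<lambda>v. G v \<tau>) v)"
    by (intro exI[of _ "N \<times> UNIV"])
      (use x e in \<open>auto simp: N_def open_Times intro: continuous_on_subset\<close>)
qed

text \<open>Differentiation under the integral gives a real derivative; being an integral of complex
  linear maps, it is complex linear.\<close>

lemma holo_on_integral:
  fixes G :: "complex ^ 'n::finite \<Rightarrow> real \<Rightarrow> complex"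
  assumes U: "open U" and cont: "continuous_on (U \<times> {0..1}) (\<lambda>(v, \<tau>). G v \<tau>)"
    and holo: "\<And>\<tau>. \<tau> \<in> {0..1} \<Longrightarrow> holo_on U (\<lambda>v. G v \<tau>)"
  shows "holo_on U (\<lambda>v. integral {0..1} (G v))"
  unfolding holo_on_def
proof
  fix v0 assume v0: "v0 \<in> U"
  obtain e where e: "e > 0" "ball v0 e \<subseteq> U" using U v0 openE by blast
  let ?N = "ball v0 e"
  \<comment> \<open>\<open>leibniz_rule\<close> takes the derivative as a bounded linear function,
    so the sum over the partial derivatives is assembled in that space, where its continuity can
    also be stated.\<close>
  define fx :: "complex ^ 'n \<Rightarrow> real \<Rightarrow> (complex ^ 'n) \<Rightarrow>\<^sub>L complex" where
    "fx v \<tau> = (\<Sum>j\<in>UNIV. blinfun_mult_right (partial j (\<lambda>v. G v \<tau>) v) o\<^sub>L Blinfun (\<lambda>u. u $ j))" for v \<tau>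
  have fx: "blinfun_apply (fx v \<tau>) u = (\<Sum>j\<in>UNIV. u $ j * partial j (\<lambda>v. G v \<tau>) v)" for v \<tau> u
    unfolding fx_def blinfun.sum_left
    by (simp add: bounded_linear_Blinfun_apply[OF bounded_linear_vec_nth] mult.commute)
  have cfx: "continuous_on (U \<times> {0..1}) (\<lambda>(v, \<tau>). fx v \<tau>)"
    unfolding fx_def case_prod_beta
    using continuous_on_partial_param[OF U cont holo]
    by (intro continuous_intros bounded_linear.continuous_on[OF bounded_linear_blinfun_mult_right])
      (auto simp: case_prod_beta)
  have "((\<lambda>v. integral (cbox 0 1) (G v)) has_derivative integral (cbox 0 1) (fx v0)) (at v0 within ?N)"
  proof (rule leibniz_rule)
    fix v \<tau> assume v: "v \<in> ?N" "\<tau> \<in> cbox (0::real) 1"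
    have "blinfun_apply (fx v \<tau>) = (\<lambda>u. \<Sum>j\<in>UNIV. u $ j * partial j (\<lambda>v. G v \<tau>) v)"
      using fx by auto
    then show "((\<lambda>v. G v \<tau>) has_derivative blinfun_apply (fx v \<tau>)) (at v within ?N)"
      using has_derivative_at_withinI[OF holo_on_has_derivative_partial[OF holo, of \<tau> v]] v e
      by auto
  next
    fix v assume v: "v \<in> ?N"
    have "continuous_on (cbox 0 1) (G v)"
      by (rule continuous_on_compose2[OF cont, of _ "\<lambda>\<tau>. (v, \<tau>)", simplified])
        (use v e in \<open>auto intro!: continuous_intros\<close>)
    then show "G v integrable_on cbox 0 1" by (rule integrable_continuous)
  next
    show "continuous_on (?N \<times> cbox 0 1) (\<lambda>(v, \<tau>). fx v \<tau>)"
      by (rule continuous_on_subset[OF cfx]) (use e in auto)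
  qed (use e in auto)
  then have D: "((\<lambda>v. integral {0..1} (G v)) has_derivative integral {0..1} (fx v0)) (at v0)"
    using e by (simp add: at_within_open[OF _ open_ball])
  have "continuous_on {0..1} (fx v0)"
    by (rule continuous_on_compose2[OF cfx, of _ "\<lambda>\<tau>. (v0, \<tau>)", simplified])
      (use v0 in \<open>auto intro!: continuous_intros\<close>)
  then have int: "fx v0 integrable_on {0..1}" by (rule integrable_continuous_interval)
  have "integral {0..1} (fx v0) (c *s u) = c * integral {0..1} (fx v0) u" for c u
    unfolding blinfun_apply_integral[OF int] integral_mult_right[symmetric]
    by (simp add: fx sum_distrib_left mult.assoc)
  then show "\<exists>L. ((\<lambda>v. integral {0..1} (G v)) has_derivative L) (at v0) \<and> (\<forall>c u. L (c *s u) = c * L u)"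
    using D by blast
qed

lemma holo_on_local:
  assumes "\<And>v. v \<in> V \<Longrightarrow> \<exists>N. v \<in> N \<and> holo_on N g" shows "holo_on V g"
  using assms unfolding holo_on_def by meson

lemma holo_on_partial:
  assumes "open V" "holo_on V g" shows "holo_on V (partial j g)"
proof (rule holo_on_local)
  fix v0 assume "v0 \<in> V"
  then obtain e where e: "e > 0" "ball v0 e \<subseteq> V" using assms openE by blast
  define N where "N = ball v0 (e/2)"
  have N: "ball v (e/2) \<subseteq> V" if "v \<in> N" for v
  proof -
    have "dist v0 w < e" if "dist v w < e/2" for w
      using \<open>v \<in> N\<close> that dist_triangle_half_r[of v v0 e w] by (auto simp: N_def dist_commute)
    then show ?thesis using e by auto
  qed
  have im: "v + circ (e/4) t *s axis j 1 \<in> V" if "v \<in> N" for v t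
    using N[OF that] e(1) by (auto simp: dist_norm subset_iff)
  have "holo_on N (\<lambda>v. integral {0..1} (\<lambda>t. g (v + circ (e/4) t *s axis j 1) / circ (e/4) t))"
  proof (rule holo_on_integral)
    show "open N" by (simp add: N_def)
    have "continuous_on (N \<times> {0..1::real}) (\<lambda>p. g (fst p + circ (e/4) (snd p) *s axis j 1) / circ (e/4) (snd p))"
      using e im
      by (intro continuous_intros continuous_on_compose2[OF holo_on_imp_continuous_on[OF assms(2)]]) auto
    then show "continuous_on (N \<times> {0..1}) (\<lambda>(v, t). g (v + circ (e/4) t *s axis j 1) / circ (e/4) t)"
      by (simp add: case_prod_beta)
    fix t :: real
    show "holo_on N (\<lambda>v. g (v + circ (e/4) t *s axis j 1) / circ (e/4) t)"
      by (intro holo_on_divide holo_on_compose[OF assms(2)]) (use e im in auto)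
  qed
  then have "holo_on N (partial j g)"
    using partial_Cauchy[OF assms(2) N, of _ "e/4" j] e holo_on_cong[of N "partial j g"]
    by (auto simp: N_def)
  then show "\<exists>N. v0 \<in> N \<and> holo_on N (partial j g)"
    using e by (intro exI[of _ N]) (auto simp: N_def)
qed

section \<open>Hadamard's lemma\<close>

definition hada :: "'n \<Rightarrow> (complex ^ 'n::finite \<Rightarrow> complex) \<Rightarrow> complex ^ 'n \<Rightarrow> complex ^ 'n \<Rightarrow> complex" where
  "hada j g a b = integral {0..1} (\<lambda>t. partial j g (b + of_real t *s (a - b)))"

lemma segment_convex:
  fixes a b :: "complex ^ 'n::finite"
  assumes "convex U" "a \<in> U" "b \<in> U" "0 \<le> t" "t \<le> 1" shows "b + of_real t *s (a - b) \<in> U"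
proof -
  have "b + of_real t *s (a - b) = (1 - t) *\<^sub>R b + t *\<^sub>R a"
    by (simp add: vec_eq_iff algebra_simps scaleR_conv_of_real[where 'a=complex])
  then show ?thesis using assms by (simp add: convexD)
qed

lemma hada_same [simp]: "hada j g a a = partial j g a"
  unfolding hada_def by simp

lemma continuous_on_segment_partial:
  assumes "open U" "convex U" "holo_on U g" "a \<in> U" "b \<in> U"
  shows "continuous_on {0..1} (\<lambda>t. partial j g (b + of_real t *s (a - b)))"
  by (rule continuous_on_compose2[OF holo_on_imp_continuous_on[OF holo_on_partial[OF assms(1,3)]]])
    (use assms segment_convex in \<open>auto intro!: continuous_intros\<close>)

text \<open>The fundamental theorem of calculus along the segment from b to a. The quotients
  \<open>hada\<close> are explicit integrals, hence holomorphic in the end points and bounded by the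
  partial derivatives.\<close>

lemma hadamard:
  assumes U: "open U" "convex U" "holo_on U g" "a \<in> U" "b \<in> U"
  shows "g a - g b = (\<Sum>j\<in>UNIV. (a $ j - b $ j) * hada j g a b)"
proof -
  let ?f = "\<lambda>t. \<Sum>j\<in>UNIV. (a $ j - b $ j) * partial j g (b + of_real t *s (a - b))"
  have "(?f has_integral g (b + of_real 1 *s (a - b)) - g (b + of_real 0 *s (a - b))) {0..1::real}"
  proof (rule fundamental_theorem_of_calculus)
    fix t :: real assume t: "t \<in> {0..1}"
    have "((\<lambda>\<xi>. g (b + \<xi> *s (a - b))) has_field_derivative
        (\<Sum>j\<in>UNIV. (a - b) $ j * partial j g (b + of_real t *s (a - b)))) (at (of_real t))"
      using t U segment_convex
      by (intro has_field_derivative_line holo_on_has_derivative_partial[OF U(3)])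
        (auto simp: sum_distrib_left mult.assoc)
    then have "((\<lambda>t. g (b + of_real t *s (a - b))) has_vector_derivative
        (\<Sum>j\<in>UNIV. (a - b) $ j * partial j g (b + of_real t *s (a - b)))) (at t within {0..1})"
      by (rule has_vector_derivative_real_field)
    then show "((\<lambda>t. g (b + of_real t *s (a - b))) has_vector_derivative ?f t) (at t within {0..1})"
      by simp
  qed simp
  then have "g a - g b = integral {0..1} ?f"
    by (simp add: integral_unique)
  also have "\<dots> = (\<Sum>j\<in>UNIV. integral {0..1} (\<lambda>t. (a $ j - b $ j) * partial j g (b + of_real t *s (a - b))))"
    by (intro integral_sum integrable_continuous_interval continuous_intros
        continuous_on_segment_partial[OF U]) auto
  finally show ?thesis by (simp add: hada_def)
qed

text \<open>Both end points may move with a parameter: later one of them is \<open>v\<close> with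
  coordinates set to 0, the image of \<open>v\<close> under a map, or a fixed point
  \<open>u\<close>.\<close>

lemma holo_on_hada:
  assumes U: "open U" "convex U" "holo_on U g" and V: "open V"
    and a: "\<And>i. holo_on V (\<lambda>y. a y $ i)" and b: "\<And>i. holo_on V (\<lambda>y. b y $ i)"
    and im: "a ` V \<subseteq> U" "b ` V \<subseteq> U"
  shows "holo_on V (\<lambda>y. hada j g (a y) (b y))"
  unfolding hada_def
proof (rule holo_on_integral[OF V])
  have s: "b y + of_real t *s (a y - b y) \<in> U" if "y \<in> V" "0 \<le> t" "t \<le> 1" for y t
    using that im segment_convex[OF U(2)] by blast
  have ca: "continuous_on V a" and cb: "continuous_on V b"
    using a b by (auto intro!: continuous_on_vec_componentwise holo_on_imp_continuous_on)
  have "continuous_on (V \<times> {0..1::real}) (\<lambda>p. partial j g (b (fst p) + of_real (snd p) *s (a (fst p) - b (fst p))))"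
    by (rule continuous_on_compose2[OF holo_on_imp_continuous_on[OF holo_on_partial[OF U(1,3)]]])
      (use s in \<open>auto intro!: continuous_intros continuous_on_compose2[OF ca] continuous_on_compose2[OF cb]\<close>)
  then show "continuous_on (V \<times> {0..1}) (\<lambda>(y, t). partial j g (b y + of_real t *s (a y - b y)))"
    by (simp add: case_prod_beta)
  fix t :: real assume t: "t \<in> {0..1}"
  show "holo_on V (\<lambda>y. partial j g (b y + of_real t *s (a y - b y)))"
    by (rule holo_on_compose[OF holo_on_partial[OF U(1,3)]])
      (use s t a b in \<open>auto intro!: holo_on_add holo_on_mult holo_on_diff\<close>)
qed

lemma hada_bound:
  assumes "open U" "convex U" "holo_on U g" "a \<in> U" "b \<in> U" "\<And>v. v \<in> U \<Longrightarrow> norm (partial j g v) \<le> B"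
  shows "norm (hada j g a b) \<le> B"
proof -
  have "norm (integral {0..1} (\<lambda>t. partial j g (b + of_real t *s (a - b)))) \<le> B * (1 - 0)"
  proof (rule integral_bound)
    show "norm (partial j g (b + of_real t *s (a - b))) \<le> B" if "t \<in> {0..1}" for t
      using that assms segment_convex[OF assms(2,4,5)] by auto
  qed (use continuous_on_segment_partial[OF assms(1-5)] in auto)
  then show ?thesis by (simp add: hada_def)
qed

text \<open>Polydiscs serve as neighbourhoods of 0 because coordinates can be changed inside them
  one at a time, each moving in its own disc.\<close>

definition polydisc :: "real \<Rightarrow> (complex ^ 'n) set" where
  "polydisc R = {v. \<forall>i. norm (v $ i) < R}"

lemma open_polydisc: "open (polydisc R :: (complex ^ 'n::finite) set)"
proof -
  have "polydisc R = (\<Inter>i. {v :: complex ^ 'n. norm (v $ i) < R})" by (auto simp: polydisc_def)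
  moreover have "open {v :: complex ^ 'n. norm (v $ i) < R}" for i
    by (intro open_Collect_less continuous_intros)
  ultimately show ?thesis by (simp add: open_INT)
qed

lemma convex_polydisc: "convex (polydisc R :: (complex ^ 'n::finite) set)"
proof (rule convexI)
  fix x y :: "complex ^ 'n" and u v :: real
  assume *: "x \<in> polydisc R" "y \<in> polydisc R" "0 \<le> u" "0 \<le> v" "u + v = 1"
  have "norm (u *\<^sub>R (x $ i) + v *\<^sub>R (y $ i)) < R" for i
    using convexD[OF convex_ball[of "0::complex" R], of "x $ i" "y $ i" u v] * by (auto simp: polydisc_def)
  then show "u *\<^sub>R x + v *\<^sub>R y \<in> polydisc R" by (simp add: polydisc_def)
qed

lemma polydisc_mono: "r \<le> R \<Longrightarrow> polydisc r \<subseteq> polydisc R"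
  unfolding polydisc_def by (auto intro: order_less_le_trans)

lemma zero_in_polydisc [simp]: "0 < R \<Longrightarrow> 0 \<in> polydisc R"
  unfolding polydisc_def by auto

lemma norm_le_sum_nth: "norm (v :: complex ^ 'n::finite) \<le> (\<Sum>i\<in>UNIV. norm (v $ i))"
  unfolding norm_vec_def by (rule L2_set_le_sum) auto

lemma polydisc_subset_ball:
  assumes "e > 0"
  shows "polydisc (e / CARD('n)) \<subseteq> ball (0 :: complex ^ 'n::finite) e"
proof
  fix v :: "complex ^ 'n" assume "v \<in> polydisc (e / CARD('n))"
  then have "(\<Sum>i\<in>UNIV. norm (v $ i)) < (\<Sum>i\<in>(UNIV::'n set). e / CARD('n))"
    by (intro sum_strict_mono) (auto simp: polydisc_def)
  also have "\<dots> = e" by simp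
  finally show "v \<in> ball 0 e" using norm_le_sum_nth[of v] by simp
qed

lemma eventually_nhds_0_polydisc:
  "eventually P (nhds (0 :: complex ^ 'n::finite)) \<longleftrightarrow> (\<exists>R>0. \<forall>v\<in>polydisc R. P v)"
proof
  assume "eventually P (nhds (0 :: complex ^ 'n))"
  then obtain e where "e > 0" "\<forall>v. dist v 0 < e \<longrightarrow> P v" unfolding eventually_nhds_metric by auto
  then show "\<exists>R>0. \<forall>v\<in>polydisc R. P v"
    using polydisc_subset_ball[of e, where 'n='n] by (intro exI[of _ "e / CARD('n)"]) auto
next
  assume "\<exists>R>0. \<forall>v\<in>polydisc R. P v"
  then show "eventually P (nhds 0)"
    unfolding eventually_nhds using open_polydisc zero_in_polydisc by meson
qed

section \<open>Iterated means over tori\<close>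

definition upd :: "complex ^ 'n \<Rightarrow> 'n \<Rightarrow> complex \<Rightarrow> complex ^ 'n" where
  "upd v i \<xi> = (\<chi> j. if j = i then \<xi> else v $ j)"

lemma upd_nth [simp]: "upd v i \<xi> $ j = (if j = i then \<xi> else v $ j)"
  unfolding upd_def by simp

lemma upd_line: "upd v i \<xi> = upd v i 0 + \<xi> *s axis i 1"
  by (simp add: vec_eq_iff axis_def)

lemma continuous_on_upd [continuous_intros]:
  fixes F :: "'b::topological_space \<Rightarrow> complex ^ 'n::finite"
  assumes "continuous_on V F" "continuous_on V f"
  shows "continuous_on V (\<lambda>v. upd (F v) i (f v))"
proof (rule continuous_on_vec_componentwise)
  show "continuous_on V (\<lambda>v. upd (F v) i (f v) $ j)" for j
    using assms by (cases "j = i") (auto intro!: continuous_intros)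
qed

lemma holo_on_upd_holomorphic:
  assumes "holo_on V g" "\<And>\<xi>. \<xi> \<in> S \<Longrightarrow> upd v i \<xi> \<in> V"
  shows "(\<lambda>\<xi>. g (upd v i \<xi>)) holomorphic_on S"
  using holo_on_line[OF assms(1), of S "upd v i 0" "axis i 1"] assms(2)
  by (simp add: upd_line[symmetric])

text \<open>Coordinates outside \<open>I\<close> are 0, so the torus lies in the coordinate subspace
  on which \<open>coord_proj I\<close> is the identity.\<close>

definition torus :: "real \<Rightarrow> 'n set \<Rightarrow> (complex ^ 'n) set" where
  "torus \<rho> I = {v. \<forall>i. if i \<in> I then norm (v $ i) = \<rho> else v $ i = 0}"

definition avg :: "'n \<Rightarrow> real \<Rightarrow> (complex ^ 'n \<Rightarrow> complex) \<Rightarrow> complex ^ 'n \<Rightarrow> complex" where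
  "avg i \<rho> F v = integral {0..1} (\<lambda>t. F (upd v i (circ \<rho> t)))"

text \<open>Averaging along a list makes induction on the variables available. Independence of the
  order is proved afterwards, for continuous functions.\<close>

fun avgs :: "'n list \<Rightarrow> real \<Rightarrow> (complex ^ 'n \<Rightarrow> complex) \<Rightarrow> complex ^ 'n \<Rightarrow> complex" where
  "avgs [] \<rho> F = F"
| "avgs (i # is) \<rho> F = avg i \<rho> (avgs is \<rho> F)"

lemma torus_nth: "v \<in> torus \<rho> I \<Longrightarrow> norm (v $ i) = (if i \<in> I then \<rho> else 0)"
  unfolding torus_def by auto

lemma torus_upd: "v \<in> torus \<rho> I \<Longrightarrow> i \<in> I \<Longrightarrow> norm \<xi> = \<rho> \<Longrightarrow> upd v i \<xi> \<in> torus \<rho> I"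
  unfolding torus_def by auto

lemma torus_upd_circ: "v \<in> torus \<rho> I \<Longrightarrow> i \<in> I \<Longrightarrow> upd v i (circ \<rho> t) \<in> torus \<rho> I"
  using torus_nth[of v \<rho> I i] by (intro torus_upd) (metis norm_circ norm_ge_zero)+

lemma avg_cong:
  "v \<in> torus \<rho> I \<Longrightarrow> i \<in> I \<Longrightarrow> (\<And>v. v \<in> torus \<rho> I \<Longrightarrow> F v = G v) \<Longrightarrow> avg i \<rho> F v = avg i \<rho> G v"
  unfolding avg_def by (simp add: torus_upd_circ)

lemma avgs_cong:
  assumes "v \<in> torus \<rho> I" "set is \<subseteq> I" "\<And>v. v \<in> torus \<rho> I \<Longrightarrow> F v = G v"
  shows "avgs is \<rho> F v = avgs is \<rho> G v"
  using assms(1,2)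
proof (induction "is" arbitrary: v)
  case (Cons i "is")
  then show ?case by (auto intro!: avg_cong[where I=I])
qed (use assms in auto)

lemma continuous_on_avg:
  fixes F :: "complex ^ 'n::finite \<Rightarrow> complex"
  assumes "continuous_on (torus \<rho> I) F" "i \<in> I"
  shows "continuous_on (torus \<rho> I) (avg i \<rho> F)"
proof -
  have "continuous_on (torus \<rho> I \<times> cbox 0 (1::real)) (\<lambda>p. F (upd (fst p) i (circ \<rho> (snd p))))"
    using assms torus_upd_circ
    by (intro continuous_on_compose2[OF assms(1)] continuous_intros) auto
  then have "continuous_on (torus \<rho> I) (\<lambda>v. integral (cbox 0 1) (\<lambda>t. F (upd v i (circ \<rho> t))))"
    by (intro integral_continuous_on_param) (simp add: case_prod_beta)
  then show ?thesis by (simp add: avg_def[abs_def])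
qed

lemma continuous_on_avgs:
  fixes F :: "complex ^ 'n::finite \<Rightarrow> complex"
  assumes "continuous_on (torus \<rho> I) F" "set is \<subseteq> I"
  shows "continuous_on (torus \<rho> I) (avgs is \<rho> F)"
  using assms by (induction "is") (auto intro: continuous_on_avg)

lemma avg_integrable:
  fixes F :: "complex ^ 'n::finite \<Rightarrow> complex"
  assumes "continuous_on (torus \<rho> I) F" "i \<in> I" "v \<in> torus \<rho> I"
  shows "(\<lambda>t. F (upd v i (circ \<rho> t))) integrable_on {0..1}"
  using assms torus_upd_circ
  by (intro integrable_continuous_interval continuous_on_compose2[OF assms(1)] continuous_intros) auto

lemma avg_commute:
  fixes F :: "complex ^ 'n::finite \<Rightarrow> complex"
  assumes "continuous_on (torus \<rho> I) F" "i \<in> I" "j \<in> I" "i \<noteq> j" "v \<in> torus \<rho> I"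
  shows "avg i \<rho> (avg j \<rho> F) v = avg j \<rho> (avg i \<rho> F) v"
proof -
  have "continuous_on (cbox (0::real,0::real) (1,1)) (\<lambda>p. F (upd (upd v i (circ \<rho> (fst p))) j (circ \<rho> (snd p))))"
    by (intro continuous_on_compose2[OF assms(1)] continuous_intros)
      (use assms in \<open>auto intro!: torus_upd_circ\<close>)
  then have "integral (cbox 0 1) (\<lambda>s. integral (cbox 0 1) (\<lambda>t. F (upd (upd v i (circ \<rho> s)) j (circ \<rho> t))))
     = integral (cbox 0 1) (\<lambda>t. integral (cbox 0 1) (\<lambda>s. F (upd (upd v i (circ \<rho> s)) j (circ \<rho> t))))"
    by (intro integral_swap_continuous) (simp add: case_prod_beta)
  moreover have "upd (upd v i x) j y = upd (upd v j y) i x" for x y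
    using assms(4) by (simp add: vec_eq_iff)
  ultimately show ?thesis by (simp add: avg_def)
qed

text \<open>Fubini moves any chosen variable to the innermost position, where one-variable facts
  about the function itself apply.\<close>

lemma avgs_remove1:
  fixes F :: "complex ^ 'n::finite \<Rightarrow> complex"
  assumes "continuous_on (torus \<rho> I) F" "distinct is" "set is \<subseteq> I" "l \<in> set is" "v \<in> torus \<rho> I"
  shows "avgs is \<rho> F v = avgs (remove1 l is) \<rho> (avg l \<rho> F) v"
  using assms(2-5)
proof (induction "is" arbitrary: v)
  case (Cons i "is")
  show ?case
  proof (cases "i = l")
    case True
    have "avg l \<rho> (avgs is \<rho> F) v = avgs is \<rho> (avg l \<rho> F) v"
      using Cons.prems True
    proof -
      have "l \<notin> set is" "l \<in> I" "distinct is" "set is \<subseteq> I" using Cons.prems True by auto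
      then show ?thesis using \<open>v \<in> torus \<rho> I\<close>
      proof (induction "is" arbitrary: v)
        case (Cons j js)
        have "avg l \<rho> (avg j \<rho> (avgs js \<rho> F)) v = avg j \<rho> (avg l \<rho> (avgs js \<rho> F)) v"
          using Cons.prems by (intro avg_commute[where I=I] continuous_on_avgs assms(1)) auto
        also have "\<dots> = avg j \<rho> (avgs js \<rho> (avg l \<rho> F)) v"
          using Cons by (intro avg_cong[where I=I]) auto
        finally show ?case by simp
      qed auto
    qed
    then show ?thesis using True by simp
  next
    case False
    then show ?thesis using Cons by (auto intro!: avg_cong[where I=I])
  qed
qed auto

lemma avgs_set_eq:
  fixes F :: "complex ^ 'n::finite \<Rightarrow> complex"
  assumes "continuous_on (torus \<rho> I) F" "distinct is" "distinct js" "set is = set js" "set js \<subseteq> I" "v \<in> torus \<rho> I"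
  shows "avgs is \<rho> F v = avgs js \<rho> F v"
  using assms
proof (induction js arbitrary: "is" F rule: rev_induct)
  case (snoc l js)
  have "avgs is \<rho> F v = avgs (remove1 l is) \<rho> (avg l \<rho> F) v"
    using snoc.prems by (intro avgs_remove1) auto
  also have "\<dots> = avgs js \<rho> (avg l \<rho> F) v"
    using snoc.prems by (intro snoc.IH continuous_on_avg) auto
  also have "\<dots> = avgs (js @ [l]) \<rho> F v"
    using avgs_remove1[of \<rho> I F "js @ [l]" l v] snoc.prems by (simp add: remove1_append)
  finally show ?case .
qed auto

text \<open>The enumeration is immaterial for continuous functions, and so is the base point, since
  every coordinate in \<open>I\<close> is overwritten by the averaging.\<close>

definition torus_mean :: "'n set \<Rightarrow> real \<Rightarrow> (complex ^ 'n::finite \<Rightarrow> complex) \<Rightarrow> complex" where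
  "torus_mean I \<rho> F = avgs (SOME is. distinct is \<and> set is = I) \<rho> F (\<chi> i. if i \<in> I then of_real \<rho> else 0)"

lemma avgs_indep:
  assumes "\<And>i. i \<notin> set is \<Longrightarrow> v $ i = w $ i"
  shows "avgs is \<rho> F v = avgs is \<rho> F w"
  using assms
proof (induction "is" arbitrary: v w)
  case Nil
  then have "v = w" by (simp add: vec_eq_iff)
  then show ?case by simp
next
  case (Cons i "is")
  have "avgs is \<rho> F (upd v i x) = avgs is \<rho> F (upd w i x)" for x
    using Cons.prems by (intro Cons.IH) auto
  then show ?case by (simp add: avg_def)
qed

lemma avgs_upd:
  assumes "l \<notin> set is"
  shows "avgs is \<rho> (\<lambda>v. F (upd v l x)) v = avgs is \<rho> F (upd v l x)"
  using assms
proof (induction "is" arbitrary: v)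
  case (Cons i "is")
  then have "upd (upd v i y) l x = upd (upd v l x) i y" for y
    by (auto simp: vec_eq_iff)
  then show ?case using Cons by (simp add: avg_def)
qed auto

lemma torus_mean_eq_avgs:
  fixes F :: "complex ^ 'n::finite \<Rightarrow> complex"
  assumes "continuous_on (torus \<rho> I) F" "distinct is" "set is = I" "v \<in> torus \<rho> I"
  shows "torus_mean I \<rho> F = avgs is \<rho> F v"
proof -
  define js where "js = (SOME is. distinct is \<and> set is = I)"
  have js: "distinct js \<and> set js = I"
    unfolding js_def using assms(2,3) by (rule someI[of "\<lambda>is. distinct is \<and> set is = I" "is", OF conjI])
  have "torus_mean I \<rho> F = avgs js \<rho> F v"
    unfolding torus_mean_def js_def[symmetric]
    using js assms(4) by (intro avgs_indep) (auto simp: torus_def)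
  also have "\<dots> = avgs is \<rho> F v"
    using js assms by (intro avgs_set_eq[where I=I]) auto
  finally show ?thesis .
qed

lemma torus_list:
  fixes I :: "'n::finite set"
  assumes "0 < \<rho>"
  obtains "is" v where "distinct is" "set is = I" "v \<in> torus \<rho> I"
proof -
  obtain "is" where "distinct is" "set is = I"
    using finite_distinct_list[of I] by auto
  moreover have "(\<chi> i. if i \<in> I then of_real \<rho> else 0) \<in> torus \<rho> I"
    using assms by (auto simp: torus_def)
  ultimately show ?thesis using that by blast
qed

lemma torus_mean_cong:
  assumes "0 < \<rho>" "\<And>v. v \<in> torus \<rho> I \<Longrightarrow> F v = G v"
  shows "torus_mean I \<rho> F = torus_mean I \<rho> G"
proof -
  have "(\<chi> i. if i \<in> I then of_real \<rho> else 0) \<in> torus \<rho> I"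
    using assms(1) by (auto simp: torus_def)
  moreover have "\<exists>is. distinct is \<and> set is = I" using finite_distinct_list[of I] by auto
  then have "set (SOME is. distinct is \<and> set is = I) = I"
    using someI_ex[of "\<lambda>is. distinct is \<and> set is = I"] by simp
  ultimately show ?thesis
    unfolding torus_mean_def using assms(2) by (intro avgs_cong[where I=I]) auto
qed

lemma avgs_linear:
  fixes F :: "complex ^ 'n::finite \<Rightarrow> complex"
  assumes "continuous_on (torus \<rho> I) F" "continuous_on (torus \<rho> I) G" "set is \<subseteq> I" "v \<in> torus \<rho> I"
  shows "avgs is \<rho> (\<lambda>v. c * F v + G v) v = c * avgs is \<rho> F v + avgs is \<rho> G v"
  using assms(3,4)
proof (induction "is" arbitrary: v)
  case (Cons i "is")
  have "avgs (i # is) \<rho> (\<lambda>v. c * F v + G v) v = avg i \<rho> (\<lambda>v. c * avgs is \<rho> F v + avgs is \<rho> G v) v"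
    using Cons by (auto intro!: avg_cong[where I=I])
  also have "\<dots> = c * avg i \<rho> (avgs is \<rho> F) v + avg i \<rho> (avgs is \<rho> G) v"
    unfolding avg_def using Cons.prems
    by (subst integral_add) (auto intro!: integrable_on_mult_right avg_integrable[where I=I] continuous_on_avgs assms)
  finally show ?case by simp
qed auto

context
  fixes \<rho> :: real and I :: "'n::finite set"
  assumes \<rho>: "0 < \<rho>"
begin

lemma torus_mean_linear:
  assumes "continuous_on (torus \<rho> I) F" "continuous_on (torus \<rho> I) G"
  shows "torus_mean I \<rho> (\<lambda>v. c * F v + G v) = c * torus_mean I \<rho> F + torus_mean I \<rho> G"
proof -
  obtain "is" v where "is": "distinct is" "set is = I" "v \<in> torus \<rho> I" by (rule torus_list[OF \<rho>])
  have "continuous_on (torus \<rho> I) (\<lambda>v. c * F v + G v)" using assms by (intro continuous_intros)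
  then show ?thesis using torus_mean_eq_avgs[OF _ "is"] avgs_linear[OF assms _ "is"(3), of "is" c] "is" assms by simp
qed

lemma torus_mean_zero [simp]: "torus_mean I \<rho> (\<lambda>v. 0) = 0"
  using torus_mean_linear[of "\<lambda>v. 0" "\<lambda>v. 0" "1"] by simp

lemma torus_mean_add:
  assumes "continuous_on (torus \<rho> I) F" "continuous_on (torus \<rho> I) G"
  shows "torus_mean I \<rho> (\<lambda>v. F v + G v) = torus_mean I \<rho> F + torus_mean I \<rho> G"
  using torus_mean_linear[OF assms, of 1] by simp

lemma torus_mean_cmult:
  assumes "continuous_on (torus \<rho> I) F"
  shows "torus_mean I \<rho> (\<lambda>v. c * F v) = c * torus_mean I \<rho> F"
  using torus_mean_linear[OF assms, of "\<lambda>v. 0" c] by simp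

lemma torus_mean_diff:
  assumes "continuous_on (torus \<rho> I) F" "continuous_on (torus \<rho> I) G"
  shows "torus_mean I \<rho> (\<lambda>v. F v - G v) = torus_mean I \<rho> F - torus_mean I \<rho> G"
  using torus_mean_linear[OF assms(2,1), of "-1"] by simp

lemma torus_mean_sum:
  assumes "finite S" "\<And>s. s \<in> S \<Longrightarrow> continuous_on (torus \<rho> I) (F s)"
  shows "torus_mean I \<rho> (\<lambda>v. \<Sum>s\<in>S. F s v) = (\<Sum>s\<in>S. torus_mean I \<rho> (F s))"
  using assms by (induction S rule: finite_induct) (auto simp: torus_mean_add continuous_on_sum)

lemma avg_norm_le:
  assumes "continuous_on (torus \<rho> I) F" "i \<in> I" "v \<in> torus \<rho> I" "\<And>v. v \<in> torus \<rho> I \<Longrightarrow> norm (F v) \<le> B"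
  shows "norm (avg i \<rho> F v) \<le> B"
proof -
  have "norm (integral {0..1} (\<lambda>t. F (upd v i (circ \<rho> t)))) \<le> B * (1 - 0)"
  proof (rule integral_bound)
    show "continuous_on {0..1} (\<lambda>t. F (upd v i (circ \<rho> t)))"
      using assms torus_upd_circ
      by (intro continuous_on_compose2[OF assms(1)] continuous_intros) auto
  qed (use torus_upd_circ[OF assms(3,2)] assms(4) in auto)
  then show ?thesis by (simp add: avg_def)
qed

lemma torus_mean_norm_le:
  assumes "continuous_on (torus \<rho> I) F" "\<And>v. v \<in> torus \<rho> I \<Longrightarrow> norm (F v) \<le> B"
  shows "norm (torus_mean I \<rho> F) \<le> B"
proof -
  obtain "is" v where "is": "distinct is" "set is = I" "v \<in> torus \<rho> I" by (rule torus_list[OF \<rho>])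
  have "norm (avgs js \<rho> F w) \<le> B" if "set js \<subseteq> I" "w \<in> torus \<rho> I" for js w
    using that
  proof (induction js arbitrary: w)
    case (Cons j js)
    then show ?case using continuous_on_avgs[OF assms(1)] by (auto intro!: avg_norm_le)
  qed (use assms in auto)
  then show ?thesis using torus_mean_eq_avgs[OF assms(1) "is"] "is" by simp
qed

lemma torus_mean_kill:
  assumes "continuous_on (torus \<rho> I) F" "l \<in> I" "\<And>v. v \<in> torus \<rho> I \<Longrightarrow> avg l \<rho> F v = 0"
  shows "torus_mean I \<rho> F = 0"
proof -
  obtain "is" v where "is": "distinct is" "set is = I" "v \<in> torus \<rho> I" by (rule torus_list[OF \<rho>])
  have "torus_mean I \<rho> F = avgs (remove1 l is) \<rho> (avg l \<rho> F) v"
    using torus_mean_eq_avgs[OF assms(1) "is"] avgs_remove1[OF assms(1) "is"(1)] "is" assms(2) by auto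
  also have "\<dots> = avgs (remove1 l is) \<rho> (\<lambda>v. 0) v"
    using "is" assms(3) set_remove1_subset[of l "is"] by (intro avgs_cong[where I=I]) auto
  also have "\<dots> = 0"
  proof -
    have "avgs js \<rho> (\<lambda>v. 0) w = 0" for js w
      by (induction js arbitrary: w) (auto simp: avg_def)
    then show ?thesis .
  qed
  finally show ?thesis .
qed

text \<open>The average over the variable l no longer depends on \<open>v $ l\<close>; evaluating
  \<open>G\<close> at \<open>upd v l 0\<close> records this and lands on the torus of one dimension
  less.\<close>

lemma torus_mean_remove:
  assumes "continuous_on (torus \<rho> I) F" "l \<in> I" "continuous_on (torus \<rho> (I - {l})) G"
    "\<And>v. v \<in> torus \<rho> I \<Longrightarrow> avg l \<rho> F v = G (upd v l 0)"
  shows "torus_mean I \<rho> F = torus_mean (I - {l}) \<rho> G"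
proof -
  obtain "is" v where "is": "distinct is" "set is = I" "v \<in> torus \<rho> I" by (rule torus_list[OF \<rho>])
  have "torus_mean I \<rho> F = avgs (remove1 l is) \<rho> (avg l \<rho> F) v"
    using torus_mean_eq_avgs[OF assms(1) "is"] avgs_remove1[OF assms(1) "is"(1)] "is" assms(2) by auto
  also have "\<dots> = avgs (remove1 l is) \<rho> (\<lambda>v. G (upd v l 0)) v"
    using "is" assms(4) set_remove1_subset[of l "is"] by (intro avgs_cong[where I=I]) auto
  also have "\<dots> = avgs (remove1 l is) \<rho> G (upd v l 0)"
    using "is" by (intro avgs_upd) auto
  also have "\<dots> = torus_mean (I - {l}) \<rho> G"
    using "is" by (intro torus_mean_eq_avgs[symmetric] assms(3)) (auto simp: torus_def)
  finally show ?thesis .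
qed

end

lemma torus_mean_holo_zero:
  fixes F :: "complex ^ 'n::finite \<Rightarrow> complex"
  assumes "0 < \<rho>" "\<rho> < R" "continuous_on (torus \<rho> I) F" "l \<in> I"
    "\<And>v. v \<in> torus \<rho> I \<Longrightarrow> \<exists>\<phi>. \<phi> holomorphic_on ball 0 R \<and> \<phi> 0 = 0 \<and> (\<forall>\<xi>. norm \<xi> = \<rho> \<longrightarrow> F (upd v l \<xi>) = \<phi> \<xi>)"
  shows "torus_mean I \<rho> F = 0"
proof (rule torus_mean_kill[OF assms(1,3,4)])
  fix v assume "v \<in> torus \<rho> I"
  then obtain \<phi> where \<phi>: "\<phi> holomorphic_on ball 0 R" "\<phi> 0 = 0" "\<And>\<xi>. norm \<xi> = \<rho> \<Longrightarrow> F (upd v l \<xi>) = \<phi> \<xi>"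
    using assms(5) by meson
  then show "avg l \<rho> F v = 0"
    using circ_mean[OF \<phi>(1) assms(1,2)] assms(1) by (simp add: avg_def)
qed

lemma upd_polydisc:
  assumes "v \<in> torus \<rho> I" "0 < \<rho>" "\<rho> < R" "norm \<xi> < R" shows "upd v l \<xi> \<in> polydisc R"
  using torus_nth[OF assms(1)] assms by (auto simp: polydisc_def)

lemma torus_subset_polydisc: "0 < \<rho> \<Longrightarrow> \<rho> < R \<Longrightarrow> torus \<rho> I \<subseteq> polydisc R"
  using torus_nth by (fastforce simp: polydisc_def)

text \<open>The mean value property removes the variables of \<open>K\<close> one at a time:
  \<open>g\<close> is holomorphic in each, and \<open>m\<close> does not depend on it. Continuity of
  \<open>m\<close> is asked for on every intermediate torus.\<close>

lemma torus_mean_holo_reduce: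
  fixes g m :: "complex ^ 'n::finite \<Rightarrow> complex"
  assumes "0 < \<rho>" "\<rho> < R" "holo_on (polydisc R) g" "K \<subseteq> I"
    "\<And>J. I - K \<subseteq> J \<Longrightarrow> J \<subseteq> I \<Longrightarrow> continuous_on (torus \<rho> J) m"
    "\<And>v l \<xi>. l \<in> K \<Longrightarrow> m (upd v l \<xi>) = m v"
  shows "torus_mean I \<rho> (\<lambda>v. g v * m v) = torus_mean (I - K) \<rho> (\<lambda>v. g v * m v)"
proof -
  have "finite K" by simp
  then show ?thesis using assms(4-6)
  proof (induction K rule: finite_induct)
    case (insert l K)
    have cont: "continuous_on (torus \<rho> J) (\<lambda>v. g v * m v)" if "I - insert l K \<subseteq> J" "J \<subseteq> I" for J
      by (rule continuous_on_mult[OF continuous_on_subset[OF holo_on_imp_continuous_on[OF assms(3)]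
            torus_subset_polydisc[OF assms(1,2)]] insert.prems(2)[OF that]])
    have "torus_mean I \<rho> (\<lambda>v. g v * m v) = torus_mean (I - K) \<rho> (\<lambda>v. g v * m v)"
    proof (rule insert.IH)
      show "continuous_on (torus \<rho> J) m" if "I - K \<subseteq> J" "J \<subseteq> I" for J
        using that by (intro insert.prems(2)) blast+
      show "K \<subseteq> I" using insert.prems(1) by blast
      show "m (upd v j \<xi>) = m v" if "j \<in> K" for v j \<xi>
        using that by (intro insert.prems(3)) blast
    qed
    also have "\<dots> = torus_mean (I - K - {l}) \<rho> (\<lambda>v. g v * m v)"
    proof (rule torus_mean_remove[OF assms(1)])
      fix v assume v: "v \<in> torus \<rho> (I - K)"
      have "integral {0..1} (\<lambda>t. g (upd v l (circ \<rho> t)) * m v) = g (upd v l 0) * m v"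
        by (rule circ_mean[OF _ assms(1,2), of "\<lambda>\<xi>. g (upd v l \<xi>) * m v"])
          (rule holomorphic_on_mult[OF holo_on_upd_holomorphic[OF assms(3)] holomorphic_on_const],
            rule upd_polydisc[OF v assms(1,2)], simp)
      moreover have "m (upd v l \<xi>) = m v" for \<xi> by (rule insert.prems(3)) blast
      ultimately show "avg l \<rho> (\<lambda>v. g v * m v) v = g (upd v l 0) * m (upd v l 0)"
        unfolding avg_def by simp
    next
      show "continuous_on (torus \<rho> (I - K)) (\<lambda>v. g v * m v)" by (rule cont) blast+
      show "continuous_on (torus \<rho> (I - K - {l})) (\<lambda>v. g v * m v)" by (rule cont) blast+
      show "l \<in> I - K" using insert.prems(1) insert.hyps(2) by blast
    qed
    finally show ?case by (subst Diff_insert)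
  next
    case empty
    show ?case by (simp only: Diff_empty)
  qed
qed

lemma torus_mean_holo:
  fixes g :: "complex ^ 'n::finite \<Rightarrow> complex"
  assumes "0 < \<rho>" "\<rho> < R" "holo_on (polydisc R) g"
  shows "torus_mean I \<rho> g = g 0"
proof -
  have "torus_mean I \<rho> g = torus_mean {} \<rho> g"
    using torus_mean_holo_reduce[OF assms, of I I "\<lambda>v. 1"] by simp
  also have "\<dots> = g 0"
  proof (subst torus_mean_eq_avgs[of _ _ _ "[]" 0])
    show "0 \<in> torus \<rho> ({} :: 'n set)" by (simp add: torus_def)
    have "torus \<rho> ({} :: 'n set) = {0}" by (auto simp: torus_def vec_eq_iff)
    then show "continuous_on (torus \<rho> {}) g" by simp
  qed auto
  finally show ?thesis .
qed

section \<open>Torus means and Cramer's rule\<close>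

text \<open>An entry of the adjugate, written as a determinant of full size with column j replaced
  by the l-th unit vector.\<close>

definition cof :: "complex ^ 'n::finite ^ 'n \<Rightarrow> 'n \<Rightarrow> 'n \<Rightarrow> complex" where
  "cof M l j = det (\<chi> i j'. if j' = j then (if i = l then 1 else 0) else M $ i $ j')"

lemma det_replace_column:
  fixes M :: "complex ^ 'n::finite ^ 'n"
  shows "det ((\<chi> i j'. if j' = j then c i else M $ i $ j') :: complex ^ 'n ^ 'n) = (\<Sum>l\<in>UNIV. c l * cof M l j)"
proof -
  have "(\<chi> i j'. if j' = j then c i else M $ i $ j') =
      transpose (\<chi> j'. if j' = j then (\<Sum>l\<in>UNIV. c l *s axis l 1) else (\<chi> i. M $ i $ j'))"
    by (simp add: vec_eq_iff transpose_def axis_def if_distrib[of "\<lambda>x. _ * x"] cong: if_cong)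
  then have "det ((\<chi> i j'. if j' = j then c i else M $ i $ j') :: complex ^ 'n ^ 'n) =
      (\<Sum>l\<in>UNIV. det (\<chi> j'. if j' = j then c l *s axis l 1 else (\<chi> i. M $ i $ j')))"
    by (simp only: det_transpose det_linear_row_sum[OF finite])
  also have "\<dots> = (\<Sum>l\<in>UNIV. c l * det ((\<chi> j'. if j' = j then axis l 1 else (\<chi> i. M $ i $ j')) :: complex ^ 'n ^ 'n))"
    by (simp only: det_row_mul)
  also have "\<dots> = (\<Sum>l\<in>UNIV. c l * cof M l j)"
  proof (rule sum.cong[OF refl])
    fix l
    have "((\<chi> j'. if j' = j then axis l 1 else (\<chi> i. M $ i $ j')) :: complex ^ 'n ^ 'n) =
        transpose (\<chi> i j'. if j' = j then (if i = l then 1 else 0) else M $ i $ j')"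
      by (simp add: vec_eq_iff transpose_def axis_def)
    then show "c l * det ((\<chi> j'. if j' = j then axis l 1 else (\<chi> i. M $ i $ j')) :: complex ^ 'n ^ 'n) =
        c l * cof M l j"
      by (simp only: det_transpose cof_def)
  qed
  finally show ?thesis .
qed

text \<open>Cramer's rule without division: \<open>det M\<close> times any entry of \<open>w\<close>
  lies in the ideal generated by the entries of \<open>M *v w\<close>.\<close>

lemma cof_cramer:
  fixes M :: "complex ^ 'n::finite ^ 'n"
  shows "det M * w $ j = (\<Sum>l\<in>UNIV. (M *v w) $ l * cof M l j)"
  using cramer_lemma[of j M w] det_replace_column[of j "\<lambda>i. (M *v w) $ i" M] by (simp add: mult.commute)

lemma holo_on_cof:
  assumes "\<And>i j. holo_on V (\<lambda>v. C v $ i $ j)"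
  shows "holo_on V (\<lambda>v. cof (C v) l j)"
proof -
  have "holo_on V (\<lambda>v. if j' = j then (if i = l then 1 else 0) else C v $ i $ j')" for i j'
    using assms by (cases "j' = j") auto
  then show ?thesis unfolding cof_def by (intro holo_on_det) simp
qed

text \<open>By linearity in row i the difference of the determinants is \<open>det D\<close>, where
  row i of \<open>D\<close> is the difference of the two rows and annihilates \<open>w\<close>.
  Cramer's rule for \<open>D\<close> therefore involves only the \<open>y $ l\<close> with l
  \<noteq> i. Combining the \<open>w $ j\<close> with the coefficients of row i of \<open>P\<close>
  gives back \<open>y $ i\<close>.\<close>

lemma row_swap:
  fixes P P' :: "complex ^ 'n::finite ^ 'n"
  assumes agree: "\<And>k. k \<noteq> i \<Longrightarrow> P $ k = P' $ k" and P: "P *v w = y" and P': "P' *v w = y"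
  defines "D \<equiv> (\<chi> k. if k = i then P $ i - P' $ i else P $ k)"
  shows "(det P - det P') * y $ i = (\<Sum>l\<in>-{i}. y $ l * (\<Sum>j\<in>UNIV. P $ i $ j * cof D l j))"
proof -
  have "P = (\<chi> k. if k = i then P' $ i + (P $ i - P' $ i) else P $ k)" by (simp add: vec_eq_iff)
  then have "det P = det (\<chi> k. if k = i then P' $ i else P $ k) + det D"
    unfolding D_def by (subst det_row_add[symmetric]) simp
  moreover have "(\<chi> k. if k = i then P' $ i else P $ k) = P'" using agree by (simp add: vec_eq_iff)
  ultimately have d: "det P - det P' = det D" by simp
  have comp: "(\<Sum>j\<in>UNIV. P $ k $ j * w $ j) = y $ k" "(\<Sum>j\<in>UNIV. P' $ k $ j * w $ j) = y $ k" for k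
    using P P' by (auto simp: matrix_vector_mult_def vec_eq_iff)
  have Dw: "(D *v w) $ l = (if l = i then 0 else y $ l)" for l
    using comp by (auto simp: D_def matrix_vector_mult_def left_diff_distrib sum_subtractf)
  have "det D * y $ i = (\<Sum>j\<in>UNIV. P $ i $ j * (det D * w $ j))"
    unfolding comp(1)[symmetric, of i] by (simp add: sum_distrib_left ac_simps)
  also have "\<dots> = (\<Sum>j\<in>UNIV. P $ i $ j * (\<Sum>l\<in>-{i}. y $ l * cof D l j))"
    unfolding cof_cramer Dw
    by (intro sum.cong refl arg_cong2[where f="(*)"] sum.mono_neutral_cong_right) auto
  also have "\<dots> = (\<Sum>l\<in>-{i}. y $ l * (\<Sum>j\<in>UNIV. P $ i $ j * cof D l j))"
    by (simp add: sum_distrib_left sum.swap[of _ "-{i}"] ac_simps)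
  finally show ?thesis using d by simp
qed

lemma continuous_on_torus_holo:
  "0 < \<rho> \<Longrightarrow> \<rho> < R \<Longrightarrow> holo_on (polydisc R) g \<Longrightarrow> continuous_on (torus \<rho> I) g"
  using continuous_on_subset[OF holo_on_imp_continuous_on torus_subset_polydisc] .

lemma torus_mean_kill_coord:
  fixes g :: "complex ^ 'n::finite \<Rightarrow> complex"
  assumes "0 < \<rho>" "\<rho> < R" "holo_on (polydisc R) g" "l \<in> I" "continuous_on (torus \<rho> I) e"
    "\<And>v \<xi>. v \<in> torus \<rho> I \<Longrightarrow> norm \<xi> = \<rho> \<Longrightarrow> e (upd v l \<xi>) = e v"
  shows "torus_mean I \<rho> (\<lambda>v. g v * v $ l * e v) = 0"
proof (rule torus_mean_holo_zero[OF assms(1,2) _ assms(4)])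
  show "continuous_on (torus \<rho> I) (\<lambda>v. g v * v $ l * e v)"
    by (intro continuous_intros continuous_on_torus_holo[OF assms(1-3)] assms(5))
  fix v assume v: "v \<in> torus \<rho> I"
  have "(\<lambda>\<xi>. g (upd v l \<xi>)) holomorphic_on ball 0 R"
    by (rule holo_on_upd_holomorphic[OF assms(3)]) (rule upd_polydisc[OF v assms(1,2)], simp)
  then have "(\<lambda>\<xi>. g (upd v l \<xi>) * \<xi> * e v) holomorphic_on ball 0 R"
    by (intro holomorphic_on_mult holomorphic_on_ident holomorphic_on_const)
  then show "\<exists>\<phi>. \<phi> holomorphic_on ball 0 R \<and> \<phi> 0 = 0 \<and>
      (\<forall>\<xi>. norm \<xi> = \<rho> \<longrightarrow> g (upd v l \<xi>) * upd v l \<xi> $ l * e (upd v l \<xi>) = \<phi> \<xi>)"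
    using assms(6)[OF v] by (intro exI[of _ "\<lambda>\<xi>. g (upd v l \<xi>) * \<xi> * e v"]) auto
qed

text \<open>Each denominator depends on a single variable and matters only on the circle. Two kinds
  occur: powers of \<xi>, and \<xi>^L - u_k^L for a fixed small point u.\<close>

locale torus_denominators =
  fixes \<rho> R :: real and I :: "'n::finite set" and Y :: "'n \<Rightarrow> complex \<Rightarrow> complex"
  assumes \<rho>_pos: "0 < \<rho>" and \<rho>_less: "\<rho> < R"
    and Y_cont: "\<And>k. k \<in> I \<Longrightarrow> continuous_on (sphere 0 \<rho>) (Y k)"
    and Y_nonzero: "\<And>k \<xi>. k \<in> I \<Longrightarrow> norm \<xi> = \<rho> \<Longrightarrow> Y k \<xi> \<noteq> 0"
begin

definition den :: "complex ^ 'n \<Rightarrow> complex" where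
  "den v = (\<Prod>k\<in>I. v $ k / Y k (v $ k))"

definition rhs :: "complex ^ 'n \<Rightarrow> complex ^ 'n" where
  "rhs v = (\<chi> l. if l \<in> I then Y l (v $ l) else 0)"

lemma Y_torus_nonzero: "k \<in> I \<Longrightarrow> v \<in> torus \<rho> I \<Longrightarrow> Y k (v $ k) \<noteq> 0"
  using Y_nonzero torus_nth by (metis (full_types))

lemma Y_torus_cont: "k \<in> I \<Longrightarrow> continuous_on (torus \<rho> I) (\<lambda>v. Y k (v $ k))"
  by (rule continuous_on_compose2[OF Y_cont]) (auto intro!: continuous_intros simp: torus_nth)

lemma continuous_on_factors:
  "S \<subseteq> I \<Longrightarrow> continuous_on (torus \<rho> I) (\<lambda>v. \<Prod>k\<in>S. v $ k / Y k (v $ k))"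
  by (intro continuous_on_prod continuous_on_divide continuous_intros Y_torus_cont)
    (use Y_torus_nonzero in auto)

lemma continuous_on_den: "continuous_on (torus \<rho> I) den"
  using continuous_on_factors[of I] by (simp add: den_def[abs_def])

text \<open>In a term with the factor Y_l(v_l) the pole in v_l cancels. The numerator v_l of the
  weight remains, so the integrand is holomorphic in v_l with value 0 at v_l = 0, and its mean
  vanishes. The factor \<open>e\<close> may have poles in variables outside \<open>S\<close>;
  \<open>torus_mean_row_swap\<close> relies on this.\<close>

lemma torus_mean_ideal:
  assumes S: "S \<subseteq> I" and q: "\<And>l. l \<in> S \<Longrightarrow> holo_on (polydisc R) (q l)"
    and e: "continuous_on (torus \<rho> I) e"
    and e_indep: "\<And>v l \<xi>. l \<in> S \<Longrightarrow> v \<in> torus \<rho> I \<Longrightarrow> norm \<xi> = \<rho> \<Longrightarrow> e (upd v l \<xi>) = e v"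
    and F: "\<And>v. v \<in> torus \<rho> I \<Longrightarrow> F v = (\<Sum>l\<in>S. Y l (v $ l) * q l v) * e v"
  shows "torus_mean I \<rho> (\<lambda>v. F v * den v) = 0"
proof -
  define G where "G l v = q l v * v $ l * (e v * (\<Prod>k\<in>I-{l}. v $ k / Y k (v $ k)))" for l v
  have cont: "continuous_on (torus \<rho> I) (\<lambda>v. e v * (\<Prod>k\<in>I-{l}. v $ k / Y k (v $ k)))" for l
    by (intro continuous_on_mult e continuous_on_factors) auto
  have "torus_mean I \<rho> (\<lambda>v. F v * den v) = torus_mean I \<rho> (\<lambda>v. \<Sum>l\<in>S. G l v)"
  proof (rule torus_mean_cong[OF \<rho>_pos])
    fix v assume v: "v \<in> torus \<rho> I"
    have "F v * den v = (\<Sum>l\<in>S. Y l (v $ l) * q l v * e v * den v)"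
      using F[OF v] by (simp add: sum_distrib_right)
    also have "\<dots> = (\<Sum>l\<in>S. G l v)"
    proof (rule sum.cong[OF refl])
      fix l assume "l \<in> S"
      then have l: "l \<in> I" using S by auto
      then have "den v = v $ l / Y l (v $ l) * (\<Prod>k\<in>I-{l}. v $ k / Y k (v $ k))"
        unfolding den_def by (intro prod.remove) auto
      then show "Y l (v $ l) * q l v * e v * den v = G l v"
        using Y_torus_nonzero[OF l v] by (simp add: G_def)
    qed
    finally show "F v * den v = (\<Sum>l\<in>S. G l v)" .
  qed
  also have "\<dots> = (\<Sum>l\<in>S. torus_mean I \<rho> (G l))"
    using q continuous_on_torus_holo[OF \<rho>_pos \<rho>_less] unfolding G_def
    by (intro torus_mean_sum[OF \<rho>_pos] continuous_on_mult[OF _ cont] continuous_intros) auto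
  also have "\<dots> = (\<Sum>l\<in>S. 0)"
  proof (rule sum.cong[OF refl])
    fix l assume l: "l \<in> S"
    show "torus_mean I \<rho> (G l) = 0"
      unfolding G_def
    proof (rule torus_mean_kill_coord[OF \<rho>_pos \<rho>_less q[OF l] _ cont])
      show "e (upd v l \<xi>) * (\<Prod>k\<in>I-{l}. upd v l \<xi> $ k / Y k (upd v l \<xi> $ k)) =
          e v * (\<Prod>k\<in>I-{l}. v $ k / Y k (v $ k))" if "v \<in> torus \<rho> I" "norm \<xi> = \<rho>" for v \<xi>
        using e_indep[OF l that] by (intro arg_cong2[where f="(*)"] prod.cong) auto
    qed (use S l in auto)
  qed
  finally show ?thesis by simp
qed

text \<open>\<open>row_swap\<close> expresses the difference of determinants only after
  multiplication by Y_i(v_i). The factor 1 / Y_i(v_i) undoes this and is harmless, because the ideal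
  in question is generated by the Y_l(v_l) with l \<noteq> i.\<close>

lemma torus_mean_row_swap:
  assumes P: "\<And>i j. holo_on (polydisc R) (\<lambda>v. P v $ i $ j)" and P': "\<And>i j. holo_on (polydisc R) (\<lambda>v. P' v $ i $ j)"
    and h: "holo_on (polydisc R) h" and i: "i \<in> I"
    and agree: "\<And>v k. v \<in> torus \<rho> I \<Longrightarrow> k \<noteq> i \<Longrightarrow> P v $ k = P' v $ k"
    and Pw: "\<And>v. v \<in> torus \<rho> I \<Longrightarrow> P v *v w v = rhs v" and P'w: "\<And>v. v \<in> torus \<rho> I \<Longrightarrow> P' v *v w v = rhs v"
  shows "torus_mean I \<rho> (\<lambda>v. h v * (det (P v) - det (P' v)) * den v) = 0"
proof -
  define D where "D v = (\<chi> k. if k = i then P v $ i - P' v $ i else P v $ k)" for v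
  have D: "holo_on (polydisc R) (\<lambda>v. D v $ k $ j)" for k j
    using P P' by (cases "k = i") (auto simp: D_def)
  show ?thesis
  proof (rule torus_mean_ideal[where S="I - {i}" and e="\<lambda>v. 1 / Y i (v $ i)"
        and q="\<lambda>l v. h v * (\<Sum>j\<in>UNIV. P v $ i $ j * cof (D v) l j)"])
    show "holo_on (polydisc R) (\<lambda>v. h v * (\<Sum>j\<in>UNIV. P v $ i $ j * cof (D v) l j))" for l
      by (intro holo_on_mult holo_on_sum h P holo_on_cof D)
    show "continuous_on (torus \<rho> I) (\<lambda>v. 1 / Y i (v $ i))"
      by (intro continuous_on_divide continuous_intros Y_torus_cont i) (use Y_torus_nonzero[OF i] in auto)
    fix v assume v: "v \<in> torus \<rho> I"
    have y: "rhs v $ l = (if l \<in> I then Y l (v $ l) else 0)" for l by (simp add: rhs_def)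
    have "(det (P v) - det (P' v)) * Y i (v $ i) = (\<Sum>l\<in>-{i}. rhs v $ l * (\<Sum>j\<in>UNIV. P v $ i $ j * cof (D v) l j))"
      using row_swap[of i "P v" "P' v" "w v" "rhs v"] agree[OF v] Pw[OF v] P'w[OF v] i by (simp add: y D_def)
    also have "\<dots> = (\<Sum>l\<in>I-{i}. Y l (v $ l) * (\<Sum>j\<in>UNIV. P v $ i $ j * cof (D v) l j))"
      by (rule sum.mono_neutral_cong_right) (auto simp: y)
    finally have "(det (P v) - det (P' v)) =
        (\<Sum>l\<in>I-{i}. Y l (v $ l) * (\<Sum>j\<in>UNIV. P v $ i $ j * cof (D v) l j)) / Y i (v $ i)"
      using Y_torus_nonzero[OF i v] by (simp add: field_simps)
    then have "h v * (det (P v) - det (P' v)) =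
        h v * (\<Sum>l\<in>I-{i}. Y l (v $ l) * (\<Sum>j\<in>UNIV. P v $ i $ j * cof (D v) l j)) * (1 / Y i (v $ i))"
      by simp
    also have "h v * (\<Sum>l\<in>I-{i}. Y l (v $ l) * (\<Sum>j\<in>UNIV. P v $ i $ j * cof (D v) l j)) =
        (\<Sum>l\<in>I-{i}. Y l (v $ l) * (h v * (\<Sum>j\<in>UNIV. P v $ i $ j * cof (D v) l j)))"
      by (subst sum_distrib_left) (simp add: mult.left_commute)
    finally show "h v * (det (P v) - det (P' v)) =
        (\<Sum>l\<in>I-{i}. Y l (v $ l) * (h v * (\<Sum>j\<in>UNIV. P v $ i $ j * cof (D v) l j))) * (1 / Y i (v $ i))" .
  qed auto
qed

text \<open>The transformation law: rows of one matrix are exchanged for those of the other one at a time.\<close>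

lemma torus_mean_det_unique:
  assumes P: "\<And>i j. holo_on (polydisc R) (\<lambda>v. P v $ i $ j)" and P': "\<And>i j. holo_on (polydisc R) (\<lambda>v. P' v $ i $ j)"
    and h: "holo_on (polydisc R) h"
    and agree: "\<And>v k. v \<in> torus \<rho> I \<Longrightarrow> k \<notin> I \<Longrightarrow> P v $ k = P' v $ k"
    and Pw: "\<And>v. v \<in> torus \<rho> I \<Longrightarrow> P v *v w v = rhs v" and P'w: "\<And>v. v \<in> torus \<rho> I \<Longrightarrow> P' v *v w v = rhs v"
  shows "torus_mean I \<rho> (\<lambda>v. h v * det (P v) * den v) = torus_mean I \<rho> (\<lambda>v. h v * det (P' v) * den v)"
proof -
  define Q where "Q S v = (\<chi> k. if k \<in> S then P' v $ k else P v $ k)" for S v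
  have Q: "holo_on (polydisc R) (\<lambda>v. Q S v $ i $ j)" for S i j
    using P P' by (cases "i \<in> S") (auto simp: Q_def)
  have Qw: "Q S v *v w v = rhs v" if v: "v \<in> torus \<rho> I" for S v
    using Pw[OF v] P'w[OF v] by (auto simp: Q_def matrix_vector_mult_def vec_eq_iff)
  have c: "continuous_on (torus \<rho> I) (\<lambda>v. h v * det (Q S v) * den v)" for S
    by (intro continuous_on_mult continuous_on_torus_holo[OF \<rho>_pos \<rho>_less] h holo_on_det Q continuous_on_den)
  have "finite S \<Longrightarrow> S \<subseteq> I \<Longrightarrow> torus_mean I \<rho> (\<lambda>v. h v * det (Q {} v) * den v) =
      torus_mean I \<rho> (\<lambda>v. h v * det (Q S v) * den v)" for S
  proof (induction S rule: finite_induct)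
    case (insert i S)
    have "torus_mean I \<rho> (\<lambda>v. h v * (det (Q (insert i S) v) - det (Q S v)) * den v) = 0"
      by (rule torus_mean_row_swap[OF Q Q h _ _ Qw Qw, of i]) (use insert in \<open>auto simp: Q_def\<close>)
    then have "torus_mean I \<rho> (\<lambda>v. h v * det (Q (insert i S) v) * den v - h v * det (Q S v) * den v) = 0"
      by (simp add: algebra_simps)
    then show ?case using torus_mean_diff[OF \<rho>_pos c c] insert by simp
  qed simp
  from this[of I] have "torus_mean I \<rho> (\<lambda>v. h v * det (Q {} v) * den v) =
      torus_mean I \<rho> (\<lambda>v. h v * det (Q I v) * den v)"
    by simp
  also have "torus_mean I \<rho> (\<lambda>v. h v * det (Q I v) * den v) = torus_mean I \<rho> (\<lambda>v. h v * det (P' v) * den v)"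
  proof (rule torus_mean_cong[OF \<rho>_pos])
    fix v assume "v \<in> torus \<rho> I"
    then have "Q I v = P' v" using agree by (simp add: Q_def vec_eq_iff)
    then show "h v * det (Q I v) * den v = h v * det (P' v) * den v" by simp
  qed
  finally show ?thesis by (simp add: Q_def)
qed

text \<open>Cramer's rule puts \<open>det (P v) * w v $ j\<close> into the ideal of the
  denominators. Applied to the equations \<open>w\<close>, it says that their multiples have residue
  0.\<close>

lemma torus_mean_det_kill:
  assumes P: "\<And>i j. holo_on (polydisc R) (\<lambda>v. P v $ i $ j)" and h: "holo_on (polydisc R) h"
    and Pw: "\<And>v. v \<in> torus \<rho> I \<Longrightarrow> P v *v w v = rhs v"
  shows "torus_mean I \<rho> (\<lambda>v. h v * det (P v) * w v $ j * den v) = 0"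
proof (rule torus_mean_ideal[where S=I and e="\<lambda>v. 1" and q="\<lambda>l v. h v * cof (P v) l j"])
  fix v assume v: "v \<in> torus \<rho> I"
  have "h v * det (P v) * w v $ j = (\<Sum>l\<in>UNIV. rhs v $ l * (h v * cof (P v) l j))"
    unfolding mult.assoc cof_cramer Pw[OF v] by (simp add: sum_distrib_left ac_simps)
  also have "\<dots> = (\<Sum>l\<in>I. Y l (v $ l) * (h v * cof (P v) l j))"
    by (rule sum.mono_neutral_cong_right) (auto simp: rhs_def)
  finally show "h v * det (P v) * w v $ j = (\<Sum>l\<in>I. Y l (v $ l) * (h v * cof (P v) l j)) * 1" by simp
qed (auto intro!: holo_on_mult h holo_on_cof P)

end

lemma circ_power_ratio_mean:
  assumes "0 < \<rho>" "a \<noteq> b"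
  shows "integral {0..1} (\<lambda>t. circ \<rho> t ^ a / circ \<rho> t ^ b) = 0"
proof -
  define c where "c = 2 * of_real pi * \<i> * (of_nat a - of_nat b :: complex)"
  have c: "c \<noteq> 0" using assms by (simp add: c_def)
  have e: "circ \<rho> t ^ a / circ \<rho> t ^ b = of_real \<rho> ^ a / of_real \<rho> ^ b * exp (c * of_real t)" for t
  proof -
    have "exp (2 * of_real pi * \<i> * of_real t) ^ a / exp (2 * of_real pi * \<i> * of_real t) ^ b = exp (c * of_real t)"
      unfolding exp_of_nat_mult[symmetric] exp_diff[symmetric] by (simp add: c_def algebra_simps)
    then show ?thesis by (simp add: circ_def power_mult_distrib divide_simps)
  qed
  have "((\<lambda>t. exp (c * of_real t)) has_integral exp (c * of_real 1) / c - exp (c * of_real 0) / c) {0..1::real}"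
  proof (rule fundamental_theorem_of_calculus)
    fix t :: real
    have "((\<lambda>z. exp (c * z) / c) has_field_derivative exp (c * of_real t)) (at (of_real t))"
      using c by (auto intro!: derivative_eq_intros)
    then show "((\<lambda>t. exp (c * of_real t) / c) has_vector_derivative exp (c * of_real t)) (at t within {0..1})"
      by (rule has_vector_derivative_real_field)
  qed simp
  moreover have "exp c = 1"
    using exp_integer_2pi[of "of_nat a - of_nat b"] by (simp add: c_def ac_simps)
  ultimately have "integral {0..1} (\<lambda>t. exp (c * of_real t)) = 0"
    by (simp add: integral_unique)
  then show ?thesis unfolding e integral_mult_right by simp
qed

text \<open>Orthogonality of the characters of the torus. Negative exponents are covered by keeping
  numerator and denominator powers apart.\<close>

lemma torus_mean_monomial:
  fixes I :: "'n::finite set"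
  assumes "0 < \<rho>"
  shows "torus_mean I \<rho> (\<lambda>v. \<Prod>i\<in>I. v $ i ^ a i / v $ i ^ b i) = (if \<forall>i\<in>I. a i = b i then 1 else 0)"
proof -
  have nz: "v $ i \<noteq> 0" if "v \<in> torus \<rho> I" "i \<in> I" for v :: "complex ^ 'n" and i
    using torus_nth[OF that(1), of i] that assms by auto
  show ?thesis
  proof (cases "\<forall>i\<in>I. a i = b i")
    case True
    have "torus_mean I \<rho> (\<lambda>v. \<Prod>i\<in>I. v $ i ^ a i / v $ i ^ b i) = torus_mean I \<rho> (\<lambda>v. 1)"
      using True nz by (intro torus_mean_cong[OF assms] prod.neutral) auto
    also have "\<dots> = 1" using torus_mean_holo[OF assms _ holo_on_const, of "\<rho> + 1" I 1] by simp
    finally show ?thesis using True by simp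
  next
    case False
    then obtain l where l: "l \<in> I" "a l \<noteq> b l" by auto
    have "torus_mean I \<rho> (\<lambda>v. \<Prod>i\<in>I. v $ i ^ a i / v $ i ^ b i) = 0"
    proof (rule torus_mean_kill[OF assms _ l(1)])
      show "continuous_on (torus \<rho> I) (\<lambda>v. \<Prod>i\<in>I. v $ i ^ a i / v $ i ^ b i)"
        using nz by (intro continuous_intros) auto
      fix v assume v: "v \<in> torus \<rho> I"
      have "(\<Prod>i\<in>I. upd v l \<xi> $ i ^ a i / upd v l \<xi> $ i ^ b i) =
          \<xi> ^ a l / \<xi> ^ b l * (\<Prod>i\<in>I - {l}. v $ i ^ a i / v $ i ^ b i)" for \<xi>
        using l(1) by (subst prod.remove[of _ l]) (auto intro!: prod.cong)
      then show "avg l \<rho> (\<lambda>v. \<Prod>i\<in>I. v $ i ^ a i / v $ i ^ b i) v = 0"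
        unfolding avg_def using circ_power_ratio_mean[OF assms l(2)]
            by (simp add: integral_mult_left del: times_divide_eq_left)
    qed
    then show ?thesis using False by simp
  qed
qed

section \<open>Residues as torus means\<close>

text \<open>Facts about germs hold on a polydisc of radius R, whereas means are taken over a torus
  of strictly smaller radius \<rho> inside it; this rule passes from the one to the other.\<close>

lemma eventually_at_right_0_shrink:
  fixes P Q :: "real \<Rightarrow> bool"
  assumes "eventually P (at_right 0)" "\<And>\<rho> R. 0 < \<rho> \<Longrightarrow> \<rho> < R \<Longrightarrow> P R \<Longrightarrow> Q \<rho>"
  shows "eventually Q (at_right 0)"
proof -
  obtain b where b: "b > 0" "\<And>y. 0 < y \<Longrightarrow> y < b \<Longrightarrow> P y"
    using assms(1) unfolding eventually_at_right_field by auto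
  have "Q \<rho>" if "0 < \<rho>" "\<rho> < b" for \<rho>
    using that b assms(2)[of \<rho> "(\<rho> + b) / 2"] by auto
  then show ?thesis unfolding eventually_at_right_field using b(1) by blast
qed

lemma eventually_at_right_0_polydisc:
  assumes "eventually P (nhds (0 :: complex ^ 'n::finite))"
  shows "eventually (\<lambda>R. \<forall>v\<in>polydisc R. P v) (at_right 0)"
proof -
  obtain R0 where R0: "R0 > 0" "\<forall>v\<in>polydisc R0. P v"
    using assms unfolding eventually_nhds_0_polydisc by auto
  then have "\<forall>v\<in>polydisc R. P v" if "0 < R" "R < R0" for R
    using polydisc_mono[of R R0] that by auto
  then show ?thesis unfolding eventually_at_right_field using R0(1) by blast
qed

lemma coord_proj_nth [simp]: "coord_proj I v $ i = (if i \<in> I then v $ i else 0)"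
  by (simp add: coord_proj_def)

lemma coord_proj_UNIV [simp]: "coord_proj UNIV v = v"
  by (simp add: vec_eq_iff)

lemma coord_proj_torus [simp]: "v \<in> torus \<rho> I \<Longrightarrow> coord_proj I v = v"
  by (auto simp: vec_eq_iff torus_def)

lemma coord_proj_polydisc: "0 < R \<Longrightarrow> v \<in> polydisc R \<Longrightarrow> coord_proj I v \<in> polydisc R"
  by (simp add: polydisc_def)

lemma holo_on_coord_proj: "holo_on V (\<lambda>v. coord_proj I v $ i)"
  by (cases "i \<in> I") auto

text \<open>A statement about all small radii, so that finitely many facts about germs can be
  brought to a common polydisc by the calculus of \<open>eventually\<close>.\<close>

lemma germ_iff: "germ I g \<longleftrightarrow> eventually (\<lambda>R. holo_on (polydisc R) (\<lambda>v. g (coord_proj I v))) (at_right 0)"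
proof
  assume "germ I g"
  then obtain V where V: "open V" "0 \<in> V" "holo_on V (g \<circ> coord_proj I)" unfolding germ_def by auto
  have "eventually (\<lambda>R. \<forall>v\<in>polydisc R. v \<in> V) (at_right 0)"
    using V by (intro eventually_at_right_0_polydisc eventually_nhds_in_open)
  then show "eventually (\<lambda>R. holo_on (polydisc R) (\<lambda>v. g (coord_proj I v))) (at_right 0)"
    by eventually_elim (rule holo_on_subset[OF V(3)[unfolded o_def]], blast)
next
  assume "eventually (\<lambda>R. holo_on (polydisc R) (\<lambda>v. g (coord_proj I v))) (at_right 0)"
  then have "eventually (\<lambda>R. 0 < R \<and> holo_on (polydisc R) (\<lambda>v. g (coord_proj I v))) (at_right 0)"
    by (intro eventually_conj eventually_at_right_less)
  then obtain R where "0 < R" "holo_on (polydisc R) (\<lambda>v. g (coord_proj I v))"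
    using eventually_happens'[OF trivial_limit_at_right_real] by blast
  then show "germ I g"
    unfolding germ_def by (intro exI[of _ "polydisc R"]) (auto simp: o_def open_polydisc)
qed

lemma germ_eqD:
  "germ_eq I g h \<Longrightarrow> eventually (\<lambda>R. \<forall>v\<in>polydisc R. g (coord_proj I v) = h (coord_proj I v)) (at_right 0)"
  unfolding germ_eq_def by (rule eventually_at_right_0_polydisc)

lemma germ_const [intro]: "germ I (\<lambda>v. c)"
  unfolding germ_iff by (simp add: holo_on_const)

lemma germ_coord [intro]: "germ I (\<lambda>v. v $ i)"
  unfolding germ_iff by (intro always_eventually allI holo_on_coord_proj)

lemma germ_add [intro]: "germ I g \<Longrightarrow> germ I h \<Longrightarrow> germ I (\<lambda>v. g v + h v)"
  unfolding germ_iff by (erule (1) eventually_elim2) (rule holo_on_add)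

lemma germ_mult [intro]: "germ I g \<Longrightarrow> germ I h \<Longrightarrow> germ I (\<lambda>v. g v * h v)"
  unfolding germ_iff by (erule (1) eventually_elim2) (rule holo_on_mult)

lemma germ_sum [intro]: "(\<And>i. i \<in> S \<Longrightarrow> germ I (g i)) \<Longrightarrow> germ I (\<lambda>v. \<Sum>i\<in>S. g i v)"
  by (induction S rule: infinite_finite_induct) auto

lemma germ_prod [intro]: "(\<And>i. i \<in> S \<Longrightarrow> germ I (g i)) \<Longrightarrow> germ I (\<lambda>v. \<Prod>i\<in>S. g i v)"
  by (induction S rule: infinite_finite_induct) auto

lemma germ_power [intro]: "germ I g \<Longrightarrow> germ I (\<lambda>v. g v ^ k)"
  by (induction k) auto

lemma germ_det:
  assumes "\<And>i j. germ I (\<lambda>v. C v $ i $ j)" shows "germ I (\<lambda>v. det (C v))"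
  unfolding det_def by (intro germ_sum germ_mult germ_const germ_prod assms)

lemma germ_cong:
  assumes "germ_eq I g h" "germ I g" shows "germ I h"
  using germ_eqD[OF assms(1)] assms(2)[unfolded germ_iff] unfolding germ_iff
proof eventually_elim
  case (elim R)
  then show ?case
    by (subst holo_on_cong[OF open_polydisc, of R _ "\<lambda>v. g (coord_proj I v)"]) auto
qed

lemma finite_exponents: "finite {\<alpha> :: 'n::finite \<Rightarrow> nat. (\<forall>i\<in>I. \<alpha> i < N) \<and> (\<forall>i. i \<notin> I \<longrightarrow> \<alpha> i = 0)}"
proof -
  have "finite {\<alpha> :: 'n \<Rightarrow> nat. \<forall>x. (x \<in> I \<longrightarrow> \<alpha> x \<in> {..<N}) \<and> (x \<notin> I \<longrightarrow> \<alpha> x = 0)}"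
    by (rule finite_set_of_finite_funs) auto
  then show ?thesis by (rule rev_finite_subset) auto
qed

lemma eventually_power_ideal:
  assumes "in_germ_ideal I (\<lambda>i v. v $ i ^ N) h"
  obtains q where "eventually (\<lambda>R. (\<forall>i\<in>I. holo_on (polydisc R) (\<lambda>v. q i (coord_proj I v))) \<and>
      (\<forall>v\<in>polydisc R. h (coord_proj I v) = (\<Sum>i\<in>I. q i (coord_proj I v) * coord_proj I v $ i ^ N))) (at_right 0)"
proof -
  obtain q where q: "\<forall>i\<in>I. germ I (q i)" "germ_eq I h (\<lambda>v. \<Sum>i\<in>I. q i v * v $ i ^ N)"
    using assms unfolding in_germ_ideal_def by blast
  have "eventually (\<lambda>R. \<forall>i\<in>I. holo_on (polydisc R) (\<lambda>v. q i (coord_proj I v))) (at_right 0)"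
    using q(1) unfolding germ_iff by (intro eventually_ball_finite) auto
  with germ_eqD[OF q(2)] show ?thesis
    by (intro that) (auto elim: eventually_elim2)
qed

lemma torus_denominators_power: "0 < \<rho> \<Longrightarrow> \<rho> < R \<Longrightarrow> torus_denominators \<rho> R I (\<lambda>k \<xi>. \<xi> ^ N)"
  by unfold_locales (auto intro!: continuous_intros)

text \<open>The ideal part of the expansion has mean 0. A monomial with exponents \<alpha>
  contributes the mean of the product of the v_i^(\<alpha>_i + 1 - N), which is nonzero only if all
  \<alpha>_i = N - 1.\<close>

lemma power_residue_torus_mean:
  assumes "power_residue I N h r" "0 < N"
  shows "eventually (\<lambda>\<rho>. r = torus_mean I \<rho> (\<lambda>v. h v * (\<Prod>k\<in>I. v $ k / v $ k ^ N))) (at_right 0)"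
proof -
  define E where "E = {\<alpha>. (\<forall>i\<in>I. \<alpha> i < N) \<and> (\<forall>i. i \<notin> I \<longrightarrow> \<alpha> i = 0)}"
  obtain c where c: "in_germ_ideal I (\<lambda>i v. v $ i ^ N) (\<lambda>v. h v - (\<Sum>\<alpha>\<in>E. c \<alpha> * (\<Prod>i\<in>I. v $ i ^ \<alpha> i)))"
    and r: "r = c (\<lambda>i. if i \<in> I then N - 1 else 0)"
    using assms(1) unfolding power_residue_def E_def by blast
  obtain q where q: "eventually (\<lambda>R. (\<forall>i\<in>I. holo_on (polydisc R) (\<lambda>v. q i (coord_proj I v))) \<and>
      (\<forall>v\<in>polydisc R. h (coord_proj I v) - (\<Sum>\<alpha>\<in>E. c \<alpha> * (\<Prod>i\<in>I. coord_proj I v $ i ^ \<alpha> i)) =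
        (\<Sum>i\<in>I. q i (coord_proj I v) * coord_proj I v $ i ^ N))) (at_right 0)"
    using eventually_power_ideal[OF c] by blast
  then show ?thesis
  proof (rule eventually_at_right_0_shrink)
    fix \<rho> R :: real
    assume \<rho>: "0 < \<rho>" "\<rho> < R" and *: "(\<forall>i\<in>I. holo_on (polydisc R) (\<lambda>v. q i (coord_proj I v))) \<and>
      (\<forall>v\<in>polydisc R. h (coord_proj I v) - (\<Sum>\<alpha>\<in>E. c \<alpha> * (\<Prod>i\<in>I. coord_proj I v $ i ^ \<alpha> i)) =
        (\<Sum>i\<in>I. q i (coord_proj I v) * coord_proj I v $ i ^ N))"
    interpret torus_denominators \<rho> R I "\<lambda>k \<xi>. \<xi> ^ N" by (rule torus_denominators_power[OF \<rho>])
    define F where "F v = (\<Sum>i\<in>I. v $ i ^ N * q i (coord_proj I v))" for v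
    have h: "h v = (\<Sum>\<alpha>\<in>E. c \<alpha> * (\<Prod>i\<in>I. v $ i ^ \<alpha> i)) + F v" if "v \<in> torus \<rho> I" for v
    proof -
      have v: "v \<in> polydisc R" using that torus_subset_polydisc[OF \<rho>] by blast
      have "h v - (\<Sum>\<alpha>\<in>E. c \<alpha> * (\<Prod>i\<in>I. v $ i ^ \<alpha> i)) = F v"
        using *[THEN conjunct2, rule_format, OF v] that by (simp add: F_def mult.commute)
      then show ?thesis by (simp add: algebra_simps)
    qed
    have F: "torus_mean I \<rho> (\<lambda>v. F v * den v) = 0"
      by (rule torus_mean_ideal[where S=I and e="\<lambda>v. 1" and q="\<lambda>l v. q l (coord_proj I v)"])
        (use * in \<open>auto simp: F_def\<close>)
    have contF: "continuous_on (torus \<rho> I) (\<lambda>v. F v * den v)"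
      unfolding F_def using *
      by (intro continuous_on_mult continuous_on_den continuous_on_torus_holo[OF \<rho>] holo_on_sum holo_on_mult
          holo_on_power holo_on_coord) auto
    have mono: "(\<Prod>i\<in>I. v $ i ^ \<alpha> i) * den v = (\<Prod>i\<in>I. v $ i ^ Suc (\<alpha> i) / v $ i ^ N)" for v \<alpha>
      unfolding den_def prod.distrib[symmetric] by (intro prod.cong) auto
    have "torus_mean I \<rho> (\<lambda>v. h v * (\<Prod>k\<in>I. v $ k / v $ k ^ N)) =
        torus_mean I \<rho> (\<lambda>v. (\<Sum>\<alpha>\<in>E. c \<alpha> * (\<Prod>i\<in>I. v $ i ^ Suc (\<alpha> i) / v $ i ^ N)) + F v * den v)"
      by (rule torus_mean_cong[OF \<rho>(1)])
        (simp only: h den_def[symmetric] mono[symmetric] distrib_right sum_distrib_right mult.assoc)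
    also have "\<dots> = torus_mean I \<rho> (\<lambda>v. \<Sum>\<alpha>\<in>E. c \<alpha> * (\<Prod>i\<in>I. v $ i ^ Suc (\<alpha> i) / v $ i ^ N))"
      unfolding mono[symmetric]
      by (subst torus_mean_add[OF \<rho>(1) _ contF]) (auto simp: F intro!: continuous_intros continuous_on_den)
    also have "\<dots> = (\<Sum>\<alpha>\<in>E. c \<alpha> * torus_mean I \<rho> (\<lambda>v. \<Prod>i\<in>I. v $ i ^ Suc (\<alpha> i) / v $ i ^ N))"
      unfolding mono[symmetric]
      by (subst torus_mean_sum[OF \<rho>(1)])
        (auto simp: E_def finite_exponents intro!: continuous_intros continuous_on_den sum.cong torus_mean_cmult[OF
            \<rho>(1)])
    also have "\<dots> = (\<Sum>\<alpha>\<in>E. if \<alpha> = (\<lambda>i. if i \<in> I then N - 1 else 0) then c \<alpha> else 0)"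
    proof (rule sum.cong[OF refl])
      fix \<alpha> assume "\<alpha> \<in> E"
      then have "(\<forall>i\<in>I. Suc (\<alpha> i) = N) \<longleftrightarrow> \<alpha> = (\<lambda>i. if i \<in> I then N - 1 else 0)"
        using assms(2) by (auto simp: E_def fun_eq_iff)
      then show "c \<alpha> * torus_mean I \<rho> (\<lambda>v. \<Prod>i\<in>I. v $ i ^ Suc (\<alpha> i) / v $ i ^ N) =
          (if \<alpha> = (\<lambda>i. if i \<in> I then N - 1 else 0) then c \<alpha> else 0)"
        unfolding torus_mean_monomial[OF \<rho>(1)] by simp
    qed
    also have "\<dots> = r"
      using assms(2) by (subst sum.delta) (auto simp: r E_def finite_exponents)
    finally show "r = torus_mean I \<rho> (\<lambda>v. h v * (\<Prod>k\<in>I. v $ k / v $ k ^ N))" ..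
  qed
qed

section \<open>Ideals of germs and expansion modulo powers of the coordinates\<close>

lemma in_germ_ideal_0: "in_germ_ideal I g (\<lambda>v. 0)"
  unfolding in_germ_ideal_def germ_eq_def by (intro exI[of _ "\<lambda>i v. 0"]) auto

lemma in_germ_ideal_add:
  assumes "in_germ_ideal I g h" "in_germ_ideal I g h'" shows "in_germ_ideal I g (\<lambda>v. h v + h' v)"
proof -
  obtain c c' where c: "\<forall>i\<in>I. germ I (c i)" "germ_eq I h (\<lambda>v. \<Sum>i\<in>I. c i v * g i v)"
    "\<forall>i\<in>I. germ I (c' i)" "germ_eq I h' (\<lambda>v. \<Sum>i\<in>I. c' i v * g i v)"
    using assms unfolding in_germ_ideal_def by blast
  have "germ_eq I (\<lambda>v. h v + h' v) (\<lambda>v. \<Sum>i\<in>I. (c i v + c' i v) * g i v)"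
    using c(2,4) unfolding germ_eq_def by eventually_elim (simp add: distrib_right sum.distrib)
  then show ?thesis
    unfolding in_germ_ideal_def using c(1,3) by (intro exI[of _ "\<lambda>i v. c i v + c' i v"]) auto
qed

lemma in_germ_ideal_mult:
  assumes "in_germ_ideal I g h" "germ I k" shows "in_germ_ideal I g (\<lambda>v. k v * h v)"
proof -
  obtain c where "\<forall>i\<in>I. germ I (c i)" "germ_eq I h (\<lambda>v. \<Sum>i\<in>I. c i v * g i v)"
    using assms unfolding in_germ_ideal_def by blast
  then show ?thesis
    unfolding in_germ_ideal_def germ_eq_def
    by (intro exI[of _ "\<lambda>i v. k v * c i v"]) (auto elim!: eventually_mono simp: sum_distrib_left assms(2) mult.assoc)
qed

lemma in_germ_ideal_generator:
  assumes "i \<in> I" shows "in_germ_ideal I g (g i)"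
  unfolding in_germ_ideal_def germ_eq_def
  by (rule exI[of _ "\<lambda>j v. if j = i then 1 else 0"])
    (use assms in \<open>auto simp: if_distrib[of "\<lambda>x. x * _"] cong: if_cong intro: germ_const\<close>)

lemma in_germ_ideal_cong: "germ_eq I h h' \<Longrightarrow> in_germ_ideal I g h \<Longrightarrow> in_germ_ideal I g h'"
  unfolding in_germ_ideal_def germ_eq_def
  by (elim exE conjE, rule exI, rule conjI, assumption, erule (1) eventually_elim2) simp

text \<open>Taylor expansion modulo the powers \<open>v\<^sub>i ^ N\<close>, without reference to the coefficients.\<close>

definition expandable :: "'n::finite set \<Rightarrow> nat \<Rightarrow> (complex ^ 'n \<Rightarrow> complex) \<Rightarrow> bool" where
  "expandable I N h \<longleftrightarrow> (\<exists>r. power_residue I N h r)"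

lemma expandable_iff:
  "expandable I N h \<longleftrightarrow> (\<exists>c. in_germ_ideal I (\<lambda>i v. v $ i ^ N)
     (\<lambda>v. h v - (\<Sum>\<alpha> | (\<forall>i\<in>I. \<alpha> i < N) \<and> (\<forall>i. i \<notin> I \<longrightarrow> \<alpha> i = 0). c \<alpha> * (\<Prod>i\<in>I. v $ i ^ \<alpha> i))))"
  unfolding expandable_def power_residue_def by blast

lemma expandable_ideal: "in_germ_ideal I (\<lambda>i v. v $ i ^ N) h \<Longrightarrow> expandable I N h"
  unfolding expandable_iff by (intro exI[of _ "\<lambda>\<alpha>. 0"]) simp

lemma expandable_add:
  assumes "expandable I N h" "expandable I N h'" shows "expandable I N (\<lambda>v. h v + h' v)"
proof -
  let ?p = "\<lambda>c v. \<Sum>\<alpha> | (\<forall>i\<in>I. \<alpha> i < N) \<and> (\<forall>i. i \<notin> I \<longrightarrow> \<alpha> i = 0). c \<alpha> * (\<Prod>i\<in>I. v $ i ^ \<alpha> i)"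
  obtain c c' where "in_germ_ideal I (\<lambda>i v. v $ i ^ N) (\<lambda>v. h v - ?p c v)"
    "in_germ_ideal I (\<lambda>i v. v $ i ^ N) (\<lambda>v. h' v - ?p c' v)"
    using assms unfolding expandable_iff by blast
  from in_germ_ideal_add[OF this] show ?thesis
    unfolding expandable_iff
    by (intro exI[of _ "\<lambda>\<alpha>. c \<alpha> + c' \<alpha>"]) (simp add: distrib_right sum.distrib algebra_simps)
qed

lemma expandable_sum:
  "finite S \<Longrightarrow> (\<And>s. s \<in> S \<Longrightarrow> expandable I N (h s)) \<Longrightarrow> expandable I N (\<lambda>v. \<Sum>s\<in>S. h s v)"
proof (induction S rule: finite_induct)
  case empty
  show ?case by (simp add: expandable_ideal in_germ_ideal_0)
qed (auto intro: expandable_add)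

text \<open>Either all exponents are below N and the monomial is its own expansion, or one of them
  is at least N and the monomial lies in the ideal.\<close>

lemma expandable_monomial: "expandable I N (\<lambda>v. c * (\<Prod>i\<in>I. v $ i ^ \<beta> i))"
proof (cases "\<forall>i\<in>I. \<beta> i < N")
  case True
  let ?\<beta> = "\<lambda>i. if i \<in> I then \<beta> i else 0"
  have "(\<Sum>\<alpha> | (\<forall>i\<in>I. \<alpha> i < N) \<and> (\<forall>i. i \<notin> I \<longrightarrow> \<alpha> i = 0). (if \<alpha> = ?\<beta> then c else 0) * (\<Prod>i\<in>I. v $ i ^ \<alpha> i))
      = (\<Sum>\<alpha> | (\<forall>i\<in>I. \<alpha> i < N) \<and> (\<forall>i. i \<notin> I \<longrightarrow> \<alpha> i = 0).
          if \<alpha> = ?\<beta> then c * (\<Prod>i\<in>I. v $ i ^ \<beta> i) else 0)" for v :: "complex ^ 'a"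
    by (intro sum.cong refl) auto
  also have "\<dots> v = c * (\<Prod>i\<in>I. v $ i ^ \<beta> i)" for v :: "complex ^ 'a"
    using True by (subst sum.delta[OF finite_exponents]) auto
  finally have "(\<Sum>\<alpha> | (\<forall>i\<in>I. \<alpha> i < N) \<and> (\<forall>i. i \<notin> I \<longrightarrow> \<alpha> i = 0). (if \<alpha> = ?\<beta> then c else 0) * (\<Prod>i\<in>I. v $ i ^ \<alpha> i))
      = c * (\<Prod>i\<in>I. v $ i ^ \<beta> i)" for v :: "complex ^ 'a" .
  then show ?thesis
    unfolding expandable_iff
    by (intro exI[of _ "\<lambda>\<alpha>. if \<alpha> = ?\<beta> then c else 0"]) (simp add: in_germ_ideal_0)
next
  case False
  then obtain l where l: "l \<in> I" "N \<le> \<beta> l" by auto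
  have eq: "(\<lambda>v. c * (\<Prod>i\<in>I. v $ i ^ \<beta> i)) =
      (\<lambda>v. (c * v $ l ^ (\<beta> l - N) * (\<Prod>i\<in>I-{l}. v $ i ^ \<beta> i)) * v $ l ^ N)"
    using l by (intro ext, subst prod.remove[of _ l]) (auto simp: power_add[symmetric])
  have "in_germ_ideal I (\<lambda>i v. v $ i ^ N) (\<lambda>v. (c * v $ l ^ (\<beta> l - N) * (\<Prod>i\<in>I-{l}. v $ i ^ \<beta> i)) * v $ l ^ N)"
    by (intro in_germ_ideal_mult in_germ_ideal_generator[OF l(1)] germ_mult germ_const germ_power germ_coord germ_prod)
  then show ?thesis unfolding eq by (rule expandable_ideal)
qed

lemma expandable_coord_mult:
  assumes "expandable I N h" "l \<in> I" shows "expandable I N (\<lambda>v. v $ l ^ m * h v)"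
proof -
  let ?E = "{\<alpha>. (\<forall>i\<in>I. \<alpha> i < N) \<and> (\<forall>i. i \<notin> I \<longrightarrow> \<alpha> i = 0)}"
  obtain c where c: "in_germ_ideal I (\<lambda>i v. v $ i ^ N) (\<lambda>v. h v - (\<Sum>\<alpha>\<in>?E. c \<alpha> * (\<Prod>i\<in>I. v $ i ^ \<alpha> i)))"
    using assms unfolding expandable_iff by blast
  let ?\<beta> = "\<lambda>\<alpha> i. if i = l then \<alpha> i + m else \<alpha> i"
  have eq: "v $ l ^ m * (\<Prod>i\<in>I. v $ i ^ \<alpha> i) = (\<Prod>i\<in>I. v $ i ^ ?\<beta> \<alpha> i)" for v \<alpha>
    using assms(2) by (simp add: prod.remove[of I l] power_add ac_simps)
  have "v $ l ^ m * (\<Sum>\<alpha>\<in>?E. c \<alpha> * (\<Prod>i\<in>I. v $ i ^ \<alpha> i)) = (\<Sum>\<alpha>\<in>?E. c \<alpha> * (\<Prod>i\<in>I. v $ i ^ ?\<beta> \<alpha> i))" for v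
    unfolding sum_distrib_left eq[symmetric] by (intro sum.cong refl) (rule mult.left_commute)
  then have "v $ l ^ m * h v = v $ l ^ m * (h v - (\<Sum>\<alpha>\<in>?E. c \<alpha> * (\<Prod>i\<in>I. v $ i ^ \<alpha> i))) +
      (\<Sum>\<alpha>\<in>?E. c \<alpha> * (\<Prod>i\<in>I. v $ i ^ ?\<beta> \<alpha> i))" for v
    by (simp add: right_diff_distrib)
  moreover have "expandable I N (\<lambda>v. v $ l ^ m * (h v - (\<Sum>\<alpha>\<in>?E. c \<alpha> * (\<Prod>i\<in>I. v $ i ^ \<alpha> i))) +
      (\<Sum>\<alpha>\<in>?E. c \<alpha> * (\<Prod>i\<in>I. v $ i ^ ?\<beta> \<alpha> i)))"
    by (intro expandable_add expandable_sum finite_exponents expandable_monomial expandable_ideal in_germ_ideal_mult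
        c germ_power germ_coord)
  ultimately show ?thesis by simp
qed

lemma expandable_cong: "germ_eq I h h' \<Longrightarrow> expandable I N h \<Longrightarrow> expandable I N h'"
  unfolding expandable_iff
  by (erule exE, rule exI, erule in_germ_ideal_cong[rotated]) (auto simp: germ_eq_def elim!: eventually_mono)

text \<open>Hadamard's lemma between v and its projection to v_l = 0: all differences of coordinates
  but one vanish.\<close>

lemma holo_divide_coord:
  fixes h :: "complex ^ 'n::finite \<Rightarrow> complex" and l :: 'n
  assumes "holo_on (polydisc R) h"
  defines "q \<equiv> (\<lambda>v. hada l h v (upd v l 0))"
  shows "holo_on (polydisc R) q" "v \<in> polydisc R \<Longrightarrow> h v = h (upd v l 0) + v $ l * q v"
proof -
  have u: "upd v l 0 \<in> polydisc R" if "v \<in> polydisc R" for v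
  proof -
    have "0 < R" using that by (auto simp: polydisc_def intro: le_less_trans[OF norm_ge_zero])
    then show ?thesis using that by (auto simp: polydisc_def)
  qed
  show "holo_on (polydisc R) q"
    unfolding q_def
  proof (rule holo_on_hada[OF open_polydisc convex_polydisc assms(1) open_polydisc])
    show "holo_on (polydisc R) (\<lambda>y. upd y l 0 $ i)" for i by (cases "i = l") auto
  qed (use u in auto)
  assume v: "v \<in> polydisc R"
  have "h v - h (upd v l 0) = (\<Sum>j\<in>UNIV. (v $ j - upd v l 0 $ j) * hada j h v (upd v l 0))"
    by (rule hadamard[OF open_polydisc convex_polydisc assms(1) v u[OF v]])
  also have "\<dots> = (\<Sum>j\<in>{l}. v $ j * hada j h v (upd v l 0))"
    by (rule sum.mono_neutral_cong_right) auto
  finally show "h v = h (upd v l 0) + v $ l * q v" by (simp add: q_def algebra_simps)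
qed

text \<open>Induction on the set of variables on which \<open>h\<close> depends. In the variable l,
  splitting off the value at v_l = 0 a total of N times writes \<open>h\<close> as p + v_l^N q. The
  functions split off depend on fewer variables, so p is expandable by induction, and v_l^N q lies
  in the ideal.\<close>

lemma expandable_germ_depends:
  fixes h :: "complex ^ 'n::finite \<Rightarrow> complex"
  assumes "finite J" "J \<subseteq> I" "germ I h" "\<And>v. h v = h (coord_proj J v)"
  shows "expandable I N h"
  using assms
proof (induction J arbitrary: h rule: finite_induct)
  case empty
  have z: "coord_proj {} v = 0" for v :: "complex ^ 'n" by (simp add: vec_eq_iff)
  have "h = (\<lambda>v. h 0 * (\<Prod>i\<in>I. v $ i ^ 0))"
  proof
    fix v show "h v = h 0 * (\<Prod>i\<in>I. v $ i ^ 0)" by (subst empty.prems(3)) (simp add: z)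
  qed
  from arg_cong[OF this, of "expandable I N"] show ?case
    by (rule iffD2) (rule expandable_monomial)
next
  case (insert l J)
  let ?J = "insert l J"
  have l: "l \<in> I" using insert.prems by auto
  have step: "\<exists>p q. expandable I N p \<and> germ I q \<and> (\<forall>v. q v = q (coord_proj ?J v)) \<and>
      germ_eq I h (\<lambda>v. p v + v $ l ^ m * q v)" for m
  proof (induction m)
    case 0
    have "expandable I N (\<lambda>v. 0)" by (intro expandable_ideal in_germ_ideal_0)
    moreover have "germ_eq I h (\<lambda>v. 0 + v $ l ^ 0 * h v)" by (simp add: germ_eq_def)
    ultimately show ?case using insert.prems(2,3) by blast
  next
    case (Suc m)
    then obtain p q where pq: "expandable I N p" "germ I q" "\<And>v. q v = q (coord_proj ?J v)"
      "germ_eq I h (\<lambda>v. p v + v $ l ^ m * q v)" by blast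
    have q_proj: "q (coord_proj I v) = q v" for v
    proof -
      have "coord_proj ?J (coord_proj I v) = coord_proj ?J v" using insert.prems(1) by (auto simp: vec_eq_iff)
      then show ?thesis using pq(3)[of "coord_proj I v"] pq(3)[of v] by argo
    qed
    define q0 where "q0 v = q (upd v l 0)" for v
    \<comment> \<open>Forming the quotient at the projected point makes \<open>q1\<close> depend on
      the variables in \<open>?J\<close> only, as an identity of functions and not merely near
      0.\<close>
    define q1 where "q1 v = hada l q (coord_proj ?J v) (upd (coord_proj ?J v) l 0)" for v
    have ev: "eventually (\<lambda>R. 0 < R \<and> holo_on (polydisc R) q) (at_right 0)"
      using pq(2) unfolding germ_iff q_proj by (intro eventually_conj eventually_at_right_less)
    have q0: "expandable I N q0"
    proof (rule insert.IH)
      show "germ I q0"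
        unfolding germ_iff
      proof (rule eventually_mono[OF ev])
        fix R :: real assume R: "0 < R \<and> holo_on (polydisc R) q"
        have "holo_on (polydisc R) (\<lambda>v. upd (coord_proj I v) l 0 $ i)" for i
          using holo_on_coord_proj[of "polydisc R" I i] by (cases "i = l") auto
        then show "holo_on (polydisc R) (\<lambda>v. q0 (coord_proj I v))"
          unfolding q0_def
          by (rule holo_on_compose[OF conjunct2[OF R]]) (use R in \<open>auto simp: polydisc_def\<close>)
      qed
      show "q0 v = q0 (coord_proj J v)" for v
      proof -
        have "coord_proj ?J (upd v l 0) = coord_proj ?J (upd (coord_proj J v) l 0)" by (auto simp: vec_eq_iff)
        then show ?thesis unfolding q0_def
          using pq(3)[of "upd v l 0"] pq(3)[of "upd (coord_proj J v) l 0"] by argo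
      qed
    qed (use insert.prems(1) in auto)
    have q1: "germ I q1"
      unfolding germ_iff
    proof (rule eventually_mono[OF ev])
      fix R :: real assume R: "0 < R \<and> holo_on (polydisc R) q"
      have F: "holo_on (polydisc R) (\<lambda>v. coord_proj ?J (coord_proj I v) $ i)" for i
        by (cases "i \<in> ?J"; cases "i \<in> I") auto
      show "holo_on (polydisc R) (\<lambda>v. q1 (coord_proj I v))"
        unfolding q1_def
      proof (rule holo_on_compose[OF holo_divide_coord(1)[of R q l]])
        show "(\<lambda>v. coord_proj ?J (coord_proj I v)) ` polydisc R \<subseteq> polydisc R"
          using R by (intro image_subsetI coord_proj_polydisc) auto
        show "holo_on (polydisc R) (\<lambda>v. coord_proj ?J (coord_proj I v) $ i)" for i by (rule F)
      qed (use R in auto)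
    qed
    have e: "germ_eq I h (\<lambda>v. (p v + v $ l ^ m * q0 v) + v $ l ^ Suc m * q1 v)"
    proof -
      have "eventually (\<lambda>R. 0 < R \<and> holo_on (polydisc R) q \<and> (\<forall>v\<in>polydisc R. h (coord_proj I v) =
          p (coord_proj I v) + coord_proj I v $ l ^ m * q (coord_proj I v))) (at_right 0)"
        using ev germ_eqD[OF pq(4)] by eventually_elim auto
      then obtain R where R: "0 < R" "holo_on (polydisc R) q"
        "\<And>v. v \<in> polydisc R \<Longrightarrow> h (coord_proj I v) = p (coord_proj I v) + coord_proj I v $ l ^ m * q (coord_proj I v)"
        using eventually_happens'[OF trivial_limit_at_right_real] by blast
      have "h u = (p u + u $ l ^ m * q0 u) + u $ l ^ Suc m * q1 u" if v: "v \<in> polydisc R"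
          and u: "u = coord_proj I v" for v u
      proof -
        have pu: "coord_proj ?J u \<in> polydisc R" using v R(1) by (auto simp: u polydisc_def)
        have "q u = q (coord_proj ?J u)" by (rule pq(3))
        also have "\<dots> = q (upd (coord_proj ?J u) l 0) + u $ l * q1 u"
          using holo_divide_coord(2)[OF R(2) pu, of l] by (simp add: q1_def)
        also have "q (upd (coord_proj ?J u) l 0) = q0 u"
        proof -
          have "coord_proj ?J (upd u l 0) = coord_proj ?J (upd (coord_proj ?J u) l 0)" by (auto simp: vec_eq_iff)
          then show ?thesis unfolding q0_def
            using pq(3)[of "upd u l 0"] pq(3)[of "upd (coord_proj ?J u) l 0"] by argo
        qed
        finally show ?thesis using R(3)[OF v] by (simp add: u algebra_simps)
      qed
      then show ?thesis unfolding germ_eq_def eventually_nhds_0_polydisc using R(1) by blast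
    qed
    have "q1 v = q1 (coord_proj ?J v)" for v
    proof -
      have "coord_proj ?J (coord_proj ?J v) = coord_proj ?J v" by (auto simp: vec_eq_iff)
      then show ?thesis by (simp add: q1_def)
    qed
    moreover have "expandable I N (\<lambda>v. p v + v $ l ^ m * q0 v)"
      by (intro expandable_add expandable_coord_mult pq(1) q0 l)
    ultimately show ?case using q1 e by blast
  qed
  obtain p q where pq: "expandable I N p" "germ I q" "germ_eq I h (\<lambda>v. p v + v $ l ^ N * q v)"
    using step[of N] by blast
  have "in_germ_ideal I (\<lambda>i v. v $ i ^ N) (\<lambda>v. q v * v $ l ^ N)"
    by (rule in_germ_ideal_mult[OF in_germ_ideal_generator[OF l, of "\<lambda>i v. v $ i ^ N"] pq(2)])
  then have "expandable I N (\<lambda>v. p v + v $ l ^ N * q v)"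
    by (intro expandable_add pq expandable_ideal) (simp add: mult.commute)
  moreover have "germ_eq I (\<lambda>v. p v + v $ l ^ N * q v) h"
    using pq(3) by (auto simp: germ_eq_def elim!: eventually_mono)
  ultimately show ?case by (rule expandable_cong[rotated])
qed

lemma expandable_germ:
  assumes "germ I h" shows "expandable I N h"
proof (rule expandable_cong)
  have pp: "coord_proj I (coord_proj I v) = coord_proj I v" for v :: "complex ^ 'a" by (simp add: vec_eq_iff)
  show "germ_eq I (\<lambda>v. h (coord_proj I v)) h" by (simp add: germ_eq_def pp)
  show "expandable I N (\<lambda>v. h (coord_proj I v))"
    by (rule expandable_germ_depends[of I]) (use assms in \<open>auto simp: germ_iff pp\<close>)
qed

text \<open>The part of \<open>is_residue\<close> that does not involve the numerator, so that
  existence of \<open>N\<close> and \<open>A\<close> can be discussed for the equations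
  alone.\<close>

definition presents :: "'n::finite set \<Rightarrow> ('n \<Rightarrow> complex ^ 'n \<Rightarrow> complex) \<Rightarrow> nat
    \<Rightarrow> ('n \<Rightarrow> 'n \<Rightarrow> complex ^ 'n \<Rightarrow> complex) \<Rightarrow> bool" where
  "presents I g N A \<longleftrightarrow> 0 < N \<and> (\<forall>i\<in>I. \<forall>j\<in>I. germ I (A i j)) \<and>
     (\<forall>i\<in>I. germ_eq I (\<lambda>v. v $ i ^ N) (\<lambda>v. \<Sum>j\<in>I. A i j v * g j v))"

definition ext_matrix :: "'n set \<Rightarrow> ('n \<Rightarrow> 'n \<Rightarrow> complex ^ 'n \<Rightarrow> complex) \<Rightarrow> complex ^ 'n::finite \<Rightarrow> complex ^ 'n ^ 'n" where
  "ext_matrix I A v = (\<chi> i j. if i \<in> I \<and> j \<in> I then A i j v else if i = j then 1 else 0)"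

lemma is_residue_iff:
  "is_residue I g h r \<longleftrightarrow> (\<exists>N A. presents I g N A \<and> power_residue I N (\<lambda>v. h v * det (ext_matrix I A v)) r)"
  unfolding is_residue_def presents_def block_det_def ext_matrix_def by blast

lemma germ_ext_matrix:
  assumes "presents I g N A" shows "germ I (\<lambda>v. det (ext_matrix I A v))"
proof (rule germ_det)
  show "germ I (\<lambda>v. ext_matrix I A v $ i $ j)" for i j
    using assms by (cases "i \<in> I \<and> j \<in> I") (auto simp: presents_def ext_matrix_def)
qed

lemma is_residue_torus_mean:
  assumes "presents I g N A" "power_residue I N (\<lambda>v. h v * det (ext_matrix I A v)) r"
  shows "eventually (\<lambda>\<rho>. r = torus_mean I \<rho> (\<lambda>v. h v * det (ext_matrix I A v) * (\<Prod>k\<in>I. v $ k / v $ k ^ N)))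
      (at_right 0)"
  using power_residue_torus_mean[OF assms(2)] assms(1) by (simp add: presents_def)

lemma prod_if_subset:
  fixes c :: "'n::finite \<Rightarrow> complex" shows "(\<Prod>i\<in>UNIV. if i \<in> I then c i else 1) = (\<Prod>i\<in>I. c i)"
  by (subst prod.inter_filter[symmetric]) auto

text \<open>Both presentations are brought to the exponent N + M: multiplying row i of
  \<open>A\<close> by v_i^M and row i of \<open>B\<close> by v_i^N changes each determinant by the
  factor that the new denominators absorb. The transformation law then applies to two solutions of
  one system.\<close>

lemma torus_mean_presents_unique:
  assumes A: "presents I g N A" and B: "presents I g M B" and h: "germ I h"
  shows "eventually (\<lambda>\<rho>. torus_mean I \<rho> (\<lambda>v. h v * det (ext_matrix I A v) * (\<Prod>k\<in>I. v $ k / v $ k ^ N)) =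
      torus_mean I \<rho> (\<lambda>v. h v * det (ext_matrix I B v) * (\<Prod>k\<in>I. v $ k / v $ k ^ M))) (at_right 0)"
proof -
  define good where "good N A R \<longleftrightarrow> (\<forall>i\<in>I. \<forall>j\<in>I. holo_on (polydisc R) (\<lambda>v. A i j (coord_proj I v))) \<and>
      (\<forall>i\<in>I. \<forall>v\<in>polydisc R. coord_proj I v $ i ^ N = (\<Sum>j\<in>I. A i j (coord_proj I v) * g j (coord_proj I v)))" for N A R
  have ev: "eventually (good N A) (at_right 0)" if "presents I g N A" for N A
    unfolding good_def
    using that unfolding presents_def germ_iff
    by (intro eventually_conj eventually_ball_finite ballI germ_eqD) auto
  have "eventually (\<lambda>R. good N A R \<and> good M B R \<and> holo_on (polydisc R) (\<lambda>v. h (coord_proj I v))) (at_right 0)"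
    using ev[OF A] ev[OF B] h unfolding germ_iff by (intro eventually_conj)
  then show ?thesis
  proof (rule eventually_at_right_0_shrink)
    fix \<rho> R :: real
    assume \<rho>: "0 < \<rho>" "\<rho> < R"
      and good: "good N A R \<and> good M B R \<and> holo_on (polydisc R) (\<lambda>v. h (coord_proj I v))"
    interpret torus_denominators \<rho> R I "\<lambda>k \<xi>. \<xi> ^ (N + M)" by (rule torus_denominators_power[OF \<rho>])
    define P where "P K A v = (\<chi> i. (if i \<in> I then v $ i ^ K else 1) *s (ext_matrix I A (coord_proj I v) $ i))"
        for K A v
    define w where "w v = (\<chi> j. if j \<in> I then g j v else 0)" for v
    have holo: "holo_on (polydisc R) (\<lambda>v. P K A v $ i $ j)" if "good L A R" for K L A i j
      using that by (cases "i \<in> I"; cases "j \<in> I") (auto simp: P_def ext_matrix_def good_def intro!: holo_on_mult)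
    have Pw: "P K A v *v w v = rhs v" if v: "v \<in> torus \<rho> I" and "good L A R" "K + L = N + M" for K L A v
    proof -
      have vR: "v \<in> polydisc R" using v torus_subset_polydisc[OF \<rho>] by blast
      have "(P K A v *v w v) $ i = rhs v $ i" for i
      proof (cases "i \<in> I")
        case True
        have "(P K A v *v w v) $ i = (\<Sum>j\<in>UNIV. if j \<in> I then v $ i ^ K * (A i j v * g j v) else 0)"
          using True v unfolding matrix_vector_mult_def P_def w_def ext_matrix_def by (auto intro!: sum.cong)
        also have "\<dots> = v $ i ^ K * (\<Sum>j\<in>I. A i j v * g j v)"
          by (simp add: sum.If_cases sum_distrib_left)
        also have "(\<Sum>j\<in>I. A i j v * g j v) = v $ i ^ L"
          using \<open>good L A R\<close>[unfolded good_def, THEN conjunct2, rule_format, OF True vR] v by simp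
        finally show ?thesis using True that(3) by (simp add: rhs_def power_add[symmetric])
      next
        case False
        then have "(P K A v *v w v) $ i = 0"
          unfolding matrix_vector_mult_def P_def w_def ext_matrix_def by (auto intro!: sum.neutral)
        then show ?thesis using False by (simp add: rhs_def)
      qed
      then show ?thesis by (simp add: vec_eq_iff)
    qed
    have det: "h v * det (ext_matrix I A v) * (\<Prod>k\<in>I. v $ k / v $ k ^ L) = h (coord_proj I v) * det (P K A v) * den v"
      if v: "v \<in> torus \<rho> I" and "K + L = N + M" for v K L A
    proof -
      have nz: "v $ k \<noteq> 0" if "k \<in> I" for k using torus_nth[OF v, of k] that \<rho> by auto
      have "det (P K A v) = (\<Prod>i\<in>I. v $ i ^ K) * det (ext_matrix I A v)"
        unfolding P_def using v by (simp add: det_rows_mul prod_if_subset)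
      moreover have "(\<Prod>k\<in>I. v $ k / v $ k ^ L) = (\<Prod>i\<in>I. v $ i ^ K) * den v"
        unfolding den_def prod.distrib[symmetric]
        by (intro prod.cong) (auto simp: that(2)[symmetric] power_add nz)
      ultimately show ?thesis using v by simp
    qed
    have "torus_mean I \<rho> (\<lambda>v. h v * det (ext_matrix I A v) * (\<Prod>k\<in>I. v $ k / v $ k ^ N)) =
        torus_mean I \<rho> (\<lambda>v. h (coord_proj I v) * det (P M A v) * den v)"
      by (rule torus_mean_cong[OF \<rho>(1)], rule det) auto
    also have "\<dots> = torus_mean I \<rho> (\<lambda>v. h (coord_proj I v) * det (P N B v) * den v)"
    proof (rule torus_mean_det_unique)
      show "holo_on (polydisc R) (\<lambda>v. P M A v $ i $ j)" for i j using holo good by blast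
      show "holo_on (polydisc R) (\<lambda>v. P N B v $ i $ j)" for i j using holo good by blast
      show "P M A v $ k = P N B v $ k" if "k \<notin> I" for v k
        using that by (simp add: P_def ext_matrix_def vec_eq_iff)
      show "P M A v *v w v = rhs v" if "v \<in> torus \<rho> I" for v
        by (rule Pw[OF that, of N]) (use good in auto)
      show "P N B v *v w v = rhs v" if "v \<in> torus \<rho> I" for v
        by (rule Pw[OF that, of M]) (use good in auto)
    qed (use good in auto)
    also have "\<dots> = torus_mean I \<rho> (\<lambda>v. h v * det (ext_matrix I B v) * (\<Prod>k\<in>I. v $ k / v $ k ^ M))"
      by (rule torus_mean_cong[OF \<rho>(1)], rule det[symmetric]) auto
    finally show "torus_mean I \<rho> (\<lambda>v. h v * det (ext_matrix I A v) * (\<Prod>k\<in>I. v $ k / v $ k ^ N)) =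
      torus_mean I \<rho> (\<lambda>v. h v * det (ext_matrix I B v) * (\<Prod>k\<in>I. v $ k / v $ k ^ M))" .
  qed
qed

lemma eventually_at_right_0_const: "eventually (\<lambda>_::real. P) (at_right 0) \<Longrightarrow> P"
  by (simp add: eventually_const)

text \<open>The means depend on the radius a priori, the numbers \<open>r\<close> and
  \<open>r'\<close> do not; comparison at one small radius is enough.\<close>

lemma is_residue_unique:
  assumes "is_residue I g h r" "is_residue I g h r'" "germ I h" shows "r = r'"
proof -
  obtain N A M B where *: "presents I g N A" "power_residue I N (\<lambda>v. h v * det (ext_matrix I A v)) r"
    "presents I g M B" "power_residue I M (\<lambda>v. h v * det (ext_matrix I B v)) r'"
    using assms(1,2) unfolding is_residue_iff by blast
  have "eventually (\<lambda>_. r = r') (at_right (0::real))"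
    using is_residue_torus_mean[OF *(1,2)] is_residue_torus_mean[OF *(3,4)]
      torus_mean_presents_unique[OF *(1,3) assms(3)] by eventually_elim simp
  then show ?thesis by (rule eventually_at_right_0_const)
qed

text \<open>The working form of the residue: any presentation may be used to compute it. Existence
  of the defining expansion comes from \<open>expandable_germ\<close>, independence of the choices
  from \<open>is_residue_unique\<close>.\<close>

lemma residue_torus_mean:
  assumes "presents I g N A" "germ I h"
  shows "eventually (\<lambda>\<rho>. residue I g h =
      torus_mean I \<rho> (\<lambda>v. h v * det (ext_matrix I A v) * (\<Prod>k\<in>I. v $ k / v $ k ^ N))) (at_right 0)"
proof -
  obtain r where "power_residue I N (\<lambda>v. h v * det (ext_matrix I A v)) r"
    using expandable_germ[OF germ_mult[OF assms(2) germ_ext_matrix[OF assms(1)]], of N]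
    unfolding expandable_def by blast
  moreover from this have r: "is_residue I g h r"
    using assms(1) unfolding is_residue_iff by blast
  moreover have "residue I g h = r"
    unfolding residue_def using r is_residue_unique[OF _ _ assms(2)] by (auto intro!: the_equality)
  ultimately show ?thesis using is_residue_torus_mean[OF assms(1)] by simp
qed

text \<open>In the default case the value is 0 for every numerator. To compare two residues it is
  then enough to transfer presentations in both directions and to treat the presented case.\<close>

lemma residue_not_presented:
  assumes "\<nexists>N A. presents I g N A" shows "residue I g h = 0"
  using assms unfolding residue_def is_residue_iff by auto

lemma residue_cong:
  assumes "germ_eq I h h'" "germ I h" shows "residue I g h = residue I g h'"
proof (cases "\<exists>N A. presents I g N A")
  case True
  then obtain N A where A: "presents I g N A" by blast
  have h': "germ I h'" using germ_cong[OF assms] .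
  have "eventually (\<lambda>\<rho>. torus_mean I \<rho> (\<lambda>v. h v * det (ext_matrix I A v) * (\<Prod>k\<in>I. v $ k / v $ k ^ N)) =
      torus_mean I \<rho> (\<lambda>v. h' v * det (ext_matrix I A v) * (\<Prod>k\<in>I. v $ k / v $ k ^ N))) (at_right 0)"
    using germ_eqD[OF assms(1)]
  proof (rule eventually_at_right_0_shrink)
    fix \<rho> R :: real assume \<rho>: "0 < \<rho>" "\<rho> < R" and *: "\<forall>v\<in>polydisc R. h (coord_proj I v) = h' (coord_proj I v)"
    have "h v = h' v" if "v \<in> torus \<rho> I" for v
      using * torus_subset_polydisc[OF \<rho>] that coord_proj_torus[OF that] by (metis subsetD)
    then show "torus_mean I \<rho> (\<lambda>v. h v * det (ext_matrix I A v) * (\<Prod>k\<in>I. v $ k / v $ k ^ N)) =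
      torus_mean I \<rho> (\<lambda>v. h' v * det (ext_matrix I A v) * (\<Prod>k\<in>I. v $ k / v $ k ^ N))"
      by (intro torus_mean_cong[OF \<rho>(1)]) simp
  qed
  with residue_torus_mean[OF A assms(2)] residue_torus_mean[OF A h']
  have "eventually (\<lambda>_. residue I g h = residue I g h') (at_right (0::real))"
    by eventually_elim simp
  then show ?thesis by (rule eventually_at_right_0_const)
qed (simp add: residue_not_presented)

lemma continuous_on_torus_presents:
  assumes "presents I g N A" "germ I h"
  shows "eventually (\<lambda>\<rho>. continuous_on (torus \<rho> I) (\<lambda>v. h v * det (ext_matrix I A v) * (\<Prod>k\<in>I. v $ k / v $ k ^ N)))
      (at_right 0)"
proof -
  have "eventually (\<lambda>R. holo_on (polydisc R) (\<lambda>v. h (coord_proj I v) * det (ext_matrix I A (coord_proj I v))))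
      (at_right 0)"
    using germ_mult[OF assms(2) germ_ext_matrix[OF assms(1)]] unfolding germ_iff .
  then show ?thesis
  proof (rule eventually_at_right_0_shrink)
    fix \<rho> R :: real assume \<rho>: "0 < \<rho>" "\<rho> < R"
      and *: "holo_on (polydisc R) (\<lambda>v. h (coord_proj I v) * det (ext_matrix I A (coord_proj I v)))"
    interpret torus_denominators \<rho> R I "\<lambda>k \<xi>. \<xi> ^ N" by (rule torus_denominators_power[OF \<rho>])
    have "continuous_on (torus \<rho> I) (\<lambda>v. h (coord_proj I v) * det (ext_matrix I A (coord_proj I v)) * den v)"
      by (intro continuous_on_mult continuous_on_den continuous_on_torus_holo[OF \<rho> *])
    then show "continuous_on (torus \<rho> I) (\<lambda>v. h v * det (ext_matrix I A v) * (\<Prod>k\<in>I. v $ k / v $ k ^ N))"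
      unfolding den_def by (subst continuous_on_cong[OF refl]) auto
  qed
qed

lemma residue_linear:
  assumes "germ I h" "germ I h'"
  shows "residue I g (\<lambda>v. c * h v + h' v) = c * residue I g h + residue I g h'"
proof (cases "\<exists>N A. presents I g N A")
  case True
  then obtain N A where A: "presents I g N A" by blast
  have ch: "germ I (\<lambda>v. c * h v + h' v)" by (intro germ_add germ_mult germ_const assms)
  have "eventually (\<lambda>_. residue I g (\<lambda>v. c * h v + h' v) = c * residue I g h + residue I g h') (at_right (0::real))"
    using residue_torus_mean[OF A ch] residue_torus_mean[OF A assms(1)] residue_torus_mean[OF A assms(2)]
      continuous_on_torus_presents[OF A assms(1)] continuous_on_torus_presents[OF A assms(2)] eventually_at_right_less
  proof eventually_elim
    case (elim \<rho>)
    then show ?case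
      using torus_mean_linear[OF elim(6,4,5), of c] by (simp add: algebra_simps)
  qed
  then show ?thesis by (rule eventually_at_right_0_const)
qed (simp add: residue_not_presented)

lemma residue_sum:
  assumes "finite S" "\<And>s. s \<in> S \<Longrightarrow> germ I (h s)"
  shows "residue I g (\<lambda>v. \<Sum>s\<in>S. c s * h s v) = (\<Sum>s\<in>S. c s * residue I g (h s))"
  using assms
proof (induction S rule: finite_induct)
  case empty
  show ?case using residue_linear[of I "\<lambda>v. 0" "\<lambda>v. 0" g 1] germ_const[of I 0] by simp
next
  case (insert s S)
  then show ?case by (simp add: residue_linear germ_sum germ_mult germ_const)
qed

section \<open>Invariance under changes of coordinates\<close>

text \<open>The polynomial (y^N - x^N) / (y - x), the one-variable kernel for denominators that are
  N-th powers.\<close>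

definition geo :: "nat \<Rightarrow> complex \<Rightarrow> complex \<Rightarrow> complex" where
  "geo N y x = (\<Sum>a<N. x ^ (N - Suc a) * y ^ a)"

lemma geo: "y ^ N - x ^ N = (y - x) * geo N y x"
  unfolding geo_def by (rule power_diff_sumr2)

text \<open>Cauchy's formula for the constant 1, one variable at a time; the other factors are
  constant in that variable.\<close>

lemma torus_mean_Cauchy_kernel:
  fixes u :: "complex ^ 'n::finite"
  assumes "0 < \<rho>" "\<And>i. norm (u $ i) < \<rho>"
  shows "torus_mean I \<rho> (\<lambda>v. \<Prod>i\<in>I. v $ i / (v $ i - u $ i)) = 1"
proof -
  have nz: "v $ i - u $ i \<noteq> 0" if "v \<in> torus \<rho> I" "i \<in> I" for v and I :: "'n set" and i
    using torus_nth[OF that(1), of i] that assms(2)[of i] by auto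
  have cont: "continuous_on (torus \<rho> J) (\<lambda>v. \<Prod>i\<in>I. v $ i / (v $ i - u $ i))" if "I \<subseteq> J" for I J :: "'n set"
    using nz that by (intro continuous_intros) blast
  have "finite I" by simp
  then show ?thesis
  proof (induction I rule: finite_induct)
    case empty
    show ?case using torus_mean_holo[OF assms(1) _ holo_on_const, of "\<rho> + 1" "{}" 1] by simp
  next
    case (insert l I)
    have "torus_mean (insert l I) \<rho> (\<lambda>v. \<Prod>i\<in>insert l I. v $ i / (v $ i - u $ i)) =
        torus_mean (insert l I - {l}) \<rho> (\<lambda>v. \<Prod>i\<in>I. v $ i / (v $ i - u $ i))"
    proof (rule torus_mean_remove[OF assms(1) cont])
      fix v assume v: "v \<in> torus \<rho> (insert l I)"
      have *: "(\<Prod>i\<in>insert l I. upd v l \<xi> $ i / (upd v l \<xi> $ i - u $ i)) =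
          \<xi> / (\<xi> - u $ l) * (\<Prod>i\<in>I. v $ i / (v $ i - u $ i))" for \<xi>
        using insert.hyps by (subst prod.insert) (auto intro!: prod.cong)
      have "integral {0..1} (\<lambda>t. circ \<rho> t / (circ \<rho> t - u $ l)) = 1"
        using circ_mean_Cauchy[of "\<lambda>_. 1" "\<rho> + 1" \<rho> "u $ l"] assms by simp
      then have "avg l \<rho> (\<lambda>v. \<Prod>i\<in>insert l I. v $ i / (v $ i - u $ i)) v = (\<Prod>i\<in>I. v $ i / (v $ i - u $ i))"
        unfolding avg_def * integral_mult_left by simp
      also have "\<dots> = (\<Prod>i\<in>I. upd v l 0 $ i / (upd v l 0 $ i - u $ i))"
        using insert.hyps by (intro prod.cong) auto
      finally show "avg l \<rho> (\<lambda>v. \<Prod>i\<in>insert l I. v $ i / (v $ i - u $ i)) v =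
          (\<Prod>i\<in>I. upd v l 0 $ i / (upd v l 0 $ i - u $ i))" .
    qed (use insert.hyps cont in auto)
    then show ?case using insert by simp
  qed
qed

text \<open>Estimates up to multiples of a control function \<open>\<delta>\<close> of the parameter \<open>u\<close>.\<close>

definition bnd :: "'a set \<Rightarrow> 'b set \<Rightarrow> ('a \<Rightarrow> 'b \<Rightarrow> complex) \<Rightarrow> bool" where
  "bnd U T F \<longleftrightarrow> (\<exists>c. \<forall>u\<in>U. \<forall>v\<in>T. norm (F u v) \<le> c)"

definition cls :: "'a set \<Rightarrow> 'b set \<Rightarrow> ('a \<Rightarrow> real) \<Rightarrow> ('a \<Rightarrow> 'b \<Rightarrow> complex) \<Rightarrow> ('a \<Rightarrow> 'b \<Rightarrow> complex) \<Rightarrow> bool" where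
  "cls U T \<delta> F G \<longleftrightarrow> (\<exists>c. \<forall>u\<in>U. \<forall>v\<in>T. norm (F u v - G u v) \<le> c * \<delta> u)"

lemma bndI: "(\<And>u v. u \<in> U \<Longrightarrow> v \<in> T \<Longrightarrow> norm (F u v) \<le> c) \<Longrightarrow> bnd U T F"
  unfolding bnd_def by blast

lemma clsI: "(\<And>u v. u \<in> U \<Longrightarrow> v \<in> T \<Longrightarrow> norm (F u v - G u v) \<le> c * \<delta> u) \<Longrightarrow> cls U T \<delta> F G"
  unfolding cls_def by blast

lemma bnd_const: "bnd U T (\<lambda>u v. c)"
  unfolding bnd_def by auto

lemma bnd_add: assumes "bnd U T F" "bnd U T G" shows "bnd U T (\<lambda>u v. F u v + G u v)"
proof -
  obtain c d where "\<And>u v. u \<in> U \<Longrightarrow> v \<in> T \<Longrightarrow> norm (F u v) \<le> c" "\<And>u v. u \<in> U \<Longrightarrow> v \<in> T \<Longrightarrow> norm (G u v) \<le> d"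
    using assms unfolding bnd_def by blast
  then show ?thesis by (intro bndI[of _ _ _ "c + d"] norm_triangle_mono) auto
qed

lemma bnd_mult: assumes "bnd U T F" "bnd U T G" shows "bnd U T (\<lambda>u v. F u v * G u v)"
proof -
  obtain c d where "\<And>u v. u \<in> U \<Longrightarrow> v \<in> T \<Longrightarrow> norm (F u v) \<le> c" "\<And>u v. u \<in> U \<Longrightarrow> v \<in> T \<Longrightarrow> norm (G u v) \<le> d"
    using assms unfolding bnd_def by blast
  then show ?thesis by (intro bndI[of _ _ _ "\<bar>c\<bar> * d"]) (force simp: norm_mult intro!: mult_mono)
qed

lemma bnd_sum: "(\<And>s. s \<in> S \<Longrightarrow> bnd U T (F s)) \<Longrightarrow> bnd U T (\<lambda>u v. \<Sum>s\<in>S. F s u v)"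
  by (induction S rule: infinite_finite_induct) (auto intro: bnd_const bnd_add)

lemma bnd_prod: "(\<And>s. s \<in> S \<Longrightarrow> bnd U T (F s)) \<Longrightarrow> bnd U T (\<lambda>u v. \<Prod>s\<in>S. F s u v)"
  by (induction S rule: infinite_finite_induct) (auto intro: bnd_const bnd_mult)

lemma bnd_power: "bnd U T F \<Longrightarrow> bnd U T (\<lambda>u v. F u v ^ k)"
  by (induction k) (auto intro: bnd_const bnd_mult)

lemma bnd_det: "(\<And>i j. bnd U T (\<lambda>u v. C u v $ i $ j)) \<Longrightarrow> bnd U T (\<lambda>u v. det (C u v))"
  unfolding det_def by (intro bnd_sum bnd_mult bnd_const bnd_prod)

lemma bnd_diff: "bnd U T F \<Longrightarrow> bnd U T G \<Longrightarrow> bnd U T (\<lambda>u v. F u v - G u v)"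
  using bnd_add[OF _ bnd_mult[OF bnd_const[of U T "-1"]]] by fastforce

context
  fixes U :: "'a set" and T :: "'b set" and \<delta> :: "'a \<Rightarrow> real"
  assumes \<delta>: "\<And>u. 0 \<le> \<delta> u"
begin

lemma cls_refl: "cls U T \<delta> F F"
  using \<delta> by (intro clsI[of _ _ _ _ 0]) auto

lemma cls_add: assumes "cls U T \<delta> F F'" "cls U T \<delta> G G'" shows "cls U T \<delta> (\<lambda>u v. F u v + G u v) (\<lambda>u v. F' u v + G' u v)"
proof -
  obtain c d where *: "\<And>u v. u \<in> U \<Longrightarrow> v \<in> T \<Longrightarrow> norm (F u v - F' u v) \<le> c * \<delta> u"
    "\<And>u v. u \<in> U \<Longrightarrow> v \<in> T \<Longrightarrow> norm (G u v - G' u v) \<le> d * \<delta> u"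
    using assms unfolding cls_def by blast
  show ?thesis
  proof (rule clsI[of _ _ _ _ "c + d"])
    fix u v assume "u \<in> U" "v \<in> T"
    from norm_triangle_mono[OF *[OF this]]
    show "norm (F u v + G u v - (F' u v + G' u v)) \<le> (c + d) * \<delta> u" by (simp add: algebra_simps)
  qed
qed

text \<open>FG - F'G' = (F - F')G + F'(G - G'). One bounded factor in each term keeps the product a
  multiple of \<open>\<delta>\<close>.\<close>

lemma cls_mult:
  assumes "cls U T \<delta> F F'" "cls U T \<delta> G G'" "bnd U T F'" "bnd U T G"
  shows "cls U T \<delta> (\<lambda>u v. F u v * G u v) (\<lambda>u v. F' u v * G' u v)"
proof -
  obtain c d where *: "\<And>u v. u \<in> U \<Longrightarrow> v \<in> T \<Longrightarrow> norm (F u v - F' u v) \<le> c * \<delta> u"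
    "\<And>u v. u \<in> U \<Longrightarrow> v \<in> T \<Longrightarrow> norm (G u v - G' u v) \<le> d * \<delta> u"
    using assms unfolding cls_def by blast
  obtain B B' where B: "\<And>u v. u \<in> U \<Longrightarrow> v \<in> T \<Longrightarrow> norm (F' u v) \<le> B" "\<And>u v. u \<in> U \<Longrightarrow> v \<in> T \<Longrightarrow> norm (G u v) \<le> B'"
    using assms unfolding bnd_def by blast
  show ?thesis
  proof (rule clsI[of _ _ _ _ "\<bar>c\<bar> * \<bar>B'\<bar> + \<bar>B\<bar> * \<bar>d\<bar>"])
    fix u v assume uv: "u \<in> U" "v \<in> T"
    have 1: "norm (F u v - F' u v) \<le> \<bar>c\<bar> * \<delta> u" "norm (G u v - G' u v) \<le> \<bar>d\<bar> * \<delta> u"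
      using *[OF uv] mult_right_mono[OF abs_ge_self[of c] \<delta>[of u]] mult_right_mono[OF abs_ge_self[of d] \<delta>[of u]]
      by linarith+
    have 2: "norm (F' u v) \<le> \<bar>B\<bar>" "norm (G u v) \<le> \<bar>B'\<bar>"
      using B[OF uv] by auto
    have "F u v * G u v - F' u v * G' u v = (F u v - F' u v) * G u v + F' u v * (G u v - G' u v)"
      by (simp add: algebra_simps)
    also have "norm \<dots> \<le> (\<bar>c\<bar> * \<delta> u) * \<bar>B'\<bar> + \<bar>B\<bar> * (\<bar>d\<bar> * \<delta> u)"
      unfolding norm_mult[symmetric]
      by (intro norm_triangle_mono) (auto simp: norm_mult \<delta> intro!: mult_mono 1 2)
    finally show "norm (F u v * G u v - F' u v * G' u v) \<le> (\<bar>c\<bar> * \<bar>B'\<bar> + \<bar>B\<bar> * \<bar>d\<bar>) * \<delta> u"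
      by (simp add: algebra_simps)
  qed
qed

lemma cls_sum: "(\<And>s. s \<in> S \<Longrightarrow> cls U T \<delta> (F s) (G s)) \<Longrightarrow> cls U T \<delta> (\<lambda>u v. \<Sum>s\<in>S. F s u v) (\<lambda>u v. \<Sum>s\<in>S. G s u v)"
  by (induction S rule: infinite_finite_induct) (auto intro: cls_refl cls_add)

lemma cls_prod:
  assumes "\<And>s. s \<in> S \<Longrightarrow> cls U T \<delta> (F s) (G s)" "\<And>s. s \<in> S \<Longrightarrow> bnd U T (F s)" "\<And>s. s \<in> S \<Longrightarrow> bnd U T (G s)"
  shows "cls U T \<delta> (\<lambda>u v. \<Prod>s\<in>S. F s u v) (\<lambda>u v. \<Prod>s\<in>S. G s u v)"
  using assms
proof (induction S rule: infinite_finite_induct)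
  case (insert s S)
  have "cls U T \<delta> (\<lambda>u v. F s u v * (\<Prod>s\<in>S. F s u v)) (\<lambda>u v. G s u v * (\<Prod>s\<in>S. G s u v))"
    by (intro cls_mult bnd_prod insert.IH insert.prems) auto
  then show ?case using insert.hyps by simp
qed (auto intro: cls_refl)

lemma cls_det:
  assumes "\<And>i j. cls U T \<delta> (\<lambda>u v. C u v $ i $ j) (\<lambda>u v. D u v $ i $ j)"
    "\<And>i j. bnd U T (\<lambda>u v. C u v $ i $ j)" "\<And>i j. bnd U T (\<lambda>u v. D u v $ i $ j)"
  shows "cls U T \<delta> (\<lambda>u v. det (C u v)) (\<lambda>u v. det (D u v))"
  unfolding det_def by (intro cls_sum cls_mult cls_refl cls_prod bnd_const bnd_prod assms)

end

lemma cls_torus_mean: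
  fixes F G :: "'a \<Rightarrow> complex ^ 'n::finite \<Rightarrow> complex"
  assumes "cls U (torus \<rho> I) \<delta> F G" "0 < \<rho>" "\<And>u. u \<in> U \<Longrightarrow> continuous_on (torus \<rho> I) (F u)"
    "\<And>u. u \<in> U \<Longrightarrow> continuous_on (torus \<rho> I) (G u)"
  shows "\<exists>c. \<forall>u\<in>U. norm (torus_mean I \<rho> (F u) - torus_mean I \<rho> (G u)) \<le> c * \<delta> u"
proof -
  obtain c where c: "\<And>u v. u \<in> U \<Longrightarrow> v \<in> torus \<rho> I \<Longrightarrow> norm (F u v - G u v) \<le> c * \<delta> u"
    using assms(1) unfolding cls_def by blast
  have "norm (torus_mean I \<rho> (F u) - torus_mean I \<rho> (G u)) \<le> c * \<delta> u" if "u \<in> U" for u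
    unfolding torus_mean_diff[OF assms(2) assms(3)[OF that] assms(4)[OF that], symmetric]
    by (rule torus_mean_norm_le[OF assms(2)]) (use assms c that in \<open>auto intro!: continuous_intros\<close>)
  then show ?thesis by blast
qed

section \<open>Comparison of the kernel of a coordinate change with Cauchy's kernel\<close>

definition jac :: "(complex ^ 'n \<Rightarrow> complex ^ 'n) \<Rightarrow> complex ^ 'n \<Rightarrow> complex ^ 'n::finite ^ 'n" where
  "jac \<phi> v = (\<chi> i j. partial j (\<lambda>v. \<phi> v $ i) v)"

definition hada_matrix :: "(complex ^ 'n \<Rightarrow> complex ^ 'n) \<Rightarrow> complex ^ 'n \<Rightarrow> complex ^ 'n \<Rightarrow> complex ^ 'n::finite ^ 'n"
    where
  "hada_matrix \<phi> v u = (\<chi> i j. hada j (\<lambda>v. \<phi> v $ i) v u)"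

text \<open>The kernel \<open>\<Prod>\<^sub>i (v\<^sub>i^L - u\<^sub>i^L) / (v\<^sub>i - u\<^sub>i)\<close> has mean 1 against \<open>\<Prod>\<^sub>i v\<^sub>i / (v\<^sub>i^L - u\<^sub>i^L)\<close>, by
  Cauchy's formula. It is compared, for a fixed small \<open>u\<close>, with the kernel built from \<open>\<phi>\<close>. All errors are
  in the ideal generated by the \<open>\<phi>\<^sub>j(u)^N\<close>, hence the control function.\<close>

locale kernel_estimate =
  fixes \<phi> :: "complex ^ 'n::finite \<Rightarrow> complex ^ 'n" and R \<rho> B \<kappa> :: real and N L :: nat
    and A :: "complex ^ 'n \<Rightarrow> complex ^ 'n ^ 'n"
  assumes \<rho>: "0 < \<rho>" "2 * \<rho> < R" and L: "0 < L" and \<kappa>: "0 < \<kappa>"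
    and holo_\<phi>: "\<And>i. holo_on (polydisc R) (\<lambda>v. \<phi> v $ i)"
    and holo_A: "\<And>i j. holo_on (polydisc R) (\<lambda>v. A v $ i $ j)"
    and A: "\<And>v i. v \<in> polydisc R \<Longrightarrow> v $ i ^ L = (\<Sum>j\<in>UNIV. A v $ i $ j * \<phi> v $ j ^ N)"
    and det_lower: "\<And>u v. u \<in> polydisc R \<Longrightarrow> v \<in> polydisc R \<Longrightarrow> \<kappa> \<le> norm (det (hada_matrix \<phi> v u))"
    and bound_\<phi>: "\<And>v i. v \<in> polydisc R \<Longrightarrow> norm (\<phi> v $ i) \<le> B"
    and bound_A: "\<And>v i j. v \<in> polydisc R \<Longrightarrow> norm (A v $ i $ j) \<le> B"
    and bound_d\<phi>: "\<And>v i j. v \<in> polydisc R \<Longrightarrow> norm (partial j (\<lambda>v. \<phi> v $ i) v) \<le> B"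
    and bound_dA: "\<And>v i j k. v \<in> polydisc R \<Longrightarrow> norm (partial k (\<lambda>v. A v $ i $ j) v) \<le> B"
begin

abbreviation "PR \<equiv> polydisc R :: (complex ^ 'n) set"
abbreviation "UU \<equiv> polydisc (\<rho> / 2) :: (complex ^ 'n) set"
abbreviation "TT \<equiv> torus \<rho> UNIV :: (complex ^ 'n) set"

lemma R_pos: "0 < R" "\<rho> < R" using \<rho> by auto

lemma UU_PR: "u \<in> UU \<Longrightarrow> u \<in> PR"
  using polydisc_mono[of "\<rho>/2" R] \<rho> by auto

lemma TT_PR: "v \<in> TT \<Longrightarrow> v \<in> PR"
  using torus_subset_polydisc[OF \<rho>(1) R_pos(2)] by auto

definition \<delta> :: "complex ^ 'n \<Rightarrow> real" where "\<delta> u = (\<Sum>j\<in>UNIV. norm (\<phi> u $ j) ^ N)"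

lemma \<delta>_nonneg: "0 \<le> \<delta> u" unfolding \<delta>_def by (intro sum_nonneg) auto

lemma power_le_\<delta>: "norm (\<phi> u $ j ^ N) \<le> \<delta> u"
  unfolding \<delta>_def norm_power by (rule member_le_sum) auto

lemma B_nonneg: "0 \<le> B"
  using bound_\<phi>[of 0 undefined] R_pos by (metis norm_ge_zero order_trans zero_in_polydisc)

text \<open>The matrix takes v - u first to \<phi>(v) - \<phi>(u) by Hadamard's lemma, then to the
  differences of the N-th powers, then by A(v) to v_i^L - sum_j A_ij(v) \<phi>_j(u)^N.\<close>

definition W :: "complex ^ 'n \<Rightarrow> complex ^ 'n \<Rightarrow> complex ^ 'n ^ 'n" where
  "W u v = A v ** ((\<chi> i j. if i = j then geo N (\<phi> v $ i) (\<phi> u $ i) else 0) ** hada_matrix \<phi> v u)"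

text \<open>The correction term replaces A(v) by A(u) in front of the \<phi>_j(u)^N, by Hadamard's
  lemma for the entries of A. Hence \<open>C\<close> takes v - u exactly to the vector of the v_i^L
  - u_i^L.\<close>

definition C :: "complex ^ 'n \<Rightarrow> complex ^ 'n \<Rightarrow> complex ^ 'n ^ 'n" where
  "C u v = W u v + (\<chi> i k. \<Sum>j\<in>UNIV. hada k (\<lambda>v. A v $ i $ j) v u * \<phi> u $ j ^ N)"

lemma W_nth: "W u v $ i $ j = (\<Sum>k\<in>UNIV. A v $ i $ k * (geo N (\<phi> v $ k) (\<phi> u $ k) * hada j (\<lambda>v. \<phi> v $ k) v u))"
  unfolding W_def matrix_matrix_mult_def hada_matrix_def by (simp add: if_distrib[of "\<lambda>x. x * _"] cong: if_cong)

lemma det_W: "det (W u v) = det (A v) * ((\<Prod>i\<in>UNIV. geo N (\<phi> v $ i) (\<phi> u $ i)) * det (hada_matrix \<phi> v u))"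
  unfolding W_def det_mul by (subst det_diagonal) auto

lemma W_diff:
  assumes "u \<in> PR" "v \<in> PR"
  shows "(W u v *v (v - u)) $ i = v $ i ^ L - (\<Sum>k\<in>UNIV. A v $ i $ k * \<phi> u $ k ^ N)"
proof -
  have h: "(\<Sum>j\<in>UNIV. hada j (\<lambda>v. \<phi> v $ k) v u * (v $ j - u $ j)) = \<phi> v $ k - \<phi> u $ k" for k
    using hadamard[OF open_polydisc convex_polydisc holo_\<phi> assms(2,1), of k] by (simp add: mult.commute)
  have "(W u v *v (v - u)) $ i = (\<Sum>k\<in>UNIV. A v $ i $ k * (geo N (\<phi> v $ k) (\<phi> u $ k)
      * (\<Sum>j\<in>UNIV. hada j (\<lambda>v. \<phi> v $ k) v u * (v $ j - u $ j))))"
    unfolding matrix_vector_mult_def W_nth vec_lambda_beta vector_minus_component sum_distrib_left sum_distrib_right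
    by (subst sum.swap) (simp add: mult.assoc)
  also have "\<dots> = (\<Sum>k\<in>UNIV. A v $ i $ k * (\<phi> v $ k ^ N - \<phi> u $ k ^ N))"
    unfolding h geo by (simp add: mult.commute)
  also have "\<dots> = v $ i ^ L - (\<Sum>k\<in>UNIV. A v $ i $ k * \<phi> u $ k ^ N)"
    using A[OF assms(2), of i] by (simp add: right_diff_distrib sum_subtractf)
  finally show ?thesis .
qed

lemma C_diff:
  assumes "u \<in> PR" "v \<in> PR"
  shows "(C u v *v (v - u)) $ i = v $ i ^ L - u $ i ^ L"
proof -
  have h: "(\<Sum>k\<in>UNIV. hada k (\<lambda>v. A v $ i $ j) v u * (v $ k - u $ k)) = A v $ i $ j - A u $ i $ j" for j
    using hadamard[OF open_polydisc convex_polydisc holo_A assms(2,1), of i j] by (simp add: mult.commute)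
  have "((\<chi> i k. \<Sum>j\<in>UNIV. hada k (\<lambda>v. A v $ i $ j) v u * \<phi> u $ j ^ N) *v (v - u)) $ i
      = (\<Sum>j\<in>UNIV. \<phi> u $ j ^ N * (\<Sum>k\<in>UNIV. hada k (\<lambda>v. A v $ i $ j) v u * (v $ k - u $ k)))"
    unfolding matrix_vector_mult_def vec_lambda_beta vector_minus_component sum_distrib_left sum_distrib_right
    by (subst sum.swap) (simp add: ac_simps)
  also have "\<dots> = (\<Sum>k\<in>UNIV. A v $ i $ k * \<phi> u $ k ^ N) - u $ i ^ L"
    unfolding h using A[OF assms(1), of i] by (simp add: algebra_simps sum_subtractf)
  finally show ?thesis
    unfolding C_def matrix_vector_mult_add_rdistrib vector_add_component W_diff[OF assms] by simp
qed

lemma holo_hada_\<phi>: "u \<in> PR \<Longrightarrow> holo_on PR (\<lambda>v. hada j (\<lambda>v. \<phi> v $ i) v u)"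
  by (rule holo_on_hada[OF open_polydisc convex_polydisc holo_\<phi> open_polydisc]) auto

lemma holo_hada_A: "u \<in> PR \<Longrightarrow> holo_on PR (\<lambda>v. hada k (\<lambda>v. A v $ i $ j) v u)"
  by (rule holo_on_hada[OF open_polydisc convex_polydisc holo_A open_polydisc]) auto

lemma holo_W: "u \<in> PR \<Longrightarrow> holo_on PR (\<lambda>v. W u v $ i $ j)"
  unfolding W_nth geo_def
  by (intro holo_on_sum holo_on_mult holo_A holo_on_power holo_\<phi> holo_on_const holo_hada_\<phi>)

lemma holo_C: "u \<in> PR \<Longrightarrow> holo_on PR (\<lambda>v. C u v $ i $ j)"
  unfolding C_def vector_add_component vec_lambda_beta
  by (intro holo_on_sum holo_on_add holo_on_mult holo_W holo_hada_A holo_on_const)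

lemma holo_det_hada: "u \<in> PR \<Longrightarrow> holo_on PR (\<lambda>v. det (hada_matrix \<phi> v u))"
  by (rule holo_on_det) (simp add: hada_matrix_def holo_hada_\<phi>)

lemma det_hada_nonzero: "u \<in> PR \<Longrightarrow> v \<in> PR \<Longrightarrow> det (hada_matrix \<phi> v u) \<noteq> 0"
  using det_lower[of u v] \<kappa> by auto

lemma holo_jac: "holo_on PR (\<lambda>v. det (jac \<phi> v))"
  by (rule holo_on_det) (simp add: jac_def holo_on_partial[OF open_polydisc holo_\<phi>])

lemma bnd_hada_\<phi>: "bnd PR PR (\<lambda>u v. hada j (\<lambda>v. \<phi> v $ i) v u)"
  by (rule bndI, rule hada_bound[OF open_polydisc convex_polydisc holo_\<phi>]) (auto intro: bound_d\<phi>)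

lemma bnd_hada_A: "bnd PR PR (\<lambda>u v. hada k (\<lambda>v. A v $ i $ j) v u)"
  by (rule bndI, rule hada_bound[OF open_polydisc convex_polydisc holo_A]) (auto intro: bound_dA)

lemma bnd_\<phi>: "bnd PR PR (\<lambda>u v. \<phi> u $ i)" "bnd PR PR (\<lambda>u v. \<phi> v $ i)"
  by (rule bndI, erule bound_\<phi>) (rule bndI, erule bound_\<phi>)

lemma bnd_A: "bnd PR PR (\<lambda>u v. A v $ i $ j)"
  by (rule bndI, erule bound_A)

lemma bnd_W: "bnd PR PR (\<lambda>u v. W u v $ i $ j)"
  unfolding W_nth geo_def
  by (intro bnd_sum bnd_mult bnd_A bnd_power bnd_\<phi> bnd_hada_\<phi>)

lemma bnd_C: "bnd PR PR (\<lambda>u v. C u v $ i $ j)"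
  unfolding C_def vector_add_component vec_lambda_beta
  by (intro bnd_add bnd_W bnd_sum bnd_mult bnd_hada_A bnd_power bnd_\<phi>)

lemma bnd_restrict: "bnd PR PR F \<Longrightarrow> bnd UU TT F"
  unfolding bnd_def using UU_PR TT_PR by blast

text \<open>The entries differ by the correction term of \<open>C\<close>, every summand of which
  carries a factor \<phi>_j(u)^N.\<close>

lemma cls_W_C: "cls UU TT \<delta> (\<lambda>u v. det (W u v)) (\<lambda>u v. det (C u v))"
proof (rule cls_det[OF \<delta>_nonneg])
  fix i k
  have "norm (W u v $ i $ k - C u v $ i $ k) \<le> (\<Sum>j\<in>(UNIV::'n set). B) * \<delta> u" if "u \<in> UU" "v \<in> TT" for u v
  proof -
    have "norm (W u v $ i $ k - C u v $ i $ k) = norm (\<Sum>j\<in>UNIV. hada k (\<lambda>v. A v $ i $ j) v u * \<phi> u $ j ^ N)"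
      unfolding C_def by (simp add: norm_minus_commute)
    also have "\<dots> \<le> (\<Sum>j\<in>(UNIV::'n set). B * \<delta> u)"
    proof (rule sum_norm_le)
      fix j
      have "norm (hada k (\<lambda>v. A v $ i $ j) v u) \<le> B"
        by (rule hada_bound[OF open_polydisc convex_polydisc holo_A]) (use that UU_PR TT_PR bound_dA in auto)
      then show "norm (hada k (\<lambda>v. A v $ i $ j) v u * \<phi> u $ j ^ N) \<le> B * \<delta> u"
        unfolding norm_mult by (intro mult_mono power_le_\<delta> B_nonneg) auto
    qed
    finally show ?thesis by simp
  qed
  then show "cls UU TT \<delta> (\<lambda>u v. W u v $ i $ k) (\<lambda>u v. C u v $ i $ k)" by (rule clsI)
qed (intro bnd_restrict bnd_W bnd_C)+

text \<open>Weights for the denominators v_k^L and v_k^L - u_k^L. The residues in question use the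
  first, while Cauchy's formula is available for the second.\<close>

definition m0 :: "complex ^ 'n \<Rightarrow> complex" where "m0 v = (\<Prod>k\<in>UNIV. v $ k / v $ k ^ L)"
definition m1 :: "complex ^ 'n \<Rightarrow> complex ^ 'n \<Rightarrow> complex" where "m1 u v = (\<Prod>k\<in>UNIV. v $ k / (v $ k ^ L - u $ k ^ L))"

text \<open>For |u_k| < \<rho>/2 and L \<ge> 1 one has |u_k|^L \<le> \<rho>^L / 2, so the
  denominators stay away from 0 uniformly in u.\<close>

lemma denom_lower:
  assumes "u \<in> UU" "norm \<xi> = \<rho>" shows "\<rho> ^ L / 2 \<le> norm (\<xi> ^ L - u $ k ^ L)"
proof -
  have "norm (u $ k) ^ L \<le> (\<rho> / 2) ^ L"
    using assms(1) by (intro power_mono) (auto simp: polydisc_def less_imp_le)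
  also have "\<dots> \<le> \<rho> ^ L / 2"
  proof -
    have "(2::real) ^ 1 \<le> 2 ^ L" by (rule power_increasing) (use L in auto)
    then show ?thesis using \<rho> by (simp add: power_divide divide_simps mult_left_mono)
  qed
  finally have "norm (u $ k) ^ L \<le> \<rho> ^ L / 2" .
  then show ?thesis using norm_triangle_ineq2[of "\<xi> ^ L" "u $ k ^ L"] assms(2) by (simp add: norm_power)
qed

lemma denominators1: "u \<in> UU \<Longrightarrow> torus_denominators \<rho> R UNIV (\<lambda>k \<xi>. \<xi> ^ L - u $ k ^ L)"
proof unfold_locales
  fix k :: 'n and \<xi> :: complex assume "u \<in> UU" "norm \<xi> = \<rho>"
  from denom_lower[OF this, of k] have "0 < norm (\<xi> ^ L - u $ k ^ L)"
    using \<rho>(1) by (meson half_gt_zero less_le_trans zero_less_power)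
  then show "\<xi> ^ L - u $ k ^ L \<noteq> 0" by auto
qed (use \<rho> in \<open>auto intro!: continuous_intros\<close>)

lemma denominators0: "torus_denominators \<rho> R UNIV (\<lambda>k \<xi>. \<xi> ^ L)"
  using \<rho> by (intro torus_denominators_power) auto

lemma m0_den: "m0 = torus_denominators.den UNIV (\<lambda>k \<xi>. \<xi> ^ L)"
  unfolding m0_def torus_denominators.den_def[OF denominators0] by simp

lemma m1_den: "u \<in> UU \<Longrightarrow> m1 u = torus_denominators.den UNIV (\<lambda>k \<xi>. \<xi> ^ L - u $ k ^ L)"
  unfolding m1_def by (rule ext) (simp add: torus_denominators.den_def[OF denominators1])

lemma cont_m0: "continuous_on TT m0"
  unfolding m0_den by (rule torus_denominators.continuous_on_den[OF denominators0])

lemma cont_m1: "u \<in> UU \<Longrightarrow> continuous_on TT (m1 u)"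
  using torus_denominators.continuous_on_den[OF denominators1] by (simp add: m1_den)

lemma cont_holo: "holo_on PR g \<Longrightarrow> continuous_on TT g"
  by (rule continuous_on_torus_holo[OF \<rho>(1) R_pos(2)])

lemma bnd_factor0: "bnd UU TT (\<lambda>u v. v $ k / v $ k ^ L)"
  by (rule bndI[of _ _ _ "\<rho> / \<rho> ^ L"]) (simp add: norm_divide norm_power torus_nth)

lemma bnd_factor1: "bnd UU TT (\<lambda>u v. v $ k / (v $ k ^ L - u $ k ^ L))"
proof (rule bndI[of _ _ _ "\<rho> / (\<rho> ^ L / 2)"])
  fix u v assume "u \<in> UU" "v \<in> TT"
  then show "norm (v $ k / (v $ k ^ L - u $ k ^ L)) \<le> \<rho> / (\<rho> ^ L / 2)"
    unfolding norm_divide using denom_lower[of u "v $ k" k] \<rho> by (intro frac_le) (auto simp: torus_nth)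
qed

lemma bnd_m0: "bnd UU TT (\<lambda>u v. m0 v)"
  unfolding m0_def by (intro bnd_prod bnd_factor0)

text \<open>The relation between coordinate powers and the \<phi>_j^N is also evaluated at u itself:
  it puts u_k^L into the ideal of the \<phi>_j(u)^N, with bounded coefficients.\<close>

lemma u_power_le: "u \<in> UU \<Longrightarrow> norm (u $ k ^ L) \<le> (\<Sum>j\<in>(UNIV::'n set). B) * \<delta> u"
proof -
  assume "u \<in> UU"
  then have u: "u \<in> PR" by (rule UU_PR)
  have "norm (u $ k ^ L) \<le> (\<Sum>j\<in>(UNIV::'n set). B * \<delta> u)"
    unfolding A[OF u] by (rule sum_norm_le) (auto simp: norm_mult intro!: mult_mono bound_A u power_le_\<delta> B_nonneg
        simp del: norm_power)
  then show ?thesis by simp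
qed

lemma cls_m: "cls UU TT \<delta> (\<lambda>u v. m0 v) m1"
  unfolding m0_def m1_def
proof (rule cls_prod[OF \<delta>_nonneg])
  fix k
  define c where "c = \<rho> / (\<rho> ^ L * (\<rho> ^ L / 2)) * (\<Sum>j\<in>(UNIV::'n set). B)"
  show "cls UU TT \<delta> (\<lambda>u v. v $ k / v $ k ^ L) (\<lambda>u v. v $ k / (v $ k ^ L - u $ k ^ L))"
  proof (rule clsI[of _ _ _ _ c])
    fix u v assume u: "u \<in> UU" and v: "v \<in> TT"
    have nv: "norm (v $ k) = \<rho>" using v by (simp add: torus_nth)
    have lower: "\<rho> ^ L / 2 \<le> norm (v $ k ^ L - u $ k ^ L)" by (rule denom_lower[OF u nv])
    have "0 < \<rho> ^ L / 2" using \<rho>(1) by simp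
    with lower have pos: "0 < norm (v $ k ^ L - u $ k ^ L)" by linarith
    then have nz: "v $ k \<noteq> 0" "v $ k ^ L - u $ k ^ L \<noteq> 0"
      using nv \<rho>(1) by auto
    have "v $ k / v $ k ^ L - v $ k / (v $ k ^ L - u $ k ^ L) =
        - (v $ k / (v $ k ^ L * (v $ k ^ L - u $ k ^ L)) * u $ k ^ L)"
      using nz by (simp add: divide_simps) (simp add: algebra_simps)
    then have "norm (v $ k / v $ k ^ L - v $ k / (v $ k ^ L - u $ k ^ L)) =
        \<rho> / (\<rho> ^ L * norm (v $ k ^ L - u $ k ^ L)) * norm (u $ k ^ L)"
      by (simp add: norm_mult norm_divide norm_power nv)
    also have "\<dots> \<le> \<rho> / (\<rho> ^ L * (\<rho> ^ L / 2)) * ((\<Sum>j\<in>(UNIV::'n set). B) * \<delta> u)"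
      using \<rho>(1) lower pos u_power_le[OF u, of k]
      by (intro mult_mono divide_left_mono mult_left_mono mult_pos_pos) auto
    finally show "norm (v $ k / v $ k ^ L - v $ k / (v $ k ^ L - u $ k ^ L)) \<le> c * \<delta> u" by (simp add: c_def)
  qed
qed (intro bnd_factor0 bnd_factor1)+

text \<open>\<open>C\<close> and the diagonal matrix with entries
  \<open>geo L (v $ i) (u $ i)\<close> both take v - u to the vector of the v_i^L - u_i^L. The
  transformation law exchanges them, and the diagonal one produces Cauchy's kernel.\<close>

lemma mean_C: "u \<in> UU \<Longrightarrow> torus_mean UNIV \<rho> (\<lambda>v. det (C u v) * m1 u v) = 1"
proof -
  assume u: "u \<in> UU"
  interpret torus_denominators \<rho> R UNIV "\<lambda>k \<xi>. \<xi> ^ L - u $ k ^ L" by (rule denominators1[OF u])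
  define D :: "complex ^ 'n \<Rightarrow> complex ^ 'n ^ 'n" where "D v = (\<chi> i j. if i = j then geo L (v $ i) (u $ i) else 0)" for v
  have "torus_mean UNIV \<rho> (\<lambda>v. 1 * det (C u v) * den v) = torus_mean UNIV \<rho> (\<lambda>v. 1 * det (D v) * den v)"
  proof (rule torus_mean_det_unique)
    show "holo_on PR (\<lambda>v. D v $ i $ j)" for i j
    proof (cases "i = j")
      case True
      then show ?thesis
        unfolding D_def geo_def by (auto intro!: holo_on_sum holo_on_mult holo_on_power holo_on_const)
    qed (simp add: D_def holo_on_const)
    show "C u v *v (v - u) = rhs v" if "v \<in> TT" for v
      using C_diff[OF UU_PR[OF u] TT_PR[OF that]] by (simp add: vec_eq_iff rhs_def)
    show "D v *v (v - u) = rhs v" if "v \<in> TT" for v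
    proof -
      have "(D v *v (v - u)) $ i = geo L (v $ i) (u $ i) * (v $ i - u $ i)" for i
        unfolding D_def matrix_vector_mult_def by (simp add: if_distrib[of "\<lambda>x. x * _"] cong: if_cong)
      then show ?thesis by (simp add: vec_eq_iff rhs_def) (simp add: geo mult.commute)
    qed
  qed (use holo_C[OF UU_PR[OF u]] in auto)
  also have "\<dots> = torus_mean UNIV \<rho> (\<lambda>v. \<Prod>i\<in>UNIV. v $ i / (v $ i - u $ i))"
  proof (rule torus_mean_cong[OF \<rho>(1)])
    fix v assume v: "v \<in> TT"
    have "det (D v) = (\<Prod>i\<in>UNIV. geo L (v $ i) (u $ i))"
      unfolding D_def by (subst det_diagonal) auto
    then have "1 * det (D v) * den v = (\<Prod>i\<in>UNIV. geo L (v $ i) (u $ i) * (v $ i / (v $ i ^ L - u $ i ^ L)))"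
      by (simp only: den_def prod.distrib mult_1)
    also have "\<dots> = (\<Prod>i\<in>UNIV. v $ i / (v $ i - u $ i))"
    proof (rule prod.cong[OF refl])
      fix i
      have "v $ i ^ L - u $ i ^ L \<noteq> 0" using Y_torus_nonzero[OF _ v, of i] by simp
      then have "geo L (v $ i) (u $ i) \<noteq> 0" "v $ i - u $ i \<noteq> 0" by (auto simp: geo)
      then show "geo L (v $ i) (u $ i) * (v $ i / (v $ i ^ L - u $ i ^ L)) = v $ i / (v $ i - u $ i)"
        unfolding geo by simp
    qed
    finally show "1 * det (D v) * den v = (\<Prod>i\<in>UNIV. v $ i / (v $ i - u $ i))" .
  qed
  also have "\<dots> = 1"
    using u \<rho>(1) by (intro torus_mean_Cauchy_kernel) (auto simp: polydisc_def intro: less_trans[of _ "\<rho>/2"])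
  finally show ?thesis using m1_den[OF u] by simp
qed

lemma estimate_hada:
  obtains c where "\<And>u. u \<in> UU \<Longrightarrow> norm (torus_mean UNIV \<rho> (\<lambda>v. det (W u v) * m0 v) - 1) \<le> c * \<delta> u"
proof -
  have bW: "bnd UU TT (\<lambda>u v. det (W u v))" and bC: "bnd UU TT (\<lambda>u v. det (C u v))"
    by (intro bnd_det bnd_restrict bnd_W bnd_C)+
  have "cls UU TT \<delta> (\<lambda>u v. det (W u v) * m0 v) (\<lambda>u v. det (C u v) * m1 u v)"
    by (intro cls_mult[OF \<delta>_nonneg] cls_W_C cls_m bC bnd_m0)
  then have "\<exists>c. \<forall>u\<in>UU. norm (torus_mean UNIV \<rho> (\<lambda>v. det (W u v) * m0 v) -
      torus_mean UNIV \<rho> (\<lambda>v. det (C u v) * m1 u v)) \<le> c * \<delta> u"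
  proof (rule cls_torus_mean[OF _ \<rho>(1)])
    fix u assume u: "u \<in> UU"
    show "continuous_on TT (\<lambda>v. det (W u v) * m0 v)"
      by (intro continuous_on_mult cont_m0 cont_holo holo_on_det holo_W UU_PR u)
    show "continuous_on TT (\<lambda>v. det (C u v) * m1 u v)"
      by (intro continuous_on_mult cont_m1 cont_holo holo_on_det holo_C UU_PR u)
  qed
  then show ?thesis using that mean_C by auto
qed

text \<open>The mean of \<open>det (W u v) * m0 v\<close> with the Hadamard determinant replaced by
  the Jacobian. After this replacement u enters only through x = \<phi>(u), and
  polynomially.\<close>

definition S :: "complex ^ 'n \<Rightarrow> complex" where
  "S x = torus_mean UNIV \<rho> (\<lambda>v. det (jac \<phi> v) * (det (A v) * (\<Prod>i\<in>UNIV. geo N (\<phi> v $ i) (x $ i))) * m0 v)"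

definition df :: "complex ^ 'n \<Rightarrow> complex ^ 'n \<Rightarrow> complex" where
  "df u v = det (jac \<phi> v) - det (hada_matrix \<phi> v u)"

lemma holo_df: "u \<in> PR \<Longrightarrow> holo_on PR (df u)"
  unfolding df_def[abs_def] by (intro holo_on_diff holo_jac holo_det_hada)

lemma df_same: "df u u = 0"
  by (simp add: df_def jac_def hada_matrix_def)

lemma bnd_df: "bnd PR PR df"
  unfolding df_def[abs_def]
  by (intro bnd_diff bnd_det) (auto simp: jac_def hada_matrix_def intro: bnd_hada_\<phi> bndI bound_d\<phi>)

text \<open>The half polydisc leaves a ball of radius R/2 inside \<open>PR\<close> around each of
  its points, as Cauchy's estimate for the derivatives of \<open>df\<close> requires. The condition
  2\<rho> < R places the torus inside it.\<close>

abbreviation "PH \<equiv> polydisc (R / 2) :: (complex ^ 'n) set"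

lemma PH: "u \<in> UU \<Longrightarrow> u \<in> PH" "v \<in> TT \<Longrightarrow> v \<in> PH" "v \<in> PH \<Longrightarrow> v \<in> PR"
  using polydisc_mono[of "\<rho>/2" "R/2"] torus_subset_polydisc[of \<rho> "R/2"] polydisc_mono[of "R/2" R] \<rho> by auto

lemma holo_hada_df: "u \<in> PH \<Longrightarrow> holo_on PH (\<lambda>v. hada i (df u) v u)"
  by (rule holo_on_hada[OF open_polydisc convex_polydisc _ open_polydisc, of "R/2"])
    (use PH in \<open>auto intro: holo_on_subset[OF holo_df]\<close>)

lemma bnd_hada_df: "bnd UU TT (\<lambda>u v. hada i (df u) v u)"
proof -
  obtain c where c: "\<And>u v. u \<in> PR \<Longrightarrow> v \<in> PR \<Longrightarrow> norm (df u v) \<le> c"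
    using bnd_df unfolding bnd_def by blast
  have "norm (partial i (df u) v) \<le> 2 * c / (R / 2)" if "u \<in> PR" "v \<in> PH" for u v
  proof (rule partial_bound[OF holo_df[OF that(1)]])
    show "ball v (R / 2) \<subseteq> PR"
    proof
      fix w assume w: "w \<in> ball v (R / 2)"
      have "norm (w $ i) < R" for i
      proof -
        have "norm (w $ i - v $ i) \<le> norm (w - v)" using Finite_Cartesian_Product.norm_nth_le[of "w - v" i] by simp
        moreover have "norm (w - v) < R / 2" using w by (simp add: dist_norm norm_minus_commute)
        moreover have "norm (v $ i) < R / 2" using that(2) by (simp add: polydisc_def)
        ultimately show ?thesis using norm_triangle_ineq2[of "w $ i" "v $ i"] by linarith
      qed
      then show "w \<in> PR" by (simp add: polydisc_def)
    qed
    then show "norm (df u w) \<le> c" if "w \<in> ball v (R / 2)" for w using c \<open>u \<in> PR\<close> that by blast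
  qed (use \<rho> in auto)
  then show ?thesis
    by (intro bndI[of _ _ _ "2 * c / (R / 2)"] hada_bound[OF open_polydisc convex_polydisc, of "R/2"])
      (use PH in \<open>auto intro: holo_on_subset[OF holo_df]\<close>)
qed

lemma bnd_cof: "bnd UU TT (\<lambda>u v. cof (W u v) l i)"
  unfolding cof_def
proof (rule bnd_det)
  fix a b
  show "bnd UU TT (\<lambda>u v. (\<chi> i' j'. if j' = i then (if i' = l then 1 else 0) else W u v $ i' $ j') $ a $ b)"
    by (cases "b = i") (auto intro: bnd_const bnd_restrict bnd_W)
qed

lemma bnd_inverse_det: "bnd UU TT (\<lambda>u v. 1 / det (hada_matrix \<phi> v u))"
proof (rule bndI[of _ _ _ "1 / \<kappa>"])
  fix u v assume "u \<in> UU" "v \<in> TT"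
  then show "norm (1 / det (hada_matrix \<phi> v u)) \<le> 1 / \<kappa>"
    using det_lower[OF UU_PR TT_PR, of u v] det_hada_nonzero[OF UU_PR TT_PR, of u v] \<kappa>
    by (auto simp: norm_divide intro!: divide_left_mono mult_pos_pos)
qed

text \<open>The difference of the integrands is \<open>df\<close> times \<open>det (W u v)\<close>
  over the Hadamard determinant. As \<open>df u\<close> vanishes at u, it is a combination of the
  v_i - u_i, and Cramer's rule turns \<open>det (W u v)\<close> times v_i - u_i into an element of
  the ideal of the v_l^L - e_l, where e_l is bounded by a multiple of \<open>\<delta> u\<close>.
  Dropping e_l costs another such multiple, and what remains has mean 0.\<close>

lemma estimate_jac:
  obtains c where "\<And>u. u \<in> UU \<Longrightarrow> norm (S (\<phi> u) - torus_mean UNIV \<rho> (\<lambda>v. det (W u v) * m0 v)) \<le> c * \<delta> u"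
proof -
  define q where "q u i l v = hada i (df u) v u * (1 / det (hada_matrix \<phi> v u)) * cof (W u v) l i" for u i l v
  define F where "F u v = (\<Sum>i\<in>UNIV. \<Sum>l\<in>UNIV. v $ l ^ L * q u i l v) * m0 v" for u v
  define G where "G u v = det (jac \<phi> v) * (det (A v) * (\<Prod>i\<in>UNIV. geo N (\<phi> v $ i) (\<phi> u $ i))) * m0 v - det (W u v)
      * m0 v" for u v
  define e where "e u l v = (\<Sum>k\<in>UNIV. A v $ l $ k * \<phi> u $ k ^ N)" for u l v
  have q: "holo_on PH (q u i l)" if "u \<in> UU" for u i l
    unfolding q_def[abs_def] using PH(1)[OF that] UU_PR[OF that] PH(3) det_hada_nonzero
    by (intro holo_on_mult holo_on_divide holo_on_const holo_hada_df holo_on_cof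
        holo_on_subset[OF holo_det_hada] holo_on_subset[OF holo_W]) auto
  have bq: "bnd UU TT (\<lambda>u v. q u i l v)" for i l
    unfolding q_def by (intro bnd_mult bnd_hada_df bnd_inverse_det bnd_cof)
  have G: "G u v = (\<Sum>i\<in>UNIV. \<Sum>l\<in>UNIV. (v $ l ^ L - e u l v) * q u i l v) * m0 v" if "u \<in> UU" "v \<in> TT" for u v
  proof -
    have PRs: "u \<in> PR" "v \<in> PR" using that UU_PR TT_PR by auto
    have nz: "det (hada_matrix \<phi> v u) \<noteq> 0" by (rule det_hada_nonzero[OF PRs])
    have "G u v = df u v * (1 / det (hada_matrix \<phi> v u)) * det (W u v) * m0 v"
      using nz by (simp add: G_def det_W df_def field_simps)
    also have "df u v = (\<Sum>i\<in>UNIV. (v $ i - u $ i) * hada i (df u) v u)"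
      using hadamard[OF open_polydisc convex_polydisc holo_df[OF PRs(1)] PRs(2,1)] df_same by simp
    also have "\<dots> * (1 / det (hada_matrix \<phi> v u)) * det (W u v) =
        (\<Sum>i\<in>UNIV. hada i (df u) v u * (1 / det (hada_matrix \<phi> v u)) * (det (W u v) * (v - u) $ i))"
      unfolding sum_distrib_right by (intro sum.cong refl) (simp add: ac_simps)
    also have "\<dots> = (\<Sum>i\<in>UNIV. \<Sum>l\<in>UNIV. (v $ l ^ L - e u l v) * q u i l v)"
      unfolding cof_cramer W_diff[OF PRs] sum_distrib_left q_def e_def
      by (intro sum.cong refl) (simp only: ac_simps)
    finally show ?thesis .
  qed
  have cls_e: "cls UU TT \<delta> (\<lambda>u v. (v $ l ^ L - e u l v) * q u i l v) (\<lambda>u v. v $ l ^ L * q u i l v)" for i l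
  proof (rule cls_mult[OF \<delta>_nonneg _ cls_refl[OF \<delta>_nonneg]])
    show "cls UU TT \<delta> (\<lambda>u v. v $ l ^ L - e u l v) (\<lambda>u v. v $ l ^ L)"
    proof (rule clsI[of _ _ _ _ "\<Sum>j\<in>(UNIV::'n set). B"])
      fix u v assume uv: "u \<in> UU" "v \<in> TT"
      have "norm (v $ l ^ L - e u l v - v $ l ^ L) = norm (e u l v)" by simp
      also have "\<dots> \<le> (\<Sum>j\<in>(UNIV::'n set). B * \<delta> u)"
        unfolding e_def by (rule sum_norm_le) (auto simp: norm_mult intro!: mult_mono bound_A TT_PR uv power_le_\<delta>
            B_nonneg simp del: norm_power)
      finally show "norm (v $ l ^ L - e u l v - v $ l ^ L) \<le> (\<Sum>j\<in>(UNIV::'n set). B) * \<delta> u" by simp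
    qed
    show "bnd UU TT (\<lambda>u v. v $ l ^ L)"
      by (rule bndI[of _ _ _ "\<rho> ^ L"]) (simp add: norm_power torus_nth)
  qed (rule bq)
  have bsum: "bnd UU TT (\<lambda>u v. \<Sum>i\<in>UNIV. \<Sum>l\<in>UNIV. v $ l ^ L * q u i l v)"
    by (intro bnd_sum bnd_mult bq bndI[of _ _ _ "\<rho> ^ L"]) (simp add: norm_power torus_nth)
  have "cls UU TT \<delta> (\<lambda>u v. (\<Sum>i\<in>UNIV. \<Sum>l\<in>UNIV. (v $ l ^ L - e u l v) * q u i l v) * m0 v) F"
    unfolding F_def
    by (intro cls_mult[OF \<delta>_nonneg] cls_sum[OF \<delta>_nonneg] cls_e cls_refl[OF \<delta>_nonneg] bnd_m0 bsum)
  then have clsGF: "cls UU TT \<delta> G F"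
    unfolding cls_def by (simp add: G)
  have contG: "continuous_on TT (G u)" if "u \<in> UU" for u
    unfolding G_def[abs_def] geo_def
    by (intro continuous_on_diff continuous_on_mult cont_m0 cont_holo holo_jac holo_on_det holo_A holo_on_prod
        holo_on_sum holo_on_mult holo_on_power holo_\<phi> holo_on_const holo_W UU_PR that)
  have contq: "continuous_on TT (q u i l)" if "u \<in> UU" for u i l
    using continuous_on_torus_holo[OF \<rho>(1) _ q[OF that]] \<rho> by simp
  have contF: "continuous_on TT (F u)" if "u \<in> UU" for u
    unfolding F_def[abs_def]
    by (intro continuous_on_mult continuous_on_sum cont_m0 contq[OF that] continuous_intros)
  have meanF: "torus_mean UNIV \<rho> (F u) = 0" if u: "u \<in> UU" for u
  proof -
    interpret torus_denominators \<rho> "R/2" UNIV "\<lambda>k \<xi>. \<xi> ^ L"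
      using \<rho> by (intro torus_denominators_power) auto
    have "torus_mean UNIV \<rho> (\<lambda>v. (\<Sum>i\<in>UNIV. \<Sum>l\<in>UNIV. v $ l ^ L * q u i l v) * den v) = 0"
    proof (rule torus_mean_ideal[where S=UNIV and e="\<lambda>v. 1" and q="\<lambda>l v. \<Sum>i\<in>UNIV. q u i l v"])
      show "(\<Sum>i\<in>UNIV. \<Sum>l\<in>UNIV. v $ l ^ L * q u i l v) = (\<Sum>l\<in>UNIV. v $ l ^ L * (\<Sum>i\<in>UNIV. q u i l v)) * 1" for v
        by (subst sum.swap) (simp add: sum_distrib_left)
    qed (use q[OF u] in \<open>auto intro!: holo_on_sum\<close>)
    then show ?thesis by (simp add: F_def[abs_def] m0_den)
  qed
  obtain c where c: "\<And>u. u \<in> UU \<Longrightarrow> norm (torus_mean UNIV \<rho> (G u) - torus_mean UNIV \<rho> (F u)) \<le> c * \<delta> u"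
    using cls_torus_mean[OF clsGF \<rho>(1) contG contF] by blast
  have "torus_mean UNIV \<rho> (G u) = S (\<phi> u) - torus_mean UNIV \<rho> (\<lambda>v. det (W u v) * m0 v)" if u: "u \<in> UU" for u
    unfolding G_def[abs_def] S_def geo_def
    by (rule torus_mean_diff[OF \<rho>(1)])
      (intro continuous_on_mult cont_m0 cont_holo holo_jac holo_on_det holo_A holo_on_prod
        holo_on_sum holo_on_mult holo_on_power holo_\<phi> holo_on_const holo_W UU_PR u)+
  with c meanF show ?thesis by (intro that[of c]) auto
qed

lemma estimate:
  obtains c where "0 \<le> c" "\<And>u. u \<in> UU \<Longrightarrow> norm (S (\<phi> u) - 1) \<le> c * \<delta> u"
proof -
  obtain c where c: "\<And>u. u \<in> UU \<Longrightarrow> norm (S (\<phi> u) - torus_mean UNIV \<rho> (\<lambda>v. det (W u v) * m0 v)) \<le> c * \<delta> u"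
    using estimate_jac by blast
  obtain d where d: "\<And>u. u \<in> UU \<Longrightarrow> norm (torus_mean UNIV \<rho> (\<lambda>v. det (W u v) * m0 v) - 1) \<le> d * \<delta> u"
    using estimate_hada by blast
  have "norm (S (\<phi> u) - 1) \<le> \<bar>c + d\<bar> * \<delta> u" if "u \<in> UU" for u
  proof -
    have "norm (S (\<phi> u) - 1) \<le> c * \<delta> u + d * \<delta> u"
      using norm_triangle_mono[OF c[OF that] d[OF that]] by simp
    also have "\<dots> \<le> \<bar>c + d\<bar> * \<delta> u"
      using \<delta>_nonneg[of u] by (simp add: distrib_right[symmetric] mult_right_mono)
    finally show ?thesis .
  qed
  then show ?thesis by (intro that[of "\<bar>c + d\<bar>"]) auto
qed

end

lemma norm_zero_if_small:
  fixes d :: complex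
  assumes "0 < e" "\<And>\<epsilon>. 0 < \<epsilon> \<Longrightarrow> \<epsilon> < e \<Longrightarrow> norm d \<le> K * \<epsilon>"
  shows "d = 0"
proof (rule ccontr)
  assume d: "d \<noteq> 0"
  define \<epsilon> where "\<epsilon> = min (e / 2) (norm d / (2 * (\<bar>K\<bar> + 1)))"
  have "0 < \<epsilon>" "\<epsilon> < e" using assms(1) d by (auto simp: \<epsilon>_def min_less_iff_disj)
  then have "norm d \<le> K * \<epsilon>" by (rule assms(2))
  also have "\<dots> \<le> (\<bar>K\<bar> + 1) * \<epsilon>" using \<open>0 < \<epsilon>\<close> by (intro mult_right_mono) auto
  also have "\<dots> \<le> (\<bar>K\<bar> + 1) * (norm d / (2 * (\<bar>K\<bar> + 1)))"
    by (intro mult_left_mono) (auto simp: \<epsilon>_def)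
  also have "\<dots> = norm d / 2" by (simp add: field_simps)
  finally show False using d by simp
qed

context kernel_estimate
begin

text \<open>The residue of \<phi>^\<alpha> times the Jacobian with denominators \<phi>_i^N, computed
  from \<open>A\<close> on the torus of radius \<rho>.\<close>

definition lam :: "('n \<Rightarrow> nat) \<Rightarrow> complex" where
  "lam \<alpha> = torus_mean UNIV \<rho> (\<lambda>v. (\<Prod>i\<in>UNIV. \<phi> v $ i ^ \<alpha> i) * det (jac \<phi> v) * det (A v) * m0 v)"

abbreviation "EE \<equiv> Pi\<^sub>E (UNIV :: 'n set) (\<lambda>_. {..<N})"

lemma continuous_on_lam: "continuous_on TT (\<lambda>v. (\<Prod>i\<in>UNIV. \<phi> v $ i ^ \<alpha> i) * det (jac \<phi> v) * det (A v) * m0 v)"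
  by (intro continuous_on_mult cont_m0 cont_holo holo_jac holo_on_det holo_A holo_on_prod holo_on_power holo_\<phi>)

text \<open>In the product of the \<open>geo\<close> kernels a factor \<phi>_i(v)^a comes with
  x_i^(N - 1 - a), so the numbers \<open>lam \<alpha>\<close> are the coefficients of
  \<open>S\<close> in complementary degrees.\<close>

lemma S_expand: "S x = (\<Sum>\<alpha>\<in>EE. lam \<alpha> * (\<Prod>i\<in>UNIV. x $ i ^ (N - Suc (\<alpha> i))))"
proof -
  have fin: "finite EE" by (intro finite_PiE) auto
  have k: "(\<Prod>i\<in>UNIV. geo N (\<phi> v $ i) (x $ i)) =
      (\<Sum>\<alpha>\<in>EE. (\<Prod>i\<in>UNIV. x $ i ^ (N - Suc (\<alpha> i))) * (\<Prod>i\<in>UNIV. \<phi> v $ i ^ \<alpha> i))" for v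
    unfolding geo_def by (subst prod_sum_PiE) (auto simp: prod.distrib)
  have "S x = torus_mean UNIV \<rho> (\<lambda>v. \<Sum>\<alpha>\<in>EE. (\<Prod>i\<in>UNIV. x $ i ^ (N - Suc (\<alpha> i))) *
      ((\<Prod>i\<in>UNIV. \<phi> v $ i ^ \<alpha> i) * det (jac \<phi> v) * det (A v) * m0 v))"
    unfolding S_def k sum_distrib_left sum_distrib_right by (simp only: ac_simps)
  also have "\<dots> = (\<Sum>\<alpha>\<in>EE. (\<Prod>i\<in>UNIV. x $ i ^ (N - Suc (\<alpha> i))) * lam \<alpha>)"
    unfolding lam_def
    by (subst torus_mean_sum[OF \<rho>(1) fin])
      (auto intro!: continuous_on_mult[OF continuous_on_const continuous_on_lam] sum.cong torus_mean_cmult[OF \<rho>(1)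
          continuous_on_lam])
  finally show ?thesis by (simp add: mult.commute)
qed

text \<open>Since \<phi> covers a neighbourhood of 0, \<open>estimate\<close> says that S(x) - 1 is
  bounded by a multiple of the sum of the |x_j|^N. The mean against x^(-\<beta>) over a torus of
  radius \<epsilon> reads off the coefficient at x^\<beta>; it is O(\<epsilon>^(N - |\<beta>|)), and
  |\<beta>| < N makes this tend to 0.\<close>

lemma lam_eq:
  assumes surj: "eventually (\<lambda>x. \<exists>u\<in>UU. \<phi> u = x) (nhds 0)" and \<alpha>0: "\<And>i. \<alpha>0 i < N"
    and small: "(\<Sum>i\<in>UNIV. N - Suc (\<alpha>0 i)) < N"
  shows "lam \<alpha>0 = (if \<forall>i. \<alpha>0 i = N - 1 then 1 else 0)"
proof -
  define \<beta> where "\<beta> i = N - Suc (\<alpha>0 i)" for i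
  define r :: complex where "r = (if \<forall>i. \<alpha>0 i = N - 1 then 1 else 0)"
  have fin: "finite EE" by (intro finite_PiE) auto
  obtain e where e: "e > 0" "\<And>x. x \<in> polydisc e \<Longrightarrow> \<exists>u\<in>UU. \<phi> u = x"
    using surj unfolding eventually_nhds_0_polydisc by blast
  obtain c where c: "0 \<le> c" "\<And>u. u \<in> UU \<Longrightarrow> norm (S (\<phi> u) - 1) \<le> c * \<delta> u"
    using estimate by blast
  have S: "norm (S x - 1) \<le> c * (\<Sum>j\<in>UNIV. norm (x $ j) ^ N)" if "x \<in> polydisc e" for x
    using e(2)[OF that] c(2) unfolding \<delta>_def by blast
  have "norm (lam \<alpha>0 - r) \<le> (c * CARD('n)) * \<epsilon>" if \<epsilon>: "0 < \<epsilon>" "\<epsilon> < min e 1" for \<epsilon>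
  proof -
    let ?T = "torus \<epsilon> UNIV :: (complex ^ 'n) set"
    define mon where "mon a x = (\<Prod>i\<in>UNIV. x $ i ^ a i / x $ i ^ \<beta> i)" for a and x :: "complex ^ 'n"
    have nz: "x $ i \<noteq> 0" if "x \<in> ?T" for x i using torus_nth[OF that, of i] \<epsilon> by auto
    have cont: "continuous_on ?T (mon a)" for a
      unfolding mon_def[abs_def] by (intro continuous_intros) (use nz in auto)
    have mean: "torus_mean UNIV \<epsilon> (mon a) = (if \<forall>i. a i = \<beta> i then 1 else 0)" for a
      using torus_mean_monomial[OF \<epsilon>(1), of UNIV a \<beta>] by (simp add: mon_def[abs_def])
    have "torus_mean UNIV \<epsilon> (\<lambda>x. (S x - 1) * mon (\<lambda>i. 0) x) =
        torus_mean UNIV \<epsilon> (\<lambda>x. (\<Sum>\<alpha>\<in>EE. lam \<alpha> * mon (\<lambda>i. N - Suc (\<alpha> i)) x) - mon (\<lambda>i. 0) x)"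
      unfolding S_expand mon_def left_diff_distrib sum_distrib_right
      by (simp add: mult.assoc prod.distrib[symmetric])
    also have "\<dots> = torus_mean UNIV \<epsilon> (\<lambda>x. \<Sum>\<alpha>\<in>EE. lam \<alpha> * mon (\<lambda>i. N - Suc (\<alpha> i)) x) - torus_mean UNIV \<epsilon> (mon (\<lambda>i. 0))"
      by (intro torus_mean_diff[OF \<epsilon>(1)] continuous_on_sum continuous_on_mult continuous_on_const cont)
    also have "torus_mean UNIV \<epsilon> (\<lambda>x. \<Sum>\<alpha>\<in>EE. lam \<alpha> * mon (\<lambda>i. N - Suc (\<alpha> i)) x) =
        (\<Sum>\<alpha>\<in>EE. lam \<alpha> * torus_mean UNIV \<epsilon> (mon (\<lambda>i. N - Suc (\<alpha> i))))"
      by (subst torus_mean_sum[OF \<epsilon>(1) fin])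
        (auto intro!: continuous_on_mult[OF continuous_on_const cont] sum.cong torus_mean_cmult[OF \<epsilon>(1) cont])
    also have "\<dots> = (\<Sum>\<alpha>\<in>EE. if \<alpha> = \<alpha>0 then lam \<alpha> else 0)"
    proof (rule sum.cong[OF refl])
      fix \<alpha> assume "\<alpha> \<in> EE"
      then have "\<alpha> i < N" for i by (auto simp: PiE_iff)
      then have "N - Suc (\<alpha> i) = \<beta> i \<longleftrightarrow> \<alpha> i = \<alpha>0 i" for i
        using \<alpha>0[of i] unfolding \<beta>_def by (metis Suc_inject Suc_leI diff_diff_cancel)
      then have "(\<forall>i. N - Suc (\<alpha> i) = \<beta> i) \<longleftrightarrow> \<alpha> = \<alpha>0"
        unfolding fun_eq_iff by simp
      then show "lam \<alpha> * torus_mean UNIV \<epsilon> (mon (\<lambda>i. N - Suc (\<alpha> i))) = (if \<alpha> = \<alpha>0 then lam \<alpha> else 0)"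
        unfolding mean by simp
    qed
    also have "\<dots> = lam \<alpha>0"
      using \<alpha>0 by (subst sum.delta[OF fin]) auto
    \<comment> \<open>The subtracted constant 1 is visible only at \<beta> = 0, that is, when all
      \<alpha>0_i equal N - 1.\<close>
    also have "torus_mean UNIV \<epsilon> (mon (\<lambda>i. 0)) = r"
    proof -
      have "0 = \<beta> i \<longleftrightarrow> \<alpha>0 i = N - 1" for i
        using \<alpha>0[of i] unfolding \<beta>_def by auto
      then show ?thesis unfolding mean r_def by simp
    qed
    finally have eq: "lam \<alpha>0 - r = torus_mean UNIV \<epsilon> (\<lambda>x. (S x - 1) * mon (\<lambda>i. 0) x)" ..
    show ?thesis
      unfolding eq
    proof (rule torus_mean_norm_le[OF \<epsilon>(1)])
      have "continuous_on ?T S"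
        unfolding S_expand[abs_def] by (intro continuous_intros)
      then show "continuous_on ?T (\<lambda>x. (S x - 1) * mon (\<lambda>i. 0) x)"
        by (intro continuous_intros cont)
      fix x assume x: "x \<in> ?T"
      have xe: "x \<in> polydisc e" using x torus_subset_polydisc[of \<epsilon> e UNIV] \<epsilon> by auto
      have nx: "norm (x $ i) = \<epsilon>" for i using x by (simp add: torus_nth)
      have 1: "norm (S x - 1) \<le> c * (CARD('n) * \<epsilon> ^ N)" using S[OF xe] by (simp add: nx)
      have 2: "norm (mon (\<lambda>i. 0) x) = 1 / \<epsilon> ^ (\<Sum>i\<in>UNIV. \<beta> i)"
        unfolding mon_def prod_norm[symmetric] by (simp add: norm_divide norm_power nx prod_dividef power_sum)
      have "norm ((S x - 1) * mon (\<lambda>i. 0) x) \<le> c * (CARD('n) * \<epsilon> ^ N) * (1 / \<epsilon> ^ (\<Sum>i\<in>UNIV. \<beta> i))"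
        unfolding norm_mult 2 using 1 \<epsilon> by (intro mult_right_mono) auto
      also have "\<dots> = c * CARD('n) * (\<epsilon> ^ N / \<epsilon> ^ (\<Sum>i\<in>UNIV. \<beta> i))" by simp
      also have "\<epsilon> ^ N / \<epsilon> ^ (\<Sum>i\<in>UNIV. \<beta> i) = \<epsilon> ^ (N - (\<Sum>i\<in>UNIV. \<beta> i))"
        using small \<epsilon> unfolding \<beta>_def by (intro power_diff[symmetric]) auto
      also have "\<dots> \<le> \<epsilon> ^ 1"
        using small \<epsilon> unfolding \<beta>_def by (intro power_decreasing) auto
      finally show "norm ((S x - 1) * mon (\<lambda>i. 0) x) \<le> c * CARD('n) * \<epsilon>"
        using c(1) by (simp add: mult_left_mono)
    qed
  qed
  then have "lam \<alpha>0 - r = 0"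
    by (rule norm_zero_if_small[of "min e 1", rotated]) (use e in auto)
  then show ?thesis by (simp add: r_def)
qed

end

text \<open>With b the sum of the remaining t_j, every term of the binomial expansion of (t_i +
  b)^(N + M) contains t_i^N or b^M, and b^M is already a combination of their N-th powers.\<close>

lemma sum_power_in_powers:
  fixes t :: "'s \<Rightarrow> complex ^ 'n::finite \<Rightarrow> complex"
  assumes "finite S" "\<And>j. j \<in> S \<Longrightarrow> germ I (t j)" "0 < N"
  shows "\<exists>M>0. \<exists>s. (\<forall>j\<in>S. germ I (s j)) \<and> (\<forall>v. (\<Sum>j\<in>S. t j v) ^ M = (\<Sum>j\<in>S. s j v * t j v ^ N))"
  using assms(1,2)
proof (induction S rule: finite_induct)
  case empty
  show ?case by (intro exI[of _ 1]) auto
next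
  case (insert i S)
  then obtain M s where M: "M > 0" and s: "\<And>j. j \<in> S \<Longrightarrow> germ I (s j)"
    and eq: "\<And>v. (\<Sum>j\<in>S. t j v) ^ M = (\<Sum>j\<in>S. s j v * t j v ^ N)" by auto
  define b where "b v = (\<Sum>j\<in>S. t j v)" for v
  have b: "germ I b" unfolding b_def[abs_def] using insert.prems by (intro germ_sum) auto
  have ti: "germ I (t i)" using insert.prems by auto
  \<comment> \<open>\<open>p\<close> collects the terms with t_i^k for k \<ge> N after division by
    t_i^N, and \<open>q\<close> the other terms after division by b^M.\<close>
  define p where "p v = (\<Sum>k\<in>{N..N+M}. of_nat ((N+M) choose k) * t i v ^ (k - N) * b v ^ (N+M-k))" for v
  define q where "q v = (\<Sum>k\<in>{..<N}. of_nat ((N+M) choose k) * t i v ^ k * b v ^ (N-k))" for v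
  have pq: "germ I p" "germ I q"
    unfolding p_def[abs_def] q_def[abs_def] by (intro germ_sum germ_mult germ_const germ_power ti b)+
  have "(t i v + b v) ^ (N+M) = p v * t i v ^ N + q v * b v ^ M" for v
  proof -
    have "(t i v + b v) ^ (N+M) = (\<Sum>k\<in>{..<N} \<union> {N..N+M}. of_nat ((N+M) choose k) * t i v ^ k * b v ^ (N+M-k))"
      unfolding binomial_ring by (rule sum.cong) auto
    also have "\<dots> = (\<Sum>k\<in>{..<N}. of_nat ((N+M) choose k) * t i v ^ k * b v ^ (N+M-k)) +
        (\<Sum>k\<in>{N..N+M}. of_nat ((N+M) choose k) * t i v ^ k * b v ^ (N+M-k))"
      by (rule sum.union_disjoint) auto
    also have "(\<Sum>k\<in>{..<N}. of_nat ((N+M) choose k) * t i v ^ k * b v ^ (N+M-k)) = q v * b v ^ M"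
      unfolding q_def sum_distrib_right
      by (intro sum.cong refl) (simp add: mult.assoc power_add[symmetric])
    also have "(\<Sum>k\<in>{N..N+M}. of_nat ((N+M) choose k) * t i v ^ k * b v ^ (N+M-k)) = p v * t i v ^ N"
      unfolding p_def sum_distrib_right
    proof (intro sum.cong refl)
      fix k assume "k \<in> {N..N+M}"
      then have "t i v ^ k = t i v ^ (k - N) * t i v ^ N" by (simp add: power_add[symmetric])
      then show "of_nat ((N+M) choose k) * t i v ^ k * b v ^ (N+M-k) =
          of_nat ((N+M) choose k) * t i v ^ (k - N) * b v ^ (N+M-k) * t i v ^ N" by simp
    qed
    finally show ?thesis by simp
  qed
  then have e: "(\<Sum>j\<in>insert i S. t j v) ^ (N+M) = (\<Sum>j\<in>insert i S. (if j = i then p v else q v * s j v) * t j v ^ N)"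
      for v
    using insert.hyps eq[of v] unfolding b_def
    by (simp add: sum_distrib_left mult.assoc) (intro sum.cong, auto)
  show ?case
  proof (intro exI[of _ "N+M"] conjI exI[of _ "\<lambda>j v. if j = i then p v else q v * s j v"] allI)
    show "\<forall>j\<in>insert i S. germ I (\<lambda>v. if j = i then p v else q v * s j v)"
    proof
      fix j assume "j \<in> insert i S"
      then show "germ I (\<lambda>v. if j = i then p v else q v * s j v)"
        using pq germ_mult[OF pq(2) s] by (cases "j = i") auto
    qed
  qed (use M e in auto)
qed

text \<open>If v_i^L lies in the ideal of the g_j, then a high power of v_i^L lies in the ideal of
  the g_j^N.\<close>

lemma presents_power:
  assumes "presents I g L A" "\<And>j. j \<in> I \<Longrightarrow> germ I (g j)" "0 < N"
  shows "\<exists>L' A'. presents I (\<lambda>i v. g i v ^ N) L' A'"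
proof -
  have A: "\<And>i j. i \<in> I \<Longrightarrow> j \<in> I \<Longrightarrow> germ I (A i j)" and L: "0 < L"
    and eq: "\<And>i. i \<in> I \<Longrightarrow> germ_eq I (\<lambda>v. v $ i ^ L) (\<lambda>v. \<Sum>j\<in>I. A i j v * g j v)"
    using assms(1) unfolding presents_def by auto
  have "\<forall>i\<in>I. \<exists>M>0. \<exists>s. (\<forall>j\<in>I. germ I (s j)) \<and>
      (\<forall>v. (\<Sum>j\<in>I. A i j v * g j v) ^ M = (\<Sum>j\<in>I. s j v * (A i j v * g j v) ^ N))"
    using assms(2,3) A by (intro ballI sum_power_in_powers) auto
  from bchoice[OF this] obtain M where M: "\<forall>i\<in>I. M i > 0 \<and> (\<exists>s. (\<forall>j\<in>I. germ I (s j)) \<and>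
      (\<forall>v. (\<Sum>j\<in>I. A i j v * g j v) ^ M i = (\<Sum>j\<in>I. s j v * (A i j v * g j v) ^ N)))" by blast
  then have "\<forall>i\<in>I. \<exists>s. (\<forall>j\<in>I. germ I (s j)) \<and>
      (\<forall>v. (\<Sum>j\<in>I. A i j v * g j v) ^ M i = (\<Sum>j\<in>I. s j v * (A i j v * g j v) ^ N))" by blast
  from bchoice[OF this] obtain s where s: "\<And>i j. i \<in> I \<Longrightarrow> j \<in> I \<Longrightarrow> germ I (s i j)"
    "\<And>i v. i \<in> I \<Longrightarrow> (\<Sum>j\<in>I. A i j v * g j v) ^ M i = (\<Sum>j\<in>I. s i j v * (A i j v * g j v) ^ N)"
    by blast
  \<comment> \<open>One exponent that dominates all the L * M_i; the summand 1 keeps it positive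
    when \<open>I\<close> is empty.\<close>
  define K where "K = 1 + L * (\<Sum>i\<in>I. M i)"
  have K: "L * M i \<le> K" if "i \<in> I" for i
  proof -
    have "M i \<le> (\<Sum>i\<in>I. M i)" using that by (intro member_le_sum) auto
    then have "L * M i \<le> L * (\<Sum>i\<in>I. M i)" by (rule mult_le_mono2)
    then show ?thesis unfolding K_def by linarith
  qed
  have "presents I (\<lambda>i v. g i v ^ N) K (\<lambda>i j v. v $ i ^ (K - L * M i) * s i j v * A i j v ^ N)"
    unfolding presents_def
  proof (intro conjI ballI)
    show "germ I (\<lambda>v. v $ i ^ (K - L * M i) * s i j v * A i j v ^ N)" if "i \<in> I" "j \<in> I" for i j
      using that by (intro germ_mult germ_power germ_coord s A)
    show "germ_eq I (\<lambda>v. v $ i ^ K) (\<lambda>v. \<Sum>j\<in>I. v $ i ^ (K - L * M i) * s i j v * A i j v ^ N * g j v ^ N)"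
        if "i \<in> I" for i
      using eq[OF that] unfolding germ_eq_def
    proof eventually_elim
      case (elim v)
      let ?w = "coord_proj I v"
      have "?w $ i ^ K = ?w $ i ^ (K - L * M i) * (?w $ i ^ L) ^ M i"
        using K[OF that] unfolding power_mult[symmetric] power_add[symmetric] by simp
      also have "(?w $ i ^ L) ^ M i = (\<Sum>j\<in>I. s i j ?w * (A i j ?w * g j ?w) ^ N)"
        unfolding elim s(2)[OF that] ..
      finally show ?case
        by (simp only: sum_distrib_left power_mult_distrib mult.assoc)
    qed
  qed (simp add: K_def)
  then show ?thesis by blast
qed

lemma residue_ideal_multiple:
  assumes "presents I g N A" "germ I q" "\<And>j. j \<in> I \<Longrightarrow> germ I (g j)" "j \<in> I"
  shows "residue I g (\<lambda>v. q v * g j v) = 0"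
proof -
  have "eventually (\<lambda>R. (\<forall>i\<in>I. \<forall>j\<in>I. holo_on (polydisc R) (\<lambda>v. A i j (coord_proj I v))) \<and>
      (\<forall>i\<in>I. \<forall>v\<in>polydisc R. coord_proj I v $ i ^ N = (\<Sum>j\<in>I. A i j (coord_proj I v) * g j (coord_proj I v))) \<and>
      holo_on (polydisc R) (\<lambda>v. q (coord_proj I v))) (at_right 0)"
    using assms(1,2) unfolding presents_def germ_iff
    by (intro eventually_conj eventually_ball_finite ballI germ_eqD) auto
  then have "eventually (\<lambda>\<rho>. torus_mean I \<rho> (\<lambda>v. q v * g j v * det (ext_matrix I A v) * (\<Prod>k\<in>I. v $ k / v $ k ^ N)) =
      0) (at_right 0)"
  proof (rule eventually_at_right_0_shrink)
    fix \<rho> R :: real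
    assume \<rho>: "0 < \<rho>" "\<rho> < R" and *: "(\<forall>i\<in>I. \<forall>j\<in>I. holo_on (polydisc R) (\<lambda>v. A i j (coord_proj I v))) \<and>
      (\<forall>i\<in>I. \<forall>v\<in>polydisc R. coord_proj I v $ i ^ N = (\<Sum>j\<in>I. A i j (coord_proj I v) * g j (coord_proj I v))) \<and>
      holo_on (polydisc R) (\<lambda>v. q (coord_proj I v))"
    interpret torus_denominators \<rho> R I "\<lambda>k \<xi>. \<xi> ^ N" by (rule torus_denominators_power[OF \<rho>])
    define w where "w v = (\<chi> j. if j \<in> I then g j v else 0)" for v
    have "torus_mean I \<rho> (\<lambda>v. q (coord_proj I v) * det (ext_matrix I A (coord_proj I v)) * w v $ j * den v) = 0"
    proof (rule torus_mean_det_kill)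
      show "holo_on (polydisc R) (\<lambda>v. ext_matrix I A (coord_proj I v) $ i $ j)" for i j
        using * by (cases "i \<in> I \<and> j \<in> I") (auto simp: ext_matrix_def)
      show "ext_matrix I A (coord_proj I v) *v w v = rhs v" if v: "v \<in> torus \<rho> I" for v
      proof -
        have vR: "v \<in> polydisc R" using v torus_subset_polydisc[OF \<rho>] by blast
        have "(ext_matrix I A v *v w v) $ i = rhs v $ i" for i
        proof (cases "i \<in> I")
          case True
          have "(ext_matrix I A v *v w v) $ i = (\<Sum>j\<in>UNIV. if j \<in> I then A i j v * g j v else 0)"
            using True unfolding matrix_vector_mult_def w_def ext_matrix_def by (auto intro!: sum.cong)
          also have "\<dots> = (\<Sum>j\<in>I. A i j v * g j v)" by (simp add: sum.If_cases)
          also have "\<dots> = v $ i ^ N"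
            using *[THEN conjunct2, THEN conjunct1, rule_format, OF True vR] v by simp
          finally show ?thesis using True by (simp add: rhs_def)
        next
          case False
          then have "(ext_matrix I A v *v w v) $ i = 0"
            unfolding matrix_vector_mult_def w_def ext_matrix_def by (auto intro!: sum.neutral)
          then show ?thesis using False by (simp add: rhs_def)
        qed
        then show ?thesis using v by (simp add: vec_eq_iff)
      qed
    qed (use * in auto)
    moreover have "torus_mean I \<rho> (\<lambda>v. q v * g j v * det (ext_matrix I A v) * (\<Prod>k\<in>I. v $ k / v $ k ^ N)) =
        torus_mean I \<rho> (\<lambda>v. q (coord_proj I v) * det (ext_matrix I A (coord_proj I v)) * w v $ j * den v)"
      by (rule torus_mean_cong[OF \<rho>(1)]) (use assms(4) in \<open>simp add: w_def den_def\<close>)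
    ultimately show "torus_mean I \<rho> (\<lambda>v. q v * g j v * det (ext_matrix I A v) * (\<Prod>k\<in>I. v $ k / v $ k ^ N)) = 0" by simp
  qed
  moreover have "germ I (\<lambda>v. q v * g j v)" using assms by (intro germ_mult) auto
  from residue_torus_mean[OF assms(1) this]
  have "eventually (\<lambda>\<rho>. residue I g (\<lambda>v. q v * g j v) =
      torus_mean I \<rho> (\<lambda>v. q v * g j v * det (ext_matrix I A v) * (\<Prod>k\<in>I. v $ k / v $ k ^ N))) (at_right 0)" .
  ultimately have "eventually (\<lambda>_. residue I g (\<lambda>v. q v * g j v) = 0) (at_right (0::real))"
    by eventually_elim simp
  then show ?thesis by (rule eventually_at_right_0_const)
qed

lemma eventually_polydisc_bound:
  fixes g :: "'i \<Rightarrow> complex ^ 'n::finite \<Rightarrow> complex"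
  assumes "finite S" "0 < R" "\<And>i. i \<in> S \<Longrightarrow> holo_on (polydisc R) (g i)"
  shows "\<exists>B. eventually (\<lambda>r. \<forall>i\<in>S. \<forall>v\<in>polydisc r. norm (g i v) \<le> B) (at_right 0)"
proof -
  define B where "B = (\<Sum>i\<in>S. norm (g i 0) + 1)"
  have "eventually (\<lambda>r. \<forall>v\<in>polydisc r. norm (g i v) \<le> B) (at_right 0)" if i: "i \<in> S" for i
  proof (rule eventually_at_right_0_polydisc)
    have "isCont (g i) 0"
      using holo_on_imp_continuous_on[OF assms(3)[OF i]] assms(2)
      by (simp add: continuous_on_eq_continuous_at open_polydisc)
    then have "((\<lambda>v. norm (g i v)) \<longlongrightarrow> norm (g i 0)) (nhds 0)"
      by (intro tendsto_norm) (simp add: continuous_at tendsto_nhds_iff)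
    then have "eventually (\<lambda>v. norm (g i v) < norm (g i 0) + 1) (nhds 0)"
      by (rule order_tendstoD) simp
    moreover have "norm (g i 0) + 1 \<le> B"
      unfolding B_def by (rule member_le_sum[OF i]) (use assms(1) in \<open>auto intro: add_nonneg_nonneg\<close>)
    ultimately show "eventually (\<lambda>v. norm (g i v) \<le> B) (nhds 0)"
      by (auto elim: eventually_mono)
  qed
  then show ?thesis using assms(1) by (intro exI[of _ B] eventually_ball_finite) auto
qed

text \<open>Closeness to a constant survives averaging along segments. This keeps the Hadamard
  determinants away from 0 for all pairs of points near 0 at once.\<close>

lemma hada_near:
  assumes "open U" "convex U" "holo_on U g" "a \<in> U" "b \<in> U" "\<And>v. v \<in> U \<Longrightarrow> norm (partial j g v - p) \<le> \<eta>"
  shows "norm (hada j g a b - p) \<le> \<eta>"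
proof -
  have c: "continuous_on {0..1} (\<lambda>t. partial j g (b + of_real t *s (a - b)))"
    by (rule continuous_on_segment_partial[OF assms(1-5)])
  have "hada j g a b - p = integral {0..1} (\<lambda>t. partial j g (b + of_real t *s (a - b)) - p)"
    unfolding hada_def using integral_diff[OF integrable_continuous_interval[OF c] integrable_const_ivl, of p] by simp
  also have "norm \<dots> \<le> \<eta> * (1 - 0)"
  proof (rule integral_bound)
    show "norm (partial j g (b + of_real t *s (a - b)) - p) \<le> \<eta>" if "t \<in> {0..1}" for t
      using that assms segment_convex[OF assms(2,4,5)] by auto
    show "continuous_on {0..1} (\<lambda>t. partial j g (b + of_real t *s (a - b)) - p)"
      by (intro continuous_on_diff c continuous_on_const)
  qed simp
  finally show ?thesis by simp
qed

lemma det_near: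
  fixes M :: "complex ^ 'n::finite ^ 'n"
  assumes "det M \<noteq> 0"
  shows "\<exists>\<eta>>0. \<forall>C. (\<forall>i j. norm (C $ i $ j - M $ i $ j) \<le> \<eta>) \<longrightarrow> norm (det M) / 2 \<le> norm (det C)"
proof -
  have "isCont (det :: complex ^ 'n ^ 'n \<Rightarrow> complex) M"
    unfolding det_def[abs_def] by (intro continuous_intros)
  then have "((\<lambda>C. norm (det C)) \<longlongrightarrow> norm (det M)) (nhds M)"
    by (intro tendsto_norm) (simp add: continuous_at tendsto_nhds_iff)
  then have "eventually (\<lambda>C. norm (det M) / 2 < norm (det C)) (nhds M)"
    by (rule order_tendstoD) (simp add: assms)
  then obtain e where e: "e > 0" "\<And>C. dist C M < e \<Longrightarrow> norm (det M) / 2 < norm (det C)"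
    unfolding eventually_nhds_metric by blast
  \<comment> \<open>Bounding the norm of a matrix by its entries, through the rows, costs a factor n
    twice; the factor 2 makes the inequality strict.\<close>
  define \<eta> where "\<eta> = e / (2 * CARD('n) * CARD('n))"
  have \<eta>: "\<eta> > 0" using e by (simp add: \<eta>_def)
  have "norm (det M) / 2 \<le> norm (det C)" if C: "\<forall>i j. norm (C $ i $ j - M $ i $ j) \<le> \<eta>" for C
  proof -
    have row: "norm ((C - M) $ i) \<le> CARD('n) * \<eta>" for i
    proof -
      have "norm ((C - M) $ i) \<le> (\<Sum>j\<in>UNIV. norm ((C - M) $ i $ j))"
        unfolding norm_vec_def by (rule L2_set_le_sum) auto
      also have "\<dots> \<le> (\<Sum>j\<in>(UNIV::'n set). \<eta>)" using C by (intro sum_mono) auto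
      finally show ?thesis by simp
    qed
    have "norm (C - M) \<le> (\<Sum>i\<in>UNIV. norm ((C - M) $ i))"
      unfolding norm_vec_def by (rule L2_set_le_sum) auto
    also have "\<dots> \<le> (\<Sum>i\<in>(UNIV::'n set). CARD('n) * \<eta>)" using row by (intro sum_mono) auto
    also have "\<dots> = e / 2" by (simp add: \<eta>_def)
    also have "\<dots> < e" using e by simp
    finally show ?thesis using e(2)[of C] by (simp add: dist_norm)
  qed
  then show ?thesis using \<eta> by blast
qed

section \<open>Local biholomorphisms and residues of top forms\<close>

lemma germ_UNIV_I: "0 < r \<Longrightarrow> holo_on (polydisc r) g \<Longrightarrow> germ UNIV g"
  unfolding germ_def by (intro exI[of _ "polydisc r"]) (auto simp: o_def open_polydisc)

lemma germ_UNIV_iff: "germ UNIV g \<longleftrightarrow> eventually (\<lambda>R. holo_on (polydisc R) g) (at_right 0)"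
  by (simp add: germ_iff)

lemma eventually_at_right_0_obtain:
  assumes "eventually P (at_right (0::real))" obtains r where "0 < r" "P r"
  using eventually_happens'[OF trivial_limit_at_right_real eventually_conj[OF eventually_at_right_less assms]] by blast

lemma isCont_holo: "0 < R \<Longrightarrow> holo_on (polydisc R) g \<Longrightarrow> isCont g (0 :: complex ^ 'n::finite)"
  by (rule continuous_on_eq_continuous_at[OF open_polydisc, THEN iffD1, rule_format, OF holo_on_imp_continuous_on])
    auto

lemma eventually_at_right_0_less: "0 < c \<Longrightarrow> eventually (\<lambda>r. r < c) (at_right (0::real))"
  unfolding eventually_at_right_field by blast

lemma holo_map_near_0:
  fixes \<phi> :: "complex ^ 'n::finite \<Rightarrow> complex ^ 'm::finite"
  assumes "0 < R" "\<And>i. holo_on (polydisc R) (\<lambda>v. \<phi> v $ i)" "\<phi> 0 = 0" "0 < r"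
  shows "eventually (\<lambda>v. \<phi> v \<in> polydisc r) (nhds 0)"
proof -
  have "eventually (\<lambda>v. norm (\<phi> v $ i) < r) (nhds 0)" for i
  proof (rule order_tendstoD)
    show "((\<lambda>v. norm (\<phi> v $ i)) \<longlongrightarrow> norm (\<phi> 0 $ i)) (nhds 0)"
      using isCont_holo[OF assms(1,2)] by (intro tendsto_norm) (simp add: continuous_at tendsto_nhds_iff)
  qed (use assms in simp)
  then have "eventually (\<lambda>v. \<forall>i. norm (\<phi> v $ i) < r) (nhds 0)"
    by (rule eventually_all_finite)
  then show ?thesis by (simp add: polydisc_def)
qed

lemma has_field_derivative_partial:
  assumes "holo_on V g" "v \<in> V"
  shows "((\<lambda>t. g (v + t *s axis j 1)) has_field_derivative partial j g v) (at 0)"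
proof -
  have "((\<lambda>t. g (v + t *s axis j 1)) has_field_derivative (\<Sum>k\<in>UNIV. axis j 1 $ k * partial k g v)) (at 0)"
    by (rule has_field_derivative_line)
      (use holo_on_has_derivative_partial[OF assms] in \<open>auto simp: sum_distrib_left mult.assoc\<close>)
  also have "(\<Sum>k\<in>UNIV. axis j 1 $ k * partial k g v) = partial j g v"
    by (simp add: axis_def if_distrib[of "\<lambda>x. x * _"] cong: if_cong)
  finally show ?thesis .
qed

text \<open>Both maps are holomorphic on one polydisc, but they are inverse to each other only as
  germs at 0.\<close>

locale local_biholo =
  fixes \<phi> \<psi> :: "complex ^ 'n::finite \<Rightarrow> complex ^ 'n" and R :: real
  assumes R: "0 < R"
    and holo_\<phi>: "\<And>i. holo_on (polydisc R) (\<lambda>v. \<phi> v $ i)" and holo_\<psi>: "\<And>i. holo_on (polydisc R) (\<lambda>v. \<psi> v $ i)"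
    and \<phi>_0: "\<phi> 0 = 0" and \<psi>_0: "\<psi> 0 = 0"
    and \<psi>_\<phi>: "eventually (\<lambda>v. \<psi> (\<phi> v) = v) (nhds 0)" and \<phi>_\<psi>: "eventually (\<lambda>x. \<phi> (\<psi> x) = x) (nhds 0)"
begin

lemma inverse: "local_biholo \<psi> \<phi> R"
  by unfold_locales (use R holo_\<phi> holo_\<psi> \<phi>_0 \<psi>_0 \<psi>_\<phi> \<phi>_\<psi> in auto)

lemma near: "0 < r \<Longrightarrow> eventually (\<lambda>v. \<phi> v \<in> polydisc r) (nhds 0)"
  by (rule holo_map_near_0[OF R holo_\<phi> \<phi>_0])

lemma germ_\<phi>: "germ UNIV (\<lambda>v. \<phi> v $ i)"
  by (rule germ_UNIV_I[OF R holo_\<phi>])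

lemma germ_compose:
  assumes "germ UNIV g" shows "germ UNIV (\<lambda>v. g (\<phi> v))"
proof -
  obtain r where r: "0 < r" "holo_on (polydisc r) g"
    using assms unfolding germ_UNIV_iff by (rule eventually_at_right_0_obtain)
  obtain r' where r': "0 < r'" "\<forall>v\<in>polydisc r'. \<phi> v \<in> polydisc r"
    using near[OF r(1)] unfolding eventually_nhds_0_polydisc by auto
  have "holo_on (polydisc (min r' R)) (\<lambda>v. g (\<phi> v))"
  proof (rule holo_on_compose[OF r(2)])
    show "holo_on (polydisc (min r' R)) (\<lambda>v. \<phi> v $ i)" for i
      by (rule holo_on_subset[OF holo_\<phi> polydisc_mono]) auto
    show "\<phi> ` polydisc (min r' R) \<subseteq> polydisc r"
      using r'(2) polydisc_mono[of "min r' R" r'] by auto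
  qed
  then show ?thesis using r' R by (intro germ_UNIV_I) auto
qed

lemma germ_jac: "germ UNIV (\<lambda>v. det (jac \<phi> v))"
  by (rule germ_UNIV_I[OF R]) (auto simp: jac_def intro!: holo_on_det holo_on_partial[OF open_polydisc holo_\<phi>])

definition b :: "'n \<Rightarrow> 'n \<Rightarrow> complex ^ 'n \<Rightarrow> complex" where
  "b i j v = hada j (\<lambda>x. \<psi> x $ i) (\<phi> v) 0"

lemma b_near:
  obtains r where "0 < r" "r \<le> R" "\<And>i j. holo_on (polydisc r) (b i j)"
    "\<And>v i. v \<in> polydisc r \<Longrightarrow> v $ i = (\<Sum>j\<in>UNIV. b i j v * \<phi> v $ j)"
proof -
  obtain r where r: "0 < r" "\<forall>v\<in>polydisc r. \<phi> v \<in> polydisc R \<and> \<psi> (\<phi> v) = v"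
    using eventually_conj[OF near[OF R] \<psi>_\<phi>] unfolding eventually_nhds_0_polydisc by blast
  define r' where "r' = min r R"
  have r': "v \<in> polydisc r" "v \<in> polydisc R" if "v \<in> polydisc r'" for v :: "complex ^ 'n"
    using that polydisc_mono[of r' r] polydisc_mono[of r' R] by (auto simp: r'_def)
  show ?thesis
  proof (rule that[of r'])
    show "holo_on (polydisc r') (b i j)" for i j
      unfolding b_def[abs_def]
      by (rule holo_on_hada[OF open_polydisc convex_polydisc holo_\<psi> open_polydisc])
        (use r r' R in \<open>auto intro: holo_on_subset[OF holo_\<phi>]\<close>)
    show "v $ i = (\<Sum>j\<in>UNIV. b i j v * \<phi> v $ j)" if v: "v \<in> polydisc r'" for v i
    proof -
      have "\<psi> (\<phi> v) $ i - \<psi> 0 $ i = (\<Sum>j\<in>UNIV. (\<phi> v $ j - 0 $ j) * hada j (\<lambda>x. \<psi> x $ i) (\<phi> v) 0)"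
        by (rule hadamard[OF open_polydisc convex_polydisc holo_\<psi>]) (use r(2) r'(1)[OF v] R in auto)
      then show ?thesis using r(2) r'(1)[OF v] by (simp add: \<psi>_0 b_def mult.commute)
    qed
  qed (use r(1) R in \<open>auto simp: r'_def\<close>)
qed

text \<open>Hadamard's lemma for \<psi> between \<phi>(v) and 0 writes v_i = \<psi>_i(\<phi>(v)) as
  a combination of the \<phi>_j(v), so exponent 1 suffices.\<close>

lemma presents_coordinates: "presents UNIV (\<lambda>i v. \<phi> v $ i) 1 b"
proof -
  obtain r where r: "0 < r" "r \<le> R" "\<And>i j. holo_on (polydisc r) (b i j)"
    "\<And>v i. v \<in> polydisc r \<Longrightarrow> v $ i = (\<Sum>j\<in>UNIV. b i j v * \<phi> v $ j)"
    using b_near by blast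
  then show ?thesis
    unfolding presents_def germ_eq_def eventually_nhds_0_polydisc
    by (auto intro: germ_UNIV_I)
qed

text \<open>Differentiate v_i = sum_j b_ij(v) \<phi>_j(v) at 0. The terms with derivatives of b_ij
  vanish because \<phi>(0) = 0, so b(0) is a left inverse of the Jacobian matrix.\<close>

lemma det_jac_nonzero: "det (jac \<phi> 0) \<noteq> 0"
proof -
  obtain r where r: "0 < r" "r \<le> R" "\<And>i j. holo_on (polydisc r) (b i j)"
    "\<And>v i. v \<in> polydisc r \<Longrightarrow> v $ i = (\<Sum>j\<in>UNIV. b i j v * \<phi> v $ j)"
    using b_near by blast
  have "(\<Sum>j\<in>UNIV. b i j 0 * partial k (\<lambda>v. \<phi> v $ j) 0) = (if i = k then 1 else 0)" for i k
  proof -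
    have "((\<lambda>t. \<Sum>j\<in>UNIV. b i j (0 + t *s axis k 1) * \<phi> (0 + t *s axis k 1) $ j) has_field_derivative
        (\<Sum>j\<in>UNIV. b i j (0 + 0 *s axis k 1) * partial k (\<lambda>v. \<phi> v $ j) 0 + partial k (b i j) 0 * \<phi> (0 + 0 *s axis k
            1) $ j)) (at 0)"
      by (intro DERIV_sum DERIV_mult' has_field_derivative_partial[OF r(3)] has_field_derivative_partial[OF holo_\<phi>])
        (use r(1) R in auto)
    then have "((\<lambda>t. \<Sum>j\<in>UNIV. b i j (t *s axis k 1) * \<phi> (t *s axis k 1) $ j) has_field_derivative
        (\<Sum>j\<in>UNIV. b i j 0 * partial k (\<lambda>v. \<phi> v $ j) 0)) (at 0)"
      by (simp add: \<phi>_0)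
    then have "((\<lambda>t. (t *s axis k 1 :: complex ^ 'n) $ i) has_field_derivative
        (\<Sum>j\<in>UNIV. b i j 0 * partial k (\<lambda>v. \<phi> v $ j) 0)) (at 0)"
    proof (rule has_field_derivative_transform_within_open[of _ _ _ "ball 0 r"])
      fix t :: complex assume t: "t \<in> ball 0 r"
      have "t *s axis k 1 \<in> polydisc r"
        using t r(1) by (simp add: polydisc_def axis_def)
      from r(4)[OF this, of i]
      show "(\<Sum>j\<in>UNIV. b i j (t *s axis k 1) * \<phi> (t *s axis k 1) $ j) = (t *s axis k 1 :: complex ^ 'n) $ i" by simp
    qed (use r in auto)
    moreover have "((\<lambda>t. (t *s axis k 1 :: complex ^ 'n) $ i) has_field_derivative (if i = k then 1 else 0)) (at 0)"
      by (auto simp: axis_def intro!: derivative_eq_intros)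
    ultimately show ?thesis by (rule DERIV_unique)
  qed
  then have "(\<chi> i j. b i j 0) ** jac \<phi> 0 = mat 1"
    by (simp add: matrix_matrix_mult_def jac_def mat_def vec_eq_iff)
  then have "det (\<chi> i j. b i j 0) * det (jac \<phi> 0) = 1"
    by (metis det_I det_mul)
  then show ?thesis by auto
qed

text \<open>All bounds are fixed on one polydisc before \<rho> is chosen. The radius may therefore
  still be shrunk until the mean also represents a given residue.\<close>

lemma kernel:
  assumes A: "presents UNIV (\<lambda>i v. \<phi> v $ i ^ N) L A"
  obtains R' B \<kappa> where "0 < R'" "\<And>\<rho>. 0 < \<rho> \<Longrightarrow> 2 * \<rho> < R' \<Longrightarrow> kernel_estimate \<phi> R' \<rho> B \<kappa> N L (\<lambda>v. \<chi> i j. A i j v)"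
proof -
  have gA: "germ UNIV (A i j)" for i j using A by (simp add: presents_def)
  have "eventually (\<lambda>r. \<forall>p\<in>UNIV. holo_on (polydisc r) (case p of (i, j) \<Rightarrow> A i j)) (at_right 0)"
    using gA unfolding germ_UNIV_iff by (intro eventually_ball_finite) auto
  then obtain R1 where R1: "0 < R1" "\<And>i j. holo_on (polydisc R1) (A i j)"
    by (rule eventually_at_right_0_obtain) auto
  obtain \<eta> where \<eta>: "\<eta> > 0" "\<And>C. (\<forall>i j. norm (C $ i $ j - jac \<phi> 0 $ i $ j) \<le> \<eta>) \<Longrightarrow> norm (det (jac \<phi> 0)) / 2 \<le>
      norm (det C)"
    using det_near[OF det_jac_nonzero] by blast
  have d\<phi>: "holo_on (polydisc R) (partial j (\<lambda>v. \<phi> v $ i))" for i j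
    by (rule holo_on_partial[OF open_polydisc holo_\<phi>])
  obtain B1 where B1: "eventually (\<lambda>r. \<forall>i\<in>UNIV. \<forall>v\<in>polydisc r. norm (\<phi> v $ i) \<le> B1) (at_right 0)"
    using eventually_polydisc_bound[OF _ R, of UNIV "\<lambda>i v. \<phi> v $ i"] holo_\<phi> by auto
  obtain B2 where B2: "eventually (\<lambda>r. \<forall>p\<in>UNIV. \<forall>v\<in>polydisc r. norm (A (fst p) (snd p) v) \<le> B2) (at_right 0)"
    using eventually_polydisc_bound[OF _ R1(1), of UNIV "\<lambda>p v. A (fst p) (snd p) v"] R1(2) by auto
  obtain B3 where B3: "eventually (\<lambda>r. \<forall>p\<in>UNIV. \<forall>v\<in>polydisc r. norm (partial (snd p) (\<lambda>v. \<phi> v $ (fst p)) v) \<le>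
      B3) (at_right 0)"
    using eventually_polydisc_bound[OF _ R, of UNIV "\<lambda>p. partial (snd p) (\<lambda>v. \<phi> v $ (fst p))"] d\<phi> by auto
  obtain B4 where B4: "eventually (\<lambda>r. \<forall>p\<in>UNIV. \<forall>v\<in>polydisc r. norm (partial (snd (snd p)) (A (fst p) (fst (snd p)))
      v) \<le> B4) (at_right 0)"
    using eventually_polydisc_bound[OF _ R1(1), of UNIV "\<lambda>p. partial (snd (snd p)) (A (fst p) (fst (snd p)))"]
      holo_on_partial[OF open_polydisc R1(2)] by auto
  have "eventually (\<lambda>v. norm (partial j (\<lambda>v. \<phi> v $ i) v - jac \<phi> 0 $ i $ j) < \<eta>) (nhds 0)" for i j
  proof (rule order_tendstoD)
    show "((\<lambda>v. norm (partial j (\<lambda>v. \<phi> v $ i) v - jac \<phi> 0 $ i $ j)) \<longlongrightarrow> norm (partial j (\<lambda>v. \<phi> v $ i) 0 - jac \<phi>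
        0 $ i $ j)) (nhds 0)"
      using isCont_holo[OF R d\<phi>[of j i]] by (intro tendsto_intros) (simp add: continuous_at tendsto_nhds_iff)
  qed (use \<eta> in \<open>simp add: jac_def\<close>)
  then have "eventually (\<lambda>v. \<forall>i j. norm (partial j (\<lambda>v. \<phi> v $ i) v - jac \<phi> 0 $ i $ j) < \<eta>) (nhds 0)"
    by (intro eventually_all_finite)
  from eventually_at_right_0_polydisc[OF this]
  have near_jac: "eventually (\<lambda>r. \<forall>v\<in>polydisc r. \<forall>i j. norm (partial j (\<lambda>v. \<phi> v $ i) v - jac \<phi> 0 $ i $ j) < \<eta>)
      (at_right 0)" .
  have eq: "eventually (\<lambda>r. \<forall>i\<in>UNIV. \<forall>v\<in>polydisc r. v $ i ^ L = (\<Sum>j\<in>UNIV. A i j v * \<phi> v $ j ^ N)) (at_right 0)"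
  proof (rule eventually_ball_finite)
    show "\<forall>i\<in>UNIV. eventually (\<lambda>r. \<forall>v\<in>polydisc r. v $ i ^ L = (\<Sum>j\<in>UNIV. A i j v * \<phi> v $ j ^ N)) (at_right 0)"
      using A germ_eqD[of UNIV] unfolding presents_def by fastforce
  qed simp
  have "eventually (\<lambda>r. r < min R R1) (at_right (0::real))"
    using R R1(1) by (intro eventually_at_right_0_less) auto
  from eventually_conj[OF this eventually_conj[OF B1 eventually_conj[OF B2 eventually_conj[OF B3 eventually_conj[OF
      B4 eventually_conj[OF near_jac eq]]]]]]
  obtain R' where R': "0 < R'" and lt: "R' < min R R1"
    and b1: "\<And>v i. v \<in> polydisc R' \<Longrightarrow> norm (\<phi> v $ i) \<le> B1"
    and b2: "\<And>v i j. v \<in> polydisc R' \<Longrightarrow> norm (A i j v) \<le> B2"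
    and b3: "\<And>v i j. v \<in> polydisc R' \<Longrightarrow> norm (partial j (\<lambda>v. \<phi> v $ i) v) \<le> B3"
    and b4: "\<And>v i j k. v \<in> polydisc R' \<Longrightarrow> norm (partial k (A i j) v) \<le> B4"
    and nj: "\<And>v i j. v \<in> polydisc R' \<Longrightarrow> norm (partial j (\<lambda>v. \<phi> v $ i) v - jac \<phi> 0 $ i $ j) < \<eta>"
    and eq': "\<And>v i. v \<in> polydisc R' \<Longrightarrow> v $ i ^ L = (\<Sum>j\<in>UNIV. A i j v * \<phi> v $ j ^ N)"
    by (rule eventually_at_right_0_obtain) force
  define B where "B = max (max B1 B2) (max B3 B4)"
  have holo_\<phi>': "holo_on (polydisc R') (\<lambda>v. \<phi> v $ i)" for i
    by (rule holo_on_subset[OF holo_\<phi> polydisc_mono]) (use lt in auto)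
  have lower: "norm (det (jac \<phi> 0)) / 2 \<le> norm (det (hada_matrix \<phi> v u))" if "u \<in> polydisc R'" "v \<in> polydisc R'" for u v
  proof (rule \<eta>(2), intro allI)
    fix i j
    show "norm (hada_matrix \<phi> v u $ i $ j - jac \<phi> 0 $ i $ j) \<le> \<eta>"
      unfolding hada_matrix_def vec_lambda_beta
      by (rule hada_near[OF open_polydisc convex_polydisc holo_\<phi>' that(2,1)]) (rule less_imp_le[OF nj])
  qed
  show ?thesis
  proof (rule that[OF R'])
    fix \<rho> :: real assume \<rho>: "0 < \<rho>" "2 * \<rho> < R'"
    show "kernel_estimate \<phi> R' \<rho> B (norm (det (jac \<phi> 0)) / 2) N L (\<lambda>v. \<chi> i j. A i j v)"
    proof
      show "0 < L" using A by (simp add: presents_def)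
      show "holo_on (polydisc R') (\<lambda>v. (\<chi> i j. A i j v) $ i $ j)" for i j
        using holo_on_subset[OF R1(2) polydisc_mono, of R'] lt by simp
      show "v $ i ^ L = (\<Sum>j\<in>UNIV. (\<chi> i j. A i j v) $ i $ j * \<phi> v $ j ^ N)" if "v \<in> polydisc R'" for v i
        using eq'[OF that] by simp
      show "norm (\<phi> v $ i) \<le> B" if "v \<in> polydisc R'" for v i
        using b1[OF that, of i] by (simp add: B_def)
      show "norm ((\<chi> i j. A i j v) $ i $ j) \<le> B" if "v \<in> polydisc R'" for v i j
        using b2[OF that, of i j] by (simp add: B_def)
      show "norm (partial j (\<lambda>v. \<phi> v $ i) v) \<le> B" if "v \<in> polydisc R'" for v i j
        using b3[OF that, of j i] by (simp add: B_def)
      show "norm (partial k (\<lambda>v. (\<chi> i j. A i j v) $ i $ j) v) \<le> B" if "v \<in> polydisc R'" for v i j k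
        using b4[OF that, of k i j] by (simp add: B_def)
    qed (use \<rho> det_jac_nonzero holo_\<phi>' lower in auto)
  qed
qed

lemma presents_coordinate_powers:
  assumes "0 < N" shows "\<exists>L A. presents UNIV (\<lambda>i v. \<phi> v $ i ^ N) L A"
  using presents_power[OF presents_coordinates germ_\<phi> assms] .

text \<open>\<open>lam_eq\<close> reaches only exponents whose complementary degree is below N.
  Multiplying numerator and denominators by the \<phi>_i^K leaves the complementary degree
  unchanged, hence at most n N0, but raises the bound to N = N0 + K; K = n N0 is enough.\<close>

lemma residue_monomial:
  assumes N0: "0 < N0" and \<alpha>: "\<And>i. \<alpha> i < N0"
  shows "residue UNIV (\<lambda>i v. \<phi> v $ i ^ N0) (\<lambda>v. (\<Prod>i\<in>UNIV. \<phi> v $ i ^ \<alpha> i) * det (jac \<phi> v)) =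
    (if \<forall>i. \<alpha> i = N0 - 1 then 1 else 0)"
proof -
  define K where "K = CARD('n) * N0"
  define N where "N = N0 + K"
  obtain L A where A: "presents UNIV (\<lambda>i v. \<phi> v $ i ^ N) L A"
    using presents_coordinate_powers[of N] N0 by (auto simp: N_def)
  \<comment> \<open>A presentation for the \<phi>_i^N is also one for the \<phi>_i^N0 after the
    factors \<phi>_j^K are absorbed into its columns. This multiplies its determinant by their
    product.\<close>
  define A1 where "A1 i j v = A i j v * \<phi> v $ j ^ K" for i j v
  have A1: "presents UNIV (\<lambda>i v. \<phi> v $ i ^ N0) L A1"
    using A unfolding presents_def A1_def
    by (auto simp: N_def power_add mult.assoc mult.commute[of "_ ^ N0"] intro!: germ_mult germ_power germ_\<phi>)
  have detA1: "det (ext_matrix UNIV A1 v) = det (\<chi> i j. A i j v) * (\<Prod>i\<in>UNIV. \<phi> v $ i ^ K)" for v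
  proof -
    have "ext_matrix UNIV A1 v = (\<chi> i j. A i j v) ** (\<chi> i j. if i = j then \<phi> v $ i ^ K else 0)"
      by (simp add: ext_matrix_def A1_def matrix_matrix_mult_def vec_eq_iff if_distrib[of "\<lambda>x. _ * x"] cong: if_cong)
    moreover have "det (\<chi> i j. if i = j then \<phi> v $ i ^ K else 0) = (\<Prod>i\<in>UNIV. \<phi> v $ i ^ K)"
      by (subst det_diagonal) auto
    ultimately show ?thesis by (simp only: det_mul)
  qed
  obtain R' B \<kappa> where R': "0 < R'" "\<And>\<rho>. 0 < \<rho> \<Longrightarrow> 2 * \<rho> < R' \<Longrightarrow> kernel_estimate \<phi> R' \<rho> B \<kappa> N L (\<lambda>v. \<chi> i j. A i j v)"
    using kernel[OF A] by blast
  have g: "germ UNIV (\<lambda>v. (\<Prod>i\<in>UNIV. \<phi> v $ i ^ \<alpha> i) * det (jac \<phi> v))"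
    by (intro germ_mult germ_prod germ_power germ_\<phi> germ_jac)
  have "eventually (\<lambda>r. r < R' / 2) (at_right (0::real))"
    using R'(1) by (intro eventually_at_right_0_less) auto
  from eventually_conj[OF this residue_torus_mean[OF A1 g]]
  obtain \<rho> where \<rho>: "0 < \<rho>" "2 * \<rho> < R'"
    and res: "residue UNIV (\<lambda>i v. \<phi> v $ i ^ N0) (\<lambda>v. (\<Prod>i\<in>UNIV. \<phi> v $ i ^ \<alpha> i) * det (jac \<phi> v)) =
      torus_mean UNIV \<rho> (\<lambda>v. (\<Prod>i\<in>UNIV. \<phi> v $ i ^ \<alpha> i) * det (jac \<phi> v) * det (ext_matrix UNIV A1 v)
          * (\<Prod>k\<in>UNIV. v $ k / v $ k ^ L))"
    by (rule eventually_at_right_0_obtain) auto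
  interpret kernel_estimate \<phi> R' \<rho> B \<kappa> N L "\<lambda>v. \<chi> i j. A i j v" by (rule R'(2)[OF \<rho>])
  have "residue UNIV (\<lambda>i v. \<phi> v $ i ^ N0) (\<lambda>v. (\<Prod>i\<in>UNIV. \<phi> v $ i ^ \<alpha> i) * det (jac \<phi> v)) = lam (\<lambda>i. \<alpha> i + K)"
    unfolding res lam_def detA1 m0_def by (simp add: power_add prod.distrib ac_simps)
  also have "\<dots> = (if \<forall>i. \<alpha> i + K = N - 1 then 1 else 0)"
  proof (rule lam_eq)
    show "eventually (\<lambda>x. \<exists>u\<in>UU. \<phi> u = x) (nhds 0)"
      using \<phi>_\<psi> local_biholo.near[OF inverse, of "\<rho> / 2"] \<rho> by (auto elim: eventually_elim2)
    show "\<alpha> i + K < N" for i using \<alpha>[of i] by (simp add: N_def)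
    have "(\<Sum>i\<in>(UNIV::'n set). N - Suc (\<alpha> i + K)) \<le> (\<Sum>i\<in>(UNIV::'n set). N0)"
      by (intro sum_mono) (auto simp: N_def)
    also have "\<dots> < N" using N0 by (simp add: N_def K_def)
    finally show "(\<Sum>i\<in>UNIV. N - Suc (\<alpha> i + K)) < N" .
  qed
  also have "\<dots> = (if \<forall>i. \<alpha> i = N0 - 1 then 1 else 0)"
  proof -
    have "\<alpha> i + K = N - 1 \<longleftrightarrow> \<alpha> i = N0 - 1" for i using N0 by (auto simp: N_def)
    then show ?thesis by simp
  qed
  finally show ?thesis .
qed

text \<open>The expansion of \<open>h\<close> modulo the v_i^N is pulled back by \<phi>. Its
  monomials are settled by \<open>residue_monomial\<close>; its ideal part becomes a combination of
  the \<phi>_i^N and has residue 0.\<close>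

theorem residue_change_of_coordinates:
  assumes N: "0 < N" and h: "power_residue UNIV N h r"
  shows "residue UNIV (\<lambda>i v. \<phi> v $ i ^ N) (\<lambda>v. h (\<phi> v) * det (jac \<phi> v)) = r"
proof -
  define E where "E = {\<alpha>. (\<forall>i\<in>(UNIV::'n set). \<alpha> i < N) \<and> (\<forall>i. i \<notin> (UNIV::'n set) \<longrightarrow> \<alpha> i = 0)}"
  have fin: "finite E" unfolding E_def by (rule finite_exponents)
  obtain c where c: "in_germ_ideal UNIV (\<lambda>i v. v $ i ^ N) (\<lambda>v. h v - (\<Sum>\<alpha>\<in>E. c \<alpha> * (\<Prod>i\<in>UNIV. v $ i ^ \<alpha> i)))"
    and r: "r = c (\<lambda>i. N - 1)"
    using h unfolding power_residue_def E_def by auto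
  obtain q where q: "\<And>i. germ UNIV (q i)"
    and hq: "eventually (\<lambda>v. h v - (\<Sum>\<alpha>\<in>E. c \<alpha> * (\<Prod>i\<in>UNIV. v $ i ^ \<alpha> i)) = (\<Sum>i\<in>UNIV. q i v * v $ i ^ N)) (nhds 0)"
    using c unfolding in_germ_ideal_def germ_eq_def by auto
  obtain L A where A: "presents UNIV (\<lambda>i v. \<phi> v $ i ^ N) L A"
    using presents_coordinate_powers[OF N] by blast
  have gm: "germ UNIV (\<lambda>v. (\<Prod>i\<in>UNIV. \<phi> v $ i ^ \<alpha> i) * det (jac \<phi> v))" for \<alpha>
    by (intro germ_mult germ_prod germ_power germ_\<phi> germ_jac)
  have gq: "germ UNIV (\<lambda>v. (q i (\<phi> v) * det (jac \<phi> v)) * \<phi> v $ i ^ N)" for i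
    by (intro germ_mult germ_compose q germ_jac germ_power germ_\<phi>)
  define H1 where "H1 v = (\<Sum>\<alpha>\<in>E. c \<alpha> * ((\<Prod>i\<in>UNIV. \<phi> v $ i ^ \<alpha> i) * det (jac \<phi> v)))" for v
  define H2 where "H2 v = (\<Sum>i\<in>UNIV. 1 * ((q i (\<phi> v) * det (jac \<phi> v)) * \<phi> v $ i ^ N))" for v
  have H1: "germ UNIV H1" and H2: "germ UNIV H2"
    unfolding H1_def[abs_def] H2_def[abs_def] by (intro germ_sum germ_mult[OF germ_const] gm gq)+
  have "eventually (\<lambda>v. h (\<phi> v) - (\<Sum>\<alpha>\<in>E. c \<alpha> * (\<Prod>i\<in>UNIV. \<phi> v $ i ^ \<alpha> i)) = (\<Sum>i\<in>UNIV. q i (\<phi> v) * \<phi> v $ i ^ N)) (nhds 0)"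
  proof -
    obtain r where "0 < r" and r: "\<forall>v\<in>polydisc r. h v - (\<Sum>\<alpha>\<in>E. c \<alpha> * (\<Prod>i\<in>UNIV. v $ i ^ \<alpha> i)) =
        (\<Sum>i\<in>UNIV. q i v * v $ i ^ N)"
      using hq unfolding eventually_nhds_0_polydisc by blast
    show ?thesis by (rule eventually_mono[OF near[OF \<open>0 < r\<close>]]) (use r in blast)
  qed
  then have "germ_eq UNIV (\<lambda>v. 1 * H1 v + H2 v) (\<lambda>v. h (\<phi> v) * det (jac \<phi> v))"
    unfolding germ_eq_def coord_proj_UNIV
  proof eventually_elim
    case (elim v)
    then have eq: "h (\<phi> v) = (\<Sum>\<alpha>\<in>E. c \<alpha> * (\<Prod>i\<in>UNIV. \<phi> v $ i ^ \<alpha> i)) + (\<Sum>i\<in>UNIV. q i (\<phi> v) * \<phi> v $ i ^ N)"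
      by (simp add: algebra_simps)
    show ?case
      unfolding eq H1_def H2_def distrib_right sum_distrib_right by (simp only: ac_simps mult_1)
  qed
  moreover have "germ UNIV (\<lambda>v. 1 * H1 v + H2 v)" by (intro germ_add germ_mult germ_const H1 H2)
  ultimately have "residue UNIV (\<lambda>i v. \<phi> v $ i ^ N) (\<lambda>v. h (\<phi> v) * det (jac \<phi> v)) =
      residue UNIV (\<lambda>i v. \<phi> v $ i ^ N) (\<lambda>v. 1 * H1 v + H2 v)"
    by (rule residue_cong[symmetric])
  also have "\<dots> = residue UNIV (\<lambda>i v. \<phi> v $ i ^ N) H1 + residue UNIV (\<lambda>i v. \<phi> v $ i ^ N) H2"
    using residue_linear[OF H1 H2, of _ 1] by simp
  also have "residue UNIV (\<lambda>i v. \<phi> v $ i ^ N) H2 = 0"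
  proof -
    have "residue UNIV (\<lambda>i v. \<phi> v $ i ^ N) (\<lambda>v. (q i (\<phi> v) * det (jac \<phi> v)) * \<phi> v $ i ^ N) = 0" for i
      by (rule residue_ideal_multiple[OF A]) (auto intro!: germ_mult germ_compose q germ_jac germ_power germ_\<phi>)
    then show ?thesis unfolding H2_def[abs_def] by (subst residue_sum) (use gq in auto)
  qed
  also have "residue UNIV (\<lambda>i v. \<phi> v $ i ^ N) H1 = (\<Sum>\<alpha>\<in>E. c \<alpha> * (if \<forall>i. \<alpha> i = N - 1 then 1 else 0))"
    unfolding H1_def[abs_def]
  proof (subst residue_sum[OF fin gm], intro sum.cong refl)
    fix \<alpha> assume "\<alpha> \<in> E"
    then show "c \<alpha> * residue UNIV (\<lambda>i v. \<phi> v $ i ^ N) (\<lambda>v. (\<Prod>i\<in>UNIV. \<phi> v $ i ^ \<alpha> i) * det (jac \<phi> v)) =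
        c \<alpha> * (if \<forall>i. \<alpha> i = N - 1 then 1 else 0)"
      using residue_monomial[OF N, of \<alpha>] by (simp add: E_def)
  qed
  also have "\<dots> = (\<Sum>\<alpha>\<in>E. if \<alpha> = (\<lambda>i. N - 1) then c \<alpha> else 0)"
    by (intro sum.cong refl) (auto simp: fun_eq_iff)
  also have "\<dots> = r" using N by (subst sum.delta[OF fin]) (auto simp: r E_def)
  finally show ?thesis by simp
qed

end

section \<open>Fixed-point residues\<close>

lemma in_germ_ideal_cong_mult:
  assumes "in_germ_ideal I g (\<lambda>v. X v - Y v)" "in_germ_ideal I g (\<lambda>v. X' v - Y' v)" "germ I X'" "germ I Y"
  shows "in_germ_ideal I g (\<lambda>v. X v * X' v - Y v * Y' v)"
proof -
  have "(\<lambda>v. X v * X' v - Y v * Y' v) = (\<lambda>v. X' v * (X v - Y v) + Y v * (X' v - Y' v))"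
    by (simp add: fun_eq_iff algebra_simps)
  then show ?thesis using in_germ_ideal_add[OF in_germ_ideal_mult[OF assms(1,3)] in_germ_ideal_mult[OF assms(2,4)]]
      by simp
qed

lemma in_germ_ideal_cong_sum:
  assumes "finite S" "\<And>s. s \<in> S \<Longrightarrow> in_germ_ideal I g (\<lambda>v. X s v - Y s v)"
  shows "in_germ_ideal I g (\<lambda>v. (\<Sum>s\<in>S. X s v) - (\<Sum>s\<in>S. Y s v))"
  using assms
proof (induction S rule: finite_induct)
  case (insert s S)
  have "in_germ_ideal I g (\<lambda>v. (X s v - Y s v) + ((\<Sum>s\<in>S. X s v) - (\<Sum>s\<in>S. Y s v)))"
    using insert by (intro in_germ_ideal_add) auto
  then show ?case using insert.hyps by (simp add: algebra_simps)
qed (simp add: in_germ_ideal_0)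

lemma in_germ_ideal_cong_prod:
  assumes "finite S" "\<And>s. s \<in> S \<Longrightarrow> in_germ_ideal I g (\<lambda>v. X s v - Y s v)"
    "\<And>s. s \<in> S \<Longrightarrow> germ I (X s)" "\<And>s. s \<in> S \<Longrightarrow> germ I (Y s)"
  shows "in_germ_ideal I g (\<lambda>v. (\<Prod>s\<in>S. X s v) - (\<Prod>s\<in>S. Y s v))"
  using assms
proof (induction S rule: finite_induct)
  case (insert s S)
  have "in_germ_ideal I g (\<lambda>v. X s v * (\<Prod>s\<in>S. X s v) - Y s v * (\<Prod>s\<in>S. Y s v))"
    by (intro in_germ_ideal_cong_mult insert.IH insert.prems germ_prod) auto
  then show ?case using insert.hyps by simp
qed (simp add: in_germ_ideal_0)

text \<open>Congruence modulo an ideal respects sums and products, hence determinants. This lets the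
  Jacobian be compared with \<open>det (Bm v)\<close> entry by entry.\<close>

lemma in_germ_ideal_cong_det:
  assumes "\<And>i j. in_germ_ideal I g (\<lambda>v. X v $ i $ j - Y v $ i $ j)" "\<And>i j. germ I (\<lambda>v. X v $ i $ j)" "\<And>i j. germ I
      (\<lambda>v. Y v $ i $ j)"
  shows "in_germ_ideal I g (\<lambda>v. det (X v) - det (Y v))"
  unfolding det_def
  by (intro in_germ_ideal_cong_sum in_germ_ideal_cong_mult in_germ_ideal_cong_prod assms germ_prod germ_const)
    (auto simp: in_germ_ideal_0 finite_permutations)

lemma residue_in_ideal:
  assumes "presents I g N A" "\<And>j. j \<in> I \<Longrightarrow> germ I (g j)" "in_germ_ideal I g h" "germ I h"
  shows "residue I g h = 0"
proof -
  obtain q where q: "\<And>i. i \<in> I \<Longrightarrow> germ I (q i)" "germ_eq I h (\<lambda>v. \<Sum>i\<in>I. q i v * g i v)"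
    using assms(3) unfolding in_germ_ideal_def by blast
  have "residue I g h = residue I g (\<lambda>v. \<Sum>i\<in>I. 1 * (q i v * g i v))"
    using residue_cong[OF q(2) assms(4)] by simp
  also have "\<dots> = (\<Sum>i\<in>I. 1 * residue I g (\<lambda>v. q i v * g i v))"
    by (rule residue_sum) (use q(1) assms(2) in auto)
  also have "\<dots> = 0"
    using residue_ideal_multiple[OF assms(1) q(1) assms(2)] by (intro sum.neutral) auto
  finally show ?thesis .
qed

text \<open>The weight t arises from differentiating t times the partial derivative along the
  segment; these are the coefficients with which \<open>partial j g a - hada j g a b\<close> is
  divided by a - b.\<close>

definition hada2 :: "'n \<Rightarrow> 'n \<Rightarrow> (complex ^ 'n::finite \<Rightarrow> complex) \<Rightarrow> complex ^ 'n \<Rightarrow> complex ^ 'n \<Rightarrow> complex" where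
  "hada2 j k g a b = integral {0..1} (\<lambda>t. of_real t * partial k (partial j g) (b + of_real t *s (a - b)))"

text \<open>Integration by parts along the segment from \<open>b\<close> to \<open>a\<close>.\<close>

lemma hadamard2:
  assumes U: "open U" "convex U" "holo_on U g" "a \<in> U" "b \<in> U"
  shows "partial j g a - hada j g a b = (\<Sum>k\<in>UNIV. (a $ k - b $ k) * hada2 j k g a b)"
proof -
  let ?p = "partial j g" and ?s = "\<lambda>t. b + of_real t *s (a - b)"
  have p: "holo_on U ?p" by (rule holo_on_partial[OF U(1,3)])
  let ?f = "\<lambda>t. ?p (?s t) + (\<Sum>k\<in>UNIV. (a $ k - b $ k) * (of_real t * partial k ?p (?s t)))"
  have c1: "continuous_on {0..1} (\<lambda>t. ?p (?s t))" by (rule continuous_on_segment_partial[OF U])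
  have c2: "continuous_on {0..1} (\<lambda>t. (a $ k - b $ k) * (of_real t * partial k ?p (?s t)))" for k
    by (intro continuous_on_mult continuous_on_const continuous_on_of_real continuous_on_id
        continuous_on_segment_partial[OF U(1,2) p U(4,5)])
  have "(?f has_integral of_real 1 * ?p (?s 1) - of_real 0 * ?p (?s 0)) {0..1::real}"
  proof (rule fundamental_theorem_of_calculus)
    fix t :: real assume t: "t \<in> {0..1}"
    have "((\<lambda>\<xi>. ?p (b + \<xi> *s (a - b))) has_field_derivative
        (\<Sum>k\<in>UNIV. (a - b) $ k * partial k ?p (?s t))) (at (of_real t))"
      using t U segment_convex
      by (intro has_field_derivative_line holo_on_has_derivative_partial[OF p])
        (auto simp: sum_distrib_left mult.assoc)
    then have "((\<lambda>\<xi>. \<xi> * ?p (b + \<xi> *s (a - b))) has_field_derivative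
        (of_real t * (\<Sum>k\<in>UNIV. (a - b) $ k * partial k ?p (?s t)) + 1 * ?p (?s t))) (at (of_real t))"
      by (intro DERIV_mult' DERIV_ident)
    then have "((\<lambda>t. of_real t * ?p (?s t)) has_vector_derivative
        (of_real t * (\<Sum>k\<in>UNIV. (a - b) $ k * partial k ?p (?s t)) + 1 * ?p (?s t))) (at t within {0..1})"
      by (rule has_vector_derivative_real_field)
    then show "((\<lambda>t. of_real t * ?p (?s t)) has_vector_derivative ?f t) (at t within {0..1})"
      by (simp add: sum_distrib_left ac_simps)
  qed simp
  then have "?p a = integral {0..1} ?f" by (simp add: integral_unique)
  also have "\<dots> = hada j g a b + (\<Sum>k\<in>UNIV. integral {0..1} (\<lambda>t. (a $ k - b $ k) * (of_real t * partial k ?p (?s t))))"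
    unfolding hada_def
    by (subst integral_add[OF integrable_continuous_interval[OF c1] integrable_continuous_interval[OF
        continuous_on_sum[OF c2]]])
      (simp_all only: integral_sum[OF finite integrable_continuous_interval[OF c2]])
  also have "(\<Sum>k\<in>UNIV. integral {0..1} (\<lambda>t. (a $ k - b $ k) * (of_real t * partial k ?p (?s t)))) =
      (\<Sum>k\<in>UNIV. (a $ k - b $ k) * hada2 j k g a b)"
    unfolding hada2_def by (simp only: integral_mult_right)
  finally show ?thesis by simp
qed

lemma holo_on_hada2:
  assumes U: "open U" "convex U" "holo_on U g" and V: "open V"
    and a: "\<And>i. holo_on V (\<lambda>y. a y $ i)" and b: "\<And>i. holo_on V (\<lambda>y. b y $ i)"
    and im: "a ` V \<subseteq> U" "b ` V \<subseteq> U"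
  shows "holo_on V (\<lambda>y. hada2 j k g (a y) (b y))"
  unfolding hada2_def
proof (rule holo_on_integral[OF V])
  have p: "holo_on U (partial k (partial j g))"
    by (intro holo_on_partial U(1,3))
  have s: "b y + of_real t *s (a y - b y) \<in> U" if "y \<in> V" "0 \<le> t" "t \<le> 1" for y t
    using that im segment_convex[OF U(2)] by blast
  have ca: "continuous_on V a" and cb: "continuous_on V b"
    using a b by (auto intro!: continuous_on_vec_componentwise holo_on_imp_continuous_on)
  have "continuous_on (V \<times> {0..1::real}) (\<lambda>p. of_real (snd p) * partial k (partial j g) (b (fst p) + of_real (snd p)
      *s (a (fst p) - b (fst p))))"
    by (intro continuous_on_mult continuous_on_of_real continuous_on_snd continuous_on_id
        continuous_on_compose2[OF holo_on_imp_continuous_on[OF p]])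
      (use s in \<open>auto intro!: continuous_intros continuous_on_compose2[OF ca] continuous_on_compose2[OF cb]\<close>)
  then show "continuous_on (V \<times> {0..1}) (\<lambda>(y, t). of_real t * partial k (partial j g) (b y + of_real t *s (a y - b y)))"
    by (simp add: case_prod_beta)
  fix t :: real assume t: "t \<in> {0..1}"
  show "holo_on V (\<lambda>y. of_real t * partial k (partial j g) (b y + of_real t *s (a y - b y)))"
    by (intro holo_on_mult holo_on_const holo_on_compose[OF p])
      (use s t a b in \<open>auto intro!: holo_on_add holo_on_mult holo_on_diff\<close>)
qed

lemma germ_inverse:
  assumes g: "germ UNIV g" and nz: "g 0 \<noteq> 0" shows "germ UNIV (\<lambda>v. inverse (g v))"
proof -
  obtain r where r: "0 < r" "holo_on (polydisc r) g"
    using g unfolding germ_UNIV_iff by (rule eventually_at_right_0_obtain)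
  have "(g \<longlongrightarrow> g 0) (nhds 0)"
    using isCont_holo[OF r] by (simp add: continuous_at tendsto_nhds_iff)
  then have "eventually (\<lambda>v. g v \<noteq> 0) (nhds 0)" using nz by (rule tendsto_imp_eventually_ne)
  then obtain r' where r': "r' > 0" "\<forall>v\<in>polydisc r'. g v \<noteq> 0"
    unfolding eventually_nhds_0_polydisc by blast
  have "holo_on (polydisc (min r r')) (\<lambda>v. inverse (g v))"
    by (rule holo_on_inverse[OF holo_on_subset[OF r(2) polydisc_mono]])
      (use r'(2) polydisc_mono[of "min r r'" r'] in auto)
  then show ?thesis using r(1) r'(1) by (intro germ_UNIV_I) auto
qed

text \<open>The maps \<open>F\<close> and \<open>G\<close> stand for one self-map read in two
  coordinate systems, with \<phi> as the transition between them.\<close>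

locale conjugate_maps = local_biholo \<phi> \<psi> R for \<phi> \<psi> :: "complex ^ 'n::finite \<Rightarrow> complex ^ 'n" and R +
  fixes F G :: "complex ^ 'n \<Rightarrow> complex ^ 'n"
  assumes holo_F: "\<And>i. holo_on (polydisc R) (\<lambda>v. F v $ i)" and F_0: "F 0 = 0"
    and conj: "eventually (\<lambda>v. \<phi> (F v) = G (\<phi> v)) (nhds 0)"
begin

definition Bm :: "complex ^ 'n \<Rightarrow> complex ^ 'n ^ 'n" where "Bm v = hada_matrix \<phi> v (F v)"

lemma F_near:
  obtains r where "0 < r" "r \<le> R" "\<And>v. v \<in> polydisc r \<Longrightarrow> F v \<in> polydisc R"
proof -
  obtain r where r: "0 < r" "\<forall>v\<in>polydisc r. F v \<in> polydisc R"
    using holo_map_near_0[OF R holo_F F_0 R] unfolding eventually_nhds_0_polydisc by auto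
  show ?thesis
    by (rule that[of "min r R"]) (use r R polydisc_mono[of "min r R" r] in auto)
qed

lemma germ_Bm: "germ UNIV (\<lambda>v. Bm v $ i $ j)"
  and Bm_jac: "in_germ_ideal UNIV (\<lambda>i v. v $ i - F v $ i) (\<lambda>v. jac \<phi> v $ i $ j - Bm v $ i $ j)"
proof -
  obtain r where r: "0 < r" "r \<le> R" "\<And>v. v \<in> polydisc r \<Longrightarrow> F v \<in> polydisc R"
    using F_near by blast
  have sub: "v \<in> polydisc R" if "v \<in> polydisc r" for v :: "complex ^ 'n" using polydisc_mono[OF r(2)] that by auto
  have hF: "holo_on (polydisc r) (\<lambda>v. F v $ i)" for i
    by (rule holo_on_subset[OF holo_F polydisc_mono[OF r(2)]])
  have "holo_on (polydisc r) (\<lambda>v. hada j (\<lambda>v. \<phi> v $ i) v (F v))"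
    by (rule holo_on_hada[OF open_polydisc convex_polydisc holo_\<phi> open_polydisc]) (use r sub hF in auto)
  then show "germ UNIV (\<lambda>v. Bm v $ i $ j)"
    unfolding Bm_def hada_matrix_def using r(1) by (intro germ_UNIV_I) auto
  have "holo_on (polydisc r) (\<lambda>v. hada2 j k (\<lambda>v. \<phi> v $ i) v (F v))" for k
    by (rule holo_on_hada2[OF open_polydisc convex_polydisc holo_\<phi> open_polydisc]) (use r sub hF in auto)
  then have "germ UNIV (\<lambda>v. hada2 j k (\<lambda>v. \<phi> v $ i) v (F v))" for k
    using r(1) by (intro germ_UNIV_I)
  moreover have "germ_eq UNIV (\<lambda>v. jac \<phi> v $ i $ j - Bm v $ i $ j)
      (\<lambda>v. \<Sum>k\<in>UNIV. hada2 j k (\<lambda>v. \<phi> v $ i) v (F v) * (v $ k - F v $ k))"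
    unfolding germ_eq_def eventually_nhds_0_polydisc coord_proj_UNIV
  proof (intro exI[of _ r] conjI ballI r(1))
    fix v :: "complex ^ 'n" assume v: "v \<in> polydisc r"
    show "jac \<phi> v $ i $ j - Bm v $ i $ j = (\<Sum>k\<in>UNIV. hada2 j k (\<lambda>v. \<phi> v $ i) v (F v) * (v $ k - F v $ k))"
      using hadamard2[OF open_polydisc convex_polydisc holo_\<phi>[of i] sub[OF v] r(3)[OF v], of j]
      by (simp add: jac_def Bm_def hada_matrix_def mult.commute)
  qed
  ultimately show "in_germ_ideal UNIV (\<lambda>i v. v $ i - F v $ i) (\<lambda>v. jac \<phi> v $ i $ j - Bm v $ i $ j)"
    unfolding in_germ_ideal_def by (intro exI[of _ "\<lambda>k v. hada2 j k (\<lambda>v. \<phi> v $ i) v (F v)"]) auto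
qed

lemma Bm_0: "det (Bm 0) \<noteq> 0"
proof -
  have "Bm 0 = jac \<phi> 0" by (simp add: Bm_def F_0 hada_matrix_def jac_def)
  then show ?thesis using det_jac_nonzero by simp
qed

lemma germ_F: "germ UNIV (\<lambda>v. F v $ i)"
  by (rule germ_UNIV_I[OF R holo_F])

lemma germ_diff: "germ I g \<Longrightarrow> germ I h \<Longrightarrow> germ I (\<lambda>v. g v - h v)"
  unfolding germ_iff by (erule (1) eventually_elim2) (rule holo_on_diff)

text \<open>A presentation for v - F(v) is the product of \<open>D\<close> for the \<phi>_i^N, of
  \<open>A\<close> at \<phi>(v), and of \<open>Bm\<close>. Since determinants multiply, the residue
  of h(\<phi>) det A(\<phi>) J with denominators \<phi>_i^N, known from the change of coordinates,
  is also the residue of h(\<phi>) J / det Bm with denominators v_i - F_i(v). There J / det Bm is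
  congruent to 1.\<close>

lemma conjugate_residue:
  assumes A: "presents UNIV (\<lambda>i v. v $ i - G v $ i) N A" and h: "germ UNIV h"
  shows "\<exists>L C. presents UNIV (\<lambda>i v. v $ i - F v $ i) L C"
    and "residue UNIV (\<lambda>i v. v $ i - G v $ i) h = residue UNIV (\<lambda>i v. v $ i - F v $ i) (\<lambda>v. h (\<phi> v))"
proof -
  let ?g = "\<lambda>i v. v $ i - F v $ i"
  have N: "0 < N" and gA: "\<And>i j. germ UNIV (A i j)" using A by (auto simp: presents_def)
  obtain L D where D: "presents UNIV (\<lambda>i v. \<phi> v $ i ^ N) L D"
    using presents_coordinate_powers[OF N] by blast
  define M where "M v = (\<chi> i j. D i j v) ** ((\<chi> i j. A i j (\<phi> v)) ** Bm v)" for v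
  have M_nth: "M v $ i $ j = (\<Sum>k\<in>UNIV. D i k v * (\<Sum>l\<in>UNIV. A k l (\<phi> v) * Bm v $ l $ j))" for v i j
    by (simp add: M_def matrix_matrix_mult_def)
  have gM: "germ UNIV (\<lambda>v. M v $ i $ j)" for i j
    unfolding M_nth using D by (intro germ_sum germ_mult germ_Bm germ_compose gA) (auto simp: presents_def)
  have C: "presents UNIV ?g L (\<lambda>i j v. M v $ i $ j)"
    unfolding presents_def
  proof (intro conjI ballI gM)
    show "0 < L" using D by (simp add: presents_def)
    fix i
    have "eventually (\<lambda>v. \<forall>k. v $ k ^ N = (\<Sum>j\<in>UNIV. A k j v * (v $ j - G v $ j))) (nhds 0)"
      using A unfolding presents_def germ_eq_def by (intro eventually_all_finite) auto
    then obtain r where r: "0 < r" "\<And>v k. v \<in> polydisc r \<Longrightarrow> v $ k ^ N = (\<Sum>j\<in>UNIV. A k j v * (v $ j - G v $ j))"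
      unfolding eventually_nhds_0_polydisc by blast
    obtain r' where r': "0 < r'" "r' \<le> R" "\<And>v. v \<in> polydisc r' \<Longrightarrow> F v \<in> polydisc R"
      using F_near by blast
    have "eventually (\<lambda>v. v $ i ^ L = (\<Sum>k\<in>UNIV. D i k v * \<phi> v $ k ^ N)) (nhds 0)"
      using D unfolding presents_def germ_eq_def by auto
    moreover have "eventually (\<lambda>v. v \<in> polydisc r') (nhds 0)"
      using r'(1) by (intro eventually_nhds_in_open open_polydisc) auto
    ultimately have "eventually (\<lambda>v. v $ i ^ L = (\<Sum>j\<in>UNIV. M v $ i $ j * (v $ j - F v $ j))) (nhds 0)"
      using near[OF r(1)] conj
    proof eventually_elim
      case (elim v)
      have vR: "v \<in> polydisc R" using polydisc_mono[OF r'(2)] elim(2) by auto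
      have B: "\<phi> v $ j - G (\<phi> v) $ j = (\<Sum>l\<in>UNIV. Bm v $ j $ l * (v $ l - F v $ l))" for j
        using hadamard[OF open_polydisc convex_polydisc holo_\<phi> vR r'(3)[OF elim(2)], of j]
        by (simp add: elim(4)[symmetric] Bm_def hada_matrix_def mult.commute)
      have "v $ i ^ L = (\<Sum>k\<in>UNIV. D i k v * (\<Sum>j\<in>UNIV. A k j (\<phi> v) * (\<Sum>l\<in>UNIV. Bm v $ j $ l * (v $ l - F v $ l))))"
        unfolding elim(1) r(2)[OF elim(3)] B ..
      also have "\<dots> = (M v *v (v - F v)) $ i"
        unfolding M_def matrix_vector_mul_assoc[symmetric] by (simp add: matrix_vector_mult_def)
      also have "\<dots> = (\<Sum>j\<in>UNIV. M v $ i $ j * (v $ j - F v $ j))"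
        by (simp add: matrix_vector_mult_def)
      finally show ?case .
    qed
    then show "germ_eq UNIV (\<lambda>v. v $ i ^ L) (\<lambda>v. \<Sum>j\<in>UNIV. M v $ i $ j * (v $ j - F v $ j))"
      by (simp add: germ_eq_def)
  qed
  then show "\<exists>L C. presents UNIV ?g L C" by blast
  define J where "J v = det (jac \<phi> v)" for v
  define e where "e v = inverse (det (Bm v))" for v
  have ge: "germ UNIV e"
    unfolding e_def[abs_def] by (rule germ_inverse[OF germ_det[OF germ_Bm] Bm_0])
  have gh: "germ UNIV (\<lambda>v. h (\<phi> v))" by (rule germ_compose[OF h])
  have gJ: "germ UNIV J" unfolding J_def[abs_def] by (rule germ_jac)
  have gg: "germ UNIV (?g j)" for j by (intro germ_diff germ_coord germ_F)
  let ?hA = "\<lambda>v. h v * det (ext_matrix UNIV A v)"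
  have ghA: "germ UNIV ?hA" by (intro germ_mult h germ_ext_matrix[OF A])
  obtain r where r: "power_residue UNIV N ?hA r"
    using expandable_germ[OF ghA, of N] unfolding expandable_def by blast
  have "is_residue UNIV (\<lambda>i v. v $ i - G v $ i) h r"
    using A r unfolding is_residue_iff by blast
  then have res_G: "residue UNIV (\<lambda>i v. v $ i - G v $ i) h = r"
    unfolding residue_def using is_residue_unique[OF _ _ h] by (auto intro!: the_equality)
  have CC: "residue UNIV (\<lambda>i v. \<phi> v $ i ^ N) (\<lambda>v. ?hA (\<phi> v) * J v) = r"
    unfolding J_def using residue_change_of_coordinates[OF N r] .
  have detM: "det (ext_matrix UNIV (\<lambda>i j v. M v $ i $ j) v) =
      det (ext_matrix UNIV D v) * (det (ext_matrix UNIV A (\<phi> v)) * det (Bm v))" for v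
    by (simp add: ext_matrix_def M_def det_mul)
  have g1: "germ UNIV (\<lambda>v. ?hA (\<phi> v) * J v)"
    by (intro germ_mult[OF germ_compose[OF ghA] gJ])
  have g2: "germ UNIV (\<lambda>v. h (\<phi> v) * J v * e v)"
    by (intro germ_mult gh gJ ge)
  have nzB: "eventually (\<lambda>v. det (Bm v) \<noteq> 0) (nhds 0)"
  proof -
    obtain r where r: "0 < r" "holo_on (polydisc r) (\<lambda>v. det (Bm v))"
      using germ_det[OF germ_Bm] unfolding germ_UNIV_iff by (rule eventually_at_right_0_obtain)
    have "((\<lambda>v. det (Bm v)) \<longlongrightarrow> det (Bm 0)) (nhds 0)"
      using isCont_holo[OF r] by (simp add: continuous_at tendsto_nhds_iff)
    then show ?thesis using Bm_0 by (rule tendsto_imp_eventually_ne)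
  qed
  have "eventually (\<lambda>\<rho>. torus_mean UNIV \<rho> (\<lambda>v. ?hA (\<phi> v) * J v * det (ext_matrix UNIV D v) * (\<Prod>k\<in>UNIV. v $ k / v $ k
      ^ L)) =
      torus_mean UNIV \<rho> (\<lambda>v. h (\<phi> v) * J v * e v * det (ext_matrix UNIV (\<lambda>i j v. M v $ i $ j) v)
          * (\<Prod>k\<in>UNIV. v $ k / v $ k ^ L))) (at_right 0)"
    using eventually_at_right_0_polydisc[OF nzB]
  proof (rule eventually_at_right_0_shrink)
    fix \<rho> R' :: real assume \<rho>: "0 < \<rho>" "\<rho> < R'" and nz: "\<forall>v\<in>polydisc R'. det (Bm v) \<noteq> 0"
    show "torus_mean UNIV \<rho> (\<lambda>v. ?hA (\<phi> v) * J v * det (ext_matrix UNIV D v) * (\<Prod>k\<in>UNIV. v $ k / v $ k ^ L)) =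
      torus_mean UNIV \<rho> (\<lambda>v. h (\<phi> v) * J v * e v * det (ext_matrix UNIV (\<lambda>i j v. M v $ i $ j) v)
          * (\<Prod>k\<in>UNIV. v $ k / v $ k ^ L))"
    proof (rule torus_mean_cong[OF \<rho>(1)])
      fix v :: "complex ^ 'n" assume "v \<in> torus \<rho> UNIV"
      then have "det (Bm v) \<noteq> 0" using nz torus_subset_polydisc[OF \<rho>] by blast
      then show "?hA (\<phi> v) * J v * det (ext_matrix UNIV D v) * (\<Prod>k\<in>UNIV. v $ k / v $ k ^ L) =
          h (\<phi> v) * J v * e v * det (ext_matrix UNIV (\<lambda>i j v. M v $ i $ j) v) * (\<Prod>k\<in>UNIV. v $ k / v $ k ^ L)"
        unfolding detM e_def by simp
    qed
  qed
  with residue_torus_mean[OF D g1] residue_torus_mean[OF C g2]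
  have "eventually (\<lambda>_. residue UNIV (\<lambda>i v. \<phi> v $ i ^ N) (\<lambda>v. ?hA (\<phi> v) * J v) =
      residue UNIV ?g (\<lambda>v. h (\<phi> v) * J v * e v)) (at_right (0::real))"
    by eventually_elim simp
  then have r_eq: "r = residue UNIV ?g (\<lambda>v. h (\<phi> v) * J v * e v)"
    using CC eventually_at_right_0_const by auto
  \<comment> \<open>Near 0, h(\<phi>) J / det Bm equals h(\<phi>) plus \<open>?d\<close>, and
    \<open>?d\<close> lies in the ideal because J and det Bm are congruent.\<close>
  let ?d = "\<lambda>v. (h (\<phi> v) * e v) * (J v - det (Bm v))"
  have id: "in_germ_ideal UNIV ?g ?d"
    unfolding J_def
    by (intro in_germ_ideal_mult in_germ_ideal_cong_det Bm_jac germ_Bm germ_mult gh ge)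
      (auto simp: jac_def intro: germ_UNIV_I[OF R] holo_on_partial[OF open_polydisc holo_\<phi>])
  have gd: "germ UNIV ?d" by (intro germ_mult germ_diff gh ge gJ germ_det germ_Bm)
  have "residue UNIV ?g (\<lambda>v. h (\<phi> v) * J v * e v) = residue UNIV ?g (\<lambda>v. 1 * ?d v + h (\<phi> v))"
  proof (rule residue_cong[OF _ g2])
    show "germ_eq UNIV (\<lambda>v. h (\<phi> v) * J v * e v) (\<lambda>v. 1 * ?d v + h (\<phi> v))"
      unfolding germ_eq_def coord_proj_UNIV using nzB
      by eventually_elim (simp add: e_def field_simps)
  qed
  also have "\<dots> = 1 * residue UNIV ?g ?d + residue UNIV ?g (\<lambda>v. h (\<phi> v))"
    by (rule residue_linear[OF gd gh])
  also have "residue UNIV ?g ?d = 0"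
    by (rule residue_in_ideal[OF C gg id gd])
  finally show "residue UNIV (\<lambda>i v. v $ i - G v $ i) h = residue UNIV ?g (\<lambda>v. h (\<phi> v))"
    using res_G r_eq by simp
qed

end

section \<open>Reduction to a coordinate subspace\<close>

text \<open>Rows in \<open>K\<close> are multiples of unit vectors, so only permutations fixing
  \<open>K\<close> pointwise contribute, on either side.\<close>

lemma det_rows_block:
  fixes M :: "'c::comm_ring_1 ^ 'n::finite ^ 'n"
  assumes M: "\<And>i j. i \<in> K \<Longrightarrow> M $ i $ j = (if i = j then c i else 0)"
  shows "det M = (\<Prod>i\<in>K. c i) *
    det ((\<chi> i j. if i \<in> -K \<and> j \<in> -K then M $ i $ j else if i = j then 1 else 0) :: 'c ^ 'n ^ 'n)"
proof -
  let ?E = "(\<chi> i j. if i \<in> -K \<and> j \<in> -K then M $ i $ j else if i = j then 1 else 0) :: 'c ^ 'n ^ 'n"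
  have "(\<Prod>i\<in>UNIV. M $ i $ p i) = (\<Prod>i\<in>K. c i) * (\<Prod>i\<in>UNIV. ?E $ i $ p i)" if p: "p permutes UNIV" for p
  proof (cases "\<forall>i\<in>K. p i = i")
    case True
    have nK: "p i \<notin> K" if "i \<notin> K" for i
    proof
      assume "p i \<in> K"
      then have "p (p i) = p i" using True by blast
      then have "p i = i" using permutes_inj[OF p] by (simp add: inj_eq)
      then show False using \<open>p i \<in> K\<close> that by simp
    qed
    have split: "(\<Prod>i\<in>UNIV. X i) = (\<Prod>i\<in>K. X i) * (\<Prod>i\<in>-K. X i)" for X :: "'n \<Rightarrow> 'c"
      using prod.union_disjoint[of K "-K" X] by simp
    show ?thesis unfolding split using True nK by (simp add: M)
  next
    case False
    then obtain i where i: "i \<in> K" "p i \<noteq> i" by blast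
    have "(\<Prod>i\<in>UNIV. M $ i $ p i) = 0" by (rule prod_zero[OF finite bexI[of _ i]]) (use i in \<open>auto simp: M\<close>)
    moreover have "(\<Prod>i\<in>UNIV. ?E $ i $ p i) = 0" by (rule prod_zero[OF finite bexI[of _ i]]) (use i in auto)
    ultimately show ?thesis by simp
  qed
  then show ?thesis
    unfolding det_def sum_distrib_left by (intro sum.cong refl) (simp add: mult.left_commute)
qed

lemma germ_coord_proj:
  assumes "germ UNIV g" shows "germ I g" "germ UNIV (\<lambda>v. g (coord_proj I v))"
proof -
  have *: "eventually (\<lambda>R. 0 < R \<and> holo_on (polydisc R) g) (at_right 0)"
    using assms unfolding germ_UNIV_iff by (intro eventually_conj eventually_at_right_less)
  have "eventually (\<lambda>R. holo_on (polydisc R) (\<lambda>v. g (coord_proj I v))) (at_right 0)"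
    using *
  proof eventually_elim
    case (elim R)
    show ?case
      by (rule holo_on_compose[OF elim[THEN conjunct2] holo_on_coord_proj])
        (use elim coord_proj_polydisc in auto)
  qed
  then show "germ I g" "germ UNIV (\<lambda>v. g (coord_proj I v))" unfolding germ_iff by simp_all
qed

lemma germ_eq_UNIV: "germ_eq UNIV g h \<longleftrightarrow> eventually (\<lambda>v. g v = h v) (nhds 0)"
  by (simp add: germ_eq_def)

lemma eventually_coord_proj:
  assumes "eventually P (nhds (0 :: complex ^ 'n::finite))" shows "eventually (\<lambda>v. P (coord_proj I v)) (nhds 0)"
proof -
  obtain R where "0 < R" "\<forall>v\<in>polydisc R. P v" using assms unfolding eventually_nhds_0_polydisc by blast
  then show ?thesis unfolding eventually_nhds_0_polydisc by (intro exI[of _ R]) (auto intro: coord_proj_polydisc)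
qed

lemma germ_eq_restrict: "germ_eq UNIV g h \<Longrightarrow> germ_eq I g h"
  unfolding germ_eq_UNIV unfolding germ_eq_def by (rule eventually_coord_proj)

text \<open>The fixed-point equations in adapted coordinates, with \<open>b\<close> in the role of 1
  - a_i; \<open>b_0\<close> is what normal non-resonance provides.\<close>

locale stratified_map =
  fixes F :: "complex ^ 'n::finite \<Rightarrow> complex ^ 'n" and K :: "'n set" and b :: "'n \<Rightarrow> complex ^ 'n \<Rightarrow> complex"
  assumes germ_F: "\<And>i. germ UNIV (\<lambda>v. F v $ i)" and germ_b: "\<And>i. i \<in> K \<Longrightarrow> germ UNIV (b i)"
    and b_0: "\<And>i. i \<in> K \<Longrightarrow> b i 0 \<noteq> 0"
    and F_K: "\<And>i. i \<in> K \<Longrightarrow> eventually (\<lambda>v. v $ i - F v $ i = v $ i * b i v) (nhds 0)"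
begin

definition g :: "'n \<Rightarrow> complex ^ 'n \<Rightarrow> complex" where "g i v = v $ i - F v $ i"

lemma germ_g: "germ UNIV (g i)"
  unfolding g_def[abs_def] germ_iff
  using germ_F[of i] by (auto simp: germ_UNIV_iff elim!: eventually_mono intro: holo_on_diff)

text \<open>On z = 0 the equations z_j b_j vanish, so the columns in \<open>K\<close> drop out.
  Together with \<open>presents_extend\<close> this shows that both sides are presented or neither
  is.\<close>

lemma presents_restrict:
  assumes "presents UNIV g N A" shows "presents (-K) g N A"
  unfolding presents_def
proof (intro conjI ballI)
  show "0 < N" "germ (-K) (A i j)" for i j using assms germ_coord_proj(1) by (auto simp: presents_def)
  fix i assume "i \<in> -K"
  have "eventually (\<lambda>v. \<forall>j\<in>K. g j v = v $ j * b j v) (nhds 0)"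
    using F_K by (intro eventually_ball_finite) (auto simp: g_def)
  then have 1: "eventually (\<lambda>v. \<forall>j\<in>K. g j (coord_proj (-K) v) =
      coord_proj (-K) v $ j * b j (coord_proj (-K) v)) (nhds 0)"
    by (rule eventually_coord_proj)
  have "germ_eq UNIV (\<lambda>v. v $ i ^ N) (\<lambda>v. \<Sum>j\<in>UNIV. A i j v * g j v)"
    using assms unfolding presents_def by blast
  then have "germ_eq (-K) (\<lambda>v. v $ i ^ N) (\<lambda>v. \<Sum>j\<in>UNIV. A i j v * g j v)"
    by (rule germ_eq_restrict)
  with 1 show "germ_eq (-K) (\<lambda>v. v $ i ^ N) (\<lambda>v. \<Sum>j\<in>-K. A i j v * g j v)"
    unfolding germ_eq_def
  proof eventually_elim
    case (elim v)
    have "(\<Sum>j\<in>UNIV. A i j (coord_proj (-K) v) * g j (coord_proj (-K) v)) =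
        (\<Sum>j\<in>-K. A i j (coord_proj (-K) v) * g j (coord_proj (-K) v))"
      by (rule sum.mono_neutral_right) (use elim(1) in auto)
    then show ?case using elim(2) by simp
  qed
qed

definition c :: "'n \<Rightarrow> 'n \<Rightarrow> complex ^ 'n \<Rightarrow> complex" where
  "c j l v = hada l (g j) v (coord_proj (-K) v)"

lemma c: "germ UNIV (c j l)"
  "eventually (\<lambda>v. g j (coord_proj (-K) v) = g j v - (\<Sum>l\<in>K. v $ l * c j l v)) (nhds 0)"
proof -
  obtain R where R: "0 < R" "holo_on (polydisc R) (g j)"
    using germ_g[of j] unfolding germ_UNIV_iff by (rule eventually_at_right_0_obtain)
  have "holo_on (polydisc R) (c j l)"
    unfolding c_def[abs_def]
    by (rule holo_on_hada[OF open_polydisc convex_polydisc R(2) open_polydisc holo_on_coord holo_on_coord_proj])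
      (use coord_proj_polydisc[OF R(1)] in auto)
  then show "germ UNIV (c j l)" by (rule germ_UNIV_I[OF R(1)])
  have "g j (coord_proj (-K) v) = g j v - (\<Sum>l\<in>K. v $ l * c j l v)" if v: "v \<in> polydisc R" for v
  proof -
    have "g j v - g j (coord_proj (-K) v) = (\<Sum>l\<in>UNIV. (v $ l - coord_proj (-K) v $ l) * c j l v)"
      unfolding c_def by (rule hadamard[OF open_polydisc convex_polydisc R(2) v coord_proj_polydisc[OF R(1) v]])
    also have "\<dots> = (\<Sum>l\<in>K. v $ l * c j l v)"
      by (rule sum.mono_neutral_cong_right) auto
    finally show ?thesis by (simp add: algebra_simps)
  qed
  then show "eventually (\<lambda>v. g j (coord_proj (-K) v) = g j v - (\<Sum>l\<in>K. v $ l * c j l v)) (nhds 0)"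
    unfolding eventually_nhds_0_polydisc using R(1) by blast
qed

text \<open>For i in \<open>K\<close>, z_i^N = z_i^(N - 1) b_i^(-1) g_i. For i outside
  \<open>K\<close>, w_i^N is a combination of the g_k(0, w); substituting g_k(0, w) = g_k - sum_l
  z_l c_kl and z_l = g_l / b_l gives the entries in the columns of \<open>K\<close>.\<close>

definition ext :: "nat \<Rightarrow> ('n \<Rightarrow> 'n \<Rightarrow> complex ^ 'n \<Rightarrow> complex) \<Rightarrow> 'n \<Rightarrow> 'n \<Rightarrow> complex ^ 'n \<Rightarrow> complex" where
  "ext N A i j v =
     (if i \<in> K then (if i = j then v $ i ^ (N - 1) * inverse (b i v) else 0)
      else if j \<in> K then - (\<Sum>k\<in>-K. A i k (coord_proj (-K) v) * c k j v) * inverse (b j v)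
      else A i j (coord_proj (-K) v))"

lemma b_nonzero: "i \<in> K \<Longrightarrow> eventually (\<lambda>v. b i v \<noteq> 0) (nhds 0)"
proof -
  assume i: "i \<in> K"
  obtain r where r: "0 < r" "holo_on (polydisc r) (b i)"
    using germ_b[OF i] unfolding germ_UNIV_iff by (rule eventually_at_right_0_obtain)
  have "(b i \<longlongrightarrow> b i 0) (nhds 0)"
    using isCont_holo[OF r] by (simp add: continuous_at tendsto_nhds_iff)
  then show ?thesis using b_0[OF i] by (rule tendsto_imp_eventually_ne)
qed

lemma presents_extend:
  assumes A: "presents (-K) g N A" shows "presents UNIV g N (ext N A)"
  unfolding presents_def
proof (intro conjI ballI)
  show N: "0 < N" using A by (simp add: presents_def)
  have gA: "germ UNIV (\<lambda>v. A i j (coord_proj (-K) v))" if "i \<notin> K" "j \<notin> K" for i j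
    using A that by (simp add: presents_def germ_iff)
  show "germ UNIV (ext N A i j)" for i j
  proof (cases "i \<in> K")
    case True
    then show ?thesis
      unfolding ext_def[abs_def]
      by (cases "i = j") (auto intro!: germ_mult germ_power germ_coord germ_inverse germ_b b_0)
  next
    case i: False
    show ?thesis
    proof (cases "j \<in> K")
      case True
      have "germ UNIV (\<lambda>v. (-1) * (\<Sum>k\<in>-K. A i k (coord_proj (-K) v) * c k j v) * inverse (b j v))"
        using i True by (intro germ_mult germ_const germ_sum gA c(1) germ_inverse germ_b b_0) auto
      then show ?thesis using i True by (simp add: ext_def[abs_def])
    qed (use i gA in \<open>simp add: ext_def[abs_def]\<close>)
  qed
  fix i
  have gK: "eventually (\<lambda>v. \<forall>j\<in>K. g j v = v $ j * b j v) (nhds 0)"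
    using F_K by (intro eventually_ball_finite) (auto simp: g_def)
  have bK: "eventually (\<lambda>v. \<forall>j\<in>K. b j v \<noteq> 0) (nhds 0)"
    using b_nonzero by (intro eventually_ball_finite) auto
  show "germ_eq UNIV (\<lambda>v. v $ i ^ N) (\<lambda>v. \<Sum>j\<in>UNIV. ext N A i j v * g j v)"
  proof (cases "i \<in> K")
    case True
    show ?thesis
      unfolding germ_eq_UNIV using gK bK
    proof eventually_elim
      case (elim v)
      have "(\<Sum>j\<in>UNIV. ext N A i j v * g j v) = (\<Sum>j\<in>{i}. ext N A i j v * g j v)"
        by (rule sum.mono_neutral_right) (use True in \<open>auto simp: ext_def\<close>)
      also have "\<dots> = v $ i ^ (N - 1) * v $ i" using True elim by (simp add: ext_def)
      also have "\<dots> = v $ i ^ N" using N by (metis power_minus_mult)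
      finally show ?case ..
    qed
  next
    case False
    have "germ_eq (-K) (\<lambda>v. v $ i ^ N) (\<lambda>v. \<Sum>j\<in>-K. A i j v * g j v)"
      using A False by (simp add: presents_def)
    then have "eventually (\<lambda>v. v $ i ^ N = (\<Sum>j\<in>-K. A i j (coord_proj (-K) v) * g j (coord_proj (-K) v))) (nhds 0)"
      using False by (simp add: germ_eq_def)
    moreover have "eventually (\<lambda>v. \<forall>j. g j (coord_proj (-K) v) = g j v - (\<Sum>l\<in>K. v $ l * c j l v)) (nhds 0)"
      by (intro eventually_all_finite c(2))
    ultimately show ?thesis
      unfolding germ_eq_UNIV using gK bK
    proof eventually_elim
      case (elim v)
      let ?A = "\<lambda>k. A i k (coord_proj (-K) v)"
      have "v $ i ^ N = (\<Sum>j\<in>-K. ?A j * g j v) - (\<Sum>j\<in>-K. \<Sum>l\<in>K. ?A j * (v $ l * c j l v))"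
        unfolding elim(1) elim(2)[rule_format] right_diff_distrib sum_subtractf sum_distrib_left ..
      also have "(\<Sum>j\<in>-K. \<Sum>l\<in>K. ?A j * (v $ l * c j l v)) = (\<Sum>l\<in>K. \<Sum>j\<in>-K. ?A j * (v $ l * c j l v))"
        by (rule sum.swap)
      also have "\<dots> = (\<Sum>l\<in>K. - (ext N A i l v * g l v))"
      proof (rule sum.cong[OF refl])
        fix l assume l: "l \<in> K"
        have "- (ext N A i l v * g l v) = (\<Sum>k\<in>-K. ?A k * c k l v) * v $ l"
          using l False elim(3,4) by (simp add: ext_def)
        also have "\<dots> = (\<Sum>j\<in>-K. ?A j * (v $ l * c j l v))"
          unfolding sum_distrib_right by (intro sum.cong refl) (simp only: ac_simps)
        finally show "(\<Sum>j\<in>-K. ?A j * (v $ l * c j l v)) = - (ext N A i l v * g l v)" ..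
      qed
      also have "(\<Sum>j\<in>-K. ?A j * g j v) = (\<Sum>j\<in>-K. ext N A i j v * g j v)"
        using False by (intro sum.cong) (auto simp: ext_def)
      finally have "v $ i ^ N = (\<Sum>j\<in>-K. ext N A i j v * g j v) + (\<Sum>j\<in>K. ext N A i j v * g j v)"
        by (simp add: sum_negf)
      also have "\<dots> = (\<Sum>j\<in>-K \<union> K. ext N A i j v * g j v)"
        by (rule sum.union_disjoint[symmetric]) auto
      finally show ?case by (simp add: Un_commute)
    qed
  qed
qed

text \<open>The determinant of the extended presentation is the product of the z_i^(N - 1) / b_i
  times the determinant on the stratum. The powers of z_i cancel against the weights z_i / z_i^N, so
  the integrand becomes holomorphic in z and averaging over z amounts to setting z = 0.\<close>

theorem residue_stratum:
  assumes H: "germ UNIV H"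
  shows "residue UNIV g H = residue (-K) g (\<lambda>v. H v * inverse (\<Prod>i\<in>K. b i v))"
proof (cases "\<exists>N A. presents (-K) g N A")
  case False
  then have "\<nexists>N A. presents UNIV g N A" using presents_restrict by blast
  with False show ?thesis by (simp add: residue_not_presented)
next
  case True
  then obtain N A where A: "presents (-K) g N A" by blast
  have N: "0 < N" using A by (simp add: presents_def)
  let ?p = "\<lambda>v. inverse (\<Prod>i\<in>K. b i v)"
  have gp: "germ UNIV ?p"
    by (rule germ_inverse[OF germ_prod]) (use germ_b b_0 in auto)
  have gHp: "germ UNIV (\<lambda>v. H v * ?p v)" by (intro germ_mult H gp)
  have gE: "germ UNIV (\<lambda>v. det (ext_matrix (-K) A (coord_proj (-K) v)))"
    using germ_ext_matrix[OF A] by (simp add: germ_iff)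
  define Q where "Q v = H v * ?p v * det (ext_matrix (-K) A (coord_proj (-K) v))" for v
  have gQ: "germ UNIV Q" unfolding Q_def[abs_def] by (intro germ_mult gHp gE)
  define m where "m v = (\<Prod>k\<in>-K. v $ k / v $ k ^ N)" for v :: "complex ^ 'n"
  have "eventually (\<lambda>\<rho>. torus_mean UNIV \<rho> (\<lambda>v. H v * det (ext_matrix UNIV (ext N A) v) * (\<Prod>k\<in>UNIV. v $ k / v $ k ^ N)) =
      torus_mean (-K) \<rho> (\<lambda>v. H v * ?p v * det (ext_matrix (-K) A v) * (\<Prod>k\<in>-K. v $ k / v $ k ^ N))) (at_right 0)"
    using gQ[unfolded germ_UNIV_iff]
  proof (rule eventually_at_right_0_shrink)
    fix \<rho> R :: real assume \<rho>: "0 < \<rho>" "\<rho> < R" and holoQ: "holo_on (polydisc R) Q"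
    have "torus_mean UNIV \<rho> (\<lambda>v. H v * det (ext_matrix UNIV (ext N A) v) * (\<Prod>k\<in>UNIV. v $ k / v $ k ^ N)) =
        torus_mean UNIV \<rho> (\<lambda>v. Q v * m v)"
    proof (rule torus_mean_cong[OF \<rho>(1)])
      fix v :: "complex ^ 'n" assume v: "v \<in> torus \<rho> UNIV"
      have nz: "v $ k \<noteq> 0" for k using torus_nth[OF v, of k] \<rho> by auto
      have "det (ext_matrix UNIV (ext N A) v) = (\<Prod>i\<in>K. v $ i ^ (N - 1) * inverse (b i v)) *
          det (\<chi> i j. if i \<in> -K \<and> j \<in> -K then ext_matrix UNIV (ext N A) v $ i $ j else if i = j then 1 else 0)"
        by (rule det_rows_block) (auto simp: ext_matrix_def ext_def)
      also have "(\<chi> i j. if i \<in> -K \<and> j \<in> -K then ext_matrix UNIV (ext N A) v $ i $ j else if i = j then 1 else 0) =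
          ext_matrix (-K) A (coord_proj (-K) v)"
        by (auto simp: ext_matrix_def ext_def vec_eq_iff)
      finally have d: "det (ext_matrix UNIV (ext N A) v) =
          (\<Prod>i\<in>K. v $ i ^ (N - 1)) * ?p v * det (ext_matrix (-K) A (coord_proj (-K) v))"
        by (simp add: prod.distrib prod_inversef[unfolded o_def])
      have "(\<Prod>k\<in>UNIV. v $ k / v $ k ^ N) = (\<Prod>k\<in>K. v $ k / v $ k ^ N) * m v"
        unfolding m_def using prod.union_disjoint[of K "-K" "\<lambda>k. v $ k / v $ k ^ N"] by simp
      moreover have "(\<Prod>i\<in>K. v $ i ^ (N - 1)) * (\<Prod>k\<in>K. v $ k / v $ k ^ N) = 1"
        unfolding prod.distrib[symmetric]
      proof (rule prod.neutral, rule ballI)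
        fix k
        have "v $ k ^ (N - 1) * v $ k = v $ k ^ N" using N by (metis power_minus_mult)
        then show "v $ k ^ (N - 1) * (v $ k / v $ k ^ N) = 1" using power_not_zero[OF nz[of k], of N] by simp
      qed
      ultimately show "H v * det (ext_matrix UNIV (ext N A) v) * (\<Prod>k\<in>UNIV. v $ k / v $ k ^ N) = Q v * m v"
        unfolding d Q_def by simp
    qed
    also have "\<dots> = torus_mean (UNIV - K) \<rho> (\<lambda>v. Q v * m v)"
    proof (rule torus_mean_holo_reduce[OF \<rho> holoQ])
      show "continuous_on (torus \<rho> J) m" if "UNIV - K \<subseteq> J" for J
        unfolding m_def[abs_def]
      proof (intro continuous_on_prod continuous_on_divide continuous_intros ballI)
        fix k and v :: "complex ^ 'n" assume "k \<in> -K" "v \<in> torus \<rho> J"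
        then have "norm (v $ k) = \<rho>" using that by (subst torus_nth) auto
        then show "v $ k ^ N \<noteq> 0" using \<rho> by auto
      qed
      show "m (upd v l \<xi>) = m v" if "l \<in> K" for v l \<xi>
        unfolding m_def using that by (intro prod.cong) auto
    qed simp
    also have "\<dots> = torus_mean (-K) \<rho> (\<lambda>v. H v * ?p v * det (ext_matrix (-K) A v) * (\<Prod>k\<in>-K. v $ k / v $ k ^ N))"
      unfolding Compl_eq_Diff_UNIV[symmetric]
      by (rule torus_mean_cong[OF \<rho>(1)]) (simp add: Q_def m_def)
    finally show "torus_mean UNIV \<rho> (\<lambda>v. H v * det (ext_matrix UNIV (ext N A) v) * (\<Prod>k\<in>UNIV. v $ k / v $ k ^ N)) =
      torus_mean (-K) \<rho> (\<lambda>v. H v * ?p v * det (ext_matrix (-K) A v) * (\<Prod>k\<in>-K. v $ k / v $ k ^ N))" .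
  qed
  with residue_torus_mean[OF presents_extend[OF A] H] residue_torus_mean[OF A germ_coord_proj(1)[OF gHp]]
  have "eventually (\<lambda>_. residue UNIV g H = residue (-K) g (\<lambda>v. H v * ?p v)) (at_right (0::real))"
    by eventually_elim simp
  then show ?thesis by (rule eventually_at_right_0_const)
qed

end

section \<open>Germs on a manifold\<close>

text \<open>Germs at an arbitrary point are needed because charts of the atlas, unlike local
  coordinates, need not send p to 0.\<close>

definition hol_near :: "complex ^ 'n::finite \<Rightarrow> (complex ^ 'n \<Rightarrow> complex) \<Rightarrow> bool" where
  "hol_near w g \<longleftrightarrow> (\<exists>V. open V \<and> w \<in> V \<and> holo_on V g)"

lemma germ_UNIV_hol_near: "germ UNIV g \<longleftrightarrow> hol_near 0 g"
  by (simp add: germ_def hol_near_def o_def)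

lemma hol_near_cong:
  assumes "hol_near w g" "eventually (\<lambda>v. g v = h v) (nhds w)" shows "hol_near w h"
proof -
  obtain V where V: "open V" "w \<in> V" "holo_on V g" using assms(1) unfolding hol_near_def by blast
  obtain U where U: "open U" "w \<in> U" "\<And>v. v \<in> U \<Longrightarrow> g v = h v"
    using assms(2) unfolding eventually_nhds by blast
  have "holo_on (V \<inter> U) h"
    using holo_on_subset[OF V(3)] holo_on_cong[of "V \<inter> U" g h] U V by auto
  then show ?thesis unfolding hol_near_def using U V by (intro exI[of _ "V \<inter> U"]) auto
qed

lemma hol_near_compose:
  assumes h: "hol_near (G w) h" and G: "\<And>i. hol_near w (\<lambda>v. G v $ i)"
  shows "hol_near w (\<lambda>v. h (G v))"
proof -
  obtain V where V: "open V" "G w \<in> V" "holo_on V h" using h unfolding hol_near_def by blast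
  obtain U where U: "\<And>i. open (U i)" "\<And>i. w \<in> U i" "\<And>i. holo_on (U i) (\<lambda>v. G v $ i)"
    using G unfolding hol_near_def by metis
  define W where "W = (\<Inter>i. U i)"
  have W: "open W" "w \<in> W" unfolding W_def using U by (auto intro: open_INT)
  have GW: "holo_on W (\<lambda>v. G v $ i)" for i
    by (rule holo_on_subset[OF U(3)[of i]]) (auto simp: W_def)
  have "continuous_on W G" by (intro continuous_on_vec_componentwise holo_on_imp_continuous_on GW)
  then have op: "open (W \<inter> G -` V)" using continuous_open_preimage W(1) V(1) by blast
  have "holo_on (W \<inter> G -` V) (\<lambda>v. h (G v))"
    by (rule holo_on_compose[OF V(3)]) (auto intro: holo_on_subset[OF GW])
  then show ?thesis unfolding hol_near_def using op W V by blast
qed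

lemma hol_near_map_tendsto:
  fixes G :: "complex ^ 'n::finite \<Rightarrow> complex ^ 'm::finite"
  assumes "\<And>i. hol_near w (\<lambda>v. G v $ i)" shows "(G \<longlongrightarrow> G w) (nhds w)"
proof -
  have "isCont (\<lambda>v. G v $ i) w" for i
  proof -
    obtain V where V: "open V" "w \<in> V" "holo_on V (\<lambda>v. G v $ i)" using assms unfolding hol_near_def by blast
    show ?thesis
      using holo_on_imp_continuous_on[OF V(3)] V(1,2) by (simp add: continuous_on_eq_continuous_at)
  qed
  then have "((\<lambda>v. G v $ i) \<longlongrightarrow> G w $ i) (nhds w)" for i
    by (simp add: continuous_at tendsto_nhds_iff)
  then show ?thesis by (rule vec_tendstoI)
qed

lemma chart_inverse:
  assumes "is_chart \<xi>"
  shows "q \<in> fst \<xi> \<Longrightarrow> chart_inv \<xi> (snd \<xi> q) = q"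
    and "v \<in> snd \<xi> ` fst \<xi> \<Longrightarrow> snd \<xi> (chart_inv \<xi> v) = v"
    and "v \<in> snd \<xi> ` fst \<xi> \<Longrightarrow> chart_inv \<xi> v \<in> fst \<xi>"
  using assms unfolding is_chart_def homeomorphism_def by (auto simp: inv_into_into)

lemma chart_image_open:
  assumes "is_chart \<xi>" "open W" shows "open (snd \<xi> ` (fst \<xi> \<inter> W))"
proof -
  have h: "homeomorphism (fst \<xi>) (snd \<xi> ` fst \<xi>) (snd \<xi>) (chart_inv \<xi>)" and o: "open (fst \<xi>)" "open (snd \<xi> ` fst \<xi>)"
    using assms(1) unfolding is_chart_def by auto
  have c: "continuous_on (snd \<xi> ` fst \<xi>) (chart_inv \<xi>)" using h unfolding homeomorphism_def by blast
  have "snd \<xi> ` (fst \<xi> \<inter> W) = snd \<xi> ` fst \<xi> \<inter> chart_inv \<xi> -` W"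
    using chart_inverse[OF assms(1)] by force
  then show ?thesis using continuous_open_preimage[OF c o(2) assms(2)] by simp
qed

lemma chart_tendsto:
  fixes \<xi> :: "('a::t2_space, 'n::finite) chart"
  assumes "is_chart \<xi>" "q \<in> fst \<xi>"
  shows "(snd \<xi> \<longlongrightarrow> snd \<xi> q) (nhds q)" "(chart_inv \<xi> \<longlongrightarrow> q) (nhds (snd \<xi> q))"
proof -
  have h: "continuous_on (fst \<xi>) (snd \<xi>)" "continuous_on (snd \<xi> ` fst \<xi>) (chart_inv \<xi>)"
    and o: "open (fst \<xi>)" "open (snd \<xi> ` fst \<xi>)"
    using assms(1) unfolding is_chart_def homeomorphism_def by auto
  show "(snd \<xi> \<longlongrightarrow> snd \<xi> q) (nhds q)"
    using h(1) assms(2) unfolding continuous_on_eq_continuous_at[OF o(1)] isCont_def tendsto_at_iff_tendsto_nhds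
    by blast
  have "(chart_inv \<xi> \<longlongrightarrow> chart_inv \<xi> (snd \<xi> q)) (nhds (snd \<xi> q))"
    using h(2) assms(2) unfolding continuous_on_eq_continuous_at[OF o(2)] isCont_def tendsto_at_iff_tendsto_nhds
    by blast
  then show "(chart_inv \<xi> \<longlongrightarrow> q) (nhds (snd \<xi> q))"
    unfolding chart_inverse(1)[OF assms] .
qed

lemma eventually_chart:
  fixes \<xi> :: "('a::t2_space, 'n::finite) chart"
  assumes "is_chart \<xi>" "q \<in> fst \<xi>"
  shows "eventually P (nhds q) \<Longrightarrow> eventually (\<lambda>v. P (chart_inv \<xi> v)) (nhds (snd \<xi> q))"
    and "eventually Q (nhds (snd \<xi> q)) \<Longrightarrow> eventually (\<lambda>u. Q (snd \<xi> u)) (nhds q)"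
  using chart_tendsto[OF assms] unfolding filterlim_iff by auto

lemma compatible_transition:
  assumes "compatible \<xi> \<eta>" "is_chart \<xi>" "is_chart \<eta>" "q \<in> fst \<xi>" "q \<in> fst \<eta>"
  shows "hol_near (snd \<xi> q) (\<lambda>v. snd \<eta> (chart_inv \<xi> v) $ i)"
    and "hol_near (snd \<eta> q) (\<lambda>v. snd \<xi> (chart_inv \<eta> v) $ i)"
proof -
  have o: "open (fst \<xi>)" "open (fst \<eta>)" using assms(2,3) unfolding is_chart_def by auto
  have h: "holo_on (snd \<xi> ` (fst \<xi> \<inter> fst \<eta>)) (\<lambda>v. snd \<eta> (chart_inv \<xi> v) $ i)"
    "holo_on (snd \<eta> ` (fst \<eta> \<inter> fst \<xi>)) (\<lambda>v. snd \<xi> (chart_inv \<eta> v) $ i)"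
    using assms(1) unfolding compatible_def by (auto simp: Int_commute)
  show "hol_near (snd \<xi> q) (\<lambda>v. snd \<eta> (chart_inv \<xi> v) $ i)"
    unfolding hol_near_def using h(1) chart_image_open[OF assms(2) o(2)] assms(4,5) by blast
  show "hol_near (snd \<eta> q) (\<lambda>v. snd \<xi> (chart_inv \<eta> v) $ i)"
    unfolding hol_near_def using h(2) chart_image_open[OF assms(3) o(1)] assms(4,5) by blast
qed

locale manifold_point =
  fixes A :: "('a::{t2_space, second_countable_topology}, 'n::finite) chart set" and p :: 'a and \<zeta> :: "('a, 'n) chart"
  assumes manifold: "complex_manifold A" and \<zeta>: "local_coordinates A p \<zeta>"
begin

lemma chart: "is_chart \<zeta>" "p \<in> fst \<zeta>" "snd \<zeta> p = 0" "\<And>\<eta>. \<eta> \<in> A \<Longrightarrow> compatible \<zeta> \<eta>"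
  using \<zeta> unfolding local_coordinates_def by auto

lemma inv_0: "chart_inv \<zeta> 0 = p"
  using chart_inverse(1)[OF chart(1,2)] chart(3) by simp

lemma ev: "eventually P (nhds p) \<Longrightarrow> eventually (\<lambda>v. P (chart_inv \<zeta> v)) (nhds 0)"
  "eventually Q (nhds 0) \<Longrightarrow> eventually (\<lambda>u. Q (snd \<zeta> u)) (nhds p)"
  using eventually_chart[OF chart(1,2)] chart(3) by auto

lemma ev_inverse: "eventually (\<lambda>v. snd \<zeta> (chart_inv \<zeta> v) = v) (nhds 0)"
  "eventually (\<lambda>v. chart_inv \<zeta> v \<in> fst \<zeta>) (nhds 0)"
  "eventually (\<lambda>u. chart_inv \<zeta> (snd \<zeta> u) = u) (nhds p)"
proof -
  have "eventually (\<lambda>v. v \<in> snd \<zeta> ` fst \<zeta>) (nhds 0)"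
    by (rule eventually_nhds_in_open) (use chart in \<open>auto simp: is_chart_def intro!: image_eqI[of 0 _ p]\<close>)
  then show "eventually (\<lambda>v. snd \<zeta> (chart_inv \<zeta> v) = v) (nhds 0)" "eventually (\<lambda>v. chart_inv \<zeta> v \<in> fst \<zeta>) (nhds 0)"
    using chart_inverse[OF chart(1)] by (auto elim: eventually_mono)
  have "eventually (\<lambda>u. u \<in> fst \<zeta>) (nhds p)"
    by (rule eventually_nhds_in_open) (use chart in \<open>auto simp: is_chart_def\<close>)
  then show "eventually (\<lambda>u. chart_inv \<zeta> (snd \<zeta> u) = u) (nhds p)"
    using chart_inverse[OF chart(1)] by (auto elim: eventually_mono)
qed

lemma atlas_chart:
  obtains \<eta> where "\<eta> \<in> A" "p \<in> fst \<eta>" "is_chart \<eta>" "compatible \<zeta> \<eta>"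
  using manifold chart(4) unfolding complex_manifold_def by blast

lemma hol_at_iff: "hol_at A p g \<longleftrightarrow> germ UNIV (\<lambda>v. g (chart_inv \<zeta> v))"
proof
  assume "hol_at A p g"
  then obtain W where W: "open W" "p \<in> W" "hol_fun_on A W g" unfolding hol_at_def by blast
  obtain \<eta> where \<eta>: "\<eta> \<in> A" "p \<in> fst \<eta>" "is_chart \<eta>" "compatible \<zeta> \<eta>" by (rule atlas_chart)
  have "hol_near (snd \<eta> p) (\<lambda>v. g (chart_inv \<eta> v))"
    unfolding hol_near_def using W(3) \<eta>(1,2) W(2) chart_image_open[OF \<eta>(3) W(1)]
    unfolding hol_fun_on_def o_def by blast
  then have "hol_near 0 (\<lambda>v. g (chart_inv \<eta> (snd \<eta> (chart_inv \<zeta> v))))"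
    using compatible_transition(1)[OF \<eta>(4) chart(1) \<eta>(3) chart(2) \<eta>(2)] inv_0 chart(3)
    by (intro hol_near_compose[of "\<lambda>v. snd \<eta> (chart_inv \<zeta> v)" 0 "\<lambda>v. g (chart_inv \<eta> v)"]) auto
  moreover have "eventually (\<lambda>v. chart_inv \<zeta> v \<in> fst \<eta>) (nhds 0)"
    using ev(1)[OF eventually_nhds_in_open[of "fst \<eta>" p]] \<eta> by (simp add: is_chart_def)
  then have "eventually (\<lambda>v. g (chart_inv \<eta> (snd \<eta> (chart_inv \<zeta> v))) = g (chart_inv \<zeta> v)) (nhds 0)"
    by eventually_elim (simp add: chart_inverse(1)[OF \<eta>(3)])
  ultimately show "germ UNIV (\<lambda>v. g (chart_inv \<zeta> v))"
    unfolding germ_UNIV_hol_near by (rule hol_near_cong)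
next
  assume "germ UNIV (\<lambda>v. g (chart_inv \<zeta> v))"
  then obtain V where V: "open V" "0 \<in> V" "holo_on V (\<lambda>v. g (chart_inv \<zeta> v))"
    unfolding germ_UNIV_hol_near hol_near_def by blast
  define W where "W = fst \<zeta> \<inter> snd \<zeta> -` V"
  have "continuous_on (fst \<zeta>) (snd \<zeta>)" "open (fst \<zeta>)"
    using chart(1) unfolding is_chart_def homeomorphism_def by auto
  then have "open W" unfolding W_def using V(1) continuous_open_preimage by blast
  moreover have "hol_fun_on A W g"
    unfolding hol_fun_on_def
  proof
    fix \<eta> assume \<eta>: "\<eta> \<in> A"
    then have \<eta>c: "is_chart \<eta>" using manifold unfolding complex_manifold_def by blast
    have "holo_on (snd \<eta> ` (fst \<zeta> \<inter> fst \<eta>)) (\<lambda>v. snd \<zeta> (chart_inv \<eta> v) $ i)" for i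
      using chart(4)[OF \<eta>] unfolding compatible_def by blast
    then have h: "holo_on (snd \<eta> ` (fst \<eta> \<inter> W)) (\<lambda>v. snd \<zeta> (chart_inv \<eta> v) $ i)" for i
      by (rule holo_on_subset) (auto simp: W_def)
    have "holo_on (snd \<eta> ` (fst \<eta> \<inter> W)) (\<lambda>v. g (chart_inv \<zeta> (snd \<zeta> (chart_inv \<eta> v))))"
      by (rule holo_on_compose[OF V(3) h]) (auto simp: W_def chart_inverse(1)[OF \<eta>c])
    moreover have "g (chart_inv \<zeta> (snd \<zeta> (chart_inv \<eta> v))) = (g \<circ> chart_inv \<eta>) v" if "v \<in> snd \<eta> ` (fst \<eta> \<inter> W)" for v
      using that by (auto simp: W_def chart_inverse(1)[OF \<eta>c] chart_inverse(1)[OF chart(1)])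
    ultimately show "holo_on (snd \<eta> ` (fst \<eta> \<inter> W)) (g \<circ> chart_inv \<eta>)"
      by (rule iffD1[OF holo_on_cong[OF chart_image_open[OF \<eta>c \<open>open W\<close>]], rotated])
  qed
  ultimately show "hol_at A p g"
    unfolding hol_at_def using V(2) chart(2,3) by (intro exI[of _ W]) (auto simp: W_def)
qed

lemma hol_at_cong: "hol_at A p g \<Longrightarrow> eventually (\<lambda>u. g u = h u) (nhds p) \<Longrightarrow> hol_at A p h"
  unfolding hol_at_iff germ_UNIV_hol_near by (erule hol_near_cong) (rule ev(1))

lemma hol_at_mult: "hol_at A p g \<Longrightarrow> hol_at A p h \<Longrightarrow> hol_at A p (\<lambda>u. g u * h u)"
  unfolding hol_at_iff by (rule germ_mult)

lemma hol_at_sum: "(\<And>i. i \<in> S \<Longrightarrow> hol_at A p (g i)) \<Longrightarrow> hol_at A p (\<lambda>u. \<Sum>i\<in>S. g i u)"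
  unfolding hol_at_iff by (rule germ_sum)

lemma hol_at_const: "hol_at A p (\<lambda>u. c)"
  unfolding hol_at_iff by (rule germ_const)

lemma hol_at_coord: "hol_at A p (\<lambda>u. snd \<zeta> u $ i)"
proof -
  have "eventually (\<lambda>v. v $ i = snd \<zeta> (chart_inv \<zeta> v) $ i) (nhds 0)"
    using ev_inverse(1) by eventually_elim simp
  then show ?thesis
    unfolding hol_at_iff germ_UNIV_hol_near
    using germ_coord[of UNIV i] unfolding germ_UNIV_hol_near by (rule hol_near_cong[rotated])
qed

end

locale manifold_fixed_point = manifold_point A p \<zeta>
  for A :: "('a::{t2_space, second_countable_topology}, 'n::finite) chart set" and p :: 'a and \<zeta> :: "('a, 'n) chart" +
  fixes f :: "'a \<Rightarrow> 'a"
  assumes f: "hol_self_map A f" and fp: "f p = p"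
begin

lemma f_tendsto: "(f \<longlongrightarrow> p) (nhds p)"
proof -
  have "(f \<longlongrightarrow> f p) (nhds p)"
    using f unfolding hol_self_map_def continuous_on_eq_continuous_at[OF open_UNIV]
        isCont_def tendsto_at_iff_tendsto_nhds
    by blast
  then show ?thesis by (simp only: fp)
qed

lemma ev_f: "eventually P (nhds p) \<Longrightarrow> eventually (\<lambda>u. P (f u)) (nhds p)"
  using f_tendsto unfolding filterlim_iff by blast

definition F where "F v = snd \<zeta> (f (chart_inv \<zeta> v))"

lemma F_0: "F 0 = 0"
  by (simp add: F_def inv_0 fp chart(3))

lemma ev_F: "eventually (\<lambda>v. chart_inv \<zeta> (F v) = f (chart_inv \<zeta> v)) (nhds 0)"
  unfolding F_def by (rule ev(1)[OF ev_f[OF ev_inverse(3)]])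

text \<open>Holomorphy of \<open>f\<close> is given in atlas charts only, so near 0 the map
  \<open>F\<close> is factored through an atlas chart \<eta>: from \<zeta> to \<eta>, then
  \<open>f\<close> in \<eta>, then back to \<zeta>.\<close>

lemma germ_F: "germ UNIV (\<lambda>v. F v $ i)"
proof -
  obtain \<eta> where \<eta>: "\<eta> \<in> A" "p \<in> fst \<eta>" "is_chart \<eta>" "compatible \<zeta> \<eta>" by (rule atlas_chart)
  have o: "open (fst \<eta>)" using \<eta>(3) unfolding is_chart_def by auto
  have cf: "continuous_on UNIV f" using f unfolding hol_self_map_def by blast
  have of: "open (f -` fst \<eta>)" using continuous_open_vimage[of "fst \<eta>" f] o cf
    by (simp add: continuous_on_eq_continuous_at)
  have "holo_on (snd \<eta> ` (fst \<eta> \<inter> f -` fst \<eta>)) (\<lambda>v. snd \<eta> (f (chart_inv \<eta> v)) $ i)" for i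
    using f \<eta>(1) unfolding hol_self_map_def by blast
  then have 1: "hol_near (snd \<eta> p) (\<lambda>v. snd \<eta> (f (chart_inv \<eta> v)) $ i)" for i
    unfolding hol_near_def using chart_image_open[OF \<eta>(3) of] \<eta>(2) fp by (metis IntI image_eqI vimageI)
  have p\<eta>: "chart_inv \<eta> (snd \<eta> p) = p" by (rule chart_inverse(1)[OF \<eta>(3,2)])
  note tr = compatible_transition[OF \<eta>(4) chart(1) \<eta>(3) chart(2) \<eta>(2), unfolded chart(3)]
  have 2: "hol_near (snd \<eta> p) (\<lambda>v. snd \<zeta> (chart_inv \<eta> (snd \<eta> (f (chart_inv \<eta> v)))) $ i)"
    by (rule hol_near_compose[of "\<lambda>v. snd \<eta> (f (chart_inv \<eta> v))" "snd \<eta> p" "\<lambda>w. snd \<zeta> (chart_inv \<eta> w) $ i"])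
      (use 1 tr(2) p\<eta> fp in auto)
  have 3: "hol_near 0 (\<lambda>v. snd \<zeta> (chart_inv \<eta> (snd \<eta> (f (chart_inv \<eta> (snd \<eta> (chart_inv \<zeta> v)))))) $ i)"
    by (rule hol_near_compose[of "\<lambda>v. snd \<eta> (chart_inv \<zeta> v)" 0 "\<lambda>v. snd \<zeta> (chart_inv \<eta>
        (snd \<eta> (f (chart_inv \<eta> v)))) $ i"])
      (use 2 tr(1) inv_0 in auto)
  have in\<eta>: "eventually (\<lambda>u. u \<in> fst \<eta>) (nhds p)" using o \<eta>(2) by (rule eventually_nhds_in_open)
  have "eventually (\<lambda>v. snd \<zeta> (chart_inv \<eta> (snd \<eta> (f (chart_inv \<eta> (snd \<eta> (chart_inv \<zeta> v)))))) $ i = F v $ i) (nhds 0)"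
    using ev(1)[OF in\<eta>] ev(1)[OF ev_f[OF in\<eta>]]
    by eventually_elim (simp add: F_def chart_inverse(1)[OF \<eta>(3)])
  with 3 show ?thesis unfolding germ_UNIV_hol_near by (rule hol_near_cong)
qed

lemma germ_compose_F:
  assumes "germ UNIV h" shows "germ UNIV (\<lambda>v. h (F v))"
  using assms germ_F unfolding germ_UNIV_hol_near
  by (intro hol_near_compose[of F 0 h]) (auto simp: F_0)

lemma hol_at_compose_f:
  assumes "hol_at A p g" shows "hol_at A p (\<lambda>u. g (f u))"
proof -
  have "germ UNIV (\<lambda>v. g (chart_inv \<zeta> (F v)))"
    using germ_compose_F[OF assms[unfolded hol_at_iff]] .
  moreover have "eventually (\<lambda>v. g (chart_inv \<zeta> (F v)) = g (f (chart_inv \<zeta> v))) (nhds 0)"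
    using ev_F by eventually_elim simp
  ultimately show ?thesis unfolding hol_at_iff germ_UNIV_hol_near by (rule hol_near_cong)
qed

lemma ev_F_nhds: "eventually Q (nhds 0) \<Longrightarrow> eventually (\<lambda>v. Q (F v)) (nhds 0)"
proof -
  assume "eventually Q (nhds 0)"
  then obtain r where r: "0 < r" "\<forall>v\<in>polydisc r. Q v" unfolding eventually_nhds_0_polydisc by blast
  have "(F \<longlongrightarrow> F 0) (nhds 0)"
    using germ_F unfolding germ_UNIV_hol_near by (rule hol_near_map_tendsto)
  then have "eventually (\<lambda>v. F v \<in> polydisc r) (nhds 0)"
    unfolding F_0 tendsto_def using r(1) open_polydisc zero_in_polydisc by blast
  then show ?thesis by eventually_elim (use r(2) in blast)
qed

text \<open>The transition between \<zeta> and x conjugates the two coordinate forms of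
  \<open>f\<close>, so \<open>conjugate_residue\<close> applies. A presentation in one system yields
  one in the other; without any, both residues have the default value.\<close>

lemma fixed_point_functional_coordinates:
  assumes x: "local_coordinates A p x" and h: "hol_at A p h"
  shows "fixed_point_functional f x h = residue UNIV (\<lambda>i v. v $ i - F v $ i) (\<lambda>v. h (chart_inv \<zeta> v))"
proof -
  interpret X: manifold_fixed_point A p x f
    using manifold x f fp by unfold_locales
  define \<phi> where "\<phi> v = snd x (chart_inv \<zeta> v)" for v
  define \<psi> where "\<psi> v = snd \<zeta> (chart_inv x v)" for v
  have g\<phi>: "germ UNIV (\<lambda>v. \<phi> v $ i)" for i
    using X.hol_at_coord[of i] unfolding hol_at_iff \<phi>_def .
  have g\<psi>: "germ UNIV (\<lambda>v. \<psi> v $ i)" for i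
    using hol_at_coord[of i] unfolding X.hol_at_iff \<psi>_def .
  have "eventually (\<lambda>R. \<forall>i\<in>UNIV. holo_on (polydisc R) (\<lambda>v. \<phi> v $ i) \<and> holo_on (polydisc R) (\<lambda>v. \<psi> v $ i) \<and>
      holo_on (polydisc R) (\<lambda>v. F v $ i) \<and> holo_on (polydisc R) (\<lambda>v. X.F v $ i)) (at_right 0)"
    using g\<phi> g\<psi> germ_F X.germ_F unfolding germ_UNIV_iff
    by (intro eventually_ball_finite ballI eventually_conj) auto
  then obtain R where R: "0 < R" "\<And>i. holo_on (polydisc R) (\<lambda>v. \<phi> v $ i)" "\<And>i. holo_on (polydisc R) (\<lambda>v. \<psi> v $ i)"
      "\<And>i. holo_on (polydisc R) (\<lambda>v. F v $ i)" "\<And>i. holo_on (polydisc R) (\<lambda>v. X.F v $ i)"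
    by (rule eventually_at_right_0_obtain) auto
  have \<psi>\<phi>: "eventually (\<lambda>v. chart_inv x (\<phi> v) = chart_inv \<zeta> v) (nhds 0)"
    unfolding \<phi>_def by (rule ev(1)[OF X.ev_inverse(3)])
  have \<phi>\<psi>: "eventually (\<lambda>v. chart_inv \<zeta> (\<psi> v) = chart_inv x v) (nhds 0)"
    unfolding \<psi>_def by (rule X.ev(1)[OF ev_inverse(3)])
  interpret C: conjugate_maps \<phi> \<psi> R F X.F
  proof
    show "0 < R" by (rule R(1))
    show "\<phi> 0 = 0" "\<psi> 0 = 0" by (simp_all add: \<phi>_def \<psi>_def inv_0 X.inv_0 chart(3) X.chart(3))
    show "eventually (\<lambda>v. \<psi> (\<phi> v) = v) (nhds 0)"
      using \<psi>\<phi> ev_inverse(1) by eventually_elim (simp add: \<psi>_def)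
    show "eventually (\<lambda>v. \<phi> (\<psi> v) = v) (nhds 0)"
      using \<phi>\<psi> X.ev_inverse(1) by eventually_elim (simp add: \<phi>_def)
    show "eventually (\<lambda>v. \<phi> (F v) = X.F (\<phi> v)) (nhds 0)"
      using \<psi>\<phi> ev_F by eventually_elim (simp add: \<phi>_def X.F_def)
  qed (use R F_0 X.germ_F in auto)
  \<comment> \<open>The opposite direction serves to transfer presentations from \<zeta> to
    x.\<close>
  interpret D: conjugate_maps \<psi> \<phi> R X.F F
  proof
    show "eventually (\<lambda>v. \<psi> (X.F v) = F (\<psi> v)) (nhds 0)"
      using \<phi>\<psi> X.ev_F by eventually_elim (simp add: \<psi>_def F_def)
  qed (use R X.F_0 germ_F C.\<phi>_0 C.\<psi>_0 C.\<phi>_\<psi> C.\<psi>_\<phi> in auto)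
  have gh: "germ UNIV (\<lambda>v. h (chart_inv x v))" using h unfolding X.hol_at_iff .
  have lhs: "fixed_point_functional f x h = residue UNIV (\<lambda>i v. v $ i - X.F v $ i) (\<lambda>v. h (chart_inv x v))"
    by (simp add: fixed_point_functional_def X.F_def o_def)
  show ?thesis
  proof (cases "\<exists>N B. presents UNIV (\<lambda>i v. v $ i - X.F v $ i) N B")
    case True
    then obtain N B where "presents UNIV (\<lambda>i v. v $ i - X.F v $ i) N B" by blast
    from C.conjugate_residue(2)[OF this gh]
    have "residue UNIV (\<lambda>i v. v $ i - X.F v $ i) (\<lambda>v. h (chart_inv x v)) =
        residue UNIV (\<lambda>i v. v $ i - F v $ i) (\<lambda>v. h (chart_inv x (\<phi> v)))" .
    also have "\<dots> = residue UNIV (\<lambda>i v. v $ i - F v $ i) (\<lambda>v. h (chart_inv \<zeta> v))"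
    proof (rule residue_cong)
      show "germ_eq UNIV (\<lambda>v. h (chart_inv x (\<phi> v))) (\<lambda>v. h (chart_inv \<zeta> v))"
        unfolding germ_eq_UNIV using \<psi>\<phi> by eventually_elim simp
      show "germ UNIV (\<lambda>v. h (chart_inv x (\<phi> v)))" by (rule C.germ_compose[OF gh])
    qed
    finally show ?thesis using lhs by simp
  next
    case False
    then have "\<nexists>N B. presents UNIV (\<lambda>i v. v $ i - F v $ i) N B"
      using D.conjugate_residue(1)[OF _ gh] by blast
    with False show ?thesis by (simp add: lhs residue_not_presented)
  qed
qed

text \<open>The frame \<open>s\<close> need not belong to \<open>T\<close>, so the matrix of \<Phi>
  is computed through a trivialisation t from \<open>T\<close>, as G(q) M(q) G'(f(q)). The last
  factor is taken at f(q) because \<Phi> at q starts in the fibre over f(q).\<close>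

lemma frame_trace_hol_at:
  assumes bun: "hol_vector_bundle A r \<pi> T" and lin: "linearisation A r \<pi> T f \<Phi>" and s: "local_frame A r \<pi> T p s"
  shows "hol_at A p (frame_trace r \<pi> s f \<Phi>)"
proof -
  obtain t where t: "t \<in> T" "p \<in> fst t" using bun unfolding hol_vector_bundle_def by blast
  have triv: "is_triv r \<pi> s" "is_triv r \<pi> t" and ps: "p \<in> fst s"
    using s bun t unfolding local_frame_def hol_vector_bundle_def by auto
  have o: "open (fst s)" "open (fst t)" using triv unfolding is_triv_def by auto
  have tr: "hol_transition A r \<pi> s t" "hol_transition A r \<pi> t s"
    using s t(1) unfolding local_frame_def by auto
  obtain G where "\<forall>i<r. \<forall>j<r. hol_fun_on A (fst s \<inter> fst t) (\<lambda>q. G q i j)"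
    "\<forall>e. \<pi> e \<in> fst s \<inter> fst t \<longrightarrow> (\<forall>i<r. snd s e i = (\<Sum>j<r. G (\<pi> e) i j * snd t e j))"
    using tr(1) unfolding hol_transition_def by blast
  then have G: "\<And>i j. i < r \<Longrightarrow> j < r \<Longrightarrow> hol_fun_on A (fst s \<inter> fst t) (\<lambda>q. G q i j)"
    "\<And>e i. \<pi> e \<in> fst s \<inter> fst t \<Longrightarrow> i < r \<Longrightarrow> snd s e i = (\<Sum>j<r. G (\<pi> e) i j * snd t e j)"
    by simp_all
  obtain G' where "\<forall>i<r. \<forall>j<r. hol_fun_on A (fst t \<inter> fst s) (\<lambda>q. G' q i j)"
    "\<forall>e. \<pi> e \<in> fst t \<inter> fst s \<longrightarrow> (\<forall>i<r. snd t e i = (\<Sum>j<r. G' (\<pi> e) i j * snd s e j))"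
    using tr(2) unfolding hol_transition_def by blast
  then have G': "\<And>i j. i < r \<Longrightarrow> j < r \<Longrightarrow> hol_fun_on A (fst t \<inter> fst s) (\<lambda>q. G' q i j)"
    "\<And>e i. \<pi> e \<in> fst t \<inter> fst s \<Longrightarrow> i < r \<Longrightarrow> snd t e i = (\<Sum>j<r. G' (\<pi> e) i j * snd s e j)"
    by simp_all
  obtain M where "\<forall>i<r. \<forall>j<r. hol_fun_on A (fst t \<inter> f -` fst t) (\<lambda>q. M q i j)"
    "\<forall>q\<in>fst t \<inter> f -` fst t. \<forall>e. \<pi> e = f q \<longrightarrow> (\<forall>i<r. snd t (\<Phi> q e) i = (\<Sum>j<r. M q i j * snd t e j))"
    using lin t(1) unfolding linearisation_def by blast
  then have M: "\<And>i j. i < r \<Longrightarrow> j < r \<Longrightarrow> hol_fun_on A (fst t \<inter> f -` fst t) (\<lambda>q. M q i j)"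
    "\<And>q e i. q \<in> fst t \<inter> f -` fst t \<Longrightarrow> \<pi> e = f q \<Longrightarrow> i < r \<Longrightarrow> snd t (\<Phi> q e) i = (\<Sum>j<r. M q i j * snd t e j)"
    by simp_all
  have proj: "\<pi> (\<Phi> q e) = q" if "\<pi> e = f q" for q e using lin that unfolding linearisation_def by blast
  have of: "open (f -` fst t)"
  proof -
    have "continuous_on UNIV f" using f unfolding hol_self_map_def by blast
    then show ?thesis using o(2) by (simp add: continuous_on_open_vimage)
  qed
  have hG: "hol_at A p (\<lambda>q. G q i j)" if "i < r" "j < r" for i j
    unfolding hol_at_def using G(1)[OF that] o ps t(2) by (intro exI[of _ "fst s \<inter> fst t"]) auto
  have hG': "hol_at A p (\<lambda>q. G' q i j)" if "i < r" "j < r" for i j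
    unfolding hol_at_def using G'(1)[OF that] o ps t(2) by (intro exI[of _ "fst t \<inter> fst s"]) auto
  have hM: "hol_at A p (\<lambda>q. M q i j)" if "i < r" "j < r" for i j
    unfolding hol_at_def using M(1)[OF that] o of ps t(2) fp by (intro exI[of _ "fst t \<inter> f -` fst t"]) auto
  have fv: "\<pi> (frame_vector \<pi> s q j) = q \<and> snd s (frame_vector \<pi> s q j) = (\<lambda>i. if i = j then 1 else 0)"
    if "q \<in> fst s" "j < r" for q j
  proof -
    have bij: "bij_betw (snd s) (\<pi> -` {q}) {v. \<forall>i\<ge>r. v i = 0}" using triv(1) that unfolding is_triv_def by blast
    have "(\<lambda>i. if i = j then 1 else 0) \<in> snd s ` (\<pi> -` {q})"
      using bij_betw_imp_surj_on[OF bij] that(2) by auto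
    then obtain e where e: "\<pi> e = q" "snd s e = (\<lambda>i. if i = j then 1 else 0)" by auto
    have uniq: "e' = e" if "\<pi> e' = q \<and> snd s e' = (\<lambda>i. if i = j then 1 else 0)" for e'
      by (rule inj_onD[OF bij_betw_imp_inj_on[OF bij]]) (use that e in auto)
    have "frame_vector \<pi> s q j = e"
      unfolding frame_vector_def by (rule the_equality) (simp add: e, rule uniq)
    then show ?thesis using e by simp
  qed
  have "hol_at A p (\<lambda>q. \<Sum>i<r. \<Sum>a<r. G q i a * (\<Sum>b<r. M q a b * G' (f q) b i))"
    by (intro hol_at_sum hol_at_mult hG hM hol_at_compose_f[OF hG']) auto
  moreover have "eventually (\<lambda>q. (\<Sum>i<r. \<Sum>a<r. G q i a * (\<Sum>b<r. M q a b * G' (f q) b i)) =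
      frame_trace r \<pi> s f \<Phi> q) (nhds p)"
  proof -
    have 1: "eventually (\<lambda>q. q \<in> fst s \<inter> fst t) (nhds p)"
      by (rule eventually_nhds_in_open) (use o ps t in auto)
    show ?thesis using 1 ev_f[OF 1]
    proof eventually_elim
      case (elim q)
      have "snd s (\<Phi> q (frame_vector \<pi> s (f q) i)) i = (\<Sum>a<r. G q i a * (\<Sum>b<r. M q a b * G' (f q) b i))"
          if i: "i < r" for i
      proof -
        let ?e = "frame_vector \<pi> s (f q) i"
        have e: "\<pi> ?e = f q" "snd s ?e = (\<lambda>j. if j = i then 1 else 0)" using fv[of "f q" i] elim i by auto
        have te: "snd t ?e b = G' (f q) b i" if "b < r" for b
          using G'(2)[of ?e b] e elim that i by (simp add: if_distrib[of "\<lambda>x. _ * x"] cong: if_cong)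
        have "snd s (\<Phi> q ?e) i = (\<Sum>a<r. G q i a * snd t (\<Phi> q ?e) a)"
          using G(2)[of "\<Phi> q ?e" i] proj[OF e(1)] elim i by simp
        also have "\<dots> = (\<Sum>a<r. G q i a * (\<Sum>b<r. M q a b * G' (f q) b i))"
          using M(2)[of q ?e] e elim te by (intro sum.cong refl) auto
        finally show ?thesis .
      qed
      then show ?case by (simp add: frame_trace_def)
    qed
  qed
  ultimately show ?thesis by (rule hol_at_cong)
qed

end

section \<open>The boundary index\<close>

lemma residue_zero: "residue I g (\<lambda>v. 0) = 0"
  using residue_sum[of "{}" I "\<lambda>_ _. 0" g "\<lambda>_. 0"] by simp

text \<open>\<open>Abs_poly\<close> is meaningful only for sequences that vanish from some index on.
  A degree bound uniform in u, together with the value 0 at the zero function, provides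
  this.\<close>

lemma coeff_coeffwise:
  assumes "\<And>u. degree (H u) \<le> D" "\<Lambda> (\<lambda>u. 0) = 0"
  shows "coeff (coeffwise \<Lambda> H) d = \<Lambda> (\<lambda>u. coeff (H u) d)"
proof -
  have "\<Lambda> (\<lambda>u. coeff (H u) i) = 0" if "i > D" for i
  proof -
    have "coeff (H u) i = 0" for u using assms(1)[of u] that by (intro coeff_eq_0) auto
    then show ?thesis using assms(2) by simp
  qed
  from coeff_Abs_poly[of D "\<lambda>i. \<Lambda> (\<lambda>u. coeff (H u) i)", OF this]
  show ?thesis unfolding coeffwise_def by metis
qed

definition poly_germ :: "'n::finite set \<Rightarrow> (complex ^ 'n \<Rightarrow> complex poly) \<Rightarrow> bool" where
  "poly_germ I P \<longleftrightarrow> (\<forall>d. germ I (\<lambda>v. coeff (P v) d))"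

lemma poly_germ_sum: "(\<And>s. s \<in> S \<Longrightarrow> poly_germ I (P s)) \<Longrightarrow> poly_germ I (\<lambda>v. \<Sum>s\<in>S. P s v)"
  unfolding poly_germ_def coeff_sum by (intro allI germ_sum) auto

lemma poly_germ_mult: "poly_germ I P \<Longrightarrow> poly_germ I Q \<Longrightarrow> poly_germ I (\<lambda>v. P v * Q v)"
  unfolding poly_germ_def coeff_mult by (intro allI germ_sum germ_mult) auto

lemma poly_germ_const: "poly_germ I (\<lambda>v. q)"
  unfolding poly_germ_def by (intro allI germ_const)

lemma poly_germ_prod: "(\<And>s. s \<in> S \<Longrightarrow> poly_germ I (P s)) \<Longrightarrow> poly_germ I (\<lambda>v. \<Prod>s\<in>S. P s v)"
  by (induction S rule: infinite_finite_induct) (auto intro: poly_germ_mult poly_germ_const)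

lemma poly_germ_det_one_plus_y:
  assumes "\<And>i j. i \<in> J \<Longrightarrow> j \<in> J \<Longrightarrow> germ I (\<lambda>v. M v i j)"
  shows "poly_germ I (\<lambda>v. det_one_plus_y J (M v))"
  unfolding det_one_plus_y_def block_det_def det_def
proof (intro poly_germ_sum poly_germ_mult poly_germ_const poly_germ_prod)
  fix p and i :: 'a
  have "poly_germ I (\<lambda>v. (if i = k then 1 else 0) + monom (M v i k) 1)" if "i \<in> J" "k \<in> J" for k
    unfolding poly_germ_def
  proof
    fix d
    show "germ I (\<lambda>v. coeff ((if i = k then 1 else 0) + monom (M v i k) 1) d)"
      using assms[OF that] by (cases "d = 1") (auto intro!: germ_add germ_const)
  qed
  then show "poly_germ I (\<lambda>v. (\<chi> i j. if i \<in> J \<and> j \<in> J then (if i = j then 1 else 0) + monom (M v i j) 1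
      else if i = j then 1 else 0) $ i $ p i)"
    by (cases "i \<in> J \<and> p i \<in> J") (auto intro: poly_germ_const)
qed

lemma degree_det_one_plus_y: "degree (det_one_plus_y (J :: 'n::finite set) M) \<le> CARD('n)"
  unfolding det_one_plus_y_def block_det_def det_def
proof (intro degree_sum_le)
  fix p :: "'n \<Rightarrow> 'n"
  let ?E = "\<lambda>i. (\<chi> i j. if i \<in> J \<and> j \<in> J then (if i = j then 1 else 0) + monom (M i j) 1
      else if i = j then 1 else 0 :: complex poly ^ 'n ^ 'n) $ i $ p i"
  have e: "degree (?E i) \<le> 1" for i
    by (auto intro!: degree_add_le order_trans[OF degree_monom_le])
  have "degree (\<Prod>i\<in>UNIV. ?E i) \<le> sum (degree \<circ> ?E) UNIV"
    by (rule degree_prod_sum_le) simp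
  also have "\<dots> \<le> (\<Sum>i\<in>(UNIV::'n set). 1)"
    by (rule sum_mono) (use e in \<open>simp only: o_def\<close>)
  finally have "degree (\<Prod>i\<in>UNIV. ?E i) \<le> CARD('n)" by simp
  moreover have "degree (of_int (sign p) * (\<Prod>i\<in>UNIV. ?E i)) \<le>
      degree (of_int (sign p) :: complex poly) + degree (\<Prod>i\<in>UNIV. ?E i)"
    by (rule degree_mult_le)
  moreover have "degree (of_int (sign p) :: complex poly) = 0" by simp
  ultimately show "degree (of_int (sign p) * (\<Prod>i\<in>UNIV. ?E i)) \<le> CARD('n)" by linarith
qed (simp add: finite_permutations)

text \<open>The unit vectors are columns here, so the matrix is transposed before
  \<open>det_rows_block\<close> applies. Each column in \<open>K\<close> of 1 + yM contributes a
  factor 1 + y.\<close>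

lemma det_one_plus_y_block:
  fixes K :: "'n::finite set"
  assumes "\<And>i j. j \<in> K \<Longrightarrow> M i j = (if i = j then 1 else 0)" "\<And>i j. i \<notin> K \<Longrightarrow> j \<notin> K \<Longrightarrow> M i j = M' i j"
  shows "det_one_plus_y UNIV M = [:1, 1:] ^ card K * det_one_plus_y (-K) M'"
proof -
  let ?X = "(\<chi> i j. (if i = j then 1 else 0) + monom (M j i) 1) :: complex poly ^ 'n ^ 'n"
  have one: "1 + monom 1 1 = ([:1, 1:] :: complex poly)" by (simp add: monom_altdef one_pCons)
  have "det_one_plus_y UNIV M = det (transpose ?X)"
    unfolding det_one_plus_y_def block_det_def transpose_def
    by (rule arg_cong[where f=det]) (simp add: vec_eq_iff)
  also have "\<dots> = det ?X" by (rule det_transpose)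
  also have "\<dots> = (\<Prod>i\<in>K. [:1, 1:]) * det ((\<chi> i j. if i \<in> -K \<and> j \<in> -K then ?X $ i $ j else if i =
      j then 1 else 0) :: complex poly ^ 'n ^ 'n)"
    by (rule det_rows_block) (use assms(1) one in auto)
  also have "((\<chi> i j. if i \<in> -K \<and> j \<in> -K then ?X $ i $ j else if i = j then 1 else 0) :: complex poly ^ 'n ^ 'n) =
      transpose (\<chi> i j. if i \<in> -K \<and> j \<in> -K then (if i = j then 1 else 0) + monom (M' i j) 1 else
          if i = j then 1 else 0)"
    using assms(2) by (auto simp: vec_eq_iff transpose_def)
  also have "det \<dots> = det_one_plus_y (-K) M'"
    unfolding det_transpose det_one_plus_y_def block_det_def ..
  finally show ?thesis by simp
qed

lemma germ_partial: "germ UNIV g \<Longrightarrow> germ UNIV (partial j g)"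
  unfolding germ_UNIV_hol_near hol_near_def using holo_on_partial by blast

section \<open>Units along the divisor and the index in adapted coordinates\<close>

context manifold_fixed_point
begin

text \<open>The two inclusions of strictness have different roles. The pull-back of z_i lies in the
  ideal of C, hence is z_i times a germ a. Conversely z_i is a combination of pull-backs g_j(f),
  each g_j being a multiple of z_i; hence z_i = z_i a s for some germ s. Cancelling z_i gives a s =
  1 at p.\<close>

lemma log_unit_properties:
  assumes C: "\<And>q. inverse_image_ideal_stalk A f C q = ideal_stalk A C q" and pC: "p \<in> C"
    and loc: "C \<inter> fst \<zeta> = {u \<in> fst \<zeta>. snd \<zeta> u $ i = 0}"
  shows "hol_at A p (log_unit A f p \<zeta> i)"
    and "eventually (\<lambda>u. snd \<zeta> (f u) $ i = snd \<zeta> u $ i * log_unit A f p \<zeta> i u) (nhds p)"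
    and "log_unit A f p \<zeta> i p \<noteq> 0"
proof -
  let ?z = "\<lambda>u. snd \<zeta> u $ i"
  have dom: "eventually (\<lambda>u. u \<in> fst \<zeta>) (nhds p)"
    by (rule eventually_nhds_in_open) (use chart in \<open>auto simp: is_chart_def\<close>)
  have z: "?z \<in> ideal_stalk A C p"
    unfolding ideal_stalk_def using dom loc hol_at_coord by (auto elim: eventually_mono)
  \<comment> \<open>Germs vanishing on C are divisible by z_i: the value at the projection to z_i =
    0 is 0, and Hadamard's lemma supplies the quotient.\<close>
  have divide: "\<exists>q. germ UNIV q \<and> eventually (\<lambda>v. g (chart_inv \<zeta> v) = v $ i * q v) (nhds 0)"
    if g: "g \<in> ideal_stalk A C p" for g
  proof -
    let ?h = "\<lambda>v. g (chart_inv \<zeta> v)"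
    have h: "germ UNIV ?h" and van: "eventually (\<lambda>u. u \<in> C \<longrightarrow> g u = 0) (nhds p)"
      using g unfolding ideal_stalk_def hol_at_iff by auto
    have "eventually (\<lambda>v. (chart_inv \<zeta> v \<in> C \<longrightarrow> ?h v = 0) \<and> chart_inv \<zeta> v \<in> fst \<zeta> \<and> snd \<zeta> (chart_inv \<zeta> v) = v) (nhds 0)"
      using ev(1)[OF van] ev_inverse by (intro eventually_conj)
    then obtain r1 where r1: "0 < r1" "\<And>v. v \<in> polydisc r1 \<Longrightarrow> (chart_inv \<zeta> v \<in> C \<longrightarrow> ?h v = 0) \<and>
        chart_inv \<zeta> v \<in> fst \<zeta> \<and> snd \<zeta> (chart_inv \<zeta> v) = v"
      unfolding eventually_nhds_0_polydisc by blast
    obtain r2 where r2: "0 < r2" "holo_on (polydisc r2) ?h"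
      using h unfolding germ_UNIV_iff by (rule eventually_at_right_0_obtain)
    define r where "r = min r1 r2"
    have r: "0 < r" using r1(1) r2(1) by (simp add: r_def)
    have hr: "holo_on (polydisc r) ?h" by (rule holo_on_subset[OF r2(2) polydisc_mono]) (simp add: r_def)
    define q where "q v = hada i ?h v (upd v i 0)" for v
    have "?h v = v $ i * q v" if v: "v \<in> polydisc r" for v
    proof -
      have "upd v i 0 \<in> polydisc r1" using v r1(1) by (auto simp: polydisc_def r_def)
      note * = r1(2)[OF this]
      then have "chart_inv \<zeta> (upd v i 0) \<in> {u \<in> fst \<zeta>. snd \<zeta> u $ i = 0}" by simp
      then have "chart_inv \<zeta> (upd v i 0) \<in> C" using loc by blast
      then have "?h (upd v i 0) = 0" using * by blast
      then show ?thesis using holo_divide_coord(2)[OF hr v, of i] by (simp add: q_def)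
    qed
    moreover have "germ UNIV q" unfolding q_def[abs_def] by (rule germ_UNIV_I[OF r holo_divide_coord(1)[OF hr]])
    ultimately show ?thesis using r unfolding eventually_nhds_0_polydisc by blast
  qed
  have "\<exists>(l::nat) c g. (\<forall>j<l. hol_at A p (c j) \<and> g j \<in> ideal_stalk A C p) \<and>
      eventually (\<lambda>u. ?z (f u) = (\<Sum>j<l. c j u * g j (f u))) (nhds p)"
    by (intro exI[of _ 1] exI[of _ "\<lambda>_ _. 1"] exI[of _ "\<lambda>_. ?z"]) (use z hol_at_const in simp)
  then have "(\<lambda>u. ?z (f u)) \<in> inverse_image_ideal_stalk A f C p"
    unfolding inverse_image_ideal_stalk_def fp using hol_at_compose_f[OF hol_at_coord] by blast
  then have "(\<lambda>u. ?z (f u)) \<in> ideal_stalk A C p" using C by simp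
  from divide[OF this] obtain q where q: "germ UNIV q" "eventually (\<lambda>v. ?z (f (chart_inv \<zeta> v)) = v $ i * q v) (nhds 0)"
    by blast
  have "hol_at A p (\<lambda>u. q (snd \<zeta> u))"
  proof -
    have "eventually (\<lambda>v. q v = q (snd \<zeta> (chart_inv \<zeta> v))) (nhds 0)"
      using ev_inverse(1) by eventually_elim simp
    then show ?thesis
      unfolding hol_at_iff germ_UNIV_hol_near using q(1) unfolding germ_UNIV_hol_near by (rule hol_near_cong[rotated])
  qed
  moreover have "eventually (\<lambda>u. ?z (f u) = ?z u * q (snd \<zeta> u)) (nhds p)"
    using ev(2)[OF q(2)] ev_inverse(3) by eventually_elim simp
  ultimately have "\<exists>a. hol_at A p a \<and> eventually (\<lambda>u. ?z (f u) = ?z u * a u) (nhds p)" by blast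
  from someI_ex[OF this]
  show a: "hol_at A p (log_unit A f p \<zeta> i)"
    and eq: "eventually (\<lambda>u. ?z (f u) = ?z u * log_unit A f p \<zeta> i u) (nhds p)"
    unfolding log_unit_def by auto
  let ?a = "\<lambda>v. log_unit A f p \<zeta> i (chart_inv \<zeta> v)"
  have ga: "germ UNIV ?a" using a unfolding hol_at_iff .
  have eqF: "eventually (\<lambda>v. F v $ i = v $ i * ?a v) (nhds 0)"
    using ev(1)[OF eq] ev_inverse(1) by eventually_elim (simp add: F_def)
  have "?z \<in> inverse_image_ideal_stalk A f C p" using z C by simp
  then obtain l :: nat and c g where cg: "\<And>j. j < l \<Longrightarrow> hol_at A p (c j) \<and> g j \<in> ideal_stalk A C p"
    and zsum: "eventually (\<lambda>u. ?z u = (\<Sum>j<l. c j u * g j (f u))) (nhds p)"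
    unfolding inverse_image_ideal_stalk_def fp by blast
  have "\<forall>j\<in>{..<l}. \<exists>q. germ UNIV q \<and> eventually (\<lambda>v. g j (chart_inv \<zeta> v) = v $ i * q v) (nhds 0)"
    using divide cg by blast
  from bchoice[OF this] obtain d where d: "\<And>j. j < l \<Longrightarrow> germ UNIV (d j)"
    "\<And>j. j < l \<Longrightarrow> eventually (\<lambda>v. g j (chart_inv \<zeta> v) = v $ i * d j v) (nhds 0)" by auto
  define S where "S v = ?a v * (\<Sum>j<l. c j (chart_inv \<zeta> v) * d j (F v))" for v
  have gS: "germ UNIV S"
    unfolding S_def[abs_def] using cg d(1)
    by (intro germ_mult ga germ_sum germ_compose_F) (auto simp: hol_at_iff)
  have "eventually (\<lambda>v. \<forall>j\<in>{..<l}. g j (chart_inv \<zeta> (F v)) = F v $ i * d j (F v)) (nhds 0)"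
    using d(2) by (intro eventually_ball_finite ballI ev_F_nhds) auto
  then have "eventually (\<lambda>v. v $ i = v $ i * S v) (nhds 0)"
    using ev(1)[OF zsum] ev_inverse(1) ev_F eqF
  proof eventually_elim
    case (elim v)
    have "v $ i = (\<Sum>j<l. c j (chart_inv \<zeta> v) * g j (chart_inv \<zeta> (F v)))" using elim(2,3,4) by simp
    also have "\<dots> = (\<Sum>j<l. c j (chart_inv \<zeta> v) * (F v $ i * d j (F v)))" using elim(1) by simp
    also have "\<dots> = v $ i * S v" unfolding S_def elim(5) by (simp add: sum_distrib_left ac_simps)
    finally show ?case .
  qed
  then obtain r where r: "0 < r" "\<And>v. v \<in> polydisc r \<Longrightarrow> v $ i = v $ i * S v"
    unfolding eventually_nhds_0_polydisc by blast
  obtain r' where r': "0 < r'" "holo_on (polydisc r') S"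
    using gS unfolding germ_UNIV_iff by (rule eventually_at_right_0_obtain)
  \<comment> \<open>The factor z_i can be cancelled only where it is nonzero, so the value of
    \<open>S\<close> at 0 is obtained as a limit along the i-th axis.\<close>
  have "((\<lambda>t. t *s (axis i 1 :: complex ^ 'n)) \<longlongrightarrow> 0 *s axis i 1) (at (0::complex))"
    using continuous_on_smult[OF continuous_on_id continuous_on_const, of UNIV "axis i 1 :: complex ^ 'n"]
    unfolding continuous_on_eq_continuous_at[OF open_UNIV] isCont_def by blast
  then have "((\<lambda>t. S (t *s axis i 1)) \<longlongrightarrow> S (0 *s axis i 1)) (at (0::complex))"
    by (rule isCont_tendsto_compose[rotated]) (use isCont_holo[OF r'] in simp)
  moreover have "((\<lambda>t. S (t *s axis i 1)) \<longlongrightarrow> 1) (at (0::complex))"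
  proof (rule tendsto_eventually)
    have "eventually (\<lambda>t::complex. t \<in> ball 0 r - {0}) (at 0)"
      unfolding eventually_at using r(1) by (intro exI[of _ r]) (simp add: dist_norm)
    then show "eventually (\<lambda>t. S (t *s axis i 1) = 1) (at (0::complex))"
    proof eventually_elim
      case (elim t)
      then have "t *s axis i 1 \<in> (polydisc r :: (complex ^ 'n) set)" using r(1) by (auto simp: polydisc_def axis_def)
      from r(2)[OF this] elim show ?case by (simp add: axis_def)
    qed
  qed
  ultimately have "S (0 *s axis i 1) = 1" by (rule tendsto_unique[OF trivial_limit_at])
  then have "S 0 = 1" by simp
  then show "log_unit A f p \<zeta> i p \<noteq> 0" by (auto simp: S_def inv_0)
qed

text \<open>After the reduction to the stratum only values on z = 0 matter. There the coefficient of
  dz_j / z_j in an exact form dg carries the factor z_j = 0. Columns of \<open>J_log\<close> in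
  \<open>K\<close> thus become those of the identity, and the remaining block is
  \<open>J_stratum\<close>.\<close>

theorem boundary_index_eq:
  fixes K :: "'n set"
  assumes x: "local_coordinates A p x" and \<tau>: "hol_at A p (frame_trace r \<pi> s f \<Phi>)"
    and a: "\<And>i. i \<in> K \<Longrightarrow> hol_at A p (log_unit A f p \<zeta> i)"
    and a_eq: "\<And>i. i \<in> K \<Longrightarrow> eventually (\<lambda>u. snd \<zeta> (f u) $ i = snd \<zeta> u $ i * log_unit A f p \<zeta> i u) (nhds p)"
    and a_nz: "\<And>i. i \<in> K \<Longrightarrow> log_unit A f p \<zeta> i p \<noteq> 0"
    and res: "normally_non_resonant A f p \<zeta> K"
  shows "boundary_index A f p x \<zeta> K r \<pi> s \<Phi> =
    [:1, 1:] ^ card K *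
    coeffwise (stratum_residue f \<zeta> K)
      (\<lambda>w. smult (frame_trace r \<pi> s f \<Phi> (chart_inv \<zeta> w) *
                  inverse (normal_det A f p \<zeta> K (chart_inv \<zeta> w)))
             (det_one_plus_y (- K) (J_stratum f \<zeta> w)))"
proof -
  define b where "b i v = 1 - log_unit A f p \<zeta> i (chart_inv \<zeta> v)" for i v
  have ga: "germ UNIV (\<lambda>v. log_unit A f p \<zeta> i (chart_inv \<zeta> v))" if "i \<in> K" for i
    using a[OF that] unfolding hol_at_iff .
  interpret S: stratified_map F K b
  proof
    show "germ UNIV (\<lambda>v. F v $ i)" for i by (rule germ_F)
    fix i assume i: "i \<in> K"
    have "germ UNIV (\<lambda>v. 1 + (-1) * log_unit A f p \<zeta> i (chart_inv \<zeta> v))"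
      by (intro germ_add germ_mult germ_const ga i)
    then show "germ UNIV (b i)" by (simp add: b_def[abs_def])
    show "b i 0 \<noteq> 0"
      using res i unfolding normally_non_resonant_def normal_det_def b_def inv_0 by auto
    show "eventually (\<lambda>v. v $ i - F v $ i = v $ i * b i v) (nhds 0)"
      using ev(1)[OF a_eq[OF i]] ev_inverse(1)
      by eventually_elim (simp add: F_def b_def algebra_simps)
  qed
  let ?\<tau> = "\<lambda>v. frame_trace r \<pi> s f \<Phi> (chart_inv \<zeta> v)"
  let ?J = "\<lambda>v. J_log A f p \<zeta> K (chart_inv \<zeta> v)"
  have g\<tau>: "germ UNIV ?\<tau>" using \<tau> unfolding hol_at_iff .
  have gJ: "germ UNIV (\<lambda>v. ?J v i j)" for i j
  proof -
    have lp: "germ UNIV (\<lambda>v. (if j \<in> K then v $ j else 1) * partial j h v)" if "germ UNIV h" for h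
      by (cases "j \<in> K") (auto intro!: germ_mult germ_coord germ_partial that)
    have "germ UNIV (\<lambda>v. if i \<in> K then (if i = j then 1 else 0) +
        ((if j \<in> K then v $ j else 1) * partial j (log_unit A f p \<zeta> i \<circ> chart_inv \<zeta>) v) * inverse (log_unit A f p \<zeta>
            i (chart_inv \<zeta> v))
      else (if j \<in> K then v $ j else 1) * partial j (\<lambda>v. F v $ i) v)"
    proof (cases "i \<in> K")
      case True
      have "germ UNIV (\<lambda>v. inverse (log_unit A f p \<zeta> i (chart_inv \<zeta> v)))"
        by (rule germ_inverse[OF ga[OF True]]) (simp add: inv_0 a_nz[OF True])
      then show ?thesis
        using True lp[of "log_unit A f p \<zeta> i \<circ> chart_inv \<zeta>"] ga[OF True]
        by (simp add: o_def germ_add germ_mult germ_const)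
    qed (use lp[OF germ_F] in simp)
    moreover have "eventually (\<lambda>v. (if i \<in> K then (if i = j then 1 else 0) +
        ((if j \<in> K then v $ j else 1) * partial j (log_unit A f p \<zeta> i \<circ> chart_inv \<zeta>) v) * inverse (log_unit A f p \<zeta>
            i (chart_inv \<zeta> v))
      else (if j \<in> K then v $ j else 1) * partial j (\<lambda>v. F v $ i) v) = ?J v i j) (nhds 0)"
      using ev_inverse(1)
      by eventually_elim (simp add: J_log_def log_partial_def F_def divide_inverse)
    ultimately show ?thesis unfolding germ_UNIV_hol_near by (rule hol_near_cong)
  qed
  define H where "H v = smult (?\<tau> v) (det_one_plus_y UNIV (?J v))" for v
  define Q where "Q v = smult (?\<tau> v * inverse (normal_det A f p \<zeta> K (chart_inv \<zeta> v))) (det_one_plus_y (-K)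
      (J_stratum f \<zeta> v))" for v
  have gH: "germ UNIV (\<lambda>v. coeff (H v) d)" for d
    using poly_germ_det_one_plus_y[of UNIV UNIV ?J] gJ g\<tau>
    unfolding poly_germ_def H_def coeff_smult by (auto intro: germ_mult)
  have nd: "normal_det A f p \<zeta> K (chart_inv \<zeta> v) = (\<Prod>i\<in>K. b i v)" for v
    by (simp add: normal_det_def b_def)
  have gnd: "germ UNIV (\<lambda>v. inverse (normal_det A f p \<zeta> K (chart_inv \<zeta> v)))"
    unfolding nd by (rule germ_inverse[OF germ_prod]) (use S.germ_b S.b_0 in auto)
  have gJS: "germ UNIV (\<lambda>v. J_stratum f \<zeta> v i j)" for i j
    using germ_partial[OF germ_F[of i], of j] by (simp add: J_stratum_def F_def)
  have gQ: "germ UNIV (\<lambda>v. coeff (Q v) d)" for d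
    using poly_germ_det_one_plus_y[of "-K" UNIV "J_stratum f \<zeta>"] gJS g\<tau> gnd
    unfolding poly_germ_def Q_def coeff_smult by (auto intro: germ_mult)
  \<comment> \<open>Residues are taken of scalar germs, so the polynomial identity on the stratum is
    stated coefficient by coefficient, as a Cauchy product with the coefficients of (1 +
    y)^k.\<close>
  have stratum: "germ_eq (-K) (\<lambda>v. coeff (H v) d * inverse (\<Prod>i\<in>K. b i v))
      (\<lambda>v. \<Sum>e\<le>d. coeff ([:1, 1:] ^ card K) e * coeff (Q v) (d - e))" for d
    unfolding germ_eq_def using eventually_coord_proj[OF ev_inverse(1), of "-K"]
  proof eventually_elim
    case (elim v)
    let ?v = "coord_proj (-K) v"
    have "det_one_plus_y UNIV (?J ?v) = [:1, 1:] ^ card K * det_one_plus_y (-K) (J_stratum f \<zeta> ?v)"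
    proof (rule det_one_plus_y_block)
      show "?J ?v i j = (if i = j then 1 else 0)" if "j \<in> K" for i j
        using that by (auto simp: J_log_def log_partial_def elim)
      show "?J ?v i j = J_stratum f \<zeta> ?v i j" if "i \<notin> K" "j \<notin> K" for i j
        using that by (simp only: J_log_def log_partial_def elim J_stratum_def) simp
    qed
    then have "smult (inverse (\<Prod>i\<in>K. b i ?v)) (H ?v) = [:1, 1:] ^ card K * Q ?v"
      unfolding H_def Q_def nd by (simp add: mult.commute)
    then have "coeff (smult (inverse (\<Prod>i\<in>K. b i ?v)) (H ?v)) d = coeff ([:1, 1:] ^ card K * Q ?v) d" by simp
    then show ?case unfolding coeff_smult coeff_mult by (simp only: mult.commute)
  qed
  have sr: "stratum_residue f \<zeta> K = residue (-K) S.g"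
    unfolding stratum_residue_def S.g_def[abs_def] F_def ..
  have fpf: "fixed_point_functional f x h = residue UNIV S.g (\<lambda>v. h (chart_inv \<zeta> v))" if "hol_at A p h" for h
    using fixed_point_functional_coordinates[OF x that] unfolding S.g_def[abs_def] .
  show ?thesis
  proof (rule poly_eqI)
    fix d
    have "coeff (boundary_index A f p x \<zeta> K r \<pi> s \<Phi>) d =
        fixed_point_functional f x (\<lambda>u. coeff (smult (frame_trace r \<pi> s f \<Phi> u) (det_one_plus_y UNIV (J_log A f p \<zeta> K
            u))) d)"
      unfolding boundary_index_def
    proof (rule coeff_coeffwise)
      show "degree (smult (frame_trace r \<pi> s f \<Phi> u) (det_one_plus_y UNIV (J_log A f p \<zeta> K u))) \<le> CARD('n)" for u
        by (rule order_trans[OF degree_smult_le degree_det_one_plus_y])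
      show "fixed_point_functional f x (\<lambda>u. 0) = 0"
        using fpf[OF hol_at_const] by (simp add: residue_zero)
    qed
    also have "\<dots> = residue UNIV S.g (\<lambda>v. coeff (H v) d)"
      unfolding H_def by (rule fpf) (use gH[of d] in \<open>simp add: hol_at_iff H_def\<close>)
    also have "\<dots> = residue (-K) S.g (\<lambda>v. coeff (H v) d * inverse (\<Prod>i\<in>K. b i v))"
      by (rule S.residue_stratum[OF gH])
    also have "\<dots> = residue (-K) S.g (\<lambda>v. \<Sum>e\<le>d. coeff ([:1, 1:] ^ card K) e * coeff (Q v) (d - e))"
      by (rule residue_cong[OF stratum germ_coord_proj(1)[OF germ_mult[OF gH gnd[unfolded nd]]]])
    also have "\<dots> = (\<Sum>e\<le>d. coeff ([:1, 1:] ^ card K) e * residue (-K) S.g (\<lambda>v. coeff (Q v) (d - e)))"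
      by (rule residue_sum) (auto intro: germ_coord_proj(1)[OF gQ])
    also have "\<dots> = (\<Sum>e\<le>d. coeff ([:1, 1:] ^ card K) e * coeff (coeffwise (stratum_residue f \<zeta> K) Q) (d - e))"
    proof (rule sum.cong[OF refl])
      fix e
      have "degree (Q v) \<le> CARD('n)" for v
        unfolding Q_def by (rule order_trans[OF degree_smult_le degree_det_one_plus_y])
      then have "coeff (coeffwise (stratum_residue f \<zeta> K) Q) (d - e) = residue (-K) S.g (\<lambda>v. coeff (Q v) (d - e))"
        unfolding sr by (rule coeff_coeffwise) (rule residue_zero)
      then show "coeff ([:1, 1:] ^ card K) e * residue (-K) S.g (\<lambda>v. coeff (Q v) (d - e)) =
          coeff ([:1, 1:] ^ card K) e * coeff (coeffwise (stratum_residue f \<zeta> K) Q) (d - e)" by simp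
    qed
    also have "\<dots> = coeff ([:1, 1:] ^ card K * coeffwise (stratum_residue f \<zeta> K) Q) d"
      by (rule coeff_mult[symmetric])
    finally show "coeff (boundary_index A f p x \<zeta> K r \<pi> s \<Phi>) d =
        coeff ([:1, 1:] ^ card K * coeffwise (stratum_residue f \<zeta> K)
          (\<lambda>w. smult (frame_trace r \<pi> s f \<Phi> (chart_inv \<zeta> w) * inverse (normal_det A f p \<zeta> K (chart_inv \<zeta> w)))
             (det_one_plus_y (- K) (J_stratum f \<zeta> w)))) d"
      unfolding Q_def[abs_def] .
  qed
qed

end

theorem theorem6p2:
  fixes A :: "('a::{t2_space, second_countable_topology}, 'n::finite) chart set"
    and DD :: "'a set set"
    and f :: "'a \<Rightarrow> 'a"
    and r :: nat
    and \<pi> :: "'e \<Rightarrow> 'a"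
    and T :: "('a, 'e) triv set"
    and \<Phi> :: "'a \<Rightarrow> 'e \<Rightarrow> 'e"
    and p :: 'a
    and k :: nat
    and x \<zeta> :: "('a, 'n) chart"
    and K :: "'n set"
    and s :: "('a, 'e) triv"
  assumes "complex_manifold A"
    and "snc_divisor A DD"
    and "strict_log_self_map A DD f"
    and "hol_vector_bundle A r \<pi> T"
    and "linearisation A r \<pi> T f \<Phi>"
    and "p \<in> \<Union>DD"
    and "isolated_fixed_point f p"
    and "card {C\<in>DD. p \<in> C} = k"
    and "local_coordinates A p x"
    and "adapted_coordinates A DD p \<zeta> K"
    and "local_frame A r \<pi> T p s"
    and "normally_non_resonant A f p \<zeta> K"
  shows "boundary_index A f p x \<zeta> K r \<pi> s \<Phi> =
    [:1, 1:] ^ k *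
    coeffwise (stratum_residue f \<zeta> K)
      (\<lambda>w. smult (frame_trace r \<pi> s f \<Phi> (chart_inv \<zeta> w) *
                  inverse (normal_det A f p \<zeta> K (chart_inv \<zeta> w)))
             (det_one_plus_y (- K) (J_stratum f \<zeta> w)))"
proof -
  have \<zeta>: "local_coordinates A p \<zeta>" using assms(10) unfolding adapted_coordinates_def by blast
  obtain \<sigma> where \<sigma>: "bij_betw \<sigma> {C\<in>DD. p \<in> C} K"
    "\<And>C. C \<in> DD \<Longrightarrow> C \<inter> fst \<zeta> = (if p \<in> C then {u\<in>fst \<zeta>. snd \<zeta> u $ \<sigma> C = 0} else {})"
    using assms(10) unfolding adapted_coordinates_def by blast
  have k: "k = card K" using bij_betw_same_card[OF \<sigma>(1)] assms(8) by simp
  interpret manifold_fixed_point A p \<zeta> f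
    using assms(1,3,7) \<zeta> by unfold_locales (auto simp: strict_log_self_map_def isolated_fixed_point_def)
  \<comment> \<open>The bijection \<open>\<sigma>\<close> assigns to each index in \<open>K\<close>
    a component through p; strictness is invoked for that component.\<close>
  have log: "\<exists>C. (\<forall>q. inverse_image_ideal_stalk A f C q = ideal_stalk A C q) \<and> p \<in> C \<and>
      C \<inter> fst \<zeta> = {u \<in> fst \<zeta>. snd \<zeta> u $ i = 0}" if i: "i \<in> K" for i
  proof -
    obtain C where C: "C \<in> DD" "p \<in> C" "\<sigma> C = i" using bij_betw_imp_surj_on[OF \<sigma>(1)] i by blast
    then have "C \<inter> fst \<zeta> = {u \<in> fst \<zeta>. snd \<zeta> u $ i = 0}" using \<sigma>(2)[OF C(1)] by simp
    moreover have "\<forall>q. inverse_image_ideal_stalk A f C q = ideal_stalk A C q"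
      using C(1) assms(3) unfolding strict_log_self_map_def by blast
    ultimately show ?thesis using C(2) by blast
  qed
  show ?thesis
    unfolding k
  proof (rule boundary_index_eq[OF assms(9) frame_trace_hol_at[OF assms(4,5,11)] _ _ _ assms(12)])
    fix i assume "i \<in> K"
    from log[OF this] obtain C where C: "\<And>q. inverse_image_ideal_stalk A f C q = ideal_stalk A C q" "p \<in> C"
      "C \<inter> fst \<zeta> = {u \<in> fst \<zeta>. snd \<zeta> u $ i = 0}" by blast
    show "hol_at A p (log_unit A f p \<zeta> i)"
      "eventually (\<lambda>u. snd \<zeta> (f u) $ i = snd \<zeta> u $ i * log_unit A f p \<zeta> i u) (nhds p)"
      "log_unit A f p \<zeta> i p \<noteq> 0"
      using log_unit_properties[OF C] by auto
  qed
qed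

end
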